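(* Let $M:[0,\infty)\to\mathbb{R}$ satisfy $M\in H^2(0,T)$ for every $T>0$. Let $T>2\pi$ and let $(\xi,\eta)\in H^1_0(0,\pi)\times L^2(0,\pi)$. Then there exists a control $f\in H^1_0(0,T)$ such that the solution $w=w(x,t)$ of $$ \begin{cases} w''(x,t)=w_{xx}(x,t)+\displaystyle\int_0^t M(t-s)\,w_{xx}(x,s)\,ds, & x\in(0,\pi),\ t>0,\\ w(0,t)=f(t),\quad w(\pi,t)=0, & t>0,\\ w(x,0)=0,\quad w'(x,0)=0, & x\in(0,\pi), \end{cases} $$ satisfies $w(\cdot,T)=\xi$ and $w'(\cdot,T)=\eta$.
   Context: A prime denotes the derivative with respect to time $t$. All functions are real valued. Meaning of solution: for $f\in L^2(0,T)$ the system has a (weak) solution $w\in C([0,T];L^2(0,\pi))\cap C^1([0,T];H^{-1}(0,\pi))$, characterized through its sine Fourier coefficients as follows. Let $N(t)=1+\int_0^t M(s)\,ds$ and let $\Phi_n(x)=\sqrt{2/\pi}\,\sin(nx)$, $n\in\mathbb{N}=\{1,2,\dots\}$, which is an orthonormal basis of $L^2(0,\pi)$. Then $w(x,t)=\sum_{n\ge 1}\Phi_n(x)w_n(t)$, where $w_n(t)=\int_0^\pi \Phi_n(x)w(x,t)\,dx$ is the solution of $$ w_n'(t)=-n^2\int_0^t N(t-s)w_n(s)\,ds+n\sqrt{\tfrac{2}{\pi}}\int_0^t N(t-s)f(s)\,ds,\qquad w_n(0)=0 . $$ (This is the projection on $\Phi_n$ of the equivalent form $w'(x,t)=\int_0^t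 N(t-s)w_{xx}(x,s)\,ds$, $w(x,0)=0$, $w(0,t)=f(t)$, $w(\pi,t)=0$, obtained by integrating the equation in time.) The equalities $w(\cdot,T)=\xi$ and $w'(\cdot,T)=\eta$ hold in $L^2(0,\pi)$ and $H^{-1}(0,\pi)$ respectively; equivalently, $w_n(T)=\int_0^\pi\Phi_n\xi\,dx$ and $w_n'(T)=\int_0^\pi\Phi_n\eta\,dx$ for every $n\ge 1$. *)

theory Defs
  imports "HOL-Analysis.Analysis"
begin

text \<open>
  Elements of the function spaces on an open interval \<open>(a,b)\<close> are represented by total functions
  \<open>real \<Rightarrow> real\<close>; only the values on \<open>(a,b)\<close>, up to null sets, matter.
\<close>

definition L2_fun :: "real \<Rightarrow> real \<Rightarrow> (real \<Rightarrow> real) set" where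
  "L2_fun a b = {u. set_borel_measurable lebesgue {a<..<b} u \<and>
                    set_integrable lebesgue {a<..<b} (\<lambda>x. (u x)\<^sup>2)}"

definition L2_norm :: "real \<Rightarrow> real \<Rightarrow> (real \<Rightarrow> real) \<Rightarrow> real" where
  "L2_norm a b u = sqrt (LINT x:{a<..<b}|lebesgue. (u x)\<^sup>2)"

text \<open>
  Sobolev spaces on an interval, following Brezis (Functional Analysis, Sobolev Spaces and PDEs,
  Chapter 8): the test functions are \<open>C\<^sup>1\<close> with compact support in \<open>(a,b)\<close>, extended by zero,
  and \<open>H\<^sup>1\<^sub>0\<close> is the closure of the test functions in \<open>H\<^sup>1\<close>.
\<close>

definition test_fun :: "real \<Rightarrow> real \<Rightarrow> (real \<Rightarrow> real) set" where
  "test_fun a b = {\<phi>. \<phi> C1_differentiable_on UNIV \<and>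
                      (\<exists>K. compact K \<and> K \<subseteq> {a<..<b} \<and> (\<forall>x. x \<notin> K \<longrightarrow> \<phi> x = 0))}"

definition has_weak_deriv :: "real \<Rightarrow> real \<Rightarrow> (real \<Rightarrow> real) \<Rightarrow> (real \<Rightarrow> real) \<Rightarrow> bool" where
  "has_weak_deriv a b u g \<longleftrightarrow>
     (\<forall>\<phi>\<in>test_fun a b. (LINT x:{a<..<b}|lebesgue. u x * deriv \<phi> x) =
                        - (LINT x:{a<..<b}|lebesgue. g x * \<phi> x))"

definition H1_fun :: "real \<Rightarrow> real \<Rightarrow> (real \<Rightarrow> real) set" where
  "H1_fun a b = {u \<in> L2_fun a b. \<exists>g\<in>L2_fun a b. has_weak_deriv a b u g}"

definition H2_fun :: "real \<Rightarrow> real \<Rightarrow> (real \<Rightarrow> real) set" where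
  "H2_fun a b = {u \<in> H1_fun a b. \<exists>g\<in>H1_fun a b. has_weak_deriv a b u g}"

text \<open>For \<open>u\<close> in \<open>H\<^sup>1\<close> the weak derivative is unique up to null sets, so the choice is harmless.\<close>

definition weak_deriv :: "real \<Rightarrow> real \<Rightarrow> (real \<Rightarrow> real) \<Rightarrow> real \<Rightarrow> real" where
  "weak_deriv a b u = (SOME g. g \<in> L2_fun a b \<and> has_weak_deriv a b u g)"

definition H1_norm :: "real \<Rightarrow> real \<Rightarrow> (real \<Rightarrow> real) \<Rightarrow> real" where
  "H1_norm a b u = sqrt ((L2_norm a b u)\<^sup>2 + (L2_norm a b (weak_deriv a b u))\<^sup>2)"

definition H10_fun :: "real \<Rightarrow> real \<Rightarrow> (real \<Rightarrow> real) set" where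
  "H10_fun a b = {u \<in> H1_fun a b. \<forall>e>0. \<exists>\<phi>\<in>test_fun a b. H1_norm a b (\<lambda>x. u x - \<phi> x) < e}"

text \<open>
  \<open>H\<^sup>-\<^sup>1\<close> is the dual of \<open>H\<^sup>1\<^sub>0\<close>. Boundedness makes a functional insensitive to the choice of
  representatives; its values outside \<open>H\<^sup>1\<^sub>0\<close> are irrelevant.
\<close>

definition Hm1 :: "real \<Rightarrow> real \<Rightarrow> ((real \<Rightarrow> real) \<Rightarrow> real) set" where
  "Hm1 a b = {F.
     (\<forall>\<phi>\<in>H10_fun a b. \<forall>\<psi>\<in>H10_fun a b. F (\<lambda>x. \<phi> x + \<psi> x) = F \<phi> + F \<psi>) \<and>
     (\<forall>c. \<forall>\<phi>\<in>H10_fun a b. F (\<lambda>x. c * \<phi> x) = c * F \<phi>) \<and>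
     (\<exists>C. \<forall>\<phi>\<in>H10_fun a b. \<bar>F \<phi>\<bar> \<le> C * H1_norm a b \<phi>)}"

definition Hm1_norm :: "real \<Rightarrow> real \<Rightarrow> ((real \<Rightarrow> real) \<Rightarrow> real) \<Rightarrow> real" where
  "Hm1_norm a b F = (SUP \<phi>\<in>{\<phi> \<in> H10_fun a b. H1_norm a b \<phi> \<le> 1}. \<bar>F \<phi>\<bar>)"

text \<open>The canonical embedding of \<open>L\<^sup>2\<close> into \<open>H\<^sup>-\<^sup>1\<close>.\<close>

definition L2_functional :: "real \<Rightarrow> real \<Rightarrow> (real \<Rightarrow> real) \<Rightarrow> (real \<Rightarrow> real) \<Rightarrow> real" where
  "L2_functional a b u \<phi> = (LINT x:{a<..<b}|lebesgue. u x * \<phi> x)"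

text \<open>
  Functions of \<open>(x,t)\<close> are written with the time first: \<open>w t\<close> is the function \<open>w(\<cdot>,t)\<close>.
\<close>

definition has_Hm1_time_deriv ::
    "real \<Rightarrow> real \<Rightarrow> real \<Rightarrow> (real \<Rightarrow> real \<Rightarrow> real) \<Rightarrow> real \<Rightarrow> ((real \<Rightarrow> real) \<Rightarrow> real) \<Rightarrow> bool" where
  "has_Hm1_time_deriv a b T w t F \<longleftrightarrow> F \<in> Hm1 a b \<and>
     ((\<lambda>s. Hm1_norm a b
              (\<lambda>\<phi>. (L2_functional a b (w s) \<phi> - L2_functional a b (w t) \<phi>) / (s - t) - F \<phi>))
        \<longlongrightarrow> 0) (at t within {0..T})"

definition C0_L2 :: "real \<Rightarrow> real \<Rightarrow> real \<Rightarrow> (real \<Rightarrow> real \<Rightarrow> real) \<Rightarrow> bool" where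
  "C0_L2 a b T w \<longleftrightarrow> (\<forall>t\<in>{0..T}. w t \<in> L2_fun a b \<and>
     ((\<lambda>s. L2_norm a b (\<lambda>x. w s x - w t x)) \<longlongrightarrow> 0) (at t within {0..T}))"

definition C1_Hm1 :: "real \<Rightarrow> real \<Rightarrow> real \<Rightarrow> (real \<Rightarrow> real \<Rightarrow> real) \<Rightarrow> bool" where
  "C1_Hm1 a b T w \<longleftrightarrow> (\<exists>v. \<forall>t\<in>{0..T}. has_Hm1_time_deriv a b T w t (v t) \<and>
     ((\<lambda>s. Hm1_norm a b (\<lambda>\<phi>. v s \<phi> - v t \<phi>)) \<longlongrightarrow> 0) (at t within {0..T}))"

definition Phi :: "nat \<Rightarrow> real \<Rightarrow> real" where
  "Phi n x = sqrt (2 / pi) * sin (real n * x)"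

definition sine_coeff :: "nat \<Rightarrow> (real \<Rightarrow> real) \<Rightarrow> real" where
  "sine_coeff n u = (LINT x:{0<..<pi}|lebesgue. Phi n x * u x)"

definition Nker :: "(real \<Rightarrow> real) \<Rightarrow> real \<Rightarrow> real" where
  "Nker M t = 1 + (LINT s:{0<..<t}|lebesgue. M s)"

text \<open>
  Weak solutions on \<open>[0,T]\<close> of
  \<open>w'' = w\<^sub>x\<^sub>x + \<integral>\<^sub>0\<^sup>t M(t-s) w\<^sub>x\<^sub>x(s) ds\<close>, \<open>w(0,t) = f(t)\<close>, \<open>w(\<pi>,t) = 0\<close>, with zero initial data.
  Integrating in time gives \<open>w' = \<integral>\<^sub>0\<^sup>t N(t-s) w\<^sub>x\<^sub>x(s) ds\<close> with \<open>N = Nker M\<close>; the equations for the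
  sine coefficients are the projections of this form, the boundary data entering through
  the integration by parts in \<open>x\<close>. The condition \<open>w'(0) = 0\<close> is their instance at \<open>t = 0\<close>.
\<close>

definition weak_solution ::
    "(real \<Rightarrow> real) \<Rightarrow> (real \<Rightarrow> real) \<Rightarrow> real \<Rightarrow> (real \<Rightarrow> real \<Rightarrow> real) \<Rightarrow> bool" where
  "weak_solution M f T w \<longleftrightarrow>
     C0_L2 0 pi T w \<and> C1_Hm1 0 pi T w \<and>
     (\<forall>n\<ge>1. sine_coeff n (w 0) = 0 \<and>
       (\<forall>t\<in>{0..T}.
          ((\<lambda>\<tau>. sine_coeff n (w \<tau>)) has_real_derivative
             (- (real n)\<^sup>2 * (LINT s:{0<..<t}|lebesgue. Nker M (t - s) * sine_coeff n (w s))
              + real n * sqrt (2 / pi) * (LINT s:{0<..<t}|lebesgue. Nker M (t - s) * f s)))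
          (at t within {0..T})))"

end

theory Submission
  imports Defs "HOL-Computational_Algebra.Formal_Power_Series"
begin

text \<open>
  Let \<open>r\<close> solve \<open>(\<delta> + r) \<star> (\<delta> + r) \<star> (\<delta> + M) = \<delta>\<close> for convolution; it is a binomial series in \<open>M\<close>.
  A transmutation operator \<open>W\<close>, which turns differentiation of \<open>\<phi>\<close> into \<open>\<lambda>\<psi>. d/dt ((\<delta> + r) \<star> \<psi>)\<close>, maps
  \<open>sin (n s)\<close> and \<open>cos (n s)\<close> to kernels \<open>S n\<close> and \<open>Cs n\<close> such that, with \<open>z n = (\<delta> + r) \<star> Cs n\<close> and a control
  \<open>f = \<integral> k\<close>, one has \<open>w\<^sub>n' = sqrt (2 / \<pi>) S n \<star> k\<close> and \<open>n w\<^sub>n = sqrt (2 / \<pi>) (f - z n \<star> k)\<close>.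
  Reaching \<open>(\<xi>, \<eta>)\<close> with \<open>f(T) = 0\<close> is therefore a moment problem for \<open>k(T - s)\<close> against \<open>z 0 = 1\<close>, \<open>z n\<close> and \<open>S n\<close>,
  with square-summable data because \<open>\<xi>\<close> has a weak derivative.

  These functions are the images of the trigonometric system under an operator \<open>Lop\<close> that differs from multiplication
  by \<open>exp (- r(0) t)\<close> by a smoothing Volterra operator. For \<open>T > 2 \<pi>\<close> they satisfy a lower Riesz bound by a
  compactness and uniqueness argument: a sequence violating it converges to a \<open>2 \<pi>\<close>-periodic \<open>\<Psi>\<close> with
  \<open>Lop \<Psi> = 0\<close> on \<open>[0,T]\<close>; then \<open>\<Psi>(0) = 0\<close>, and \<open>\<Psi>'\<close> solves the analogous equation (with the even part replaced by the odd
  part, and back) and is bounded by a multiple of \<open>\<Psi>\<close>, so that \<open>\<Psi>\<close> is \<open>O((C t)\<^sup>k / k!)\<close> for all \<open>k\<close>, hence zero.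
  The lower bound makes the minimal-norm solutions of the truncated moment problems converge.
\<close>

section \<open>Convolution\<close>

text \<open>The square root comes from the Laplace transform in time. Writing M^ and r^ for
  transforms, mode n satisfies lambda^2 = - n^2 (1 + M^). Put mu = lambda (1 + r^) with (1 + r^)^2
  (1 + M^) = 1; then mu^2 = - n^2, the relation of the plain wave equation, and the transmutation
  substitutes mu for lambda. It can be expanded in a series because mu - lambda = lambda r^ belongs
  to a bounded operator: M in H^2 makes r a constant plus the primitive of a continuous function.

  The smoothing remainder is Hilbert-Schmidt but not small, so by itself it yields a lower bound
  only up to a finite-dimensional kernel; this is why compactness must be joined by a separate
  uniqueness result. T > 2 pi is used there in two ways. The interval [0,T] overlaps its translate
  by 2 pi, so limits on [0,T] of periodic functions can be glued continuously. And the open interval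
  (0,T) contains a translate of every real number, so a derivative found in its interior is found
  everywhere.\<close>

abbreviation cts :: "(real \<Rightarrow> real) \<Rightarrow> bool" where
  "cts f \<equiv> continuous_on UNIV f"

text \<open>For t < 0 the interval \<open>{0..t}\<close> is empty and the convolution vanishes;
  commutativity and associativity can therefore be equations between functions on the whole
  line.\<close>

definition conv :: "(real \<Rightarrow> real) \<Rightarrow> (real \<Rightarrow> real) \<Rightarrow> real \<Rightarrow> real" (infixl "\<star>" 70) where
  "(a \<star> b) t = integral {0..t} (\<lambda>s. a (t - s) * b s)"

lemma cts_on: "cts f \<Longrightarrow> continuous_on {a..b} f"
  by (rule continuous_on_subset) auto

lemma cts_compose: "cts f \<Longrightarrow> continuous_on S g \<Longrightarrow> continuous_on S (\<lambda>x. f (g x))"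
  using continuous_on_compose2[of UNIV f S g] by simp

lemma cts_integrable: "cts f \<Longrightarrow> f integrable_on {a..b}"
  by (intro integrable_continuous_real cts_on)

lemma conv_neg: "t \<le> 0 \<Longrightarrow> (a \<star> b) t = 0"
  by (cases "t = 0") (auto simp: conv_def)

lemma conv_cong:
  assumes "\<And>s. 0 \<le> s \<Longrightarrow> s \<le> t \<Longrightarrow> a s = a' s" "\<And>s. 0 \<le> s \<Longrightarrow> s \<le> t \<Longrightarrow> b s = b' s"
  shows "(a \<star> b) t = (a' \<star> b') t"
  unfolding conv_def by (rule integral_cong) (use assms in auto)

lemma conv_integrand: "cts a \<Longrightarrow> cts b \<Longrightarrow> cts (\<lambda>s. a (t - s) * b s)"
proof -
  assume a: "cts a" and b: "cts b"
  show ?thesis by (intro continuous_on_mult cts_compose[OF a] b continuous_intros)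
qed

lemma conv_integrable: "cts a \<Longrightarrow> cts b \<Longrightarrow> (\<lambda>s. a (t - s) * b s) integrable_on {x..y}"
  by (intro cts_integrable conv_integrand)

lemma conv_add_right: "cts a \<Longrightarrow> cts b \<Longrightarrow> cts c \<Longrightarrow> (a \<star> (\<lambda>s. b s + c s)) = (\<lambda>t. (a \<star> b) t + (a \<star> c) t)"
  unfolding conv_def fun_eq_iff by (auto simp: distrib_left conv_integrable integral_add)

lemma conv_add_left: "cts a \<Longrightarrow> cts b \<Longrightarrow> cts c \<Longrightarrow> ((\<lambda>s. b s + c s) \<star> a) = (\<lambda>t. (b \<star> a) t + (c \<star> a) t)"
  unfolding conv_def fun_eq_iff by (auto simp: distrib_right conv_integrable integral_add)

lemma conv_scale_right: "(a \<star> (\<lambda>s. x * b s)) = (\<lambda>t. x * (a \<star> b) t)"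
  unfolding conv_def fun_eq_iff
  by (metis (no_types, lifting) integral_mult_right mult.left_commute integral_cong)

lemma conv_scale_left: "((\<lambda>s. x * b s) \<star> a) = (\<lambda>t. x * (b \<star> a) t)"
  unfolding conv_def fun_eq_iff by (simp add: mult.assoc)

text \<open>Substituting s = t u moves the parameter t from the limits of integration into the
  integrand, where continuity of parametric integrals applies.\<close>

lemma conv_scaled:
  assumes "cts a" "cts b" "0 \<le> t"
  shows "(a \<star> b) t = t * integral {0..1} (\<lambda>u. a (t * (1 - u)) * b (t * u))"
proof -
  have "((\<lambda>x. t *\<^sub>R (\<lambda>s. a (t - s) * b s) (t * x)) has_integral (integral {t*0..t*1} (\<lambda>s. a (t - s) * b s))) {0..1}"
    by (rule has_integral_substitution[where c=0 and d=t])
       (use assms in \<open>auto intro!: derivative_eq_intros cts_on conv_integrand simp: mult_left_le\<close>)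
  hence "integral {0..1} (\<lambda>u. t * (a (t * (1 - u)) * b (t * u))) = (a \<star> b) t"
    unfolding conv_def by (auto dest!: integral_unique simp: right_diff_distrib)
  thus ?thesis by simp
qed

lemma conv_cts [intro]:
  assumes "cts a" "cts b"
  shows "cts (a \<star> b)"
proof -
  \<comment> \<open>With \<open>max t 0\<close> the rescaled formula also covers negative t, so
    continuity follows on the whole line at once.\<close>
  have eq: "(a \<star> b) t = max t 0 * integral {0..1} (\<lambda>u. a (max t 0 * (1 - u)) * b (max t 0 * u))" for t
    using conv_scaled[OF assms, of t] conv_neg[of t a b] by (cases "t \<ge> 0") auto
  have "cts (\<lambda>t. integral (cbox 0 1) (\<lambda>u. a (max t 0 * (1 - u)) * b (max t 0 * u)))"
    by (rule integral_continuous_on_param)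
       (auto simp: split_beta intro!: continuous_intros cts_compose[OF assms(1)] cts_compose[OF assms(2)])
  thus ?thesis unfolding eq[abs_def] by (auto intro!: continuous_intros)
qed

lemma conv_commute: "cts a \<Longrightarrow> cts b \<Longrightarrow> a \<star> b = b \<star> a"
proof
  fix t :: real
  assume ab: "cts a" "cts b"
  have "((\<lambda>s. b (t - s) * a s) has_integral integral {0..t} (\<lambda>s. b (t - s) * a s)) {0..t}"
    using conv_integrable[OF ab(2,1)] by (rule integrable_integral)
  hence "((\<lambda>s. b (t - s) * a s) has_integral integral {0..t} (\<lambda>s. b (t - s) * a s)) (cbox 0 t)"
    by simp
  from has_integral_affinity[OF this, of "-1" t]
  have "((\<lambda>x. b (t - (t - x)) * a (t - x)) has_integral integral {0..t} (\<lambda>s. b (t - s) * a s)) ((\<lambda>x. t - x) ` {0..t})"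
    by (simp add: algebra_simps)
  moreover have "((\<lambda>x. t - x) ` {0..t}) = {0..t}"
    by (auto simp: image_iff intro: bexI[of _ "t - _"])
  ultimately show "(a \<star> b) t = (b \<star> a) t"
    unfolding conv_def by (simp add: integral_unique mult.commute)
qed

text \<open>Fubini on the triangle a \<le> \<tau> \<le> s \<le> b. A majorant in \<tau> alone
  suffices since s stays in a bounded interval; thus the factor depending on \<tau> may be merely
  integrable.\<close>

lemma triangle_swap:
  fixes F :: "real \<Rightarrow> real \<Rightarrow> real"
  assumes [measurable]: "case_prod F \<in> borel_measurable (lborel \<Otimes>\<^sub>M lborel)"
    and g: "integrable lborel g"
    and bound: "\<And>s \<tau>. a \<le> \<tau> \<Longrightarrow> \<tau> \<le> s \<Longrightarrow> s \<le> b \<Longrightarrow> \<bar>F s \<tau>\<bar> \<le> \<bar>g \<tau>\<bar>"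
  shows "(LBINT s:{a..b}. (LBINT \<tau>:{a..s}. F s \<tau>)) = (LBINT \<tau>:{a..b}. (LBINT s:{\<tau>..b}. F s \<tau>))"
proof -
  let ?G = "\<lambda>s \<tau>. if a \<le> \<tau> \<and> \<tau> \<le> s \<and> s \<le> b then F s \<tau> else 0"
  let ?H = "\<lambda>(s, \<tau>). indicator {a..b} s * \<bar>g \<tau>\<bar>"
  have [measurable]: "g \<in> borel_measurable borel" using g by auto
  have "integrable lborel (indicat_real {a..b})" by (rule integrable_real_indicator) (auto simp: emeasure_lborel_Icc_eq)
  with g have Hi: "integrable (lborel \<Otimes>\<^sub>M lborel) ?H"
    by (intro lborel_pair.Fubini_integrable) (auto simp: abs_mult)
  have "integrable (lborel \<Otimes>\<^sub>M lborel) (case_prod ?G)"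
    by (rule Bochner_Integration.integrable_bound[OF Hi])
       (use bound in \<open>auto simp: indicator_def split_beta\<close>)
  from lborel_pair.Fubini_integral[OF this]
  have "(LBINT \<tau>. LBINT s. ?G s \<tau>) = (LBINT s. LBINT \<tau>. ?G s \<tau>)" .
  also have "(LBINT s. LBINT \<tau>. ?G s \<tau>) = (LBINT s:{a..b}. (LBINT \<tau>:{a..s}. F s \<tau>))"
  proof -
    have "(LBINT \<tau>. ?G s \<tau>) = indicator {a..b} s *\<^sub>R (LBINT \<tau>:{a..s}. F s \<tau>)" for s
    proof (cases "s \<in> {a..b}")
      case True then show ?thesis unfolding set_lebesgue_integral_def
        by (auto intro!: Bochner_Integration.integral_cong simp: indicator_def)
    next
      case False
      then have "?G s \<tau> = 0" for \<tau> by auto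
      then show ?thesis using False by simp
    qed
    then show ?thesis unfolding set_lebesgue_integral_def[of lborel "{a..b}"] by simp
  qed
  also have "(LBINT \<tau>. LBINT s. ?G s \<tau>) = (LBINT \<tau>:{a..b}. (LBINT s:{\<tau>..b}. F s \<tau>))"
  proof -
    have "(LBINT s. ?G s \<tau>) = indicator {a..b} \<tau> *\<^sub>R (LBINT s:{\<tau>..b}. F s \<tau>)" for \<tau>
    proof (cases "\<tau> \<in> {a..b}")
      case True then show ?thesis unfolding set_lebesgue_integral_def
        by (auto intro!: Bochner_Integration.integral_cong simp: indicator_def)
    next
      case False
      then have "?G s \<tau> = 0" for s by auto
      then show ?thesis using False by simp
    qed
    then show ?thesis unfolding set_lebesgue_integral_def[of lborel "{a..b}"] by simp
  qed
  finally show ?thesis ..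
qed

lemma cts_measurable: "cts f \<Longrightarrow> f \<in> borel_measurable borel"
  by (rule borel_measurable_continuous_onI)

lemma cts_bounded_on:
  assumes "cts f" shows "\<exists>B\<ge>0. \<forall>s. \<bar>s\<bar> \<le> T \<longrightarrow> \<bar>f s\<bar> \<le> B"
proof -
  have "compact (f ` {-T..T})" by (intro compact_continuous_image cts_on assms) auto
  then obtain B where B: "\<forall>x\<in>f ` {-T..T}. norm x \<le> B" using compact_imp_bounded bounded_iff by meson
  have "\<bar>f s\<bar> \<le> max B 0" if "\<bar>s\<bar> \<le> T" for s
  proof -
    have "f s \<in> f ` {-T..T}" using that by (intro imageI) (auto simp: abs_le_iff)
    then have "norm (f s) \<le> B" using B by blast
    then show ?thesis by simp
  qed
  thus ?thesis by (intro exI[of _ "max B 0"]) auto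
qed

text \<open>Absolutely integrable functions are Lebesgue measurable, whereas Fubini for pairs of
  \<open>lborel\<close> asks for Borel functions. Changing the function on a negligible set bridges
  the two.\<close>

lemma borel_representative:
  assumes "g absolutely_integrable_on {a..b::real}"
  obtains h N where "integrable lborel h" "negligible N" "\<And>x. x \<notin> N \<Longrightarrow> x \<in> {a..b} \<Longrightarrow> g x = (h x::real)"
proof -
  have i: "integrable lebesgue (\<lambda>x. indicator {a..b} x *\<^sub>R g x)"
    using assms by (simp add: set_integrable_def)
  from completion_ex_borel_measurable_real[OF borel_measurable_integrable[OF i]]
  obtain h where h: "h \<in> borel_measurable lborel" "AE x in lborel. indicator {a..b} x *\<^sub>R g x = h x" by auto
  have ae: "AE x in lebesgue. indicator {a..b} x *\<^sub>R g x = h x" by (rule AE_completion[OF h(2)])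
  have "integrable lebesgue h"
    by (rule integrable_cong_AE_imp[OF i]) (use h ae in \<open>auto intro: measurable_completion\<close>)
  hence 1: "integrable lborel h" using h(1) by (simp add: integrable_completion)
  obtain N where N: "N \<in> null_sets lebesgue" "{x \<in> space lebesgue. \<not> indicator {a..b} x *\<^sub>R g x = h x} \<subseteq> N"
    using ae unfolding eventually_ae_filter by auto
  show ?thesis
  proof (rule that[of h N])
    show "negligible N" using N(1) by (simp add: negligible_iff_null_sets)
    fix x assume "x \<notin> N" "x \<in> {a..b}"
    then show "g x = h x" using N(2) by (cases "g x = h x") (auto simp: indicator_def subset_eq)
  qed (rule 1)
qed

lemma conv_spike:
  assumes "negligible N" "\<And>x. x \<notin> N \<Longrightarrow> x \<in> {0..t} \<Longrightarrow> g x = h x"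
  shows "(a \<star> g) t = (a \<star> h) t"
  unfolding conv_def by (rule integral_spike[OF assms(1)]) (use assms(2) in auto)

lemma set_integrable_cts_mult:
  assumes "cts a" "integrable lborel g"
  shows "set_integrable lborel {x..y} (\<lambda>s. a s * g s)"
proof -
  have [measurable]: "a \<in> borel_measurable borel" "g \<in> borel_measurable borel"
    using cts_measurable[OF assms(1)] borel_measurable_integrable[OF assms(2)] by auto
  obtain B where B: "B \<ge> 0" "\<forall>s. \<bar>s\<bar> \<le> max \<bar>x\<bar> \<bar>y\<bar> \<longrightarrow> \<bar>a s\<bar> \<le> B" using cts_bounded_on[OF assms(1)] by blast
  show ?thesis unfolding set_integrable_def
    by (rule Bochner_Integration.integrable_bound[of _ "\<lambda>s. B * g s"])
       (use assms(2) B in \<open>auto simp: indicator_def abs_mult intro!: mult_right_mono\<close>)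
qed

lemma conv_borel:
  assumes "cts a" "integrable lborel g"
  shows "(a \<star> g) t = (LBINT s:{0..t}. a (t - s) * g s)"
proof -
  have "cts (\<lambda>s. a (t - s))" by (intro cts_compose[OF assms(1)] continuous_intros)
  from set_borel_integral_eq_integral(2)[OF set_integrable_cts_mult[OF this assms(2)]]
  show ?thesis unfolding conv_def by simp
qed

text \<open>The last factor is only integrable because it will be the derivative k of the control,
  which is merely in L^2.\<close>

lemma conv_assoc_L1:
  assumes a: "cts a" and b: "cts b" and g: "g absolutely_integrable_on {0..t}"
  shows "(a \<star> (b \<star> g)) t = ((a \<star> b) \<star> g) t"
proof (cases "0 \<le> t")
  case False then show ?thesis by (simp add: conv_neg)
next
  case True
  obtain h N where h: "integrable lborel h" and N: "negligible N" "\<And>x. x \<notin> N \<Longrightarrow> x \<in> {0..t} \<Longrightarrow> g x = h x"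
    using borel_representative[OF g] by blast
  have [measurable]: "a \<in> borel_measurable borel" "b \<in> borel_measurable borel" "h \<in> borel_measurable borel"
    using cts_measurable[OF a] cts_measurable[OF b] borel_measurable_integrable[OF h] by auto
  obtain A where A: "A \<ge> 0" "\<forall>s. \<bar>s\<bar> \<le> t \<longrightarrow> \<bar>a s\<bar> \<le> A" using cts_bounded_on[OF a] by blast
  obtain B where B: "B \<ge> 0" "\<forall>s. \<bar>s\<bar> \<le> t \<longrightarrow> \<bar>b s\<bar> \<le> B" using cts_bounded_on[OF b] by blast
  let ?F = "\<lambda>s \<tau>. a (t - s) * (b (s - \<tau>) * h \<tau>)"
  have bh: "(b \<star> g) s = (LBINT \<tau>:{0..s}. b (s - \<tau>) * h \<tau>)" if "s \<le> t" for s
  proof -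
    have "(b \<star> g) s = (b \<star> h) s" by (rule conv_spike[OF N(1)]) (use N(2) that in auto)
    then show ?thesis using conv_borel[OF b h] by simp
  qed
  have L: "(LBINT s:{0..t}. (LBINT \<tau>:{0..s}. ?F s \<tau>)) = (LBINT \<tau>:{0..t}. (LBINT s:{\<tau>..t}. ?F s \<tau>))"
  proof (rule triangle_swap[where g="\<lambda>\<tau>. A * (B * h \<tau>)"])
    fix s \<tau> assume "0 \<le> \<tau>" "\<tau> \<le> s" "s \<le> t"
    then show "\<bar>?F s \<tau>\<bar> \<le> \<bar>A * (B * h \<tau>)\<bar>"
      unfolding abs_mult using A B by (intro mult_mono) auto
  qed (use h in auto)
  have "(LBINT s:{0..t}. (LBINT \<tau>:{0..s}. ?F s \<tau>)) = (LBINT s:{0..t}. a (t - s) * (b \<star> g) s)"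
    by (intro set_lebesgue_integral_cong) (auto simp: bh)
  also have "\<dots> = (a \<star> (b \<star> g)) t"
  proof -
    have "set_integrable lborel {0..t} (\<lambda>s. a (t - s) * (b \<star> g) s)"
    proof -
      \<comment> \<open>Measurability and integrability of the outer integrand come from Fubini: it
        is the marginal of an integrable function on the plane.\<close>
      have "integrable lborel (\<lambda>s. LBINT \<tau>. (if 0 \<le> \<tau> \<and> \<tau> \<le> s \<and> s \<le> t then ?F s \<tau> else 0))"
      proof (rule lborel_pair.integrable_fst[where f="\<lambda>s \<tau>. if 0 \<le> \<tau> \<and> \<tau> \<le> s \<and> s \<le> t then ?F s \<tau> else 0"], rule Bochner_Integration.integrable_bound[of _ "\<lambda>(s,\<tau>). indicator {0..t} s * (A * (B * \<bar>h \<tau>\<bar>))"])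
        show "integrable (lborel \<Otimes>\<^sub>M lborel) (\<lambda>(s,\<tau>). indicator {0..t} s * (A * (B * \<bar>h \<tau>\<bar>)))"
          using h integrable_real_indicator[of "{0..t}" lborel]
          by (intro lborel_pair.Fubini_integrable) (auto simp: abs_mult emeasure_lborel_Icc_eq)
        have "\<bar>?F s \<tau>\<bar> \<le> A * (B * \<bar>h \<tau>\<bar>)" if "0 \<le> \<tau>" "\<tau> \<le> s" "s \<le> t" for s \<tau>
          unfolding abs_mult using A B that by (intro mult_mono) auto
        then show "AE x in lborel \<Otimes>\<^sub>M lborel. norm (case x of (s, \<tau>) \<Rightarrow> if 0 \<le> \<tau> \<and> \<tau> \<le> s \<and> s \<le> t then ?F s \<tau> else 0)
           \<le> norm (case x of (s,\<tau>) \<Rightarrow> indicator {0..t} s * (A * (B * \<bar>h \<tau>\<bar>)))"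
          using A(1) B(1) by (auto simp: indicator_def intro!: AE_I2)
      qed (auto simp: split_beta)
      also have "(\<lambda>s. LBINT \<tau>. (if 0 \<le> \<tau> \<and> \<tau> \<le> s \<and> s \<le> t then ?F s \<tau> else 0)) = (\<lambda>s. indicator {0..t} s *\<^sub>R (a (t - s) * (b \<star> g) s))"
      proof
        fix s show "(LBINT \<tau>. (if 0 \<le> \<tau> \<and> \<tau> \<le> s \<and> s \<le> t then ?F s \<tau> else 0)) = indicator {0..t} s *\<^sub>R (a (t - s) * (b \<star> g) s)"
        proof (cases "s \<in> {0..t}")
          case True
          have "(LBINT \<tau>. (if 0 \<le> \<tau> \<and> \<tau> \<le> s \<and> s \<le> t then ?F s \<tau> else 0)) = (LBINT \<tau>:{0..s}. ?F s \<tau>)"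
            unfolding set_lebesgue_integral_def using True by (intro Bochner_Integration.integral_cong) (auto simp: indicator_def)
          then show ?thesis using True bh by simp
        next
          case False
          then have z: "(if 0 \<le> \<tau> \<and> \<tau> \<le> s \<and> s \<le> t then ?F s \<tau> else 0) = 0" for \<tau> by auto
          show ?thesis unfolding z using False by simp
        qed
      qed
      finally show ?thesis unfolding set_integrable_def .
    qed
    from set_borel_integral_eq_integral(2)[OF this] show ?thesis by (simp add: conv_def)
  qed
  finally have 1: "(LBINT s:{0..t}. (LBINT \<tau>:{0..s}. ?F s \<tau>)) = (a \<star> (b \<star> g)) t" .
  have "(LBINT s:{\<tau>..t}. ?F s \<tau>) = (a \<star> b) (t - \<tau>) * h \<tau>" if "\<tau> \<in> {0..t}" for \<tau>
  proof -
    have c: "cts (\<lambda>s. a (t - s) * b (s - \<tau>))" by (intro continuous_intros cts_compose[OF a] cts_compose[OF b])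
    have "set_integrable lborel {\<tau>..t} (\<lambda>s. a (t - s) * b (s - \<tau>))"
      unfolding set_integrable_def using borel_integrable_atLeastAtMost'[OF cts_on[OF c]] by (simp add: set_integrable_def)
    from set_borel_integral_eq_integral(2)[OF this]
    have "(LBINT s:{\<tau>..t}. a (t - s) * b (s - \<tau>)) = integral {\<tau>..t} (\<lambda>s. a (t - s) * b (s - \<tau>))" .
    also have "\<dots> = integral {0 + \<tau>..(t - \<tau>) + \<tau>} (\<lambda>s. a (t - s) * b (s - \<tau>))" by simp
    also have "\<dots> = integral {0..t - \<tau>} ((\<lambda>s. a (t - s) * b (s - \<tau>)) \<circ> (\<lambda>x. x + \<tau>))"
      by (rule integral_shift[symmetric]) (rule cts_on[OF c])
    also have "\<dots> = (a \<star> b) (t - \<tau>)" by (simp add: conv_def o_def algebra_simps)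
    finally show ?thesis by (simp add: mult.assoc[symmetric])
  qed
  then have "(LBINT \<tau>:{0..t}. (LBINT s:{\<tau>..t}. ?F s \<tau>)) = (LBINT \<tau>:{0..t}. (a \<star> b) (t - \<tau>) * h \<tau>)"
    by (intro set_lebesgue_integral_cong) auto
  also have "\<dots> = ((a \<star> b) \<star> h) t" by (rule conv_borel[symmetric]) (use a b h in auto)
  also have "\<dots> = ((a \<star> b) \<star> g) t" by (rule conv_spike[OF N(1), symmetric]) (use N(2) in auto)
  finally show ?thesis using L 1 by simp
qed

lemma cts_abs_integrable: "cts f \<Longrightarrow> f absolutely_integrable_on {a..b}"
  by (rule absolutely_integrable_continuous_real) (rule cts_on)

lemma conv_assoc: "cts a \<Longrightarrow> cts b \<Longrightarrow> cts c \<Longrightarrow> a \<star> (b \<star> c) = (a \<star> b) \<star> c"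
  by (rule ext) (rule conv_assoc_L1, auto intro: cts_abs_integrable)

lemma conv_left_commute: "cts a \<Longrightarrow> cts b \<Longrightarrow> cts c \<Longrightarrow> a \<star> (b \<star> c) = b \<star> (a \<star> c)"
  by (simp only: conv_assoc conv_commute[of a b])

lemma conv_bound:
  assumes a: "\<And>s. 0 \<le> s \<Longrightarrow> s \<le> t \<Longrightarrow> \<bar>a s\<bar> \<le> A" and "cts a" "g absolutely_integrable_on {0..t}"
  shows "\<bar>(a \<star> g) t\<bar> \<le> A * integral {0..t} (\<lambda>s. \<bar>g s\<bar>)"
proof -
  have gi: "(\<lambda>s. \<bar>g s\<bar>) integrable_on {0..t}" using assms(3) by (auto simp: absolutely_integrable_on_def)
  have "(\<lambda>s. a (t - s) * g s) absolutely_integrable_on {0..t}"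
  proof (rule absolutely_integrable_bounded_measurable_product_real)
    show "(\<lambda>s. a (t - s)) \<in> borel_measurable (lebesgue_on {0..t})"
      by (intro continuous_imp_measurable_on_sets_lebesgue cts_compose[OF assms(2)] continuous_intros) auto
    have "\<bar>a (t - x)\<bar> \<le> A" if "x \<in> {0..t}" for x using a[of "t - x"] that by auto
    then show "bounded ((\<lambda>s. a (t - s)) ` {0..t})" by (auto simp: bounded_iff intro!: exI[of _ A])
  qed (use assms in auto)
  then have "norm (integral {0..t} (\<lambda>s. a (t - s) * g s)) \<le> integral {0..t} (\<lambda>s. A * \<bar>g s\<bar>)"
    using integrable_cmul[OF gi, of A] a
    by (intro integral_norm_bound_integral) (auto simp: abs_mult absolutely_integrable_on_def intro!: mult_right_mono)
  then show ?thesis using gi by (simp add: conv_def)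
qed

text \<open>Continuity is local, so the summable majorant may depend on the radius of the ball on
  which the Weierstrass test is run.\<close>

lemma cts_suminf:
  fixes f :: "nat \<Rightarrow> real \<Rightarrow> real"
  assumes f: "\<And>k. cts (f k)"
    and b: "\<And>x. \<exists>\<beta>. summable \<beta> \<and> (\<forall>k s. \<bar>s\<bar> \<le> x \<longrightarrow> \<bar>f k s\<bar> \<le> \<beta> k)"
  shows "cts (\<lambda>t. \<Sum>k. f k t)"
proof -
  have "continuous_on (ball 0 n) (\<lambda>t. \<Sum>k. f k t)" for n :: real
  proof (rule uniform_limit_theorem[of _ "\<lambda>m t. \<Sum>k<m. f k t" sequentially])
    obtain \<beta> where \<beta>: "summable \<beta>" "\<And>k s. \<bar>s\<bar> \<le> n \<Longrightarrow> \<bar>f k s\<bar> \<le> \<beta> k" using b[of n] by blast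
    show "uniform_limit (ball 0 n) (\<lambda>m t. \<Sum>k<m. f k t) (\<lambda>t. \<Sum>k. f k t) sequentially"
      by (rule Weierstrass_m_test[OF _ \<beta>(1)]) (use \<beta>(2) in auto)
  qed (auto intro!: always_eventually continuous_intros continuous_on_subset[OF f])
  then have "continuous_on (ball 0 (\<bar>x\<bar> + 1)) (\<lambda>t. \<Sum>k. f k t)" for x :: real by simp
  then have "isCont (\<lambda>t. \<Sum>k. f k t) x" for x
    using continuous_on_interior[of "ball 0 (\<bar>x\<bar> + 1)" _ x] by auto
  then show ?thesis by (simp add: continuous_on_eq_continuous_at)
qed

lemma conv_suminf:
  fixes f :: "nat \<Rightarrow> real \<Rightarrow> real"
  assumes a: "cts a" and f: "\<And>k. cts (f k)" and b: "\<And>k s. 0 \<le> s \<Longrightarrow> s \<le> t \<Longrightarrow> \<bar>f k s\<bar> \<le> \<beta> k" and sm: "summable \<beta>"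
  shows "(\<lambda>k. (a \<star> f k) t) sums (a \<star> (\<lambda>s. \<Sum>k. f k s)) t"
proof -
  obtain A where A: "A \<ge> 0" "\<forall>s. \<bar>s\<bar> \<le> t \<longrightarrow> \<bar>a s\<bar> \<le> A" using cts_bounded_on[OF a] by blast
  have ul: "uniform_limit {0..t} (\<lambda>m s. \<Sum>k<m. a (t - s) * f k s) (\<lambda>s. \<Sum>k. a (t - s) * f k s) sequentially"
  proof (rule Weierstrass_m_test)
    fix k s assume "s \<in> {0..t}"
    then show "norm (a (t - s) * f k s) \<le> A * \<beta> k"
      unfolding real_norm_def abs_mult using A b[of s k] by (intro mult_mono) auto
  qed (use sm in auto)
  obtain I J where IJ: "\<And>m. ((\<lambda>s. \<Sum>k<m. a (t - s) * f k s) has_integral I m) {0..t}"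
     "((\<lambda>s. \<Sum>k. a (t - s) * f k s) has_integral J) {0..t}" "I \<longlonglongrightarrow> J"
    by (rule uniform_limit_integral[OF ul]) (intro continuous_intros cts_on[OF f] cts_compose[OF a], auto)
  have "I = (\<lambda>m. \<Sum>k<m. (a \<star> f k) t)"
  proof
    fix m
    have "integral {0..t} (\<lambda>s. \<Sum>k<m. a (t - s) * f k s) = (\<Sum>k<m. integral {0..t} (\<lambda>s. a (t - s) * f k s))"
      by (rule integral_sum) (auto intro!: conv_integrable a f)
    then show "I m = (\<Sum>k<m. (a \<star> f k) t)" using IJ(1)[of m] by (simp add: conv_def integral_unique)
  qed
  moreover have "J = (a \<star> (\<lambda>s. \<Sum>k. f k s)) t"
  proof -
    have "(\<Sum>k. a (t - s) * f k s) = a (t - s) * (\<Sum>k. f k s)" if "s \<in> {0..t}" for s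
      by (rule suminf_mult) (rule summable_comparison_test'[OF sm, of 0], use b that in auto)
    then have "integral {0..t} (\<lambda>s. \<Sum>k. a (t - s) * f k s) = (a \<star> (\<lambda>s. \<Sum>k. f k s)) t"
      unfolding conv_def by (intro integral_cong) auto
    then show ?thesis using IJ(2) by (simp add: integral_unique)
  qed
  ultimately show ?thesis using IJ(3) by (simp add: sums_def)
qed

text \<open>As a convolution with the constant 1, the primitive is moved past other kernels by
  associativity and commutativity.\<close>

abbreviation J :: "(real \<Rightarrow> real) \<Rightarrow> real \<Rightarrow> real" where
  "J \<phi> \<equiv> (\<lambda>_. 1) \<star> \<phi>"

lemma J_eq: "J \<phi> t = integral {0..t} \<phi>"
  by (simp add: conv_def)

lemma cts_const: "cts (\<lambda>_. c)" by simp

lemma integral_power_fact: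
  assumes "0 \<le> t" shows "((\<lambda>s. s ^ k / fact k) has_integral (t ^ Suc k / fact (Suc k))) {0..t::real}"
proof -
  have "((\<lambda>s. s ^ k / fact k) has_integral (t ^ Suc k / fact (Suc k) - 0 ^ Suc k / fact (Suc k))) {0..t}"
  proof (rule fundamental_theorem_of_calculus[OF assms])
    fix x assume "x \<in> {0..t}"
    have "((\<lambda>s. s ^ Suc k / fact (Suc k)) has_real_derivative (x ^ k / fact k)) (at x within {0..t})"
      by (rule derivative_eq_intros refl | simp)+
    then show "((\<lambda>s. s ^ Suc k / fact (Suc k)) has_vector_derivative (x ^ k / fact k)) (at x within {0..t})"
      by (simp add: has_real_derivative_iff_has_vector_derivative)
  qed
  then show ?thesis by simp
qed

text \<open>Integrating s^k / k! raises the power and the factorial by one. Iterated, this gives the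
  factorial decay that makes series in convolution powers converge.\<close>

lemma conv_power_bound:
  assumes a: "cts a" "\<And>s. \<bar>s\<bar> \<le> T \<Longrightarrow> \<bar>a s\<bar> \<le> A" and b: "cts b" "\<And>s. \<bar>s\<bar> \<le> T \<Longrightarrow> \<bar>b s\<bar> \<le> C * \<bar>s\<bar> ^ k / fact k"
    and t: "\<bar>t\<bar> \<le> T" and "A \<ge> 0" "C \<ge> 0"
  shows "\<bar>(a \<star> b) t\<bar> \<le> A * C * \<bar>t\<bar> ^ Suc k / fact (Suc k)"
proof (cases "0 \<le> t")
  case True
  have i: "((\<lambda>s. A * C * (s ^ k / fact k)) has_integral (A * C * (t ^ Suc k / fact (Suc k)))) {0..t}"
    by (intro has_integral_mult_right integral_power_fact True)
  have "norm (integral {0..t} (\<lambda>s. a (t - s) * b s)) \<le> integral {0..t} (\<lambda>s. A * C * (s ^ k / fact k))"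
  proof (rule integral_norm_bound_integral)
    fix s assume s: "s \<in> {0..t}"
    have "\<bar>a (t - s)\<bar> * \<bar>b s\<bar> \<le> A * (C * \<bar>s\<bar> ^ k / fact k)"
      by (intro mult_mono a b) (use s t \<open>A \<ge> 0\<close> in auto)
    then show "norm (a (t - s) * b s) \<le> A * C * (s ^ k / fact k)" using s by (simp add: abs_mult)
  qed (use a b i in \<open>auto intro: conv_integrable\<close>)
  also have "\<dots> = A * C * (t ^ Suc k / fact (Suc k))" using i by (rule integral_unique)
  finally show ?thesis using True by (simp add: conv_def)
next
  case False
  have "0 \<le> A * C * \<bar>t\<bar> ^ Suc k / fact (Suc k)"
    using assms(6,7) by (intro divide_nonneg_nonneg mult_nonneg_nonneg) auto
  with False conv_neg[of t a b] show ?thesis by simp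
qed

section \<open>Convolution powers and the inverse square root\<close>

text \<open>\<open>cpow a k\<close> has k + 1 factors: the zeroth power would be \<delta>, which is
  not a function. Hence the coefficients with index \<open>Suc k\<close> in the series built on
  it.\<close>

primrec cpow :: "(real \<Rightarrow> real) \<Rightarrow> nat \<Rightarrow> real \<Rightarrow> real" where
  "cpow a 0 = a"
| "cpow a (Suc k) = a \<star> cpow a k"

lemma cpow_cts: "cts a \<Longrightarrow> cts (cpow a k)"
  by (induction k) auto

lemma cpow_conv: "cts a \<Longrightarrow> cpow a i \<star> cpow a j = cpow a (Suc (i + j))"
  by (induction i) (auto simp: cpow_cts simp flip: conv_assoc)

lemma cpow_bound:
  assumes a: "cts a" "\<And>s. \<bar>s\<bar> \<le> T \<Longrightarrow> \<bar>a s\<bar> \<le> A" and "\<bar>t\<bar> \<le> T" "A \<ge> 0"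
  shows "\<bar>cpow a k t\<bar> \<le> A ^ Suc k * \<bar>t\<bar> ^ k / fact k"
  using assms(3)
proof (induction k arbitrary: t)
  case (Suc k)
  from conv_power_bound[OF a cpow_cts[OF a(1)] Suc.IH Suc.prems assms(4)]
  show ?case using assms(4) by simp
qed (use a in simp)

lemma summable_power_fact: "summable (\<lambda>k. C * x ^ k / fact k :: real)"
  using summable_mult[OF summable_exp[of x], of C] by (simp add: field_simps)

definition cser :: "(real \<Rightarrow> real) \<Rightarrow> (nat \<Rightarrow> real) \<Rightarrow> real \<Rightarrow> real" where
  "cser a d t = (\<Sum>k. d k * cpow a k t)"

text \<open>The weight k + 1 anticipates the product of two series, in which k + 1 pairs of indices
  have the same sum k.\<close>

lemma cpow_majorant:
  assumes "cts a"
  shows "\<exists>\<beta>. summable (\<lambda>k. real (Suc k) * \<beta> k) \<and> summable \<beta> \<and> (\<forall>k s. \<bar>s\<bar> \<le> x \<longrightarrow> \<bar>cpow a k s\<bar> \<le> \<beta> k)"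
proof -
  obtain A where A: "A \<ge> 0" "\<forall>s. \<bar>s\<bar> \<le> x \<longrightarrow> \<bar>a s\<bar> \<le> A" using cts_bounded_on[OF assms] by blast
  let ?\<beta> = "\<lambda>k. A * (A * \<bar>x\<bar>) ^ k / fact k"
  have 1: "summable ?\<beta>" by (rule summable_power_fact)
  \<comment> \<open>The weight is absorbed by k + 1 \<le> 2^(k + 1), at the price of a factor 2 and
    of doubling the argument of the exponential series.\<close>
  have "real (Suc k) * (1 / fact k) \<le> 2 * 2 ^ k / fact k" for k :: nat
  proof -
    have "real (Suc k) < real (2 ^ Suc k)" using less_exp[of "Suc k"] by (simp only: of_nat_less_iff)
    then show ?thesis by (simp add: divide_right_mono)
  qed
  then have "real (Suc k) * (1 / fact k) * (A * (A * \<bar>x\<bar>) ^ k) \<le> 2 * 2 ^ k / fact k * (A * (A * \<bar>x\<bar>) ^ k)" for k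
    using A by (intro mult_right_mono) auto
  then have le: "real (Suc k) * ?\<beta> k \<le> (2 * A) * (2 * A * \<bar>x\<bar>) ^ k / fact k" for k
    by (simp add: power_mult_distrib mult_ac)
  have 2: "summable (\<lambda>k. real (Suc k) * ?\<beta> k)"
  proof (rule summable_comparison_test'[OF summable_power_fact[of "2 * A" "2 * A * \<bar>x\<bar>"], of 0])
    fix n :: nat show "norm (real (Suc n) * ?\<beta> n) \<le> (2 * A) * (2 * A * \<bar>x\<bar>) ^ n / fact n"
      using le[of n] A(1) by (simp add: abs_mult)
  qed
  have 3: "\<bar>cpow a k s\<bar> \<le> ?\<beta> k" if "\<bar>s\<bar> \<le> x" for k s
  proof -
    have "\<bar>cpow a k s\<bar> \<le> A ^ Suc k * \<bar>s\<bar> ^ k / fact k"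
      using cpow_bound[OF assms _ that A(1)] A(2) by blast
    also have "\<dots> \<le> A ^ Suc k * \<bar>x\<bar> ^ k / fact k"
      using A that by (intro divide_right_mono mult_left_mono power_mono) auto
    finally show ?thesis by (simp add: power_mult_distrib mult_ac)
  qed
  show ?thesis by (intro exI[of _ ?\<beta>] conjI allI impI 1 2 3)
qed

lemma coeff_mult_le: "\<bar>d\<bar> \<le> 1 \<Longrightarrow> \<bar>y\<bar> \<le> b \<Longrightarrow> \<bar>d * y\<bar> \<le> (b::real)"
  using mult_mono[of "\<bar>d\<bar>" 1 "\<bar>y\<bar>" b] by (simp add: abs_mult)

context
  fixes a :: "real \<Rightarrow> real"
  assumes a: "cts a"
begin

lemma cser_majorant:
  assumes "\<forall>k. \<bar>d k\<bar> \<le> 1"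
  shows "\<exists>\<beta>. summable \<beta> \<and> (\<forall>k s. \<bar>s\<bar> \<le> x \<longrightarrow> \<bar>d k * cpow a k s\<bar> \<le> \<beta> k)"
proof -
  obtain \<beta> where \<beta>: "summable \<beta>" "\<forall>k s. \<bar>s\<bar> \<le> x \<longrightarrow> \<bar>cpow a k s\<bar> \<le> \<beta> k"
    using cpow_majorant[OF a, of x] by blast
  show ?thesis by (rule exI[of _ \<beta>]) (use \<beta> assms in \<open>auto intro!: coeff_mult_le\<close>)
qed

lemma cser_summable: "(\<forall>k. \<bar>d k\<bar> \<le> 1) \<Longrightarrow> summable (\<lambda>k. d k * cpow a k s)"
proof -
  assume "\<forall>k. \<bar>d k\<bar> \<le> 1"
  from cser_majorant[of d "\<bar>s\<bar>", OF this] obtain \<beta>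
    where \<beta>: "summable \<beta>" "\<forall>k s'. \<bar>s'\<bar> \<le> \<bar>s\<bar> \<longrightarrow> \<bar>d k * cpow a k s'\<bar> \<le> \<beta> k" by blast
  show ?thesis by (rule summable_comparison_test'[OF \<beta>(1), of 0]) (use \<beta>(2) in auto)
qed

lemma cser_cts: "(\<forall>k. \<bar>d k\<bar> \<le> 1) \<Longrightarrow> cts (cser a d)"
  unfolding cser_def[abs_def] by (rule cts_suminf) (auto intro!: continuous_intros cpow_cts a cser_majorant)

lemma conv_cser:
  assumes d: "\<forall>k. \<bar>d k\<bar> \<le> 1" and b: "cts b"
  shows "(\<lambda>k. d k * (b \<star> cpow a k) t) sums (b \<star> cser a d) t"
proof -
  obtain \<beta> where \<beta>: "summable \<beta>" "\<And>k s. \<bar>s\<bar> \<le> t \<Longrightarrow> \<bar>d k * cpow a k s\<bar> \<le> \<beta> k"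
    using cser_majorant[of d t, OF d] by blast
  have "(\<lambda>k. (b \<star> (\<lambda>s. d k * cpow a k s)) t) sums (b \<star> (\<lambda>s. \<Sum>k. d k * cpow a k s)) t"
    by (rule conv_suminf[OF b _ _ \<beta>(1)]) (auto intro!: continuous_intros cpow_cts a \<beta>)
  then show ?thesis by (simp add: conv_scale_right cser_def[abs_def])
qed

end

text \<open>A Cauchy product whose absolute convergence is measured by i + j alone: diagonal n has n
  + 1 entries, each at most \<open>\<beta> n\<close>. Unordered sums permit the reindexing of (i, j)
  by (i + j, i).\<close>

lemma double_sum_diagonal:
  fixes f :: "nat \<Rightarrow> nat \<Rightarrow> real"
  assumes le: "\<And>i j. \<bar>f i j\<bar> \<le> \<beta> (i + j)" and sm: "summable (\<lambda>n. real (Suc n) * \<beta> n)"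
  shows "(\<lambda>n. \<Sum>i\<le>n. f i (n - i)) sums (\<Sum>i. \<Sum>j. f i j)"
proof -
  have \<beta>0: "\<beta> n \<ge> 0" for n using le[of n 0] by (smt (verit) add_0_right)
  let ?S = "SIGMA n:UNIV. {..n::nat}"
  let ?g = "\<lambda>(n, i). f i (n - i)"
  have bij: "bij_betw (\<lambda>(n, i). (i, n - i)) ?S (UNIV \<times> UNIV)"
    by (rule bij_betwI[where g="\<lambda>(i, j). (i + j, i)"]) auto
  have 0: "(\<lambda>n. norm (\<Sum>\<^sub>\<infinity>i\<in>{..n}. norm (?g (n, i)))) summable_on UNIV"
  proof (rule summable_on_comparison_test[of "\<lambda>n. real (Suc n) * \<beta> n"])
    show "(\<lambda>n. real (Suc n) * \<beta> n) summable_on UNIV"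
      using sm \<beta>0 by (intro norm_summable_imp_summable_on) (simp add: abs_mult)
    fix n :: nat
    have "(\<Sum>i\<le>n. \<bar>f i (n - i)\<bar>) \<le> (\<Sum>i\<le>n. \<beta> n)"
    proof (rule sum_mono)
      fix i assume "i \<in> {..n}" then show "\<bar>f i (n - i)\<bar> \<le> \<beta> n" using le[of i "n - i"] by simp
    qed
    then show "norm (\<Sum>\<^sub>\<infinity>i\<in>{..n}. norm (?g (n, i))) \<le> real (Suc n) * \<beta> n"
      by (simp add: sum_nonneg)
  qed auto
  have "(\<lambda>x. norm (?g x)) summable_on ?S"
    by (rule Infinite_Sum.abs_summable_on_Sigma_iff[THEN iffD2]) (use 0 in auto)
  then have gs: "?g summable_on ?S" by (rule abs_summable_summable)
  have fs: "(\<lambda>(i, j). f i j) summable_on (UNIV \<times> UNIV)"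
    using gs summable_on_reindex_bij_betw[OF bij, of "\<lambda>(i, j). f i j"] by (simp add: case_prod_unfold)
  have eq: "infsum ?g ?S = infsum (\<lambda>(i, j). f i j) (UNIV \<times> UNIV)"
    using infsum_reindex_bij_betw[OF bij, of "\<lambda>(i, j). f i j"] by (simp add: case_prod_unfold)
  have 1: "((\<lambda>n. \<Sum>i\<le>n. f i (n - i)) has_sum infsum ?g ?S) UNIV"
    by (rule has_sum_SigmaD[OF has_sum_infsum[OF gs]]) auto
  have inner: "((\<lambda>j. f i j) has_sum (\<Sum>j. f i j)) UNIV" for i
  proof -
    have "(\<lambda>j. f i j) summable_on UNIV" using summable_on_SigmaD1[OF fs, of i] by simp
    then show ?thesis using has_sum_imp_sums has_sum_infsum sums_unique by metis
  qed
  have "((\<lambda>i. \<Sum>j. f i j) has_sum infsum (\<lambda>(i, j). f i j) (UNIV \<times> UNIV)) UNIV"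
    by (rule has_sum_SigmaD[OF has_sum_infsum[OF fs]]) (use inner in auto)
  then have "(\<Sum>i. \<Sum>j. f i j) = infsum ?g ?S"
    unfolding eq by (metis has_sum_imp_sums sums_unique)
  then show ?thesis using has_sum_imp_sums[OF 1] by simp
qed

text \<open>The Taylor coefficients of (1 + x)^(-1/2).\<close>

definition rc :: "nat \<Rightarrow> real" where "rc k = ((-1/2) gchoose k)"

text \<open>The quotient of consecutive coefficients is - (k + 1/2) / (k + 1).\<close>

lemma rc_bound: "\<bar>rc k\<bar> \<le> 1"
proof (induction k)
  case (Suc k)
  have "rc (Suc k) = rc k * ((-1/2 - real k) / real (Suc k))"
    using gbinomial_absorb_comp[of "-1/2::real" k] gbinomial_mult_1[of "-1/2::real" k]
    unfolding rc_def by (simp add: field_simps)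
  moreover have "\<bar>(-1/2 - real k) / real (Suc k)\<bar> \<le> 1" by (simp add: field_simps)
  ultimately show ?case using Suc mult_le_one[of "\<bar>rc k\<bar>"] by (metis abs_ge_zero abs_mult)
qed (simp add: rc_def)

text \<open>Vandermonde's identity: the square of (1 + x)^(-1/2) is the geometric series 1 / (1 +
  x).\<close>

lemma rc_conv: "(\<Sum>i\<le>n. rc i * rc (n - i)) = (-1) ^ n"
proof -
  have "(\<Sum>i\<le>n. rc i * rc (n - i)) = ((-1::real) gchoose n)"
    using gbinomial_Vandermonde[where a="-1/2::real" and b="-1/2" and n=n] by (simp add: rc_def atLeast0AtMost)
  also have "\<dots> = (-1) ^ n" using gbinomial_minus[of "1::real" n] by (simp flip: binomial_gbinomial)
  finally show ?thesis .
qed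

text \<open>With \<delta> as unit, \<delta> + r is (\<delta> + a)^(-1/2) and \<delta> + q is
  (\<delta> + a)^(-1). The claims are (\<delta> + r)^2 = \<delta> + q and (\<delta> + a) \<star>
  (\<delta> + q) = \<delta> with the unit cancelled.\<close>

lemma conv_sqrt_series:
  assumes a: "cts a"
  defines "r \<equiv> cser a (\<lambda>k. rc (Suc k))"
  defines "q \<equiv> cser a (\<lambda>k. (-1) ^ Suc k)"
  shows "2 * r t + (r \<star> r) t = q t" "q t + a t + (a \<star> q) t = 0"
proof -
  have d: "\<forall>k. \<bar>rc (Suc k)\<bar> \<le> 1" using rc_bound by simp
  have e: "\<forall>k. \<bar>(-1::real) ^ Suc k\<bar> \<le> 1" by simp
  have rcts: "cts r" unfolding r_def by (rule cser_cts[OF a d])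
  have ci: "(cpow a i \<star> r) t = (\<Sum>j. rc (Suc j) * cpow a (Suc (i + j)) t)" for i
    using conv_cser[OF a d cpow_cts[OF a, of i], of t] unfolding r_def[symmetric]
    by (simp add: cpow_conv[OF a] sums_unique)
  have "(\<lambda>i. rc (Suc i) * (r \<star> cpow a i) t) sums (r \<star> r) t"
    using conv_cser[OF a d rcts, of t] unfolding r_def[symmetric] .
  then have rr: "(r \<star> r) t = (\<Sum>i. rc (Suc i) * (\<Sum>j. rc (Suc j) * cpow a (Suc (i + j)) t))"
    by (simp add: conv_commute[OF rcts cpow_cts[OF a]] ci sums_unique)
  obtain \<beta> where \<beta>: "summable (\<lambda>k. real (Suc k) * \<beta> k)" "\<And>s k. \<bar>s\<bar> \<le> \<bar>t\<bar> \<Longrightarrow> \<bar>cpow a k s\<bar> \<le> \<beta> k"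
    using cpow_majorant[OF a, of "\<bar>t\<bar>"] by blast
  have \<beta>0: "\<beta> n \<ge> 0" for n using \<beta>(2)[of t n] abs_ge_zero[of "cpow a n t"] by linarith
  have sm1: "summable (\<lambda>n. real (Suc n) * \<beta> (Suc n))"
    by (rule summable_comparison_test'[OF \<beta>(1)[THEN summable_Suc_iff[THEN iffD2]], of 0]) (use \<beta>0 in \<open>auto simp: abs_mult intro!: mult_right_mono\<close>)
  let ?f = "\<lambda>i j. rc (Suc i) * (rc (Suc j) * cpow a (Suc (i + j)) t)"
  have fb: "\<bar>?f i j\<bar> \<le> \<beta> (Suc (i + j))" for i j
    by (intro coeff_mult_le rc_bound \<beta>) simp
  have "(\<Sum>i. \<Sum>j. ?f i j) = (r \<star> r) t"
    unfolding rr
  proof (intro arg_cong[where f=suminf] ext suminf_mult)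
    fix i
    have "summable (\<lambda>j. \<beta> (Suc (i + j)))"
    proof -
      have "summable (\<lambda>j. \<beta> (j + Suc i))"
        by (rule summable_ignore_initial_segment) (rule summable_comparison_test'[OF \<beta>(1), of 0], use \<beta>0 in \<open>auto simp: distrib_right\<close>)
      then show ?thesis by (simp add: add_ac)
    qed
    then show "summable (\<lambda>j. rc (Suc j) * cpow a (Suc (i + j)) t)"
    proof (rule summable_comparison_test'[of _ 0])
      fix j show "norm (rc (Suc j) * cpow a (Suc (i + j)) t) \<le> \<beta> (Suc (i + j))"
        unfolding real_norm_def by (intro coeff_mult_le rc_bound \<beta>) simp
    qed
  qed
  moreover have "(\<lambda>n. \<Sum>i\<le>n. ?f i (n - i)) sums (\<Sum>i. \<Sum>j. ?f i j)"
    by (rule double_sum_diagonal[where \<beta>="\<lambda>n. \<beta> (Suc n)", OF fb sm1])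
  ultimately have rrs: "(\<lambda>n. (\<Sum>i\<le>n. rc (Suc i) * rc (Suc (n - i))) * cpow a (Suc n) t) sums (r \<star> r) t"
    by (simp add: sum_distrib_right mult.assoc)
  have rs: "(\<lambda>k. rc (Suc k) * cpow a k t) sums r t"
    unfolding r_def cser_def by (rule summable_sums) (rule cser_summable[OF a d])
  have qs: "(\<lambda>k. (-1) ^ Suc k * cpow a k t) sums q t"
    unfolding q_def cser_def by (rule summable_sums) (rule cser_summable[OF a e])
  \<comment> \<open>\<open>r \<star> r\<close> starts with \<open>cpow a 1\<close>, so the terms in
    \<open>cpow a 0\<close> are split off before coefficients are compared.\<close>
  have rs': "(\<lambda>k. rc (Suc (Suc k)) * cpow a (Suc k) t) sums (r t - rc 1 * a t)"
    using rs sums_Suc_iff[of "\<lambda>k. rc (Suc k) * cpow a k t" "r t - rc 1 * a t"] by simp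
  have qs': "(\<lambda>k. (-1) ^ Suc (Suc k) * cpow a (Suc k) t) sums (q t - (-1) * a t)"
    using qs sums_Suc_iff[of "\<lambda>k. (-1) ^ Suc k * cpow a k t" "q t - (-1) * a t"] by simp
  \<comment> \<open>In \<open>rc_conv\<close> at degree n + 2 the two extreme terms both equal
    \<open>rc (n + 2)\<close>; they account for the summand 2 r.\<close>
  have "(\<Sum>i\<le>n. rc (Suc i) * rc (Suc (n - i))) + 2 * rc (Suc (Suc n)) = (-1) ^ Suc (Suc n)" for n
  proof -
    have "(\<Sum>i\<le>Suc (Suc n). rc i * rc (Suc (Suc n) - i))
      = rc 0 * rc (Suc (Suc n)) + (\<Sum>i\<le>Suc n. rc (Suc i) * rc (Suc n - i))"
      by (subst sum.atMost_Suc_shift) simp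
    also have "(\<Sum>i\<le>Suc n. rc (Suc i) * rc (Suc n - i)) = (\<Sum>i\<le>n. rc (Suc i) * rc (Suc (n - i))) + rc (Suc (Suc n)) * rc 0"
      by (simp add: Suc_diff_le)
    finally show ?thesis using rc_conv[of "Suc (Suc n)"] by (simp add: rc_def)
  qed
  note h = this
  have co: "(-1) ^ Suc (Suc n) * y = 2 * (rc (Suc (Suc n)) * y) + (\<Sum>i\<le>n. rc (Suc i) * rc (Suc (n - i))) * y" for n y
    using arg_cong[OF h[of n], of "\<lambda>z. z * y"] by (simp add: algebra_simps)
  have "(\<lambda>n. (-1) ^ Suc (Suc n) * cpow a (Suc n) t) sums (2 * (r t - rc 1 * a t) + (r \<star> r) t)"
    unfolding co by (intro sums_add sums_mult rs' rrs)
  from sums_unique2[OF this qs'] have "2 * (r t - rc 1 * a t) + (r \<star> r) t = q t - (-1) * a t" .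
  then show "2 * r t + (r \<star> r) t = q t" by (simp add: rc_def)
  have "(\<lambda>k. (-1) ^ Suc k * (a \<star> cpow a k) t) sums (a \<star> q) t"
    unfolding q_def by (rule conv_cser[OF a e a])
  then have "(\<lambda>k. - ((-1) ^ Suc k * cpow a (Suc k) t)) sums - (a \<star> q) t" by (intro sums_minus) simp
  then have "(\<lambda>k. (-1) ^ Suc (Suc k) * cpow a (Suc k) t) sums - (a \<star> q) t" by simp
  from sums_unique2[OF this qs'] show "q t + a t + (a \<star> q) t = 0" by simp
qed

text \<open>All terms after the first contain a convolution with a, so the whole series inherits the
  regularity of a.\<close>

lemma cser_Suc:
  assumes a: "cts a" and d: "\<forall>k. \<bar>d k\<bar> \<le> 1"
  shows "cser a d t = d 0 * a t + (a \<star> cser a (\<lambda>k. d (Suc k))) t"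
proof -
  have "(\<lambda>k. d k * cpow a k t) sums cser a d t"
    unfolding cser_def by (rule summable_sums) (rule cser_summable[OF a d])
  then have "(\<lambda>k. d (Suc k) * cpow a (Suc k) t) sums (cser a d t - d 0 * a t)"
    using sums_Suc_iff[of "\<lambda>k. d k * cpow a k t" "cser a d t - d 0 * a t"] by simp
  moreover have "(\<lambda>k. d (Suc k) * (a \<star> cpow a k) t) sums (a \<star> cser a (\<lambda>k. d (Suc k))) t"
    by (rule conv_cser[OF a _ a]) (use d in simp)
  ultimately show ?thesis using sums_unique2 by fastforce
qed

lemma primitive_conv:
  assumes "cts b" "cts s"
  shows "((\<lambda>t. b0 + J b t) \<star> s) t = b0 * J s t + J (b \<star> s) t"
proof -
  have "((\<lambda>t. b0 + J b t) \<star> s) = (\<lambda>t. ((\<lambda>t. b0 * 1) \<star> s) t + (J b \<star> s) t)"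
    using conv_add_left[of s "\<lambda>_. b0" "J b"] assms by (simp add: conv_cts)
  then show ?thesis using assms by (simp add: conv_assoc conv_scale_left[of b0 "\<lambda>_. 1", simplified])
qed

text \<open>What is gained over \<open>conv_sqrt_series\<close> is regularity: for m = m0 + J m1 the
  splitting \<open>cser_Suc\<close> exhibits r as a constant plus the primitive of a continuous
  function. This makes d/dt (r \<star> \<phi>) meaningful for every continuous \<phi>. The constant
  is r0 = - m0 / 2.\<close>

theorem conv_sqrt:
  fixes m0 :: real
  assumes m1: "cts m1"
  defines "m \<equiv> \<lambda>t. m0 + J m1 t"
  obtains r0 r1 where "cts r1"
    "\<And>t. 0 \<le> t \<Longrightarrow> (let r = (\<lambda>t. r0 + J r1 t); q = (\<lambda>t. 2 * r t + (r \<star> r) t) in q t + m t + (m \<star> q) t) = 0"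
proof -
  have m: "cts m" unfolding m_def using m1 by (intro continuous_intros conv_cts) auto
  define s where "s = cser m (\<lambda>k. rc (Suc (Suc k)))"
  define R where "R = cser m (\<lambda>k. rc (Suc k))"
  have s: "cts s" and R: "cts R" unfolding s_def R_def by (intro cser_cts m allI rc_bound)+
  define r1 where "r1 = (\<lambda>t. rc 1 * m1 t + m0 * s t + (m1 \<star> s) t)"
  define r where "r = (\<lambda>t. rc 1 * m0 + J r1 t)"
  have r1: "cts r1" unfolding r1_def using m1 s by (intro continuous_intros conv_cts) auto
  have eq: "r t = R t" if "0 \<le> t" for t
  proof -
    have "R t = rc 1 * m t + (m \<star> s) t"
      unfolding R_def s_def using cser_Suc[OF m, of "\<lambda>k. rc (Suc k)" t] rc_bound by simp
    also have "(m \<star> s) t = m0 * J s t + J (m1 \<star> s) t" unfolding m_def by (rule primitive_conv[OF m1 s])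
    also have "J r1 = (\<lambda>t. rc 1 * J m1 t + m0 * J s t + J (m1 \<star> s) t)"
      unfolding r1_def using m1 s
      by (simp add: conv_add_right conv_scale_right continuous_on_add continuous_on_mult conv_cts)
    ultimately show ?thesis by (simp add: r_def m_def algebra_simps)
  qed
  have rr: "(r \<star> r) t = (R \<star> R) t" for t by (rule conv_cong) (auto simp: eq)
  have "2 * r t + (r \<star> r) t + m t + (m \<star> (\<lambda>t. 2 * r t + (r \<star> r) t)) t = 0" if "0 \<le> t" for t
  proof -
    let ?q = "cser m (\<lambda>k. (-1) ^ Suc k)"
    have q: "2 * r t + (r \<star> r) t = ?q t" if "t \<ge> 0" for t
      using conv_sqrt_series(1)[OF m, of t] eq[OF that] by (simp add: rr R_def)
    have "(m \<star> (\<lambda>t. 2 * r t + (r \<star> r) t)) t = (m \<star> ?q) t" by (rule conv_cong) (auto simp: q)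
    then show ?thesis using conv_sqrt_series(2)[OF m, of t] q[OF that] by simp
  qed
  then show ?thesis using r1 by (intro that[of r1 "rc 1 * m0"]) (auto simp: r_def Let_def)
qed

section \<open>Volterra equations\<close>

lemma J_abs_mono:
  assumes "cts \<phi>" "0 \<le> s" "s \<le> t"
  shows "integral {0..s} (\<lambda>x. \<bar>\<phi> x\<bar>) \<le> integral {0..t} (\<lambda>x. \<bar>\<phi> x\<bar>)"
proof -
  have c: "cts (\<lambda>x. \<bar>\<phi> x\<bar>)" using assms(1) by (intro continuous_intros)
  show ?thesis by (rule integral_subset_le) (use assms cts_integrable[OF c] in auto)
qed

lemma J_abs_le:
  assumes "cts \<phi>" "0 \<le> t" "\<And>s. 0 \<le> s \<Longrightarrow> s \<le> t \<Longrightarrow> \<bar>\<phi> s\<bar> \<le> b"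
  shows "integral {0..t} (\<lambda>x. \<bar>\<phi> x\<bar>) \<le> t * b"
proof -
  have c: "cts (\<lambda>x. \<bar>\<phi> x\<bar>)" using assms(1) by (intro continuous_intros)
  have "integral {0..t} (\<lambda>x. \<bar>\<phi> x\<bar>) \<le> integral {0..t} (\<lambda>x. b)"
    by (rule integral_le[OF cts_integrable[OF c]]) (use assms in auto)
  then show ?thesis using assms by simp
qed

lemma conv_bound_cts:
  assumes "cts a" "cts \<phi>" "\<And>s. 0 \<le> s \<Longrightarrow> s \<le> t \<Longrightarrow> \<bar>a s\<bar> \<le> A"
  shows "\<bar>(a \<star> \<phi>) t\<bar> \<le> A * integral {0..t} (\<lambda>x. \<bar>\<phi> x\<bar>)"
  by (rule conv_bound) (use assms cts_abs_integrable in auto)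

lemma volterra_iterate_bound:
  assumes u: "cts u" "\<And>s. 0 \<le> s \<Longrightarrow> s \<le> t \<Longrightarrow> \<bar>u s\<bar> \<le> b * (C * s) ^ n / fact n"
    and v: "\<bar>v\<bar> \<le> C * integral {0..t} (\<lambda>s. \<bar>u s\<bar>)" and "0 \<le> t" "0 \<le> C"
  shows "\<bar>v\<bar> \<le> b * (C * t) ^ Suc n / fact (Suc n)"
proof -
  have i: "((\<lambda>s. b * C ^ n * (s ^ n / fact n)) has_integral (b * C ^ n * (t ^ Suc n / fact (Suc n)))) {0..t}"
    by (intro has_integral_mult_right integral_power_fact assms)
  have c: "cts (\<lambda>x. \<bar>u x\<bar>)" using u by (intro continuous_intros)
  have "integral {0..t} (\<lambda>s. \<bar>u s\<bar>) \<le> b * C ^ n * (t ^ Suc n / fact (Suc n))"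
    by (rule has_integral_le[OF integrable_integral[OF cts_integrable[OF c]] i])
       (use u in \<open>auto simp: power_mult_distrib mult.assoc\<close>)
  then have "C * integral {0..t} (\<lambda>s. \<bar>u s\<bar>) \<le> C * (b * C ^ n * (t ^ Suc n / fact (Suc n)))"
    using assms by (intro mult_left_mono) auto
  then show ?thesis using v by (simp add: power_mult_distrib mult_ac)
qed

lemma power_fact_tendsto_0: "(\<lambda>n. b * (x::real) ^ n / fact n) \<longlonglongrightarrow> 0"
  by (rule summable_LIMSEQ_zero) (rule summable_power_fact)

text \<open>Gronwall by iteration: n applications of the hypothesis improve the constant bound b to
  b (C t)^n / n!.\<close>

lemma volterra_unique:
  assumes u: "cts u" and le: "\<And>t. 0 \<le> t \<Longrightarrow> t \<le> T \<Longrightarrow> \<bar>u t\<bar> \<le> C * integral {0..t} (\<lambda>s. \<bar>u s\<bar>)"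
    and "0 \<le> C" "0 \<le> t" "t \<le> T"
  shows "u t = 0"
proof -
  obtain b where b: "b \<ge> 0" "\<And>s. \<bar>s\<bar> \<le> T \<Longrightarrow> \<bar>u s\<bar> \<le> b" using cts_bounded_on[OF u] by blast
  have "\<bar>u t\<bar> \<le> b * (C * t) ^ n / fact n" if "0 \<le> t" "t \<le> T" for n t
    using that
  proof (induction n arbitrary: t)
    case (Suc n)
    show ?case by (rule volterra_iterate_bound[OF u _ le]) (use Suc assms in auto)
  qed (use b in auto)
  from this[OF assms(4,5)] have "(\<lambda>n. \<bar>u t\<bar>) \<longlonglongrightarrow> 0"
    by (intro tendsto_sandwich[OF _ _ tendsto_const[of 0] power_fact_tendsto_0[of b "C * t"]]) auto
  then show ?thesis by (simp add: LIMSEQ_const_iff)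
qed

text \<open>The Neumann series of I + K, which converges by the L^1 Volterra bound. K is kept
  abstract because the intended operator is the remainder of \<open>W\<close> after division by its
  leading factor, given by a series and not by a single kernel.\<close>

lemma volterra_solve:
  fixes K :: "(real \<Rightarrow> real) \<Rightarrow> real \<Rightarrow> real"
  assumes Kc: "\<And>\<phi>. cts \<phi> \<Longrightarrow> cts (K \<phi>)"
    and add: "\<And>\<phi> \<psi> t. cts \<phi> \<Longrightarrow> cts \<psi> \<Longrightarrow> K (\<lambda>s. \<phi> s - \<psi> s) t = K \<phi> t - K \<psi> t"
    and le: "\<And>\<phi> t. cts \<phi> \<Longrightarrow> 0 \<le> t \<Longrightarrow> t \<le> T \<Longrightarrow> \<bar>K \<phi> t\<bar> \<le> C * integral {0..t} (\<lambda>s. \<bar>\<phi> s\<bar>)"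
    and F: "cts F" and C: "0 \<le> C" and T: "0 \<le> T" and b: "\<And>t. 0 \<le> t \<Longrightarrow> t \<le> T \<Longrightarrow> \<bar>F t\<bar> \<le> b"
  obtains y where "cts y" "\<And>t. 0 \<le> t \<Longrightarrow> t \<le> T \<Longrightarrow> y t + K y t = F t"
    "\<And>t. 0 \<le> t \<Longrightarrow> t \<le> T \<Longrightarrow> \<bar>y t\<bar> \<le> b * exp (C * T)"
proof -
  \<comment> \<open>The bound on K is available on [0,T] only. Freezing the iterates outside this
    interval keeps them continuous and gives them the same bounds on the whole line.\<close>
  define cl where "cl t = min (max t 0) T" for t
  have cl: "cts cl" "\<And>t. 0 \<le> cl t" "\<And>t. cl t \<le> T" "\<And>t. 0 \<le> t \<Longrightarrow> t \<le> T \<Longrightarrow> cl t = t"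
    using T unfolding cl_def[abs_def] by (auto intro!: continuous_intros)
  have b0: "0 \<le> b" using b[of 0] T by (smt (verit))
  define x where "x = rec_nat (\<lambda>t. F (cl t)) (\<lambda>_ u t. - K u (cl t))"
  have x0: "x 0 = (\<lambda>t. F (cl t))" and xS: "x (Suc n) = (\<lambda>t. - K (x n) (cl t))" for n
    by (simp_all add: x_def)
  have xc: "cts (x n)" for n
    by (induction n) (auto simp: x0 xS intro!: continuous_intros cts_compose[OF F] cts_compose[OF Kc] cl)
  have xb: "\<bar>x n t\<bar> \<le> b * (C * t) ^ n / fact n" if "0 \<le> t" "t \<le> T" for n t
    using that
  proof (induction n arbitrary: t)
    case (Suc n)
    show ?case by (rule volterra_iterate_bound[OF xc[of n]]) (use Suc C cl le[OF xc] in \<open>auto simp: xS\<close>)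
  qed (use b cl in \<open>auto simp: x0\<close>)
  let ?\<beta> = "\<lambda>n. b * (C * T) ^ n / fact n"
  have sm: "summable ?\<beta>" by (rule summable_power_fact)
  have xB: "\<bar>x n t\<bar> \<le> ?\<beta> n" for n t
  proof -
    have "x n t = x n (cl t)" by (cases n) (auto simp: x0 xS cl)
    then have "\<bar>x n t\<bar> \<le> b * (C * cl t) ^ n / fact n" using xb[of "cl t" n] cl by simp
    also have "\<dots> \<le> ?\<beta> n"
      using b0 C cl T by (intro divide_right_mono mult_left_mono power_mono) auto
    finally show ?thesis .
  qed
  have xs: "summable (\<lambda>n. x n t)" for t
    by (rule summable_comparison_test'[OF sm, of 0]) (use xB in auto)
  define y where "y t = (\<Sum>n. x n t)" for t
  have yc: "cts y" unfolding y_def[abs_def] by (rule cts_suminf) (use xc sm xB in blast)+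
  have sumc: "cts (\<lambda>t. \<Sum>n<N. x n t)" for N by (intro continuous_intros xc)
  \<comment> \<open>The hypothesis on differences first yields K 0 = 0 and K (- x) = - K x, and from
    these finite additivity.\<close>
  have Ksum: "K (\<lambda>t. \<Sum>n<N. x n t) t = (\<Sum>n<N. K (x n) t)" for N t
  proof (induction N)
    case 0
    have "K (\<lambda>t. x 0 t - x 0 t) t = 0" by (subst add) (auto simp: xc)
    then show ?case by simp
  next
    case (Suc N)
    have "K (\<lambda>t. 0 - x N t) t = K (\<lambda>t. x 0 t - x 0 t) t - K (x N) t" by (subst add[symmetric]) (auto simp: xc)
    also have "K (\<lambda>t. x 0 t - x 0 t) t = 0" by (subst add) (auto simp: xc)
    finally have m: "K (\<lambda>t. - x N t) t = - K (x N) t" by simp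
    have "K (\<lambda>t. (\<Sum>n<N. x n t) - (- x N t)) t = K (\<lambda>t. \<Sum>n<N. x n t) t - K (\<lambda>t. - x N t) t"
      by (rule add) (use sumc xc in \<open>auto intro!: continuous_intros\<close>)
    then show ?case using Suc m by simp
  qed
  have eq: "y t + K y t = F t" if t: "0 \<le> t" "t \<le> T" for t
  proof -
    have "(\<lambda>N. \<Sum>n. ?\<beta> (n + N)) \<longlonglongrightarrow> 0" using suminf_exist_split2[OF sm] .
    from tendsto_mult[OF tendsto_const tendsto_mult[OF tendsto_const this], of C t]
    have z: "(\<lambda>N. C * (t * (\<Sum>n. ?\<beta> (n + N)))) \<longlonglongrightarrow> 0" by (simp only: mult_zero_right)
    have Kle: "\<bar>K y t - (\<Sum>n<N. K (x n) t)\<bar> \<le> C * (t * (\<Sum>n. ?\<beta> (n + N)))" for N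
    proof -
      have tl: "\<bar>y s - (\<Sum>n<N. x n s)\<bar> \<le> (\<Sum>n. ?\<beta> (n + N))" for s
      proof -
        have "y s - (\<Sum>n<N. x n s) = (\<Sum>n. x (n + N) s)"
          unfolding y_def using suminf_minus_initial_segment[OF xs[of s], of N] by simp
        moreover have "norm (\<Sum>n. x (n + N) s) \<le> (\<Sum>n. ?\<beta> (n + N))"
          by (rule norm_suminf_le) (use xB summable_ignore_initial_segment[OF sm] in auto)
        ultimately show ?thesis by simp
      qed
      have c: "cts (\<lambda>s. y s - (\<Sum>n<N. x n s))" by (intro continuous_intros yc xc)
      have "\<bar>K (\<lambda>s. y s - (\<Sum>n<N. x n s)) t\<bar> \<le> C * integral {0..t} (\<lambda>s. \<bar>y s - (\<Sum>n<N. x n s)\<bar>)"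
        by (rule le[OF c t])
      also have "\<dots> \<le> C * (t * (\<Sum>n. ?\<beta> (n + N)))"
        by (intro mult_left_mono J_abs_le c t tl C)
      finally show ?thesis by (simp add: add[OF yc sumc] Ksum)
    qed
    have "(\<lambda>N. K y t - (\<Sum>n<N. K (x n) t)) \<longlonglongrightarrow> 0"
      by (rule Lim_null_comparison[OF always_eventually z]) (use Kle in simp)
    from tendsto_diff[OF tendsto_const[of "K y t"] this]
    have 1: "(\<lambda>N. \<Sum>n<N. K (x n) t) \<longlonglongrightarrow> K y t" by simp
    have "(\<lambda>N. \<Sum>n<Suc N. x n t) \<longlonglongrightarrow> y t"
      using summable_LIMSEQ[OF xs[of t]] LIMSEQ_Suc unfolding y_def by blast
    then have "(\<lambda>N. x 0 t + (\<Sum>n<N. x (Suc n) t)) \<longlonglongrightarrow> y t" by (simp only: sum.lessThan_Suc_shift)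
    then have "(\<lambda>N. F t - (\<Sum>n<N. K (x n) t)) \<longlonglongrightarrow> y t" using t cl by (simp add: x0 xS sum_negf)
    moreover have "(\<lambda>N. F t - (\<Sum>n<N. K (x n) t)) \<longlonglongrightarrow> F t - K y t" by (intro tendsto_intros 1)
    ultimately show ?thesis using LIMSEQ_unique by fastforce
  qed
  have "\<bar>y t\<bar> \<le> b * exp (C * T)" for t
  proof -
    have "norm (y t) \<le> (\<Sum>n. ?\<beta> n)" unfolding y_def by (rule norm_suminf_le) (use xB sm in auto)
    also have "(\<lambda>n. b * ((C * T) ^ n /\<^sub>R fact n)) sums (b * exp (C * T))" by (intro sums_mult exp_converges)
    then have "(\<Sum>n. ?\<beta> n) = b * exp (C * T)" by (auto dest!: sums_unique simp: field_simps)
    finally show ?thesis by simp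
  qed
  then show ?thesis using that[OF yc eq] by blast
qed

section \<open>The transmutation operator\<close>

text \<open>The assumption \<open>root\<close> is (\<delta> + r)^2 \<star> (\<delta> + m) = \<delta>
  with the unit cancelled; q stands for (\<delta> + r)^2 - \<delta>.\<close>

locale conv_root =
  fixes m r1 :: "real \<Rightarrow> real" and r0 :: real
  assumes m: "cts m" and r1: "cts r1"
    and root: "\<And>t. 0 \<le> t \<Longrightarrow> (let r = (\<lambda>t. r0 + J r1 t); q = (\<lambda>t. 2 * r t + (r \<star> r) t) in q t + m t + (m \<star> q) t) = 0"
begin

definition r :: "real \<Rightarrow> real" where "r = (\<lambda>t. r0 + J r1 t)"

text \<open>The derivative of \<open>r \<star> \<phi>\<close>, as \<open>J_A\<close>
  confirms.\<close>

definition A :: "(real \<Rightarrow> real) \<Rightarrow> real \<Rightarrow> real" where "A \<phi> = (\<lambda>t. r0 * \<phi> t + (r1 \<star> \<phi>) t)"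

definition B :: "(real \<Rightarrow> real) \<Rightarrow> real \<Rightarrow> real" where "B \<phi> = (\<lambda>t. \<phi> t + (r \<star> \<phi>) t)"

lemma r_cts: "cts r"
  unfolding r_def by (intro continuous_intros conv_cts r1)

lemma A_cts: "cts \<phi> \<Longrightarrow> cts (A \<phi>)"
  unfolding A_def by (intro continuous_intros conv_cts r1)

lemma B_cts: "cts \<phi> \<Longrightarrow> cts (B \<phi>)"
  unfolding B_def by (intro continuous_intros conv_cts r_cts)

lemma A_add: "cts \<phi> \<Longrightarrow> cts \<psi> \<Longrightarrow> A (\<lambda>s. \<phi> s + \<psi> s) = (\<lambda>t. A \<phi> t + A \<psi> t)"
  unfolding A_def by (auto simp: conv_add_right r1 algebra_simps)

lemma A_scale: "A (\<lambda>s. c * \<phi> s) = (\<lambda>t. c * A \<phi> t)"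
  unfolding A_def by (auto simp: conv_scale_right algebra_simps)

lemma B_add: "cts \<phi> \<Longrightarrow> cts \<psi> \<Longrightarrow> B (\<lambda>s. \<phi> s + \<psi> s) = (\<lambda>t. B \<phi> t + B \<psi> t)"
  unfolding B_def by (auto simp: conv_add_right r_cts algebra_simps)

lemma B_scale: "B (\<lambda>s. c * \<phi> s) = (\<lambda>t. c * B \<phi> t)"
  unfolding B_def by (auto simp: conv_scale_right algebra_simps)

lemma A_cong: "(\<And>s. 0 \<le> s \<Longrightarrow> s \<le> t \<Longrightarrow> \<phi> s = \<psi> s) \<Longrightarrow> 0 \<le> t \<Longrightarrow> A \<phi> t = A \<psi> t"
  unfolding A_def using conv_cong[of t r1 r1 \<phi> \<psi>] by simp

lemma B_cong: "(\<And>s. 0 \<le> s \<Longrightarrow> s \<le> t \<Longrightarrow> \<phi> s = \<psi> s) \<Longrightarrow> 0 \<le> t \<Longrightarrow> B \<phi> t = B \<psi> t"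
  unfolding B_def using conv_cong[of t r r \<phi> \<psi>] by simp

lemma A_conv: "cts a \<Longrightarrow> cts \<phi> \<Longrightarrow> A (a \<star> \<phi>) = a \<star> A \<phi>"
  unfolding A_def using r1
  by (simp add: conv_add_right conv_scale_right conv_left_commute[of r1 a \<phi>] continuous_on_mult_left conv_cts)

lemma B_conv: "cts a \<Longrightarrow> cts \<phi> \<Longrightarrow> B (a \<star> \<phi>) = a \<star> B \<phi>"
  unfolding B_def using r_cts
  by (simp add: conv_add_right conv_left_commute[of r a \<phi>] conv_cts)

lemma J_A: "cts \<phi> \<Longrightarrow> J (A \<phi>) = r \<star> \<phi>"
  unfolding A_def r_def fun_eq_iff using r1
  by (simp add: primitive_conv conv_add_right conv_scale_right continuous_on_mult_left conv_cts)

text \<open>B is convolution with \<delta> + r, so this is \<open>root\<close> applied to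
  \<phi>.\<close>

lemma B_B:
  assumes "cts \<phi>"
  shows "B (B \<phi>) t + (m \<star> B (B \<phi>)) t = \<phi> t"
proof -
  define q where "q = (\<lambda>t. 2 * r t + (r \<star> r) t)"
  have q: "cts q" unfolding q_def by (intro continuous_intros conv_cts r_cts)
  have "B (B \<phi>) = (\<lambda>t. \<phi> t + (q \<star> \<phi>) t)"
    unfolding B_def q_def using assms r_cts
    by (auto simp: fun_eq_iff conv_add_right conv_add_left conv_scale_left conv_assoc conv_cts continuous_on_mult_left)
  then have "B (B \<phi>) t + (m \<star> B (B \<phi>)) t = \<phi> t + ((q \<star> \<phi>) t + (m \<star> \<phi>) t + ((m \<star> q) \<star> \<phi>) t)"
    using assms q m by (simp add: conv_add_right conv_assoc conv_cts)
  also have "(q \<star> \<phi>) t + (m \<star> \<phi>) t + ((m \<star> q) \<star> \<phi>) t = ((\<lambda>t. q t + m t + (m \<star> q) t) \<star> \<phi>) t"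
    using assms q m by (simp add: conv_add_left conv_cts continuous_on_add)
  also have "\<dots> = ((\<lambda>_. 0) \<star> \<phi>) t"
    by (rule conv_cong) (use root in \<open>auto simp: q_def r_def Let_def\<close>)
  finally show ?thesis by (simp add: conv_def)
qed

text \<open>B \<phi> = 0 is the homogeneous Volterra equation \<phi> = - r \<star> \<phi>.\<close>

lemma B_inj:
  assumes "cts \<phi>" "\<And>t. 0 \<le> t \<Longrightarrow> t \<le> T \<Longrightarrow> B \<phi> t = 0" "0 \<le> t" "t \<le> T"
  shows "\<phi> t = 0"
proof -
  obtain R where R: "R \<ge> 0" "\<And>s. \<bar>s\<bar> \<le> T \<Longrightarrow> \<bar>r s\<bar> \<le> R" using cts_bounded_on[OF r_cts] by blast
  show ?thesis
  proof (rule volterra_unique[OF assms(1) _ R(1) assms(3,4)])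
    fix t assume t: "0 \<le> t" "t \<le> T"
    have "\<phi> t = - (r \<star> \<phi>) t" using assms(2)[OF t] by (simp add: B_def)
    then show "\<bar>\<phi> t\<bar> \<le> R * integral {0..t} (\<lambda>s. \<bar>\<phi> s\<bar>)"
      using conv_bound_cts[OF r_cts assms(1), of t R] R(2) t by auto
  qed
qed

text \<open>The coefficient of x^k in exp (- s x); the operator \<open>A\<close> will take the place
  of x.\<close>

definition mk :: "nat \<Rightarrow> real \<Rightarrow> real" where "mk k s = (- s) ^ k / fact k"

definition Wt :: "nat \<Rightarrow> (real \<Rightarrow> real) \<Rightarrow> real \<Rightarrow> real" where
  "Wt k \<phi> = (A ^^ k) (\<lambda>s. mk k s * \<phi> s)"

text \<open>Formally, if \<open>\<mu>(\<lambda>)\<close> is \<open>\<lambda>\<close> times the Laplace transform of \<open>\<delta> + r\<close>, then the Laplace transform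
  of \<open>W \<phi>\<close> at \<open>\<lambda>\<close> is that of \<open>\<phi>\<close> at \<open>\<mu>(\<lambda>)\<close>; the series expands \<open>exp (- s (\<mu> - \<lambda>))\<close>,
  where \<open>\<mu> - \<lambda>\<close> is the symbol of \<open>A\<close>.\<close>

definition W :: "(real \<Rightarrow> real) \<Rightarrow> real \<Rightarrow> real" where "W \<phi> t = (\<Sum>k. Wt k \<phi> t)"

lemma mk_cts: "cts (mk k)"
  unfolding mk_def[abs_def] by (intro continuous_intros) auto

lemma mk_bound: "\<bar>s\<bar> \<le> x \<Longrightarrow> \<bar>mk k s\<bar> \<le> x ^ k / fact k"
  unfolding mk_def by (simp add: power_abs divide_right_mono power_mono)

lemma Apow_cts: "cts \<phi> \<Longrightarrow> cts ((A ^^ k) \<phi>)"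
  by (induction k) (auto simp: A_cts)

lemma Wt_cts: "cts \<phi> \<Longrightarrow> cts (Wt k \<phi>)"
  unfolding Wt_def by (intro Apow_cts continuous_intros mk_cts)

lemma Apow_add: "cts \<phi> \<Longrightarrow> cts \<psi> \<Longrightarrow> (A ^^ k) (\<lambda>s. \<phi> s + \<psi> s) = (\<lambda>t. (A ^^ k) \<phi> t + (A ^^ k) \<psi> t)"
  by (induction k) (auto simp: A_add Apow_cts)

lemma Apow_scale: "(A ^^ k) (\<lambda>s. c * \<phi> s) = (\<lambda>t. c * (A ^^ k) \<phi> t)"
  by (induction k) (auto simp: A_scale)

lemma Apow_cong: "(\<And>s. 0 \<le> s \<Longrightarrow> s \<le> t \<Longrightarrow> \<phi> s = \<psi> s) \<Longrightarrow> 0 \<le> t \<Longrightarrow> (A ^^ k) \<phi> t = (A ^^ k) \<psi> t"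
proof (induction k arbitrary: t)
  case (Suc k)
  have "A ((A ^^ k) \<phi>) t = A ((A ^^ k) \<psi>) t"
    by (rule A_cong) (use Suc in auto)
  then show ?case by simp
qed auto

lemma Apow_J: "cts \<phi> \<Longrightarrow> (A ^^ k) (J \<phi>) = J ((A ^^ k) \<phi>)"
  by (induction k) (auto simp: A_conv Apow_cts)

lemma A_bound:
  assumes "cts \<phi>" and R: "0 \<le> R" "\<And>s. \<bar>s\<bar> \<le> x \<Longrightarrow> \<bar>r1 s\<bar> \<le> R" and b: "0 \<le> b" "\<And>s. \<bar>s\<bar> \<le> x \<Longrightarrow> \<bar>\<phi> s\<bar> \<le> b" and t: "\<bar>t\<bar> \<le> x"
  shows "\<bar>A \<phi> t\<bar> \<le> (\<bar>r0\<bar> + x * R) * b"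
proof -
  have "\<bar>(r1 \<star> \<phi>) t\<bar> \<le> R * (x * b)"
  proof (cases "0 \<le> t")
    case True
    have "\<bar>(r1 \<star> \<phi>) t\<bar> \<le> R * integral {0..t} (\<lambda>x. \<bar>\<phi> x\<bar>)"
      by (rule conv_bound_cts) (use r1 assms True in auto)
    also have "\<dots> \<le> R * (t * b)" by (intro mult_left_mono J_abs_le) (use assms True in auto)
    also have "\<dots> \<le> R * (x * b)" using t True b R by (intro mult_left_mono mult_right_mono) auto
    finally show ?thesis .
  next
    case False then show ?thesis using R b t by (simp add: conv_neg)
  qed
  moreover have "\<bar>r0 * \<phi> t\<bar> \<le> \<bar>r0\<bar> * b" unfolding abs_mult using b t by (intro mult_left_mono) auto
  ultimately show ?thesis unfolding A_def by (simp add: algebra_simps)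
qed

lemma Apow_bound:
  assumes "cts \<phi>" and R: "0 \<le> R" "\<And>s. \<bar>s\<bar> \<le> x \<Longrightarrow> \<bar>r1 s\<bar> \<le> R" and b: "0 \<le> b" "\<And>s. \<bar>s\<bar> \<le> x \<Longrightarrow> \<bar>\<phi> s\<bar> \<le> b" and t: "\<bar>t\<bar> \<le> x"
  shows "\<bar>(A ^^ k) \<phi> t\<bar> \<le> (\<bar>r0\<bar> + x * R) ^ k * b"
  using t
proof (induction k arbitrary: t)
  case (Suc k)
  have "\<bar>A ((A ^^ k) \<phi>) t\<bar> \<le> (\<bar>r0\<bar> + x * R) * ((\<bar>r0\<bar> + x * R) ^ k * b)"
    by (rule A_bound[OF Apow_cts[OF assms(1)] R]) (use Suc R b in auto)
  then show ?case by (simp add: mult.assoc)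
qed (use b in auto)

lemma Wt_majorant:
  assumes "cts \<phi>"
  shows "\<exists>\<beta>. summable \<beta> \<and> (\<forall>k s. \<bar>s\<bar> \<le> x \<longrightarrow> \<bar>Wt k \<phi> s\<bar> \<le> \<beta> k)"
proof (cases "0 \<le> x")
  case True
  obtain R where R: "R \<ge> 0" "\<And>s. \<bar>s\<bar> \<le> x \<Longrightarrow> \<bar>r1 s\<bar> \<le> R" using cts_bounded_on[OF r1] by blast
  obtain b where b: "b \<ge> 0" "\<And>s. \<bar>s\<bar> \<le> x \<Longrightarrow> \<bar>\<phi> s\<bar> \<le> b" using cts_bounded_on[OF assms] by blast
  have "\<bar>Wt k \<phi> s\<bar> \<le> (\<bar>r0\<bar> + x * R) ^ k * (x ^ k / fact k * b)" if "\<bar>s\<bar> \<le> x" for k s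
    unfolding Wt_def
  proof (rule Apow_bound[OF _ R])
    fix s assume "\<bar>s\<bar> \<le> x"
    then show "\<bar>mk k s * \<phi> s\<bar> \<le> x ^ k / fact k * b"
      unfolding abs_mult using True by (intro mult_mono mk_bound b) auto
  qed (use that b True in \<open>auto intro!: continuous_intros mk_cts assms\<close>)
  moreover have "(\<lambda>k. (\<bar>r0\<bar> + x * R) ^ k * (x ^ k / fact k * b)) = (\<lambda>k. b * ((\<bar>r0\<bar> + x * R) * x) ^ k / fact k)"
    by (simp add: power_mult_distrib mult_ac)
  then have "summable (\<lambda>k. (\<bar>r0\<bar> + x * R) ^ k * (x ^ k / fact k * b))" using summable_power_fact by metis
  ultimately show ?thesis by blast
next
  case False
  then show ?thesis by (intro exI[of _ "\<lambda>_. 0"]) auto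
qed

lemma Wt_summable: "cts \<phi> \<Longrightarrow> summable (\<lambda>k. Wt k \<phi> t)"
proof -
  assume "cts \<phi>"
  from Wt_majorant[OF this, of "\<bar>t\<bar>"] obtain \<beta> where
    \<beta>: "summable \<beta>" "\<forall>k s. \<bar>s\<bar> \<le> \<bar>t\<bar> \<longrightarrow> \<bar>Wt k \<phi> s\<bar> \<le> \<beta> k" by blast
  show ?thesis by (rule summable_comparison_test'[OF \<beta>(1), of 0]) (use \<beta>(2) in auto)
qed

lemma W_cts: "cts \<phi> \<Longrightarrow> cts (W \<phi>)"
  unfolding W_def[abs_def] by (rule cts_suminf) (use Wt_cts Wt_majorant in blast)+

lemma conv_W:
  assumes "cts a" "cts \<phi>"
  shows "(\<lambda>k. (a \<star> Wt k \<phi>) t) sums (a \<star> W \<phi>) t"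
proof -
  obtain \<beta> where \<beta>: "summable \<beta>" "\<forall>k s. \<bar>s\<bar> \<le> \<bar>t\<bar> \<longrightarrow> \<bar>Wt k \<phi> s\<bar> \<le> \<beta> k"
    using Wt_majorant[OF assms(2), of "\<bar>t\<bar>"] by blast
  show ?thesis unfolding W_def[abs_def]
    by (rule conv_suminf[OF assms(1) Wt_cts[OF assms(2)] _ \<beta>(1)]) (use \<beta>(2) in auto)
qed

lemma Wt_add: "cts \<phi> \<Longrightarrow> cts \<psi> \<Longrightarrow> Wt k (\<lambda>s. \<phi> s + \<psi> s) = (\<lambda>t. Wt k \<phi> t + Wt k \<psi> t)"
  unfolding Wt_def by (simp add: distrib_left Apow_add continuous_on_mult mk_cts)

lemma Wt_scale: "Wt k (\<lambda>s. c * \<phi> s) = (\<lambda>t. c * Wt k \<phi> t)"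
  unfolding Wt_def by (simp add: mult.left_commute[of _ c] Apow_scale)

lemma W_add: "cts \<phi> \<Longrightarrow> cts \<psi> \<Longrightarrow> W (\<lambda>s. \<phi> s + \<psi> s) = (\<lambda>t. W \<phi> t + W \<psi> t)"
  unfolding W_def[abs_def] by (simp add: Wt_add suminf_add Wt_summable)

lemma W_scale: "cts \<phi> \<Longrightarrow> W (\<lambda>s. c * \<phi> s) = (\<lambda>t. c * W \<phi> t)"
  unfolding W_def[abs_def] by (simp add: Wt_scale suminf_mult Wt_summable)

text \<open>\<open>W\<close> is causal because \<open>A\<close> is, so an equation known only on
  [0,t] may be used under it.\<close>

lemma W_cong: "(\<And>s. 0 \<le> s \<Longrightarrow> s \<le> t \<Longrightarrow> \<phi> s = \<psi> s) \<Longrightarrow> 0 \<le> t \<Longrightarrow> W \<phi> t = W \<psi> t"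
  unfolding W_def Wt_def by (intro arg_cong[where f=suminf] ext Apow_cong) auto

text \<open>The product rule with (mk (k + 1))' = - mk k. The boundary term vanishes because
  \<open>mk (Suc k) 0 = 0\<close>; only the term of index 0 in the series of \<open>W\<close> keeps
  the initial value c.\<close>

lemma mk_Suc_primitive:
  assumes \<phi>: "cts \<phi>" and \<phi>': "cts \<phi>'" and eq: "\<And>s. 0 \<le> s \<Longrightarrow> \<phi> s = c + J \<phi>' s" and "0 \<le> t"
  shows "mk (Suc k) t * \<phi> t = J (\<lambda>s. (-1) * (mk k s * \<phi> s) + mk (Suc k) s * \<phi>' s) t"
proof -
  have "((\<lambda>s. (-1) * (mk k s * \<phi> s) + mk (Suc k) s * \<phi>' s) has_integral
      (mk (Suc k) t * (c + J \<phi>' t) - mk (Suc k) 0 * (c + J \<phi>' 0))) {0..t}"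
  proof (rule fundamental_theorem_of_calculus[OF \<open>0 \<le> t\<close>])
    fix x assume x: "x \<in> {0..t}"
    have "((\<lambda>s. c + J \<phi>' s) has_real_derivative \<phi>' x) (at x within {0..t})"
      unfolding J_eq[abs_def] has_real_derivative_iff_has_vector_derivative
      by (auto intro!: derivative_eq_intros integral_has_vector_derivative cts_on \<phi>' x)
    moreover have "(mk (Suc k) has_real_derivative (- mk k x)) (at x within {0..t})"
      unfolding mk_def[abs_def] by (rule derivative_eq_intros refl | simp)+
    ultimately have "((\<lambda>s. mk (Suc k) s * (c + J \<phi>' s)) has_real_derivative
       (- mk k x * (c + J \<phi>' x) + \<phi>' x * mk (Suc k) x)) (at x within {0..t})"
      using DERIV_mult by blast
    then show "((\<lambda>s. mk (Suc k) s * (c + J \<phi>' s)) has_vector_derivative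
        ((-1) * (mk k x * \<phi> x) + mk (Suc k) x * \<phi>' x)) (at x within {0..t})"
      using eq[of x] x by (simp add: has_real_derivative_iff_has_vector_derivative mult.commute)
  qed
  then show ?thesis using eq[OF \<open>0 \<le> t\<close>] by (simp add: J_eq mk_def integral_unique)
qed

text \<open>The integrated form of d/dt B (W \<phi>) = W \<phi>'. On the Laplace side it is the rule
  mu \<phi>^(mu) = c + (\<phi>')^(mu) for derivatives. In the series it follows from the recursion
  \<open>S\<close> for single terms, whose parts \<open>r \<star> Wt k \<phi>\<close> add up to the
  convolution contained in B.\<close>

theorem W_intertwine:
  assumes \<phi>: "cts \<phi>" and \<phi>': "cts \<phi>'" and eq: "\<And>s. 0 \<le> s \<Longrightarrow> \<phi> s = c + J \<phi>' s" and t: "0 \<le> t"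
  shows "B (W \<phi>) t = c + J (W \<phi>') t"
proof -
  note cs = mk_cts \<phi> \<phi>'
  have S: "Wt (Suc k) \<phi> t = J (Wt (Suc k) \<phi>') t - (r \<star> Wt k \<phi>) t" for k
  proof -
    let ?h = "\<lambda>s. (-1) * (mk k s * \<phi> s) + mk (Suc k) s * \<phi>' s"
    have c: "cts (\<lambda>s. mk k s * \<phi> s)" "cts (\<lambda>s. mk (Suc k) s * \<phi>' s)" using cs by (auto intro!: continuous_intros)
    from cs have h: "cts ?h" by (auto intro!: continuous_intros)
    have "Wt (Suc k) \<phi> t = (A ^^ Suc k) (J ?h) t"
      unfolding Wt_def by (rule Apow_cong[OF _ t]) (rule mk_Suc_primitive[OF \<phi> \<phi>' eq])
    also have "\<dots> = J ((A ^^ Suc k) ?h) t" by (simp only: Apow_J[OF h])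
    also have "(A ^^ Suc k) ?h = (\<lambda>t. (-1) * A (Wt k \<phi>) t + Wt (Suc k) \<phi>' t)"
      using c by (subst Apow_add) (auto simp: Apow_scale[where c="-1", simplified] Wt_def A_scale[where c="-1", simplified] intro!: continuous_intros)
    also have "J \<dots> = (\<lambda>t. (-1) * J (A (Wt k \<phi>)) t + J (Wt (Suc k) \<phi>') t)"
      by (subst conv_add_right) (auto simp: conv_scale_right[where x="-1", simplified] intro!: continuous_intros A_cts Wt_cts \<phi> \<phi>')
    finally show ?thesis by (simp add: J_A Wt_cts \<phi>)
  qed
  have 0: "Wt 0 \<phi> t = c + J (Wt 0 \<phi>') t" using eq[OF t] by (simp add: Wt_def mk_def)
  have Ws: "(\<lambda>k. Wt k \<phi> t) sums W \<phi> t" unfolding W_def by (rule summable_sums) (rule Wt_summable[OF \<phi>])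
  have "(\<lambda>k. J (Wt (Suc k) \<phi>') t) sums (J (W \<phi>') t - J (Wt 0 \<phi>') t)"
    using conv_W[OF cts_const[of 1] \<phi>', of t] sums_Suc_iff[of "\<lambda>k. J (Wt k \<phi>') t" "J (W \<phi>') t - J (Wt 0 \<phi>') t"] by simp
  then have "(\<lambda>k. Wt (Suc k) \<phi> t) sums (J (W \<phi>') t - J (Wt 0 \<phi>') t - (r \<star> W \<phi>) t)"
    unfolding S by (intro sums_diff conv_W r_cts \<phi>)
  then have "(\<lambda>k. Wt k \<phi> t) sums (J (W \<phi>') t - J (Wt 0 \<phi>') t - (r \<star> W \<phi>) t + Wt 0 \<phi> t)"
    by (rule sums_Suc)
  from sums_unique2[OF Ws this] show ?thesis by (simp add: B_def 0)
qed

section \<open>Leading part and inversion of \<open>W\<close>\<close>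

text \<open>When the k-th power of \<open>A\<close> is expanded, every term other than r0^k contains
  a convolution with r1 and is bounded by an L^1 norm. The natural bound is k a^(k - 1) R; the base
  1 + a avoids the exponent k - 1.\<close>

lemma Apow_smoothing:
  assumes \<phi>: "cts \<phi>" and R: "0 \<le> R" "\<And>s. \<bar>s\<bar> \<le> T \<Longrightarrow> \<bar>r1 s\<bar> \<le> R" and t: "0 \<le> t" "t \<le> T" and a: "a = \<bar>r0\<bar> + T * R"
  shows "\<bar>(A ^^ k) \<phi> t - r0 ^ k * \<phi> t\<bar> \<le> real k * (1 + a) ^ k * R * integral {0..t} (\<lambda>s. \<bar>\<phi> s\<bar>)"
  using t
proof (induction k arbitrary: t)
  case (Suc k)
  let ?I = "integral {0..t} (\<lambda>s. \<bar>\<phi> s\<bar>)"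
  let ?d = "\<lambda>s. (A ^^ k) \<phi> s - r0 ^ k * \<phi> s"
  have T: "0 \<le> T" using Suc.prems by simp
  have a0: "0 \<le> a" using R a T by simp
  have I0: "?I \<ge> 0" by (intro integral_nonneg cts_integrable continuous_intros \<phi>) auto
  have d: "cts ?d" by (intro continuous_intros Apow_cts \<phi>)
  have db: "\<bar>?d s\<bar> \<le> real k * (1 + a) ^ k * R * ?I" if "0 \<le> s" "s \<le> t" for s
  proof -
    have "\<bar>?d s\<bar> \<le> real k * (1 + a) ^ k * R * integral {0..s} (\<lambda>s. \<bar>\<phi> s\<bar>)" using Suc that by auto
    also have "\<dots> \<le> real k * (1 + a) ^ k * R * ?I"
      by (intro mult_left_mono J_abs_mono \<phi> that) (use R a0 in auto)
    finally show ?thesis .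
  qed
  have "A ((A ^^ k) \<phi>) t = A (\<lambda>s. ?d s + r0 ^ k * \<phi> s) t" by simp
  also have "\<dots> = A ?d t + r0 ^ k * A \<phi> t"
    by (subst A_add) (auto simp: A_scale d intro!: continuous_intros \<phi>)
  finally have e: "(A ^^ Suc k) \<phi> t - r0 ^ Suc k * \<phi> t = r0 * ?d t + (r1 \<star> ?d) t + r0 ^ k * (r1 \<star> \<phi>) t"
    by (simp add: A_def algebra_simps)
  have 1: "\<bar>r0 * ?d t\<bar> \<le> \<bar>r0\<bar> * (real k * (1 + a) ^ k * R * ?I)"
    unfolding abs_mult using db[of t] Suc.prems by (intro mult_left_mono) auto
  have "\<bar>(r1 \<star> ?d) t\<bar> \<le> R * integral {0..t} (\<lambda>s. \<bar>?d s\<bar>)"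
    by (rule conv_bound_cts[OF r1 d]) (use R Suc.prems in auto)
  also have "\<dots> \<le> R * (t * (real k * (1 + a) ^ k * R * ?I))"
    by (intro mult_left_mono J_abs_le d db) (use Suc.prems R in auto)
  also have "\<dots> \<le> R * (T * (real k * (1 + a) ^ k * R * ?I))"
    using Suc.prems R I0 a0 by (intro mult_left_mono mult_right_mono) auto
  finally have 2: "\<bar>(r1 \<star> ?d) t\<bar> \<le> R * (T * (real k * (1 + a) ^ k * R * ?I))" .
  have "\<bar>(r1 \<star> \<phi>) t\<bar> \<le> R * ?I" by (rule conv_bound_cts[OF r1 \<phi>]) (use R Suc.prems in auto)
  moreover have "\<bar>r0 ^ k\<bar> \<le> (1 + a) ^ k" unfolding power_abs by (intro power_mono) (use a T R in auto)
  ultimately have 3: "\<bar>r0 ^ k * (r1 \<star> \<phi>) t\<bar> \<le> (1 + a) ^ k * (R * ?I)"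
    unfolding abs_mult using a0 by (intro mult_mono) auto
  have "\<bar>(A ^^ Suc k) \<phi> t - r0 ^ Suc k * \<phi> t\<bar> \<le> \<bar>r0\<bar> * (real k * (1 + a) ^ k * R * ?I) + R * (T * (real k * (1 + a) ^ k * R * ?I)) + (1 + a) ^ k * (R * ?I)"
    unfolding e using 1 2 3 by linarith
  also have "\<dots> = (a * real k + 1) * ((1 + a) ^ k * (R * ?I))" unfolding a by (simp add: algebra_simps)
  also have "\<dots> \<le> (real (Suc k) * (1 + a)) * ((1 + a) ^ k * (R * ?I))"
    by (rule mult_right_mono) (use a0 R I0 in \<open>auto simp: algebra_simps\<close>)
  finally show ?case by (simp add: mult_ac)
qed simp

text \<open>With r0 in place of \<open>A\<close> the series of \<open>W\<close> sums to exp (- r0 t)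
  \<phi> t. That the error is measured by an L^1 norm and not by a supremum is the source of the
  compactness used for the lower bound.\<close>

theorem W_smoothing:
  "\<exists>C\<ge>0. \<forall>\<phi> t. cts \<phi> \<longrightarrow> 0 \<le> t \<longrightarrow> t \<le> T \<longrightarrow>
     \<bar>W \<phi> t - exp (- (r0 * t)) * \<phi> t\<bar> \<le> C * integral {0..t} (\<lambda>s. \<bar>\<phi> s\<bar>)"
proof (cases "0 \<le> T")
  case True
  obtain R where R: "R \<ge> 0" "\<And>s. \<bar>s\<bar> \<le> T \<Longrightarrow> \<bar>r1 s\<bar> \<le> R" using cts_bounded_on[OF r1] by blast
  define a where "a = \<bar>r0\<bar> + T * R"
  define c where "c k = real k * (1 + a) ^ k * R * (T ^ k / fact k)" for k
  have a0: "a \<ge> 0" using R True by (simp add: a_def)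
  have c0: "c k \<ge> 0" for k using a0 R True by (simp add: c_def)
  have csum: "summable c"
  proof (rule summable_comparison_test'[OF summable_power_fact[of R "2 * (1 + a) * T"], of 0])
    fix k :: nat
    have "real k \<le> 2 ^ k" using of_nat_less_two_power[of k] by (simp add: less_imp_le)
    then have "real k * ((1 + a) ^ k * R * (T ^ k / fact k)) \<le> 2 ^ k * ((1 + a) ^ k * R * (T ^ k / fact k))"
      using a0 R True by (intro mult_right_mono) auto
    then have "c k \<le> R * (2 * (1 + a) * T) ^ k / fact k"
      unfolding c_def power_mult_distrib by (simp add: mult_ac)
    then show "norm (c k) \<le> R * (2 * (1 + a) * T) ^ k / fact k" using c0[of k] by simp
  qed
  have "\<bar>W \<phi> t - exp (- (r0 * t)) * \<phi> t\<bar> \<le> (\<Sum>k. c k) * integral {0..t} (\<lambda>s. \<bar>\<phi> s\<bar>)"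
    if \<phi>: "cts \<phi>" and t: "0 \<le> t" "t \<le> T" for \<phi> t
  proof -
    let ?I = "integral {0..t} (\<lambda>s. \<bar>\<phi> s\<bar>)"
    have "(\<lambda>k. ((- (r0 * t)) ^ k /\<^sub>R fact k) * \<phi> t) sums (exp (- (r0 * t)) * \<phi> t)"
      by (intro sums_mult2 exp_converges)
    moreover have "(\<lambda>k. ((- (r0 * t)) ^ k /\<^sub>R fact k) * \<phi> t) = (\<lambda>k. r0 ^ k * (mk k t * \<phi> t))"
      by (simp add: mk_def power_mult_distrib[symmetric] field_simps)
    ultimately have s: "(\<lambda>k. r0 ^ k * (mk k t * \<phi> t)) sums (exp (- (r0 * t)) * \<phi> t)" by metis
    have "(\<lambda>k. Wt k \<phi> t - r0 ^ k * (mk k t * \<phi> t)) sums (W \<phi> t - exp (- (r0 * t)) * \<phi> t)"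
      by (rule sums_diff[OF _ s]) (simp add: W_def summable_sums Wt_summable \<phi>)
    then have eq: "W \<phi> t - exp (- (r0 * t)) * \<phi> t = (\<Sum>k. Wt k \<phi> t - r0 ^ k * (mk k t * \<phi> t))"
      by (simp add: sums_unique)
    have le: "\<bar>Wt k \<phi> t - r0 ^ k * (mk k t * \<phi> t)\<bar> \<le> c k * ?I" for k
    proof -
      have cm: "cts (\<lambda>s. mk k s * \<phi> s)" by (intro continuous_intros mk_cts \<phi>)
      have "\<bar>Wt k \<phi> t - r0 ^ k * (mk k t * \<phi> t)\<bar> \<le> real k * (1 + a) ^ k * R * integral {0..t} (\<lambda>s. \<bar>mk k s * \<phi> s\<bar>)"
        unfolding Wt_def by (rule Apow_smoothing[OF cm R t a_def])
      also have "integral {0..t} (\<lambda>s. \<bar>mk k s * \<phi> s\<bar>) \<le> integral {0..t} (\<lambda>s. T ^ k / fact k * \<bar>\<phi> s\<bar>)"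
      proof (rule integral_le)
        show "(\<lambda>s. \<bar>mk k s * \<phi> s\<bar>) integrable_on {0..t}" "(\<lambda>s. T ^ k / fact k * \<bar>\<phi> s\<bar>) integrable_on {0..t}"
          by (intro cts_integrable continuous_intros mk_cts \<phi>)+
        fix s assume "s \<in> {0..t}"
        then show "\<bar>mk k s * \<phi> s\<bar> \<le> T ^ k / fact k * \<bar>\<phi> s\<bar>"
          unfolding abs_mult using t by (intro mult_right_mono mk_bound) auto
      qed
      then have "real k * (1 + a) ^ k * R * integral {0..t} (\<lambda>s. \<bar>mk k s * \<phi> s\<bar>) \<le> real k * (1 + a) ^ k * R * (T ^ k / fact k * ?I)"
        using a0 R by (intro mult_left_mono) auto
      finally show ?thesis by (simp add: c_def mult_ac)
    qed
    have "norm (\<Sum>k. Wt k \<phi> t - r0 ^ k * (mk k t * \<phi> t)) \<le> (\<Sum>k. c k * ?I)"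
      by (rule norm_suminf_le) (use le csum in \<open>auto intro: summable_mult2\<close>)
    then show ?thesis unfolding eq using suminf_mult2[OF csum, of ?I] by simp
  qed
  moreover have "(\<Sum>k. c k) \<ge> 0" by (rule suminf_nonneg[OF csum c0])
  ultimately show ?thesis by blast
qed auto

text \<open>Multiplied by exp (r0 t), the equation W y = F becomes (I + K) y = exp (r0 t) F, where
  \<open>W_smoothing\<close> makes K a Volterra operator.\<close>

theorem W_solve:
  assumes "0 \<le> T"
  shows "\<exists>C\<ge>0. \<forall>F b. cts F \<longrightarrow> (\<forall>t. 0 \<le> t \<longrightarrow> t \<le> T \<longrightarrow> \<bar>F t\<bar> \<le> b) \<longrightarrow>
     (\<exists>y. cts y \<and> (\<forall>t. 0 \<le> t \<longrightarrow> t \<le> T \<longrightarrow> W y t = F t \<and> \<bar>y t\<bar> \<le> C * b))"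
proof -
  obtain C where C: "C \<ge> 0" "\<And>\<phi> t. cts \<phi> \<Longrightarrow> 0 \<le> t \<Longrightarrow> t \<le> T \<Longrightarrow>
     \<bar>W \<phi> t - exp (- (r0 * t)) * \<phi> t\<bar> \<le> C * integral {0..t} (\<lambda>s. \<bar>\<phi> s\<bar>)"
    using W_smoothing[of T] by blast
  define E where "E = exp (\<bar>r0\<bar> * T)"
  have E: "exp (r0 * t) \<le> E" if "0 \<le> t" "t \<le> T" for t
  proof -
    have "r0 * t \<le> \<bar>r0\<bar> * T" using that by (intro mult_mono) auto
    then show ?thesis by (simp add: E_def)
  qed
  define K where "K \<phi> t = exp (r0 * t) * W \<phi> t - \<phi> t" for \<phi> t
  have "\<exists>y. cts y \<and> (\<forall>t. 0 \<le> t \<longrightarrow> t \<le> T \<longrightarrow> W y t = F t \<and> \<bar>y t\<bar> \<le> E * exp (E * C * T) * b)"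
    if F: "cts F" and b: "\<And>t. 0 \<le> t \<Longrightarrow> t \<le> T \<Longrightarrow> \<bar>F t\<bar> \<le> b" for F b
  proof -
    obtain y where y: "cts y" "\<And>t. 0 \<le> t \<Longrightarrow> t \<le> T \<Longrightarrow> y t + K y t = exp (r0 * t) * F t"
      "\<And>t. 0 \<le> t \<Longrightarrow> t \<le> T \<Longrightarrow> \<bar>y t\<bar> \<le> (E * b) * exp ((E * C) * T)"
    proof (rule volterra_solve[of K T "E * C" "\<lambda>t. exp (r0 * t) * F t" "E * b"])
      show "cts (K \<phi>)" if "cts \<phi>" for \<phi>
        unfolding K_def[abs_def] by (intro continuous_intros W_cts that)
      show "K (\<lambda>s. \<phi> s - \<psi> s) t = K \<phi> t - K \<psi> t" if "cts \<phi>" "cts \<psi>" for \<phi> \<psi> t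
        using W_add[OF that(1), of "\<lambda>s. (-1) * \<psi> s"] W_scale[OF that(2), of "-1"] that
        by (simp add: K_def algebra_simps continuous_on_minus)
      fix \<phi> t assume \<phi>: "cts \<phi>" and t: "0 \<le> t" "t \<le> T"
      have I0: "integral {0..t} (\<lambda>s. \<bar>\<phi> s\<bar>) \<ge> 0" by (intro integral_nonneg cts_integrable continuous_intros \<phi>) auto
      have "K \<phi> t = exp (r0 * t) * (W \<phi> t - exp (- (r0 * t)) * \<phi> t)"
        by (simp add: K_def right_diff_distrib mult.assoc[symmetric] exp_add[symmetric])
      then have "\<bar>K \<phi> t\<bar> = exp (r0 * t) * \<bar>W \<phi> t - exp (- (r0 * t)) * \<phi> t\<bar>" by (simp add: abs_mult)
      also have "\<dots> \<le> E * (C * integral {0..t} (\<lambda>s. \<bar>\<phi> s\<bar>))"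
        by (intro mult_mono E C \<phi> t) (use C I0 E_def in auto)
      finally show "\<bar>K \<phi> t\<bar> \<le> E * C * integral {0..t} (\<lambda>s. \<bar>\<phi> s\<bar>)" by (simp add: mult.assoc)
    next
      fix t assume t: "0 \<le> t" "t \<le> T"
      show "\<bar>exp (r0 * t) * F t\<bar> \<le> E * b" unfolding abs_mult by (intro mult_mono) (use E b t E_def in auto)
    qed (use F C assms E_def in \<open>auto intro!: continuous_intros\<close>)
    have "W y t = F t" if "0 \<le> t" "t \<le> T" for t using y(2)[OF that] by (simp add: K_def)
    then show ?thesis using y(1,3) by (intro exI[of _ y]) (auto simp: mult_ac)
  qed
  moreover have "E * exp (E * C * T) \<ge> 0" by (simp add: E_def)
  ultimately show ?thesis by blast
qed

text \<open>If W \<phi> = 0, the leading term exp (- r0 t) \<phi> t equals the Volterra remainder up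
  to sign, and Gronwall applies.\<close>

lemma W_inj:
  assumes "cts \<phi>" "\<And>t. 0 \<le> t \<Longrightarrow> t \<le> T \<Longrightarrow> W \<phi> t = 0" "0 \<le> t" "t \<le> T"
  shows "\<phi> t = 0"
proof -
  obtain C where C: "C \<ge> 0" "\<And>\<phi> t. cts \<phi> \<Longrightarrow> 0 \<le> t \<Longrightarrow> t \<le> T \<Longrightarrow>
     \<bar>W \<phi> t - exp (- (r0 * t)) * \<phi> t\<bar> \<le> C * integral {0..t} (\<lambda>s. \<bar>\<phi> s\<bar>)"
    using W_smoothing[of T] by blast
  define E where "E = exp (\<bar>r0\<bar> * T)"
  show ?thesis
  proof (rule volterra_unique[OF assms(1) _ _ assms(3,4)])
    fix t assume t: "0 \<le> t" "t \<le> T"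
    have "r0 * t \<le> \<bar>r0\<bar> * T" using t by (intro mult_mono) auto
    then have E: "exp (r0 * t) \<le> E" by (simp add: E_def)
    have I0: "integral {0..t} (\<lambda>s. \<bar>\<phi> s\<bar>) \<ge> 0" by (intro integral_nonneg cts_integrable continuous_intros assms) auto
    have "\<bar>exp (- (r0 * t)) * \<phi> t\<bar> \<le> C * integral {0..t} (\<lambda>s. \<bar>\<phi> s\<bar>)"
      using C(2)[OF assms(1) t] assms(2)[OF t] by simp
    then have "exp (r0 * t) * \<bar>exp (- (r0 * t)) * \<phi> t\<bar> \<le> E * (C * integral {0..t} (\<lambda>s. \<bar>\<phi> s\<bar>))"
      using E I0 C by (intro mult_mono) (auto simp: E_def)
    then show "\<bar>\<phi> t\<bar> \<le> E * C * integral {0..t} (\<lambda>s. \<bar>\<phi> s\<bar>)"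
      by (simp add: abs_mult mult.assoc[symmetric] exp_add[symmetric])
  qed (use C E_def in auto)
qed

end

section \<open>Periodic functions, even and odd parts\<close>

definition periodic :: "(real \<Rightarrow> real) \<Rightarrow> bool" where
  "periodic f \<longleftrightarrow> (\<forall>t. f (t + 2 * pi) = f t)"

lemma periodic_int:
  assumes "periodic f" shows "f (t + 2 * pi * of_int k) = f t"
proof (induction k rule: int_induct[where k=0])
  case (step1 i)
  have "f (t + 2 * pi * of_int (i + 1)) = f ((t + 2 * pi * of_int i) + 2 * pi)" by (simp add: algebra_simps)
  then show ?case using step1 assms by (simp add: periodic_def)
next
  case (step2 i)
  have "f (t + 2 * pi * of_int i) = f ((t + 2 * pi * of_int (i - 1)) + 2 * pi)" by (simp add: algebra_simps)
  then show ?case using step2 assms by (simp add: periodic_def)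
qed simp

text \<open>The period is taken open at 0: for T > 2 pi it then lies in the open interval (0,T),
  where two-sided derivatives are available.\<close>

lemma shift_into_period: "\<exists>k::int. 0 < t + 2 * pi * of_int k \<and> t + 2 * pi * of_int k \<le> 2 * pi"
proof -
  define k where "k = \<lceil>t / (2 * pi)\<rceil> - 1"
  have "of_int k < t / (2 * pi)" "t / (2 * pi) \<le> of_int k + 1" unfolding k_def by linarith+
  then have "of_int k * (2 * pi) < t" "t \<le> (of_int k + 1) * (2 * pi)"
    by (auto simp: field_simps)
  then show ?thesis by (intro exI[of _ "- k"]) (auto simp: algebra_simps)
qed

lemma periodic_bounded:
  assumes "periodic f" "cts f" shows "\<exists>b\<ge>0. \<forall>t. \<bar>f t\<bar> \<le> b"
proof -
  obtain b where b: "b \<ge> 0" "\<And>s. \<bar>s\<bar> \<le> 2 * pi \<Longrightarrow> \<bar>f s\<bar> \<le> b" using cts_bounded_on[OF assms(2)] by blast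
  have "\<bar>f t\<bar> \<le> b" for t
  proof -
    obtain k :: int where k: "0 < t + 2 * pi * of_int k" "t + 2 * pi * of_int k \<le> 2 * pi" using shift_into_period by blast
    then show ?thesis using b(2)[of "t + 2 * pi * of_int k"] periodic_int[OF assms(1), of t k] by simp
  qed
  then show ?thesis using b by blast
qed

lemma cts_zero_closure:
  assumes "cts h" "\<And>t. 0 < t \<Longrightarrow> t < T \<Longrightarrow> h t = 0" "0 < T" "0 \<le> t" "t \<le> T"
  shows "h t = 0"
proof -
  have "continuous_on (closure {0<..<T}) h" using continuous_on_subset[OF assms(1)] by blast
  from continuous_constant_on_closure[OF this, of 0 t] show ?thesis using assms by auto
qed

text \<open>The even part for \<sigma> = 1 and the odd part for \<sigma> = -1.\<close>

definition par :: "real \<Rightarrow> (real \<Rightarrow> real) \<Rightarrow> real \<Rightarrow> real" where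
  "par \<sigma> \<Psi> s = (\<Psi> s + \<sigma> * \<Psi> (- s)) / 2"

lemma par_cts: "cts \<Psi> \<Longrightarrow> cts (par \<sigma> \<Psi>)"
  unfolding par_def[abs_def] by (intro continuous_intros cts_compose[of \<Psi> UNIV uminus]) auto

lemma par_bound: "\<bar>\<sigma>\<bar> = 1 \<Longrightarrow> (\<And>t. \<bar>\<Psi> t\<bar> \<le> b) \<Longrightarrow> \<bar>par \<sigma> \<Psi> s\<bar> \<le> b"
proof -
  assume s: "\<bar>\<sigma>\<bar> = 1" and b: "\<And>t. \<bar>\<Psi> t\<bar> \<le> b"
  have "\<bar>\<sigma> * \<Psi> (- s)\<bar> \<le> b" using s b by (simp add: abs_mult)
  with b[of s] abs_triangle_ineq[of "\<Psi> s" "\<sigma> * \<Psi> (- s)"] have "\<bar>\<Psi> s + \<sigma> * \<Psi> (- s)\<bar> \<le> 2 * b" by linarith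
  then show ?thesis by (simp add: par_def)
qed

lemma J_derivative:
  assumes "cts y" "0 < t"
  shows "(J y has_real_derivative y t) (at t)"
proof -
  have "((\<lambda>u. integral {0..u} y) has_real_derivative y t) (at t within {0..t+1})"
    using integral_has_vector_derivative[of 0 "t + 1" y t] cts_on[OF assms(1)] assms(2)
    by (auto simp: has_real_derivative_iff_has_vector_derivative)
  moreover have "at t within {0..t+1} = at t" by (rule at_within_interior) (use assms in auto)
  ultimately show ?thesis by (simp add: J_eq[abs_def])
qed

lemma FTC_J:
  assumes "\<And>t. 0 \<le> t \<Longrightarrow> (f has_real_derivative f' t) (at t)" "0 \<le> t"
  shows "f t = f 0 + J f' t"
proof -
  have "(f' has_integral (f t - f 0)) {0..t}"
    by (rule fundamental_theorem_of_calculus)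
       (use assms in \<open>auto simp flip: has_real_derivative_iff_has_vector_derivative intro: DERIV_subset has_field_derivative_at_within\<close>)
  then show ?thesis by (simp add: J_eq integral_unique)
qed

section \<open>Uniqueness for periodic annihilators\<close>

context conv_root
begin

text \<open>Boundedness in the supremum norm of [0,T], phrased with arbitrary majorants b in place
  of suprema.\<close>

definition op_bound :: "real \<Rightarrow> ((real \<Rightarrow> real) \<Rightarrow> real \<Rightarrow> real) \<Rightarrow> real \<Rightarrow> bool" where
  "op_bound T K C \<longleftrightarrow> (\<forall>\<phi> b. cts \<phi> \<longrightarrow> (\<forall>t. 0 \<le> t \<longrightarrow> t \<le> T \<longrightarrow> \<bar>\<phi> t\<bar> \<le> b) \<longrightarrow> (\<forall>t. 0 \<le> t \<longrightarrow> t \<le> T \<longrightarrow> \<bar>K \<phi> t\<bar> \<le> C * b))"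

definition bop :: "real \<Rightarrow> ((real \<Rightarrow> real) \<Rightarrow> real \<Rightarrow> real) \<Rightarrow> bool" where
  "bop T K \<longleftrightarrow> (\<exists>C\<ge>0. op_bound T K C)"

lemma op_boundD:
  assumes "op_bound T K C" "cts \<phi>" "\<And>t. 0 \<le> t \<Longrightarrow> t \<le> T \<Longrightarrow> \<bar>\<phi> t\<bar> \<le> b" "0 \<le> t" "t \<le> T"
  shows "\<bar>K \<phi> t\<bar> \<le> C * b"
  using assms(1)[unfolded op_bound_def, rule_format, of \<phi> b t] assms(2-) by simp

lemma bop_comp:
  assumes "bop T K" "bop T L" "\<And>\<phi>. cts \<phi> \<Longrightarrow> cts (L \<phi>)"
  shows "bop T (\<lambda>\<phi>. K (L \<phi>))"
proof -
  obtain C where C: "C \<ge> 0" "op_bound T K C" using assms(1) by (auto simp: bop_def)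
  obtain D where D: "D \<ge> 0" "op_bound T L D" using assms(2) by (auto simp: bop_def)
  have "op_bound T (\<lambda>\<phi>. K (L \<phi>)) (C * D)"
    unfolding op_bound_def
  proof (intro allI impI)
    fix \<phi> b t assume \<phi>: "cts \<phi>" and b: "\<forall>t. 0 \<le> t \<longrightarrow> t \<le> T \<longrightarrow> \<bar>\<phi> t\<bar> \<le> b" and t: "0 \<le> t" "t \<le> T"
    have "\<bar>L \<phi> t\<bar> \<le> D * b" if "0 \<le> t" "t \<le> T" for t by (rule op_boundD[OF D(2) \<phi> _ that]) (use b in simp)
    then have "\<bar>K (L \<phi>) t\<bar> \<le> C * (D * b)" by (intro op_boundD[OF C(2) assms(3)[OF \<phi>] _ t]) simp
    then show "\<bar>K (L \<phi>) t\<bar> \<le> C * D * b" by (simp add: mult.assoc)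
  qed
  then show ?thesis unfolding bop_def using C(1) D(1) by (intro exI[of _ "C * D"]) auto
qed

lemma bop_of_bound:
  assumes K: "\<And>\<phi> t. cts \<phi> \<Longrightarrow> 0 \<le> t \<Longrightarrow> t \<le> T \<Longrightarrow> \<bar>K \<phi> t\<bar> \<le> c * \<bar>\<phi> t\<bar> + d * integral {0..t} (\<lambda>s. \<bar>\<phi> s\<bar>)"
    and "c \<ge> 0" "d \<ge> 0" "T \<ge> 0"
  shows "bop T K"
  unfolding bop_def op_bound_def
proof (intro exI[of _ "c + d * T"] conjI allI impI)
  fix \<phi> b t assume \<phi>: "cts \<phi>" and b: "\<forall>t. 0 \<le> t \<longrightarrow> t \<le> T \<longrightarrow> \<bar>\<phi> t\<bar> \<le> b" and t: "0 \<le> t" "t \<le> T"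
  have b0: "b \<ge> 0" using b t abs_ge_zero[of "\<phi> t"] by (meson order_trans)
  have "\<bar>K \<phi> t\<bar> \<le> c * \<bar>\<phi> t\<bar> + d * integral {0..t} (\<lambda>s. \<bar>\<phi> s\<bar>)" by (rule K[OF \<phi> t])
  also have "\<dots> \<le> c * b + d * (t * b)"
    by (intro add_mono mult_left_mono J_abs_le \<phi>) (use b t assms in auto)
  also have "\<dots> \<le> c * b + d * (T * b)" using t b0 assms by (intro add_left_mono mult_left_mono mult_right_mono) auto
  finally show "\<bar>K \<phi> t\<bar> \<le> (c + d * T) * b" by (simp add: algebra_simps)
qed (use assms in auto)

lemma bop_A: "T \<ge> 0 \<Longrightarrow> bop T A"
proof -
  assume T: "T \<ge> 0"
  obtain R where R: "R \<ge> 0" "\<And>s. \<bar>s\<bar> \<le> T \<Longrightarrow> \<bar>r1 s\<bar> \<le> R" using cts_bounded_on[OF r1] by blast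
  show ?thesis
  proof (rule bop_of_bound[of T A "\<bar>r0\<bar>" R])
    fix \<phi> t assume "cts \<phi>" "0 \<le> t" "t \<le> T"
    then have "\<bar>(r1 \<star> \<phi>) t\<bar> \<le> R * integral {0..t} (\<lambda>s. \<bar>\<phi> s\<bar>)" by (intro conv_bound_cts r1) (use R in auto)
    then show "\<bar>A \<phi> t\<bar> \<le> \<bar>r0\<bar> * \<bar>\<phi> t\<bar> + R * integral {0..t} (\<lambda>s. \<bar>\<phi> s\<bar>)"
      unfolding A_def using abs_triangle_ineq[of "r0 * \<phi> t" "(r1 \<star> \<phi>) t"] by (simp add: abs_mult)
  qed (use R T in auto)
qed

lemma bop_B: "T \<ge> 0 \<Longrightarrow> bop T B"
proof -
  assume T: "T \<ge> 0"
  obtain R where R: "R \<ge> 0" "\<And>s. \<bar>s\<bar> \<le> T \<Longrightarrow> \<bar>r s\<bar> \<le> R" using cts_bounded_on[OF r_cts] by blast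
  show ?thesis
  proof (rule bop_of_bound[of T B 1 R])
    fix \<phi> t assume "cts \<phi>" "0 \<le> t" "t \<le> T"
    then have "\<bar>(r \<star> \<phi>) t\<bar> \<le> R * integral {0..t} (\<lambda>s. \<bar>\<phi> s\<bar>)" by (intro conv_bound_cts r_cts) (use R in auto)
    then show "\<bar>B \<phi> t\<bar> \<le> 1 * \<bar>\<phi> t\<bar> + R * integral {0..t} (\<lambda>s. \<bar>\<phi> s\<bar>)"
      unfolding B_def using abs_triangle_ineq[of "\<phi> t" "(r \<star> \<phi>) t"] by simp
  qed (use R T in auto)
qed

lemma bop_W: "T \<ge> 0 \<Longrightarrow> bop T W"
proof -
  assume T: "T \<ge> 0"
  obtain C where C: "C \<ge> 0" "\<And>\<phi> t. cts \<phi> \<Longrightarrow> 0 \<le> t \<Longrightarrow> t \<le> T \<Longrightarrow>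
     \<bar>W \<phi> t - exp (- (r0 * t)) * \<phi> t\<bar> \<le> C * integral {0..t} (\<lambda>s. \<bar>\<phi> s\<bar>)"
    using W_smoothing[of T] by blast
  show ?thesis
  proof (rule bop_of_bound[of T W "exp (\<bar>r0\<bar> * T)" C])
    fix \<phi> t assume \<phi>: "cts \<phi>" and t: "0 \<le> t" "t \<le> T"
    have "(- r0) * t \<le> \<bar>r0\<bar> * T" using t by (intro mult_mono) auto
    then have "exp (- (r0 * t)) * \<bar>\<phi> t\<bar> \<le> exp (\<bar>r0\<bar> * T) * \<bar>\<phi> t\<bar>" by (intro mult_right_mono) auto
    then show "\<bar>W \<phi> t\<bar> \<le> exp (\<bar>r0\<bar> * T) * \<bar>\<phi> t\<bar> + C * integral {0..t} (\<lambda>s. \<bar>\<phi> s\<bar>)"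
      using C(2)[OF \<phi> t] abs_triangle_ineq[of "W \<phi> t - exp (- (r0 * t)) * \<phi> t" "exp (- (r0 * t)) * \<phi> t"]
      by (simp add: abs_mult)
  qed (use C T in auto)
qed

end

lemma isCont_locally:
  assumes "isCont f t" "open S" "t \<in> S" "\<And>s. s \<in> S \<Longrightarrow> f s = g s"
  shows "isCont g (t::real)"
proof -
  have "eventually (\<lambda>s. f s = g s) (nhds t)" using assms(2-4) eventually_nhds by blast
  then show ?thesis using isCont_cong assms(1) by blast
qed

context conv_root begin
text \<open>The orthogonal complement of the moment functions, as periodic functions; differentiation exchanges the classes
  \<open>\<sigma> = 1\<close> and \<open>\<sigma> = -1\<close>.\<close>

definition annih :: "real \<Rightarrow> real \<Rightarrow> (real \<Rightarrow> real) \<Rightarrow> bool" where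
  "annih T \<sigma> \<Psi> \<longleftrightarrow> cts \<Psi> \<and> periodic \<Psi> \<and> (\<forall>t. 0 \<le> t \<longrightarrow> t \<le> T \<longrightarrow> W \<Psi> t + (r \<star> W (par \<sigma> \<Psi>)) t = 0)"

text \<open>Regularity is drawn from the equation W \<Psi> = - r \<star> W L with L = par \<sigma>
  \<Psi>. Applying B makes its right side a primitive, so that \<Psi> itself is a primitive J y on
  [0,T] with W y known explicitly; periodicity carries this to the whole line. The constant C is
  uniform in \<sigma>, \<Psi> and b because the statement will be applied again to the
  derivative.\<close>

lemma annih_derivative:
  assumes T: "2 * pi < T"
  shows "\<exists>C\<ge>0. \<forall>\<sigma> \<Psi> b. \<bar>\<sigma>\<bar> = 1 \<longrightarrow> annih T \<sigma> \<Psi> \<longrightarrow> (\<forall>t. \<bar>\<Psi> t\<bar> \<le> b) \<longrightarrow>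
    \<Psi> 0 = 0 \<and> (\<exists>\<Psi>'. annih T (- \<sigma>) \<Psi>' \<and> (\<forall>t. \<bar>\<Psi>' t\<bar> \<le> C * b) \<and> (\<forall>t. (\<Psi> has_real_derivative \<Psi>' t) (at t)))"
proof -
  have T0: "0 \<le> T" "0 < T" using T pi_gt_zero by linarith+
  have abw: "bop T (\<lambda>\<phi>. A (B (W \<phi>)))"
    by (intro bop_comp[of T A "\<lambda>\<phi>. B (W \<phi>)"] bop_comp[of T B W] bop_A bop_B bop_W T0 B_cts W_cts)
  then obtain C1 where C1: "C1 \<ge> 0" "op_bound T (\<lambda>\<phi>. A (B (W \<phi>))) C1" by (auto simp: bop_def)
  obtain C2 where C2: "C2 \<ge> 0" "\<forall>F b. cts F \<longrightarrow> (\<forall>t. 0 \<le> t \<longrightarrow> t \<le> T \<longrightarrow> \<bar>F t\<bar> \<le> b) \<longrightarrow>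
     (\<exists>y. cts y \<and> (\<forall>t. 0 \<le> t \<longrightarrow> t \<le> T \<longrightarrow> W y t = F t \<and> \<bar>y t\<bar> \<le> C2 * b))"
    using W_solve[OF T0(1)] by (elim exE conjE)
  have "\<Psi> 0 = 0 \<and> (\<exists>\<Psi>'. annih T (- \<sigma>) \<Psi>' \<and> (\<forall>t. \<bar>\<Psi>' t\<bar> \<le> (C2 * C1) * b) \<and> (\<forall>t. (\<Psi> has_real_derivative \<Psi>' t) (at t)))"
    if \<sigma>: "\<bar>\<sigma>\<bar> = 1" and an: "annih T \<sigma> \<Psi>" and b: "\<And>t. \<bar>\<Psi> t\<bar> \<le> b" for \<sigma> \<Psi> b
  proof -
    have c: "cts \<Psi>" and per: "periodic \<Psi>" and eq: "\<And>t. 0 \<le> t \<Longrightarrow> t \<le> T \<Longrightarrow> W \<Psi> t + (r \<star> W (par \<sigma> \<Psi>)) t = 0"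
      using an by (auto simp: annih_def)
    define L where "L = par \<sigma> \<Psi>"
    have L: "cts L" "\<And>s. \<bar>L s\<bar> \<le> b" unfolding L_def using par_cts[OF c] par_bound[OF \<sigma> b] by auto
    define Y where "Y = W L"
    have Y: "cts Y" unfolding Y_def by (rule W_cts[OF L(1)])
    \<comment> \<open>The equation that the derivative must satisfy: B (W \<Psi>) = - r \<star> B (W
      L) = - J (A (B (W L))), whereas \<open>W_intertwine\<close> would give B (W \<Psi>) = \<Psi> 0
      + J (W \<Psi>').\<close>
    let ?F = "\<lambda>t. (-1) * A (B Y) t"
    have Fc: "cts ?F" by (intro continuous_intros A_cts B_cts Y)
    have Fb: "\<bar>?F t\<bar> \<le> C1 * b" if "0 \<le> t" "t \<le> T" for t
      using op_boundD[OF C1(2) L(1) L(2) that] by (simp add: Y_def)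
    have "\<exists>y. cts y \<and> (\<forall>t. 0 \<le> t \<longrightarrow> t \<le> T \<longrightarrow> W y t = ?F t \<and> \<bar>y t\<bar> \<le> C2 * (C1 * b))"
      using C2(2)[rule_format, of ?F "C1 * b"] Fc Fb by simp
    then obtain y where y: "cts y" "\<And>t. 0 \<le> t \<Longrightarrow> t \<le> T \<Longrightarrow> W y t = ?F t"
      "\<And>t. 0 \<le> t \<Longrightarrow> t \<le> T \<Longrightarrow> \<bar>y t\<bar> \<le> C2 * (C1 * b)" by blast
    have Jy: "cts (J y)" by (intro conv_cts y) auto
    have \<Psi>_eq: "\<Psi> t = J y t" if t: "0 \<le> t" "t \<le> T" for t
    proof -
      have BW: "B (W (J y)) t = B (W \<Psi>) t" if t: "0 \<le> t" "t \<le> T" for t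
      proof -
        have "B (W (J y)) t = 0 + J (W y) t" by (rule W_intertwine[OF Jy y(1) _ t(1)]) simp
        also have "J (W y) t = J ?F t" by (rule conv_cong) (use y(2) t in auto)
        also have "J ?F t = - (r \<star> B Y) t" unfolding conv_scale_right J_A[OF B_cts[OF Y]] by simp
        also have "(r \<star> B Y) = B (r \<star> Y)" by (rule B_conv[symmetric, OF r_cts Y])
        also have "- B (r \<star> Y) t = B (\<lambda>t. (-1) * (r \<star> Y) t) t" by (simp only: B_scale)
        also have "\<dots> = B (W \<Psi>) t"
          by (rule B_cong) (use eq t in \<open>auto simp: Y_def L_def add_eq_0_iff\<close>)
        finally show ?thesis by simp
      qed
      have lin: "W (\<lambda>s. J y s + (-1) * \<Psi> s) = (\<lambda>t. W (J y) t + (-1) * W \<Psi> t)"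
        using W_add[OF Jy, of "\<lambda>s. (-1) * \<Psi> s"] W_scale[OF c, of "-1"] c by (simp add: continuous_on_minus)
      have "W (\<lambda>s. J y s + (-1) * \<Psi> s) t = 0" if t: "0 \<le> t" "t \<le> T" for t
        unfolding lin
      proof (rule B_inj[of "\<lambda>t. W (J y) t + (-1) * W \<Psi> t" T])
        show "cts (\<lambda>t. W (J y) t + (-1) * W \<Psi> t)" by (intro continuous_intros W_cts Jy c)
        show "B (\<lambda>t. W (J y) t + (-1) * W \<Psi> t) t = 0" if "0 \<le> t" "t \<le> T" for t
          using BW[OF that] W_cts[OF Jy] W_cts[OF c]
          by (subst B_add) (auto simp: B_scale[of "-1", simplified] intro!: continuous_intros)
      qed (use t in auto)
      then have "J y t + (-1) * \<Psi> t = 0"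
        by (intro W_inj[of "\<lambda>s. J y s + (-1) * \<Psi> s" T]) (use t in \<open>auto intro!: continuous_intros c conv_cts y(1)\<close>)
      then show ?thesis by simp
    qed
    have \<Psi>0: "\<Psi> 0 = 0" using \<Psi>_eq[of 0] T0 by (simp add: conv_neg)
    have der1: "(\<Psi> has_real_derivative y t) (at t)" if t: "0 < t" "t < T" for t
    proof (rule has_field_derivative_transform_within_open[OF J_derivative[OF y(1) t(1)], of "{0<..<T}"])
      show "J y s = \<Psi> s" if "s \<in> {0<..<T}" for s using \<Psi>_eq[of s] that by auto
    qed (use t in auto)
    \<comment> \<open>\<Psi> is differentiable at t as soon as some translate of t by a multiple of
      2 pi lies in (0,T).\<close>
    have der2: "(\<Psi> has_real_derivative y (t + 2 * pi * of_int k)) (at t)"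
      if "0 < t + 2 * pi * of_int k" "t + 2 * pi * of_int k < T" for t and k :: int
    proof -
      have "((\<lambda>s. \<Psi> (s + 2 * pi * of_int k)) has_real_derivative y (t + 2 * pi * of_int k)) (at t)"
        by (rule DERIV_shift[THEN iffD1]) (rule der1[OF that])
      then show ?thesis by (simp add: periodic_int[OF per])
    qed
    define \<Psi>' where "\<Psi>' = deriv \<Psi>"
    have d\<Psi>': "\<Psi>' t = y (t + 2 * pi * of_int k)" if "0 < t + 2 * pi * of_int k" "t + 2 * pi * of_int k < T" for t and k :: int
      unfolding \<Psi>'_def by (rule DERIV_imp_deriv) (rule der2[OF that])
    have ex: "\<exists>k::int. 0 < t + 2 * pi * of_int k \<and> t + 2 * pi * of_int k < T" for t
      using shift_into_period[of t] T by (meson order_le_less_trans)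
    have der: "(\<Psi> has_real_derivative \<Psi>' t) (at t)" for t
      using ex[of t] der2 d\<Psi>' by metis
    have c': "cts \<Psi>'"
      unfolding continuous_on_eq_continuous_at[OF open_UNIV]
    proof
      fix t
      obtain k :: int where k: "0 < t + 2 * pi * of_int k" "t + 2 * pi * of_int k < T" using ex by blast
      have "cts (\<lambda>s. y (s + 2 * pi * of_int k))" by (intro cts_compose[OF y(1)] continuous_intros)
      then have "isCont (\<lambda>s. y (s + 2 * pi * of_int k)) t" by (simp add: continuous_on_eq_continuous_at)
      then show "isCont \<Psi>' t"
      proof (rule isCont_locally[of _ _ "{- 2 * pi * of_int k<..<T - 2 * pi * of_int k}"])
        show "t \<in> {- 2 * pi * of_int k<..<T - 2 * pi * of_int k}" using k by auto
        fix s assume "s \<in> {- 2 * pi * of_int k<..<T - 2 * pi * of_int k}"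
        then show "y (s + 2 * pi * of_int k) = \<Psi>' s" by (intro d\<Psi>'[symmetric]) auto
      qed simp
    qed
    have per': "periodic \<Psi>'"
      unfolding periodic_def
    proof
      fix t
      have "((\<lambda>s. \<Psi> (s + 2 * pi)) has_real_derivative \<Psi>' (t + 2 * pi)) (at t)"
        by (rule DERIV_shift[THEN iffD1]) (rule der)
      then have "(\<Psi> has_real_derivative \<Psi>' (t + 2 * pi)) (at t)" using per by (simp add: periodic_def)
      then show "\<Psi>' (t + 2 * pi) = \<Psi>' t" using der DERIV_unique by blast
    qed
    have b': "\<bar>\<Psi>' t\<bar> \<le> C2 * C1 * b" for t
    proof -
      obtain k :: int where k: "0 < t + 2 * pi * of_int k" "t + 2 * pi * of_int k < T" using ex by blast
      show ?thesis using d\<Psi>'[OF k] y(3)[of "t + 2 * pi * of_int k"] k by (simp add: mult.assoc)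
    qed
    define L' where "L' = par (- \<sigma>) \<Psi>'"
    have L': "cts L'" unfolding L'_def by (rule par_cts[OF c'])
    have "(L has_real_derivative L' t) (at t)" for t
    proof -
      have "((\<lambda>s. \<Psi> (- s)) has_real_derivative \<Psi>' (- t) * (-1)) (at t)"
        by (rule DERIV_chain2[OF der]) (auto intro!: derivative_eq_intros)
      then show ?thesis unfolding L_def L'_def par_def[abs_def]
        by (auto intro!: derivative_eq_intros der)
    qed
    then have LJ: "L s = 0 + J L' s" if "0 \<le> s" for s
      using FTC_J[of L L' s] that \<Psi>0 by (simp add: L_def par_def)
    \<comment> \<open>\<open>annih\<close> asks for its equation on the closed interval; at the end
      points \<Psi>' and y agree by continuity.\<close>
    have yeq: "\<Psi>' t = y t" if "0 \<le> t" "t \<le> T" for t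
    proof -
      have "\<Psi>' t - y t = 0"
        by (rule cts_zero_closure[of "\<lambda>t. \<Psi>' t - y t" T]) (use c' y(1) T0 that d\<Psi>'[of _ 0] in \<open>auto intro!: continuous_intros\<close>)
      then show ?thesis by simp
    qed
    \<comment> \<open>L 0 = 0, a consequence of \<Psi> 0 = 0, removes the constant in
      \<open>W_intertwine\<close>. Hence A (B (W L)) = A (J (W L')) = r \<star> W L', where L' is
      the part of \<Psi>' of the opposite parity.\<close>
    have "W \<Psi>' t + (r \<star> W L') t = 0" if t: "0 \<le> t" "t \<le> T" for t
    proof -
      have "W \<Psi>' t = W y t" by (rule W_cong) (use yeq t in auto)
      also have "\<dots> = - A (B Y) t" using y(2)[OF t] by simp
      also have "A (B Y) t = A (J (W L')) t"
        by (rule A_cong) (use W_intertwine[OF L(1) L' LJ] t in \<open>auto simp: Y_def\<close>)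
      also have "A (J (W L')) = r \<star> W L'"
        by (simp add: A_conv J_A W_cts L')
      finally show ?thesis by simp
    qed
    then have "annih T (- \<sigma>) \<Psi>'" using c' per' by (auto simp: annih_def L'_def)
    then show ?thesis using \<Psi>0 b' der by blast
  qed
  then show ?thesis using C1(1) C2(1) by (intro exI[of _ "C2 * C1"]) auto
qed

theorem annih_trivial:
  assumes T: "2 * pi < T" and an: "annih T 1 \<Psi>"
  shows "\<Psi> t = 0"
proof -
  obtain C where C: "C \<ge> 0" and step: "\<And>\<sigma> \<Psi> b. \<bar>\<sigma>\<bar> = 1 \<Longrightarrow> annih T \<sigma> \<Psi> \<Longrightarrow> (\<And>t. \<bar>\<Psi> t\<bar> \<le> b) \<Longrightarrow>
    \<Psi> 0 = 0 \<and> (\<exists>\<Psi>'. annih T (- \<sigma>) \<Psi>' \<and> (\<forall>t. \<bar>\<Psi>' t\<bar> \<le> C * b) \<and> (\<forall>t. (\<Psi> has_real_derivative \<Psi>' t) (at t)))"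
    using annih_derivative[OF T] by blast
  \<comment> \<open>The induction varies \<sigma>, \<Psi> and b: its step passes to \<Psi>', which
    belongs to - \<sigma> and has the bound C b.\<close>
  have main: "\<bar>\<Psi> t\<bar> \<le> b * (C * t) ^ n / fact n"
    if "\<bar>\<sigma>\<bar> = 1" "annih T \<sigma> \<Psi>" "\<And>t. \<bar>\<Psi> t\<bar> \<le> b" "0 \<le> t" for n \<sigma> \<Psi> b t
    using that
  proof (induction n arbitrary: \<sigma> \<Psi> b t)
    case (Suc n)
    obtain \<Psi>' where \<Psi>': "annih T (- \<sigma>) \<Psi>'" "\<And>t. \<bar>\<Psi>' t\<bar> \<le> C * b" "\<And>t. (\<Psi> has_real_derivative \<Psi>' t) (at t)"
      and 0: "\<Psi> 0 = 0" using step[OF Suc.prems(1-3)] by blast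
    have "\<Psi> t = J \<Psi>' t" using FTC_J[of \<Psi> \<Psi>' t] \<Psi>'(3) 0 Suc.prems by simp
    have c': "cts \<Psi>'" using \<Psi>'(1) by (simp add: annih_def)
    have le: "\<bar>\<Psi>' s\<bar> \<le> (C * b) * (C * s) ^ n / fact n" if "0 \<le> s" for s
      by (rule Suc.IH[of "- \<sigma>"]) (use \<Psi>' Suc.prems that in auto)
    have i: "((\<lambda>s. C * b * C ^ n * (s ^ n / fact n)) has_integral (C * b * C ^ n * (t ^ Suc n / fact (Suc n)))) {0..t}"
      by (intro has_integral_mult_right integral_power_fact Suc.prems)
    have "norm (integral {0..t} \<Psi>') \<le> integral {0..t} (\<lambda>s. C * b * C ^ n * (s ^ n / fact n))"
      by (rule integral_norm_bound_integral[OF cts_integrable[OF c'] has_integral_integrable[OF i]])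
         (use le in \<open>auto simp: power_mult_distrib mult.assoc\<close>)
    also have "\<dots> = C * b * C ^ n * (t ^ Suc n / fact (Suc n))" using i by (rule integral_unique)
    also have "\<dots> = b * (C * t) ^ Suc n / fact (Suc n)" by (simp add: power_mult_distrib mult_ac)
    finally show ?case using \<open>\<Psi> t = J \<Psi>' t\<close> by (simp add: J_eq)
  qed simp
  have per: "periodic \<Psi>" and c: "cts \<Psi>" using an by (auto simp: annih_def)
  obtain b where b: "\<And>t. \<bar>\<Psi> t\<bar> \<le> b" using periodic_bounded[OF per c] by blast
  have z: "\<Psi> t = 0" if "0 \<le> t" for t
  proof -
    have "(\<lambda>n. \<bar>\<Psi> t\<bar>) \<longlonglongrightarrow> 0"
      by (rule tendsto_sandwich[OF _ _ tendsto_const[of 0] power_fact_tendsto_0[of b "C * t"]])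
         (use main[of 1 \<Psi> b t] an b that in auto)
    then show ?thesis by (simp add: LIMSEQ_const_iff)
  qed
  obtain k :: int where "0 < t + 2 * pi * of_int k" using shift_into_period by blast
  then show ?thesis using z[of "t + 2 * pi * of_int k"] periodic_int[OF per, of t k] by simp
qed

end

section \<open>The moment functions\<close>

text \<open>The discriminant argument for the Cauchy-Schwarz inequality, stated for numbers because
  it serves two integrals: \<open>CS_cts\<close> for continuous functions and \<open>L2_CS\<close>
  for square integrable ones.\<close>

lemma quadratic_nonneg_discrim:
  assumes "\<And>x::real. 0 \<le> F - 2 * x * P + x\<^sup>2 * G" and "0 \<le> G"
  shows "P\<^sup>2 \<le> F * G"
proof (cases "G = 0")
  case True
  have "P = 0"
  proof (rule ccontr)
    assume "P \<noteq> 0"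
    \<comment> \<open>At this value of x the expression equals -1.\<close>
    then show False using assms(1)[of "(F + 1) / (2 * P)"] True by (simp add: field_simps)
  qed
  then show ?thesis using True by simp
next
  case False
  have "0 \<le> (F - 2 * (P / G) * P + (P / G)\<^sup>2 * G) * G" using assms(1)[of "P / G"] \<open>0 \<le> G\<close> by simp
  also have "\<dots> = F * G - P\<^sup>2" using False by (simp add: field_simps power2_eq_square)
  finally show ?thesis by simp
qed

section \<open>Square norms of continuous functions, and periodic extension\<close>

definition nrm2 :: "real \<Rightarrow> (real \<Rightarrow> real) \<Rightarrow> real" where
  "nrm2 T f = integral {0..T} (\<lambda>s. (f s)\<^sup>2)"

lemma sq_cts: "cts f \<Longrightarrow> cts (\<lambda>s. (f s)\<^sup>2)"
  by (intro continuous_intros)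

lemma nrm2_nonneg: "cts f \<Longrightarrow> 0 \<le> nrm2 T f"
  unfolding nrm2_def by (intro integral_nonneg cts_integrable sq_cts) auto

lemma nrm2_add_le:
  assumes "cts f" "cts g" shows "nrm2 T (\<lambda>s. f s + g s) \<le> 2 * nrm2 T f + 2 * nrm2 T g"
proof -
  have fg: "cts (\<lambda>s. f s + g s)" by (intro continuous_intros assms)
  have i: "(\<lambda>s. 2 * (f s)\<^sup>2 + 2 * (g s)\<^sup>2) integrable_on {0..T}" by (intro cts_integrable continuous_intros assms)
  have "nrm2 T (\<lambda>s. f s + g s) \<le> integral {0..T} (\<lambda>s. 2 * (f s)\<^sup>2 + 2 * (g s)\<^sup>2)"
    unfolding nrm2_def
  proof (rule integral_le[OF cts_integrable[OF sq_cts[OF fg]] i])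
    fix s show "(f s + g s)\<^sup>2 \<le> 2 * (f s)\<^sup>2 + 2 * (g s)\<^sup>2"
      using zero_le_power2[of "f s - g s"] by (simp add: power2_eq_square algebra_simps)
  qed
  also have "\<dots> = 2 * nrm2 T f + 2 * nrm2 T g"
    unfolding nrm2_def using cts_integrable[OF sq_cts[OF assms(1)]] cts_integrable[OF sq_cts[OF assms(2)]]
    by (subst integral_add) auto
  finally show ?thesis .
qed

lemma nrm2_diff_le:
  assumes "cts f" "cts g" shows "nrm2 T (\<lambda>s. f s - g s) \<le> 2 * nrm2 T f + 2 * nrm2 T g"
  using nrm2_add_le[OF assms(1), of "\<lambda>s. - g s" T] assms(2) by (simp add: nrm2_def continuous_on_minus)

lemma nrm2_mono:
  assumes "cts f" "cts g" "\<And>s. 0 \<le> s \<Longrightarrow> s \<le> T \<Longrightarrow> \<bar>f s\<bar> \<le> \<bar>g s\<bar>" shows "nrm2 T f \<le> nrm2 T g"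
  unfolding nrm2_def
  by (rule integral_le[OF cts_integrable[OF sq_cts[OF assms(1)]] cts_integrable[OF sq_cts[OF assms(2)]]])
     (use assms(3) in \<open>auto simp: abs_le_square_iff\<close>)

lemma nrm2_mono_T: "cts f \<Longrightarrow> 0 \<le> S \<Longrightarrow> S \<le> T \<Longrightarrow> nrm2 S f \<le> nrm2 T f"
  unfolding nrm2_def by (rule integral_subset_le) (auto intro!: cts_integrable sq_cts)

lemma nrm2_scale: "nrm2 T (\<lambda>s. c * f s) = c\<^sup>2 * nrm2 T f"
  by (simp add: nrm2_def power_mult_distrib)

lemma nrm2_le_bound:
  assumes "cts f" "0 \<le> T" "\<And>s. 0 \<le> s \<Longrightarrow> s \<le> T \<Longrightarrow> \<bar>f s\<bar> \<le> b" shows "nrm2 T f \<le> T * b\<^sup>2"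
proof -
  have "nrm2 T f \<le> nrm2 T (\<lambda>_. b)"
  proof (rule nrm2_mono[OF assms(1)])
    fix s assume "0 \<le> s" "s \<le> T"
    from assms(3)[OF this] show "\<bar>f s\<bar> \<le> \<bar>b\<bar>" by simp
  qed simp
  also have "\<dots> = T * b\<^sup>2" using assms(2) by (simp add: nrm2_def)
  finally show ?thesis .
qed

lemma nrm2_eq_0:
  assumes "cts f" "nrm2 T f \<le> 0" "0 \<le> t" "t \<le> T" "0 < T" shows "f t = 0"
proof -
  have "nrm2 T f = 0" using assms nrm2_nonneg[of f T] by simp
  then have "((\<lambda>s. (f s)\<^sup>2) has_integral 0) (cbox 0 T)"
    using integrable_integral[OF cts_integrable[OF sq_cts[OF assms(1)], of 0 T]] by (simp add: nrm2_def)
  then have "(f t)\<^sup>2 = 0"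
    by (intro has_integral_0_cbox_imp_0[of 0 T "\<lambda>s. (f s)\<^sup>2"]) (use assms sq_cts[OF assms(1), THEN cts_on] in auto)
  then show ?thesis by simp
qed

lemma CS_cts:
  assumes "cts f" "cts g" "0 \<le> T"
  shows "(integral {0..T} (\<lambda>s. f s * g s))\<^sup>2 \<le> nrm2 T f * nrm2 T g"
proof (rule quadratic_nonneg_discrim)
  fix x :: real
  have c: "cts (\<lambda>s. f s - x * g s)" by (intro continuous_intros assms)
  have i: "(\<lambda>s. (f s)\<^sup>2) integrable_on {0..T}" "(\<lambda>s. (g s)\<^sup>2) integrable_on {0..T}" "(\<lambda>s. f s * g s) integrable_on {0..T}"
    by (intro cts_integrable continuous_intros assms)+
  have "((\<lambda>s. (f s)\<^sup>2 + ((- 2 * x) * (f s * g s) + x\<^sup>2 * (g s)\<^sup>2)) has_integral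
      (nrm2 T f + ((- 2 * x) * integral {0..T} (\<lambda>s. f s * g s) + x\<^sup>2 * nrm2 T g))) {0..T}"
    unfolding nrm2_def by (intro has_integral_add has_integral_mult_right integrable_integral i)
  moreover have "(\<lambda>s. (f s)\<^sup>2 + ((- 2 * x) * (f s * g s) + x\<^sup>2 * (g s)\<^sup>2)) = (\<lambda>s. (f s - x * g s)\<^sup>2)"
    by (auto simp: power2_eq_square algebra_simps)
  ultimately have "nrm2 T (\<lambda>s. f s - x * g s) = nrm2 T f + ((- 2 * x) * integral {0..T} (\<lambda>s. f s * g s) + x\<^sup>2 * nrm2 T g)"
    unfolding nrm2_def by (simp add: integral_unique)
  then show "0 \<le> nrm2 T f - 2 * x * integral {0..T} (\<lambda>s. f s * g s) + x\<^sup>2 * nrm2 T g"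
    using nrm2_nonneg[OF c, of T] by (simp add: algebra_simps)
qed (rule nrm2_nonneg[OF assms(2)])

lemma integral_abs_le_sqrt:
  assumes "cts f" "0 \<le> T"
  shows "integral {0..T} (\<lambda>s. \<bar>f s\<bar>) \<le> sqrt (T * nrm2 T f)"
proof (rule real_le_rsqrt)
  have "cts (\<lambda>s. \<bar>f s\<bar>)" by (intro continuous_intros assms)
  from CS_cts[OF this cts_const[of 1] assms(2)]
  show "(integral {0..T} (\<lambda>s. \<bar>f s\<bar>))\<^sup>2 \<le> T * nrm2 T f" using assms(2) by (simp add: nrm2_def mult.commute)
qed

lemma periodic_integral_le:
  assumes "cts f" "periodic f" "\<And>s. 0 \<le> f s" "T \<le> 2 * pi * real K"
  shows "integral {0..T} f \<le> real K * integral {0..2 * pi} f"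
proof -
  have "integral {0..2 * pi * real K} f = real K * integral {0..2 * pi} f"
  proof (induction K)
    case (Suc K)
    have "integral {0..2 * pi * real (Suc K)} f = integral {0..2 * pi * real K} f + integral {2 * pi * real K..2 * pi * real (Suc K)} f"
      by (rule Henstock_Kurzweil_Integration.integral_combine[symmetric]) (auto intro!: cts_integrable assms simp: algebra_simps)
    also have "integral {2 * pi * real K..2 * pi * real (Suc K)} f = integral {0 + 2 * pi * real K..2 * pi + 2 * pi * real K} f"
      by (simp add: algebra_simps)
    also have "\<dots> = integral {0..2 * pi} (f \<circ> (\<lambda>x. x + 2 * pi * real K))"
      by (rule integral_shift[symmetric]) (rule cts_on[OF assms(1)])
    also have "f \<circ> (\<lambda>x. x + 2 * pi * real K) = f"
      using periodic_int[OF assms(2), of _ "int K"] by (auto simp: o_def)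
    finally show ?case using Suc by (simp add: algebra_simps)
  qed simp
  moreover have "integral {0..T} f \<le> integral {0..2 * pi * real K} f"
    by (rule integral_subset_le) (use assms in \<open>auto intro!: cts_integrable\<close>)
  ultimately show ?thesis by simp
qed

lemma periodic_reflect: "periodic f \<Longrightarrow> periodic (\<lambda>s. f (- s))"
  unfolding periodic_def
proof (intro allI)
  fix t assume a: "\<forall>t. f (t + 2 * pi) = f t"
  show "f (- (t + 2 * pi)) = f (- t)" using a[rule_format, of "- (t + 2 * pi)"] by simp
qed

lemma periodic_integral_reflect:
  assumes "cts f" "periodic f"
  shows "integral {0..2 * pi} (\<lambda>s. f (- s)) = integral {0..2 * pi} f"
proof -
  have "integral {0..2 * pi} (\<lambda>s. f (- s)) = integral {- (2 * pi)..0} f"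
    using Henstock_Kurzweil_Integration.integral_reflect_real[of "2*pi" 0 "\<lambda>s. f (- s)"] by simp
  also have "\<dots> = integral {- (2 * pi)..0} (f \<circ> (\<lambda>x. x + 2 * pi))"
    using assms(2) by (simp add: periodic_def o_def)
  also have "\<dots> = integral {- (2 * pi) + 2 * pi..0 + 2 * pi} f"
    by (rule integral_shift) (rule cts_on[OF assms(1)])
  finally show ?thesis by simp
qed

lemma periodic_extension:
  assumes F: "cts F" and eq: "F 0 = F (2 * pi)"
  obtains \<Psi> where "cts \<Psi>" "periodic \<Psi>" "\<And>t. 0 \<le> t \<Longrightarrow> t \<le> 2 * pi \<Longrightarrow> \<Psi> t = F t"
proof -
  define \<Psi> where "\<Psi> t = F (t - 2 * pi * (of_int \<lceil>t / (2 * pi)\<rceil> - 1))" for t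
  \<comment> \<open>\<open>H\<close> describes two consecutive periods, so that the seam 2 pi
    becomes an interior point; its continuity gives that of \<Psi> everywhere by
    translation.\<close>
  define H where "H u = (if u \<le> 2 * pi then F u else F (u - 2 * pi))" for u
  have per: "periodic \<Psi>"
    unfolding periodic_def
  proof
    fix t
    have "(t + 2 * pi) / (2 * pi) = t / (2 * pi) + 1" by (simp add: add_divide_distrib)
    then have "\<lceil>(t + 2 * pi) / (2 * pi)\<rceil> = \<lceil>t / (2 * pi)\<rceil> + 1" by simp
    then show "\<Psi> (t + 2 * pi) = \<Psi> t" unfolding \<Psi>_def by (simp add: algebra_simps)
  qed
  have in1: "\<Psi> u = F u" if "0 < u" "u \<le> 2 * pi" for u
  proof -
    have "0 < u / (2 * pi)" "u / (2 * pi) \<le> 1" using that by auto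
    then have "\<lceil>u / (2 * pi)\<rceil> = 1" by (simp add: ceiling_eq_iff)
    then show ?thesis by (simp add: \<Psi>_def)
  qed
  have in2: "\<Psi> u = H u" if "0 < u" "u < 4 * pi" for u
  proof (cases "u \<le> 2 * pi")
    case False
    then have "\<Psi> (u - 2 * pi) = F (u - 2 * pi)" using that by (intro in1) auto
    moreover have "\<Psi> (u - 2 * pi) = \<Psi> u" using per[unfolded periodic_def, rule_format, of "u - 2 * pi"] by simp
    ultimately show ?thesis using False by (simp add: H_def)
  qed (use in1 that in \<open>auto simp: H_def\<close>)
  \<comment> \<open>Without a case distinction the continuity of \<open>H\<close> is evident; the
    hypothesis F 0 = F (2 pi) makes both forms agree.\<close>
  have "H = (\<lambda>u. F (min u (2 * pi)) + (F (max u (2 * pi) - 2 * pi) - F 0))"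
    using eq by (auto simp: H_def fun_eq_iff min_def max_def)
  then have Hc: "cts H" by (auto intro!: continuous_intros cts_compose[OF F])
  have c: "cts \<Psi>"
    unfolding continuous_on_eq_continuous_at[OF open_UNIV]
  proof
    fix t
    obtain k :: int where k: "0 < t + 2 * pi * of_int k" "t + 2 * pi * of_int k \<le> 2 * pi" using shift_into_period by blast
    have "cts (\<lambda>s. H (s + 2 * pi * of_int k))" by (intro cts_compose[OF Hc] continuous_intros)
    then have "isCont (\<lambda>s. H (s + 2 * pi * of_int k)) t" by (simp add: continuous_on_eq_continuous_at)
    then show "isCont \<Psi> t"
    proof (rule isCont_locally[of _ _ "{- 2 * pi * of_int k<..<4 * pi - 2 * pi * of_int k}"])
      show "t \<in> {- 2 * pi * of_int k<..<4 * pi - 2 * pi * of_int k}" using k pi_gt_zero by (auto simp: algebra_simps)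
      fix s assume "s \<in> {- 2 * pi * of_int k<..<4 * pi - 2 * pi * of_int k}"
      then have "\<Psi> (s + 2 * pi * of_int k) = H (s + 2 * pi * of_int k)" by (intro in2) (auto simp: algebra_simps)
      then show "H (s + 2 * pi * of_int k) = \<Psi> s" using periodic_int[OF per, of s k] by simp
    qed auto
  qed
  have "\<Psi> t = F t" if "0 \<le> t" "t \<le> 2 * pi" for t
  proof (cases "t = 0")
    case True
    have "\<Psi> 0 = \<Psi> (2 * pi)" using per[unfolded periodic_def, rule_format, of 0] by simp
    then show ?thesis using True in1[of "2 * pi"] eq pi_gt_zero by simp
  qed (use in1 that in auto)
  then show ?thesis using that c per by blast
qed

section \<open>The trigonometric system\<close>

text \<open>Index 2 n gives cos (n s), beginning with the constant; index 2 n + 1 gives sin ((n + 1)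
  s). The zero function sin (0 s) has to be skipped, as no lower Riesz bound could hold with
  it.\<close>

definition bas :: "nat \<Rightarrow> real \<Rightarrow> real" where
  "bas j s = (if even j then cos (real (j div 2) * s) else sin (real (Suc (j div 2)) * s))"

lemma bas_cts: "cts (bas j)"
  unfolding bas_def[abs_def] by (cases "even j") (auto intro!: continuous_intros)

lemma bas_periodic: "periodic (bas j)"
proof -
  have "cos (real n * (t + 2 * pi)) = cos (real n * t)" "sin (real n * (t + 2 * pi)) = sin (real n * t)" for n t
    using cos.plus_of_nat[of "real n * t" n] sin.plus_of_nat[of "real n * t" n] by (simp_all add: algebra_simps)
  then show ?thesis unfolding periodic_def bas_def by (simp del: of_nat_Suc)
qed

lemma integral_cos_int: "integral {0..2 * pi} (\<lambda>s. cos (real_of_int k * s)) = (if k = 0 then 2 * pi else 0)"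
proof (cases "k = 0")
  case False
  have "((\<lambda>s. cos (real_of_int k * s)) has_integral (sin (real_of_int k * (2 * pi)) / k - sin (real_of_int k * 0) / k)) {0..2 * pi}"
    by (rule fundamental_theorem_of_calculus)
       (use False in \<open>auto intro!: derivative_eq_intros simp flip: has_real_derivative_iff_has_vector_derivative\<close>)
  moreover have "sin (real_of_int k * (2 * pi)) = 0" using sin_int_2pin[of k] by (simp add: mult_ac)
  ultimately show ?thesis using False by (auto dest: integral_unique)
qed simp

lemma integral_sin_int: "integral {0..2 * pi} (\<lambda>s. sin (real_of_int k * s)) = 0"
proof (cases "k = 0")
  case False
  have "((\<lambda>s. sin (real_of_int k * s)) has_integral (- cos (real_of_int k * (2 * pi)) / k - (- cos (real_of_int k * 0) / k))) {0..2 * pi}"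
    by (rule fundamental_theorem_of_calculus)
       (use False in \<open>auto intro!: derivative_eq_intros simp flip: has_real_derivative_iff_has_vector_derivative\<close>)
  moreover have "cos (real_of_int k * (2 * pi)) = 1" using cos_int_2pin[of k] by (simp add: mult_ac)
  ultimately show ?thesis using False by (auto dest: integral_unique)
qed simp

lemma int_cos_cts: "(\<lambda>s. cos (real_of_int k * s)) integrable_on {a..b}" "(\<lambda>s. sin (real_of_int k * s)) integrable_on {a..b}"
  by (intro cts_integrable continuous_intros)+

lemma integral_products:
  fixes m n :: int
  shows "integral {0..2 * pi} (\<lambda>s. cos (real_of_int m * s) * cos (real_of_int n * s)) = ((if m = n then 2 * pi else 0) + (if m + n = 0 then 2 * pi else 0)) / 2"
    "integral {0..2 * pi} (\<lambda>s. sin (real_of_int m * s) * sin (real_of_int n * s)) = ((if m = n then 2 * pi else 0) - (if m + n = 0 then 2 * pi else 0)) / 2"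
    "integral {0..2 * pi} (\<lambda>s. sin (real_of_int m * s) * cos (real_of_int n * s)) = 0"
proof -
  have "(\<lambda>s. cos (real_of_int m * s) * cos (real_of_int n * s)) = (\<lambda>s. (cos (real_of_int (m - n) * s) + cos (real_of_int (m + n) * s)) / 2)"
    by (auto simp: cos_times_cos algebra_simps)
  then show "integral {0..2 * pi} (\<lambda>s. cos (real_of_int m * s) * cos (real_of_int n * s)) = ((if m = n then 2 * pi else 0) + (if m + n = 0 then 2 * pi else 0)) / 2"
    using integral_cos_int[of "m - n"] integral_cos_int[of "m + n"] by (simp only: integral_divide integral_add int_cos_cts) simp
  have "(\<lambda>s. sin (real_of_int m * s) * sin (real_of_int n * s)) = (\<lambda>s. (cos (real_of_int (m - n) * s) - cos (real_of_int (m + n) * s)) / 2)"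
    by (auto simp: sin_times_sin algebra_simps)
  then show "integral {0..2 * pi} (\<lambda>s. sin (real_of_int m * s) * sin (real_of_int n * s)) = ((if m = n then 2 * pi else 0) - (if m + n = 0 then 2 * pi else 0)) / 2"
    using integral_cos_int[of "m - n"] integral_cos_int[of "m + n"] by (simp only: integral_divide integral_diff int_cos_cts) simp
  have "(\<lambda>s. sin (real_of_int m * s) * cos (real_of_int n * s)) = (\<lambda>s. (sin (real_of_int (m + n) * s) + sin (real_of_int (m - n) * s)) / 2)"
    by (simp add: sin_times_cos distrib_right left_diff_distrib)
  then show "integral {0..2 * pi} (\<lambda>s. sin (real_of_int m * s) * cos (real_of_int n * s)) = 0"
    using integral_sin_int[of "m - n"] integral_sin_int[of "m + n"] by (simp only: integral_divide integral_add int_cos_cts) simp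
qed

lemma bas_orthogonal: "integral {0..2 * pi} (\<lambda>s. bas i s * bas j s) = (if i = j then (if i = 0 then 2 * pi else pi) else 0)"
proof (cases "even i"; cases "even j")
  assume "even i" "even j"
  then obtain m n where "i = 2 * m" "j = 2 * n" by (auto elim!: evenE)
  then show ?thesis using integral_products(1)[of "int m" "int n"] by (auto simp: bas_def)
next
  assume "odd i" "odd j"
  then obtain m n where "i = 2 * m + 1" "j = 2 * n + 1" by (auto elim!: oddE)
  then show ?thesis using integral_products(2)[of "int (Suc m)" "int (Suc n)"] by (auto simp: bas_def)
next
  assume "odd i" "even j"
  then have "i \<noteq> j" by auto
  with \<open>odd i\<close> \<open>even j\<close>
  obtain m n where "i = 2 * m + 1" "j = 2 * n" "i \<noteq> j" by (auto elim!: evenE oddE)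
  then show ?thesis using integral_products(3)[of "int (Suc m)" "int n"] by (auto simp: bas_def)
next
  assume "even i" "odd j"
  then have "i \<noteq> j" by auto
  with \<open>even i\<close> \<open>odd j\<close>
  obtain m n where "i = 2 * m" "j = 2 * n + 1" "i \<noteq> j" by (auto elim!: evenE oddE)
  then show ?thesis using integral_products(3)[of "int (Suc n)" "int m"] by (auto simp: bas_def mult.commute)
qed

definition trig :: "nat \<Rightarrow> (nat \<Rightarrow> real) \<Rightarrow> real \<Rightarrow> real" where
  "trig N x s = (\<Sum>j<N. x j * bas j s)"

lemma trig_cts: "cts (trig N x)"
  unfolding trig_def[abs_def] by (intro continuous_intros bas_cts)

lemma trig_periodic: "periodic (trig N x)"
  using bas_periodic unfolding periodic_def trig_def by simp

lemma nrm2_trig: "nrm2 (2 * pi) (trig N x) = (\<Sum>j<N. (x j)\<^sup>2 * (if j = 0 then 2 * pi else pi))"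
proof -
  have i: "(\<lambda>s. x i * x j * (bas i s * bas j s)) integrable_on {0..2 * pi}" for i j
    by (intro cts_integrable continuous_intros bas_cts)
  have "(\<lambda>s. (trig N x s)\<^sup>2) = (\<lambda>s. \<Sum>i<N. \<Sum>j<N. x i * x j * (bas i s * bas j s))"
    unfolding trig_def by (auto simp: power2_eq_square sum_product mult_ac)
  then have "nrm2 (2 * pi) (trig N x) = (\<Sum>i<N. \<Sum>j<N. x i * x j * integral {0..2 * pi} (\<lambda>s. bas i s * bas j s))"
    unfolding nrm2_def by (simp add: integral_sum integrable_sum i)
  also have "\<dots> = (\<Sum>i<N. \<Sum>j<N. if j = i then (x i)\<^sup>2 * (if i = 0 then 2 * pi else pi) else 0)"
    by (intro sum.cong refl) (auto simp: bas_orthogonal power2_eq_square)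
  also have "\<dots> = (\<Sum>i<N. (x i)\<^sup>2 * (if i = 0 then 2 * pi else pi))"
    by (intro sum.cong refl) (simp add: sum.delta)
  finally show ?thesis .
qed

lemma nrm2_trig_bounds:
  "pi * (\<Sum>j<N. (x j)\<^sup>2) \<le> nrm2 (2 * pi) (trig N x)" "nrm2 (2 * pi) (trig N x) \<le> 2 * pi * (\<Sum>j<N. (x j)\<^sup>2)"
  unfolding nrm2_trig sum_distrib_left by (intro sum_mono; simp add: mult.commute)+

text \<open>Cauchy-Schwarz at each point s. The second factor is the squared Hilbert-Schmidt norm of
  the map from coefficients x to the sum of the \<open>x j * e j\<close>.\<close>

lemma nrm2_sum_le:
  assumes "\<And>j. cts (e j)"
  shows "nrm2 T (\<lambda>s. \<Sum>j\<in>S. x j * e j s) \<le> (\<Sum>j\<in>S. (x j)\<^sup>2) * (\<Sum>j\<in>S. nrm2 T (e j))"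
proof -
  have i: "(\<lambda>s. (\<Sum>j\<in>S. (x j)\<^sup>2) * (\<Sum>j\<in>S. (e j s)\<^sup>2)) integrable_on {0..T}"
    by (intro cts_integrable continuous_intros assms)
  have "nrm2 T (\<lambda>s. \<Sum>j\<in>S. x j * e j s) \<le> integral {0..T} (\<lambda>s. (\<Sum>j\<in>S. (x j)\<^sup>2) * (\<Sum>j\<in>S. (e j s)\<^sup>2))"
    unfolding nrm2_def
    by (rule integral_le[OF _ i]) (auto intro!: cts_integrable continuous_intros assms Cauchy_Schwarz_ineq_sum)
  also have "\<dots> = (\<Sum>j\<in>S. (x j)\<^sup>2) * integral {0..T} (\<lambda>s. \<Sum>j\<in>S. (e j s)\<^sup>2)" by simp
  also have "integral {0..T} (\<lambda>s. \<Sum>j\<in>S. (e j s)\<^sup>2) = (\<Sum>j\<in>S. nrm2 T (e j))"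
    unfolding nrm2_def
  proof (cases "finite S")
    case True then show "integral {0..T} (\<lambda>s. \<Sum>j\<in>S. (e j s)\<^sup>2) = (\<Sum>j\<in>S. integral {0..T} (\<lambda>s. (e j s)\<^sup>2))"
      by (intro integral_sum) (auto intro!: cts_integrable sq_cts assms)
  qed simp
  finally show ?thesis .
qed

text \<open>Tychonoff's theorem for a countable power of [-1,1], which is metrizable and therefore
  sequentially compact, in place of a diagonal argument.\<close>

lemma nat_bounded_subseq:
  fixes X :: "nat \<Rightarrow> nat \<Rightarrow> real"
  assumes "\<And>k j. \<bar>X k j\<bar> \<le> 1"
  shows "\<exists>\<sigma> x. strict_mono \<sigma> \<and> (\<forall>j. (\<lambda>k. X (\<sigma> k) j) \<longlonglongrightarrow> x j)"
proof -
  have "compactin (product_topology (\<lambda>_. euclidean) UNIV) (Pi\<^sub>E UNIV (\<lambda>_::nat. {-1..1::real}))"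
    by (subst compactin_PiE) auto
  then have "compact (Pi\<^sub>E UNIV (\<lambda>_::nat. {-1..1::real}))" by (simp add: euclidean_product_topology)
  then have sc: "seq_compact (Pi\<^sub>E UNIV (\<lambda>_::nat. {-1..1::real}))" by (rule compact_imp_seq_compact)
  have "\<forall>k. X k \<in> Pi\<^sub>E UNIV (\<lambda>_::nat. {-1..1::real})" using assms by (auto simp: abs_le_iff minus_le_iff)
  with sc obtain x \<sigma> where *: "strict_mono \<sigma>" "(X \<circ> \<sigma>) \<longlonglongrightarrow> x" unfolding seq_compact_def by blast
  have "(\<lambda>k. X (\<sigma> k) j) \<longlonglongrightarrow> x j" for j
  proof -
    have "continuous_on UNIV (\<lambda>f::nat \<Rightarrow> real. f j)" by (rule continuous_on_product_coordinates)
    then have "isCont (\<lambda>f::nat \<Rightarrow> real. f j) x"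
      using continuous_on_eq_continuous_at[OF open_UNIV, of "\<lambda>f::nat \<Rightarrow> real. f j"] by blast
    from isCont_tendsto_compose[OF this *(2)] show ?thesis by (simp add: o_def)
  qed
  then show ?thesis using *(1) by (intro exI[of _ \<sigma>] exI[of _ x]) simp
qed

section \<open>The operator from the trigonometric system to the moment functions\<close>

context conv_root
begin

text \<open>The even part annihilates sines and fixes cosines, so the convolution with r acts on
  cosines only: cosines go to B (W cos) and sines to W sin, which are the moment functions by
  \<open>Lop_even\<close> and \<open>Lop_odd\<close>.\<close>

definition Lop :: "(real \<Rightarrow> real) \<Rightarrow> real \<Rightarrow> real" where
  "Lop \<Phi> t = W \<Phi> t + (r \<star> W (par 1 \<Phi>)) t"

definition Eop :: "(real \<Rightarrow> real) \<Rightarrow> real \<Rightarrow> real" where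
  "Eop \<Phi> t = Lop \<Phi> t - exp (- (r0 * t)) * \<Phi> t"

lemma Lop_cts: "cts \<Phi> \<Longrightarrow> cts (Lop \<Phi>)"
  unfolding Lop_def[abs_def] by (intro continuous_intros W_cts conv_cts r_cts par_cts)

lemma Eop_cts: "cts \<Phi> \<Longrightarrow> cts (Eop \<Phi>)"
  unfolding Eop_def[abs_def] by (intro continuous_intros Lop_cts)

lemma par_add: "par \<sigma> (\<lambda>s. \<Phi> s + \<Psi> s) = (\<lambda>s. par \<sigma> \<Phi> s + par \<sigma> \<Psi> s)"
  by (auto simp: par_def algebra_simps add_divide_distrib)

lemma par_scale: "par \<sigma> (\<lambda>s. c * \<Phi> s) = (\<lambda>s. c * par \<sigma> \<Phi> s)"
  by (auto simp: par_def algebra_simps)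

lemma Lop_add: "cts \<Phi> \<Longrightarrow> cts \<Psi> \<Longrightarrow> Lop (\<lambda>s. \<Phi> s + \<Psi> s) = (\<lambda>t. Lop \<Phi> t + Lop \<Psi> t)"
  unfolding Lop_def[abs_def] by (auto simp: W_add par_add par_cts conv_add_right r_cts W_cts)

lemma Lop_scale: "cts \<Phi> \<Longrightarrow> Lop (\<lambda>s. c * \<Phi> s) = (\<lambda>t. c * Lop \<Phi> t)"
  unfolding Lop_def[abs_def] by (auto simp: W_scale par_scale par_cts conv_scale_right algebra_simps)

lemma Lop_diff: "cts \<Phi> \<Longrightarrow> cts \<Psi> \<Longrightarrow> Lop (\<lambda>s. \<Phi> s - \<Psi> s) = (\<lambda>t. Lop \<Phi> t - Lop \<Psi> t)"
  using Lop_add[of \<Phi> "\<lambda>s. (-1) * \<Psi> s"] Lop_scale[of \<Psi> "-1"] by (simp add: continuous_on_minus)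

lemma Lop_0: "Lop (\<lambda>s. 0) = (\<lambda>t. 0)"
  using Lop_scale[of "\<lambda>_. 0" 0] by simp

lemma Lop_trig: "Lop (trig N x) = (\<lambda>t. \<Sum>j<N. x j * Lop (bas j) t)"
proof (induction N)
  case 0 then show ?case using Lop_0 by (simp add: trig_def[abs_def])
next
  case (Suc N)
  have "trig (Suc N) x = (\<lambda>s. trig N x s + x N * bas N s)" by (auto simp: trig_def)
  then have "Lop (trig (Suc N) x) = (\<lambda>t. Lop (trig N x) t + x N * Lop (bas N) t)"
    using Lop_add[OF trig_cts[of N x], of "\<lambda>s. x N * bas N s"] Lop_scale[OF bas_cts[of N]] bas_cts[of N]
    by (simp add: continuous_on_mult_left)
  then show ?case using Suc by simp
qed

lemma Eop_diff: "cts \<Phi> \<Longrightarrow> cts \<Psi> \<Longrightarrow> Eop (\<lambda>s. \<Phi> s - \<Psi> s) t = Eop \<Phi> t - Eop \<Psi> t"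
  by (simp add: Eop_def Lop_diff algebra_simps)

lemma Eop_trig: "Eop (trig N x) t = (\<Sum>j<N. x j * Eop (bas j) t)"
  by (simp add: Eop_def Lop_trig trig_def sum_distrib_left sum_subtractf algebra_simps)

text \<open>By \<open>W_smoothing\<close>, \<Phi> and its even part enter only through L^1 norms on
  [0,T]. Periodicity bounds these by the L^1 norm over one period, with K the number of periods
  covering [0,T], and Cauchy-Schwarz by the L^2 norm.\<close>

theorem Eop_bound:
  assumes T: "0 \<le> T"
  shows "\<exists>C\<ge>0. \<forall>\<Phi> t. cts \<Phi> \<longrightarrow> periodic \<Phi> \<longrightarrow> 0 \<le> t \<longrightarrow> t \<le> T \<longrightarrow> \<bar>Eop \<Phi> t\<bar> \<le> C * sqrt (nrm2 (2 * pi) \<Phi>)"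
proof -
  obtain C1 where C1: "C1 \<ge> 0" and C1le: "\<forall>\<phi> t. cts \<phi> \<longrightarrow> 0 \<le> t \<longrightarrow> t \<le> T \<longrightarrow>
     \<bar>W \<phi> t - exp (- (r0 * t)) * \<phi> t\<bar> \<le> C1 * integral {0..t} (\<lambda>s. \<bar>\<phi> s\<bar>)"
    using W_smoothing[of T] by (elim exE conjE)
  obtain R where R: "R \<ge> 0" "\<forall>s. \<bar>s\<bar> \<le> T \<longrightarrow> \<bar>r s\<bar> \<le> R" using cts_bounded_on[OF r_cts] by blast
  obtain K where K: "T \<le> 2 * pi * real K"
    using real_arch_simple[of "T / (2 * pi)"] pi_gt_zero by (auto simp: field_simps)
  define E where "E = exp (\<bar>r0\<bar> * T)"
  define D where "D = C1 + R * (E + C1 * T)"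
  have D0: "D \<ge> 0" unfolding D_def E_def using C1 R T by (intro add_nonneg_nonneg mult_nonneg_nonneg) auto
  have "\<bar>Eop \<Phi> t\<bar> \<le> D * real K * sqrt (2 * pi) * sqrt (nrm2 (2 * pi) \<Phi>)"
    if \<Phi>: "cts \<Phi>" and per: "periodic \<Phi>" and t: "0 \<le> t" "t \<le> T" for \<Phi> t
  proof -
    let ?I = "integral {0..2 * pi} (\<lambda>s. \<bar>\<Phi> s\<bar>)"
    define \<Lambda> where "\<Lambda> = par 1 \<Phi>"
    have \<Lambda>: "cts \<Lambda>" unfolding \<Lambda>_def by (rule par_cts[OF \<Phi>])
    have ac: "cts (\<lambda>s. \<bar>\<Phi> s\<bar>)" by (intro continuous_intros \<Phi>)
    have ap: "periodic (\<lambda>s. \<bar>\<Phi> s\<bar>)" using per by (simp add: periodic_def)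
    have I0: "0 \<le> ?I" by (intro integral_nonneg cts_integrable ac) auto
    have 1: "integral {0..T} (\<lambda>s. \<bar>\<Phi> s\<bar>) \<le> real K * ?I" by (rule periodic_integral_le[OF ac ap _ K]) simp
    have acr: "cts (\<lambda>s. \<bar>\<Phi> (- s)\<bar>)" by (intro continuous_intros cts_compose[OF \<Phi>])
    have "integral {0..T} (\<lambda>s. \<bar>\<Phi> (- s)\<bar>) \<le> real K * integral {0..2 * pi} (\<lambda>s. \<bar>\<Phi> (- s)\<bar>)"
      by (rule periodic_integral_le[OF acr _ _ K]) (use periodic_reflect[OF ap] in auto)
    then have 2: "integral {0..T} (\<lambda>s. \<bar>\<Phi> (- s)\<bar>) \<le> real K * ?I" by (simp add: periodic_integral_reflect[OF ac ap])
    have "integral {0..T} (\<lambda>s. \<bar>\<Lambda> s\<bar>) \<le> integral {0..T} (\<lambda>s. (1/2) * \<bar>\<Phi> s\<bar> + (1/2) * \<bar>\<Phi> (- s)\<bar>)"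
    proof (rule integral_le)
      fix s show "\<bar>\<Lambda> s\<bar> \<le> (1/2) * \<bar>\<Phi> s\<bar> + (1/2) * \<bar>\<Phi> (- s)\<bar>"
        unfolding \<Lambda>_def par_def using abs_triangle_ineq[of "\<Phi> s" "\<Phi> (- s)"] by simp
    qed (intro cts_integrable continuous_intros \<Lambda> ac acr)+
    also have "\<dots> = (1/2) * integral {0..T} (\<lambda>s. \<bar>\<Phi> s\<bar>) + (1/2) * integral {0..T} (\<lambda>s. \<bar>\<Phi> (- s)\<bar>)"
      using cts_integrable[OF ac, of 0 T] cts_integrable[OF acr, of 0 T] by (subst integral_add) auto
    finally have 3: "integral {0..T} (\<lambda>s. \<bar>\<Lambda> s\<bar>) \<le> real K * ?I" using 1 2 by linarith
    have L0: "0 \<le> integral {0..T} (\<lambda>s. \<bar>\<Lambda> s\<bar>)" by (intro integral_nonneg cts_integrable continuous_intros \<Lambda>) auto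
    have "\<bar>W \<Phi> t - exp (- (r0 * t)) * \<Phi> t\<bar> \<le> C1 * integral {0..t} (\<lambda>s. \<bar>\<Phi> s\<bar>)" using C1le \<Phi> t by blast
    also have "\<dots> \<le> C1 * (real K * ?I)"
      using J_abs_mono[OF \<Phi> t] 1 C1 by (intro mult_left_mono) auto
    finally have 4: "\<bar>W \<Phi> t - exp (- (r0 * t)) * \<Phi> t\<bar> \<le> C1 * (real K * ?I)" .
    \<comment> \<open>The convolution with r integrates once more, so even the leading part E
      |\<Lambda>| of this bound ends up in an L^1 norm.\<close>
    have WL: "\<bar>W \<Lambda> s\<bar> \<le> E * \<bar>\<Lambda> s\<bar> + C1 * (real K * ?I)" if s: "0 \<le> s" "s \<le> T" for s
    proof -
      have "\<bar>W \<Lambda> s - exp (- (r0 * s)) * \<Lambda> s\<bar> \<le> C1 * integral {0..s} (\<lambda>s. \<bar>\<Lambda> s\<bar>)" using C1le \<Lambda> s by blast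
      also have "\<dots> \<le> C1 * (real K * ?I)" using J_abs_mono[OF \<Lambda> s] 3 C1 by (intro mult_left_mono) auto
      finally have a: "\<bar>W \<Lambda> s - exp (- (r0 * s)) * \<Lambda> s\<bar> \<le> C1 * (real K * ?I)" .
      have "(- r0) * s \<le> \<bar>r0\<bar> * T" using s by (intro mult_mono) auto
      then have "exp (- (r0 * s)) * \<bar>\<Lambda> s\<bar> \<le> E * \<bar>\<Lambda> s\<bar>" unfolding E_def by (intro mult_right_mono) auto
      then have b: "\<bar>exp (- (r0 * s)) * \<Lambda> s\<bar> \<le> E * \<bar>\<Lambda> s\<bar>" by (simp add: abs_mult)
      show ?thesis using a b by linarith
    qed
    have "\<bar>(r \<star> W \<Lambda>) t\<bar> \<le> R * integral {0..t} (\<lambda>s. \<bar>W \<Lambda> s\<bar>)"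
      by (rule conv_bound_cts[OF r_cts W_cts[OF \<Lambda>]]) (use R t in auto)
    also have "\<dots> \<le> R * integral {0..T} (\<lambda>s. \<bar>W \<Lambda> s\<bar>)"
      by (intro mult_left_mono J_abs_mono W_cts \<Lambda> t R)
    also have "integral {0..T} (\<lambda>s. \<bar>W \<Lambda> s\<bar>) \<le> integral {0..T} (\<lambda>s. E * \<bar>\<Lambda> s\<bar> + C1 * (real K * ?I))"
      by (rule integral_le) (use WL in \<open>auto intro!: cts_integrable continuous_intros W_cts \<Lambda>\<close>)
    also have "\<dots> = E * integral {0..T} (\<lambda>s. \<bar>\<Lambda> s\<bar>) + T * (C1 * (real K * ?I))"
      using T by (subst integral_add) (auto intro!: cts_integrable continuous_intros \<Lambda>)
    also have "\<dots> \<le> E * (real K * ?I) + T * (C1 * (real K * ?I))"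
      using 3 by (intro add_right_mono mult_left_mono) (auto simp: E_def)
    finally have 5: "\<bar>(r \<star> W \<Lambda>) t\<bar> \<le> R * (E * (real K * ?I) + T * (C1 * (real K * ?I)))"
      using R(1) by (simp add: mult_left_mono)
    have "\<bar>Eop \<Phi> t\<bar> \<le> C1 * (real K * ?I) + R * (E * (real K * ?I) + T * (C1 * (real K * ?I)))"
      using 4 5 unfolding Eop_def Lop_def \<Lambda>_def by linarith
    also have "\<dots> = D * real K * ?I" unfolding D_def by (simp add: algebra_simps)
    also have "\<dots> \<le> D * real K * sqrt (2 * pi * nrm2 (2 * pi) \<Phi>)"
      using D0 integral_abs_le_sqrt[OF \<Phi>, of "2 * pi"] by (intro mult_left_mono) auto
    finally show ?thesis by (simp add: real_sqrt_mult mult.assoc)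
  qed
  then show ?thesis using D0 by (intro exI[of _ "D * real K * sqrt (2 * pi)"]) auto
qed

text \<open>Evaluating \<open>Eop\<close> at t is a bounded functional on L^2 of a period, so its
  values on an orthogonal system of bounded norms are square summable. Integrated over t, this says
  that \<open>Eop\<close> is Hilbert-Schmidt.\<close>

lemma Eop_bas_square_sum:
  assumes T: "0 \<le> T"
  shows "\<exists>C\<ge>0. \<forall>N t. 0 \<le> t \<longrightarrow> t \<le> T \<longrightarrow> (\<Sum>j<N. (Eop (bas j) t)\<^sup>2) \<le> C"
proof -
  obtain C where C: "C \<ge> 0" and le: "\<forall>\<Phi> t. cts \<Phi> \<longrightarrow> periodic \<Phi> \<longrightarrow> 0 \<le> t \<longrightarrow> t \<le> T \<longrightarrow> \<bar>Eop \<Phi> t\<bar> \<le> C * sqrt (nrm2 (2 * pi) \<Phi>)"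
    using Eop_bound[OF T] by (elim exE conjE)
  have "(\<Sum>j<N. (Eop (bas j) t)\<^sup>2) \<le> C\<^sup>2 * (2 * pi)" if t: "0 \<le> t" "t \<le> T" for N t
  proof -
    \<comment> \<open>Testing the functional with its own coefficients gives S \<le> C sqrt (2 pi S)
      for their square sum S, that is S \<le> 2 pi C^2.\<close>
    let ?x = "\<lambda>j. Eop (bas j) t"
    let ?S = "\<Sum>j<N. (?x j)\<^sup>2"
    have S0: "?S \<ge> 0" by (intro sum_nonneg) auto
    have "?S = Eop (trig N ?x) t" by (simp add: Eop_trig power2_eq_square)
    then have "?S \<le> C * sqrt (nrm2 (2 * pi) (trig N ?x))"
      using le trig_cts[of N ?x] trig_periodic[of N ?x] t by (metis abs_le_iff)
    also have "\<dots> \<le> C * sqrt (2 * pi * ?S)"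
      using nrm2_trig_bounds(2)[of N ?x] C by (intro mult_left_mono real_sqrt_le_mono) auto
    finally have "?S\<^sup>2 \<le> (C * sqrt (2 * pi * ?S))\<^sup>2" using S0 by (intro power_mono) auto
    also have "\<dots> = C\<^sup>2 * (2 * pi) * ?S" using S0 by (simp add: power_mult_distrib)
    finally have "?S * ?S \<le> (C\<^sup>2 * (2 * pi)) * ?S" by (simp add: power2_eq_square)
    then show ?thesis using S0 by (cases "?S = 0") (auto simp: mult_le_cancel_right)
  qed
  then show ?thesis by (intro exI[of _ "C\<^sup>2 * (2 * pi)"]) auto
qed

end

section \<open>The lower Riesz bound\<close>

lemma tendsto_zeroI_le:
  fixes f g :: "nat \<Rightarrow> real"
  assumes "g \<longlonglongrightarrow> 0" "\<And>n. 0 \<le> f n" "\<And>n. f n \<le> g n"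
  shows "f \<longlonglongrightarrow> 0"
  by (rule tendsto_sandwich[OF _ _ tendsto_const[of 0] assms(1)]) (use assms(2,3) in auto)

lemma zero_of_le_null_sequence:
  fixes a :: real
  assumes "g \<longlonglongrightarrow> 0" "\<And>n. a \<le> g n"
  shows "a \<le> 0"
  by (rule LIMSEQ_le_const[OF assms(1)]) (use assms(2) in auto)

context conv_root
begin

text \<open>A Hilbert-Schmidt operator turns coordinatewise convergence of bounded coefficients into
  norm convergence: the coefficients of finitely many modes converge, and on the remaining modes the
  operator is small. Since \<open>Lop\<close> tends to 0 along the sequence, the Cauchy property of
  \<open>Eop\<close> passes to \<Phi> = exp (r0 t) (Lop \<Phi> - Eop \<Phi>).\<close>

lemma almost_kernel_cauchy:
  assumes T: "2 * pi \<le> T"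
    and sub: "\<And>j. (\<lambda>k. X k j) \<longlonglongrightarrow> x j"
    and supp: "\<And>k j. N k \<le> j \<Longrightarrow> X k j = 0"
    and one: "\<And>k. (\<Sum>j<N k. (X k j)\<^sup>2) = 1"
    and small: "(\<lambda>k. nrm2 T (Lop (trig (N k) (X k)))) \<longlonglongrightarrow> 0"
    and e: "0 < e"
  shows "\<exists>K. \<forall>k\<ge>K. \<forall>l\<ge>K. nrm2 (2 * pi) (\<lambda>s. trig (N k) (X k) s - trig (N l) (X l) s) < e"
proof -
  have T0: "0 \<le> T" using T pi_gt_zero by linarith
  obtain C where C: "C \<ge> 0" "\<forall>n t. 0 \<le> t \<longrightarrow> t \<le> T \<longrightarrow> (\<Sum>j<n. (Eop (bas j) t)\<^sup>2) \<le> C"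
    using Eop_bas_square_sum[OF T0] by (elim exE conjE)
  define d where "d j = nrm2 T (Eop (bas j))" for j
  have d0: "d j \<ge> 0" for j unfolding d_def by (rule nrm2_nonneg[OF Eop_cts[OF bas_cts]])
  have dsum: "(\<Sum>j<n. d j) \<le> T * C" for n
  proof -
    have "(\<Sum>j<n. d j) = integral {0..T} (\<lambda>t. \<Sum>j<n. (Eop (bas j) t)\<^sup>2)"
      unfolding d_def nrm2_def by (rule integral_sum[symmetric]) (auto intro!: cts_integrable sq_cts Eop_cts bas_cts)
    also have "\<dots> \<le> integral {0..T} (\<lambda>t. C)"
      by (rule integral_le) (use C in \<open>auto intro!: cts_integrable continuous_intros Eop_cts bas_cts\<close>)
    finally show ?thesis using T0 by simp
  qed
  have dsm: "summable d"
  proof (rule bounded_imp_summable[of d "T * C"])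
    fix n show "sum d {..n} \<le> T * C" using dsum[of "Suc n"] by (simp add: lessThan_Suc_atMost)
  qed (rule d0)
  define D where "D = T * C + 1"
  define E where "E = exp (\<bar>r0\<bar> * T)"
  have E0: "E > 0" by (simp add: E_def)
  have Dp: "D > 0" unfolding D_def using T0 C by (intro add_nonneg_pos mult_nonneg_nonneg) auto
  \<comment> \<open>For a difference \<Phi> of two members, low modes contribute at most \<delta>
    and high modes 4 \<delta> to the square norm of Eop \<Phi>, hence 10 \<delta> together; Lop
    \<Phi> has at most 4 \<delta>, so Lop \<Phi> - Eop \<Phi> has at most 28 \<delta>, which is
    finally multiplied by E^2.\<close>
  define \<delta> where "\<delta> = e / (100 * E\<^sup>2)"
  have \<delta>: "\<delta> > 0" using e E0 by (simp add: \<delta>_def)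
  obtain N0 where N0: "\<And>n. (\<Sum>j\<in>{N0..<n}. d j) < \<delta>"
  proof -
    from summable_Cauchy[of d] dsm \<delta> obtain N0 where "\<forall>m\<ge>N0. \<forall>n. norm (sum d {m..<n}) < \<delta>" by blast
    then have "sum d {N0..<n} < \<delta>" for n using abs_ge_self[of "sum d {N0..<n}"] by (metis le_refl le_less_trans real_norm_def)
    then show ?thesis using that by blast
  qed
  have Cauchy0: "\<exists>K. \<forall>k\<ge>K. \<forall>l\<ge>K. (\<Sum>j<N0. (X k j - X l j)\<^sup>2) < \<delta> / D"
  proof -
    have "(\<lambda>k. \<Sum>j<N0. (X k j - x j)\<^sup>2) \<longlonglongrightarrow> (\<Sum>j<N0. (x j - x j)\<^sup>2)" by (intro tendsto_intros sub)
    then have "(\<lambda>k. \<Sum>j<N0. (X k j - x j)\<^sup>2) \<longlonglongrightarrow> 0" by simp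
    from LIMSEQ_D[OF this, of "\<delta> / D / 4"] \<delta> Dp obtain K where K: "\<And>k. k \<ge> K \<Longrightarrow> (\<Sum>j<N0. (X k j - x j)\<^sup>2) < \<delta> / D / 4"
      by (auto simp: abs_of_nonneg sum_nonneg)
    have "(\<Sum>j<N0. (X k j - X l j)\<^sup>2) < \<delta> / D" if "k \<ge> K" "l \<ge> K" for k l
    proof -
      have "(\<Sum>j<N0. (X k j - X l j)\<^sup>2) \<le> (\<Sum>j<N0. 2 * (X k j - x j)\<^sup>2 + 2 * (X l j - x j)\<^sup>2)"
      proof (rule sum_mono)
        fix j show "(X k j - X l j)\<^sup>2 \<le> 2 * (X k j - x j)\<^sup>2 + 2 * (X l j - x j)\<^sup>2"
          using zero_le_power2[of "(X k j - x j) + (X l j - x j)"] by (simp add: power2_eq_square algebra_simps)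
      qed
      also have "\<dots> = 2 * (\<Sum>j<N0. (X k j - x j)\<^sup>2) + 2 * (\<Sum>j<N0. (X l j - x j)\<^sup>2)"
        by (simp add: sum.distrib sum_distrib_left)
      finally show ?thesis using K[OF that(1)] K[OF that(2)] by linarith
    qed
    then show ?thesis by blast
  qed
  then obtain K1 where K1: "\<And>k l. k \<ge> K1 \<Longrightarrow> l \<ge> K1 \<Longrightarrow> (\<Sum>j<N0. (X k j - X l j)\<^sup>2) < \<delta> / D" by blast
  obtain K2 where K2: "\<And>k. k \<ge> K2 \<Longrightarrow> nrm2 T (Lop (trig (N k) (X k))) < \<delta>"
    using LIMSEQ_D[OF small \<delta>] abs_ge_self by (metis diff_zero le_less_trans real_norm_def)
  have "nrm2 (2 * pi) (\<lambda>s. trig (N k) (X k) s - trig (N l) (X l) s) < e" if kl: "k \<ge> max K1 K2" "l \<ge> max K1 K2" for k l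
  proof -
    define n where "n = max N0 (max (N k) (N l))"
    have tr: "trig (N i) (X i) = trig n (X i)" if "N i \<le> n" for i
      unfolding trig_def fun_eq_iff
      by (intro allI sum.mono_neutral_left) (use that supp in auto)
    have trk: "trig (N k) (X k) = trig n (X k)" "trig (N l) (X l) = trig n (X l)" by (rule tr, simp add: n_def)+
    have onen: "(\<Sum>j<n. (X i j)\<^sup>2) = 1" if "N i \<le> n" for i
    proof -
      have "(\<Sum>j<N i. (X i j)\<^sup>2) = (\<Sum>j<n. (X i j)\<^sup>2)"
        by (rule sum.mono_neutral_left) (use that supp in auto)
      then show ?thesis using one by simp
    qed
    let ?y = "\<lambda>j. X k j - X l j"
    let ?\<Phi> = "\<lambda>s. trig (N k) (X k) s - trig (N l) (X l) s"
    have \<Phi>: "cts ?\<Phi>" by (intro continuous_intros trig_cts)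
    have y4: "(\<Sum>j<n. (?y j)\<^sup>2) \<le> 4"
    proof -
      have "(\<Sum>j<n. (?y j)\<^sup>2) \<le> (\<Sum>j<n. 2 * (X k j)\<^sup>2 + 2 * (X l j)\<^sup>2)"
      proof (rule sum_mono)
        fix j show "(X k j - X l j)\<^sup>2 \<le> 2 * (X k j)\<^sup>2 + 2 * (X l j)\<^sup>2"
          using zero_le_power2[of "X k j + X l j"] by (simp add: power2_eq_square algebra_simps)
      qed
      also have "\<dots> = 4" using onen[of k] onen[of l] by (simp add: sum.distrib sum_distrib_left[symmetric] n_def)
      finally show ?thesis .
    qed
    have phi: "?\<Phi> = trig n ?y" unfolding trk by (simp add: trig_def fun_eq_iff left_diff_distrib sum_subtractf)
    have eop: "Eop ?\<Phi> t = (\<Sum>j<N0. ?y j * Eop (bas j) t) + (\<Sum>j\<in>{N0..<n}. ?y j * Eop (bas j) t)" for t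
    proof -
      have u: "{..<n} = {..<N0} \<union> {N0..<n}" by (auto simp: n_def)
      show ?thesis unfolding phi Eop_trig u by (rule sum.union_disjoint) auto
    qed
    have c1: "cts (\<lambda>t. \<Sum>j\<in>S. ?y j * Eop (bas j) t)" for S by (intro continuous_intros Eop_cts bas_cts)
    have "nrm2 T (\<lambda>t. \<Sum>j<N0. ?y j * Eop (bas j) t) \<le> (\<Sum>j<N0. (?y j)\<^sup>2) * (\<Sum>j<N0. d j)"
      unfolding d_def by (rule nrm2_sum_le[OF Eop_cts[OF bas_cts]])
    also have "\<dots> \<le> (\<delta> / D) * D"
      using K1[of k l] kl dsum[of N0] \<delta> Dp by (intro mult_mono) (auto simp: D_def intro: sum_nonneg d0)
    finally have n1: "nrm2 T (\<lambda>t. \<Sum>j<N0. ?y j * Eop (bas j) t) \<le> \<delta>" using Dp by simp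
    have "nrm2 T (\<lambda>t. \<Sum>j\<in>{N0..<n}. ?y j * Eop (bas j) t) \<le> (\<Sum>j\<in>{N0..<n}. (?y j)\<^sup>2) * (\<Sum>j\<in>{N0..<n}. d j)"
      unfolding d_def by (rule nrm2_sum_le[OF Eop_cts[OF bas_cts]])
    also have "\<dots> \<le> 4 * \<delta>"
    proof (intro mult_mono)
      have "(\<Sum>j\<in>{N0..<n}. (?y j)\<^sup>2) \<le> (\<Sum>j<n. (?y j)\<^sup>2)" by (rule sum_mono2) auto
      then show "(\<Sum>j\<in>{N0..<n}. (?y j)\<^sup>2) \<le> 4" using y4 by simp
    qed (use N0[of n] in \<open>auto intro: sum_nonneg d0\<close>)
    finally have n2: "nrm2 T (\<lambda>t. \<Sum>j\<in>{N0..<n}. ?y j * Eop (bas j) t) \<le> 4 * \<delta>" .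
    have n3: "nrm2 T (Eop ?\<Phi>) \<le> 10 * \<delta>"
      using nrm2_add_le[OF c1[of "{..<N0}"] c1[of "{N0..<n}"], of T] n1 n2 unfolding eop[abs_def] by linarith
    have n4: "nrm2 T (Lop ?\<Phi>) \<le> 4 * \<delta>"
      using nrm2_diff_le[OF Lop_cts[OF trig_cts] Lop_cts[OF trig_cts], of T "N k" "X k" "N l" "X l"] K2[of k] K2[of l] kl
      unfolding Lop_diff[OF trig_cts trig_cts] by simp
    have le: "nrm2 T (\<lambda>t. Lop ?\<Phi> t - Eop ?\<Phi> t) \<le> 28 * \<delta>"
      using nrm2_diff_le[OF Lop_cts[OF \<Phi>] Eop_cts[OF \<Phi>], of T] n3 n4 by linarith
    have "nrm2 T ?\<Phi> \<le> nrm2 T (\<lambda>t. E * (Lop ?\<Phi> t - Eop ?\<Phi> t))"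
    proof (rule nrm2_mono[OF \<Phi>])
      show "cts (\<lambda>t. E * (Lop ?\<Phi> t - Eop ?\<Phi> t))" by (intro continuous_intros Lop_cts Eop_cts \<Phi>)
      fix s assume s: "0 \<le> s" "s \<le> T"
      have "r0 * s \<le> \<bar>r0\<bar> * T" using s by (intro mult_mono) auto
      then have "exp (r0 * s) \<le> E" by (simp add: E_def)
      have "\<bar>?\<Phi> s\<bar> = exp (r0 * s) * \<bar>Lop ?\<Phi> s - Eop ?\<Phi> s\<bar>"
        by (simp add: Eop_def abs_mult mult.assoc[symmetric] exp_add[symmetric])
      also have "\<dots> \<le> E * \<bar>Lop ?\<Phi> s - Eop ?\<Phi> s\<bar>" using \<open>exp (r0 * s) \<le> E\<close> by (intro mult_right_mono) auto
      finally show "\<bar>?\<Phi> s\<bar> \<le> \<bar>E * (Lop ?\<Phi> s - Eop ?\<Phi> s)\<bar>" using E0 by (simp add: abs_mult)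
    qed
    also have "\<dots> = E\<^sup>2 * nrm2 T (\<lambda>t. Lop ?\<Phi> t - Eop ?\<Phi> t)" by (rule nrm2_scale)
    also have "\<dots> \<le> E\<^sup>2 * (28 * \<delta>)" using le by (intro mult_left_mono) auto
    also have "\<dots> < e" using E0 e by (simp add: \<delta>_def field_simps)
    finally show ?thesis using nrm2_mono_T[OF \<Phi> _ T] by simp
  qed
  then show ?thesis by blast
qed

theorem Lop_lower_bound:
  assumes T: "2 * pi < T"
  shows "\<exists>c>0. \<forall>N x. c * (\<Sum>j<N. (x j)\<^sup>2) \<le> nrm2 T (Lop (trig N x))"
proof (rule ccontr)
  assume neg: "\<not> ?thesis"
  have T0: "0 < T" "2 * pi \<le> T" using T pi_gt_zero by linarith+
  have "\<exists>N X. (\<forall>j\<ge>N. X j = 0) \<and> (\<Sum>j<N. (X j)\<^sup>2) = 1 \<and> nrm2 T (Lop (trig N X)) \<le> 1 / real (Suc k)" for k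
  proof -
    have "1 / real (Suc k) > 0" by simp
    with neg obtain N x where Nx: "nrm2 T (Lop (trig N x)) < 1 / real (Suc k) * (\<Sum>j<N. (x j)\<^sup>2)"
      by (meson not_le)
    define q where "q = (\<Sum>j<N. (x j)\<^sup>2)"
    have "0 \<le> nrm2 T (Lop (trig N x))" by (rule nrm2_nonneg[OF Lop_cts[OF trig_cts]])
    then have q: "q > 0" using Nx unfolding q_def
      by (smt (verit, best) divide_nonneg_nonneg mult_nonneg_nonpos of_nat_0_le_iff sum_nonneg zero_le_power2)
    define X where "X j = (if j < N then x j / sqrt q else 0)" for j
    have "trig N X = (\<lambda>s. (1 / sqrt q) * trig N x s)" unfolding trig_def X_def by (auto simp: sum_distrib_left)
    then have "Lop (trig N X) = (\<lambda>t. (1 / sqrt q) * Lop (trig N x) t)" by (simp only: Lop_scale[OF trig_cts])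
    then have "nrm2 T (Lop (trig N X)) = (1 / q) * nrm2 T (Lop (trig N x))"
      using q by (simp only: nrm2_scale) (simp add: power_divide)
    also have "\<dots> \<le> (1 / q) * (1 / real (Suc k) * q)" using Nx q unfolding q_def by (intro mult_left_mono) auto
    also have "\<dots> = 1 / real (Suc k)" using q by simp
    finally have "nrm2 T (Lop (trig N X)) \<le> 1 / real (Suc k)" .
    moreover have "(\<Sum>j<N. (X j)\<^sup>2) = (\<Sum>j<N. (x j)\<^sup>2 / q)" using q by (intro sum.cong refl) (auto simp: X_def power_divide)
    then have "(\<Sum>j<N. (X j)\<^sup>2) = 1" using q by (simp add: sum_divide_distrib[symmetric] q_def[symmetric])
    ultimately show ?thesis by (intro exI[of _ N] exI[of _ X]) (auto simp: X_def)
  qed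
  then obtain N0 X0 where X0: "\<And>k j. N0 k \<le> j \<Longrightarrow> X0 k j = 0" "\<And>k. (\<Sum>j<N0 k. (X0 k j)\<^sup>2) = 1"
    "\<And>k. nrm2 T (Lop (trig (N0 k) (X0 k))) \<le> 1 / real (Suc k)" by metis
  have b1: "\<bar>X0 k j\<bar> \<le> 1" for k j
  proof (cases "j < N0 k")
    case True
    have "(X0 k j)\<^sup>2 \<le> (\<Sum>j<N0 k. (X0 k j)\<^sup>2)" by (rule member_le_sum) (use True in auto)
    then show ?thesis using X0(2)[of k] by (simp add: abs_square_le_1)
  qed (use X0(1) in auto)
  from nat_bounded_subseq[of X0, OF b1] obtain \<sigma> x
    where \<sigma>: "strict_mono \<sigma>" and conv: "\<forall>j. (\<lambda>k. X0 (\<sigma> k) j) \<longlonglongrightarrow> x j"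
    by (elim exE conjE)
  define N where "N k = N0 (\<sigma> k)" for k
  define X where "X k = X0 (\<sigma> k)" for k
  define \<Phi> where "\<Phi> k = trig (N k) (X k)" for k
  have \<Phi>: "cts (\<Phi> k)" "periodic (\<Phi> k)" for k unfolding \<Phi>_def by (rule trig_cts trig_periodic)+
  have small: "(\<lambda>k. nrm2 T (Lop (\<Phi> k))) \<longlonglongrightarrow> 0"
  proof (rule tendsto_zeroI_le)
    show "(\<lambda>k. 1 / real (Suc (\<sigma> k))) \<longlonglongrightarrow> 0"
      using LIMSEQ_subseq_LIMSEQ[OF LIMSEQ_Suc[OF lim_1_over_n] \<sigma>] by (simp add: o_def)
  qed (use X0(3) nrm2_nonneg[OF Lop_cts[OF \<Phi>(1)]] in \<open>auto simp: \<Phi>_def N_def X_def\<close>)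
  have cauchy: "\<exists>K. \<forall>k\<ge>K. \<forall>l\<ge>K. nrm2 (2 * pi) (\<lambda>s. \<Phi> k s - \<Phi> l s) < e" if "e > 0" for e
    unfolding \<Phi>_def
    by (rule almost_kernel_cauchy[OF T0(2) _ _ _ small[unfolded \<Phi>_def] that, where x=x])
       (use conv X0 in \<open>auto simp: N_def X_def\<close>)
  obtain C where C: "C \<ge> 0" and Cle: "\<forall>\<Phi> t. cts \<Phi> \<longrightarrow> periodic \<Phi> \<longrightarrow> 0 \<le> t \<longrightarrow> t \<le> T \<longrightarrow> \<bar>Eop \<Phi> t\<bar> \<le> C * sqrt (nrm2 (2 * pi) \<Phi>)"
    using Eop_bound[OF less_imp_le[OF T0(1)]] by (elim exE conjE)
  have dif: "cts (\<lambda>s. f s - g s)" "periodic (\<lambda>s. f s - g s)" if "cts f" "cts g" "periodic f" "periodic g" for f g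
    using that by (auto simp: periodic_def intro!: continuous_intros)
  \<comment> \<open>Time is clamped to [0,T], where \<open>Eop_bound\<close> applies, so that
    convergence is uniform on the whole line and the limit is continuous there.\<close>
  define h where "h k t = Eop (\<Phi> k) (min (max t 0) T)" for k t
  have hc: "cts (h k)" for k unfolding h_def[abs_def] by (intro cts_compose[OF Eop_cts[OF \<Phi>(1)]] continuous_intros)
  have hle: "\<bar>h k t - h l t\<bar> \<le> C * sqrt (nrm2 (2 * pi) (\<lambda>s. \<Phi> k s - \<Phi> l s))" for k l t
    using Cle[rule_format, of "\<lambda>s. \<Phi> k s - \<Phi> l s" "min (max t 0) T"] dif[OF \<Phi>(1) \<Phi>(1) \<Phi>(2) \<Phi>(2)] T0
    by (simp add: h_def Eop_diff[OF \<Phi>(1) \<Phi>(1)])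
  have "uniformly_Cauchy_on UNIV h"
    unfolding uniformly_Cauchy_on_def
  proof (intro allI impI)
    fix e :: real assume "e > 0"
    define e' where "e' = (e / (C + 1))\<^sup>2"
    have "e' > 0" using \<open>e > 0\<close> C by (simp add: e'_def)
    from cauchy[OF this] obtain K where K: "\<forall>k\<ge>K. \<forall>l\<ge>K. nrm2 (2 * pi) (\<lambda>s. \<Phi> k s - \<Phi> l s) < e'" by blast
    have "dist (h k t) (h l t) < e" if "k \<ge> K" "l \<ge> K" for k l t
    proof -
      have "sqrt (nrm2 (2 * pi) (\<lambda>s. \<Phi> k s - \<Phi> l s)) < e / (C + 1)"
        using K that \<open>e > 0\<close> C real_sqrt_less_mono[of _ e'] by (simp add: e'_def real_sqrt_unique)
      then have "C * sqrt (nrm2 (2 * pi) (\<lambda>s. \<Phi> k s - \<Phi> l s)) \<le> C * (e / (C + 1))"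
        using C by (intro mult_left_mono) auto
      also have "\<dots> < e" using \<open>e > 0\<close> C by (simp add: field_simps)
      finally show ?thesis using hle[of k t l] by (simp add: dist_real_def)
    qed
    then show "\<exists>M. \<forall>x\<in>UNIV. \<forall>m\<ge>M. \<forall>n\<ge>M. dist (h m x) (h n x) < e" by blast
  qed
  then obtain h\<^sub>0 where ul: "uniform_limit UNIV h h\<^sub>0 sequentially"
    using Cauchy_uniformly_convergent[of UNIV h] unfolding uniformly_convergent_on_def by blast
  have h0c: "cts h\<^sub>0" by (rule uniform_limit_theorem[OF _ ul]) (simp_all add: hc)
  have hlim: "(\<lambda>k. h k t) \<longlonglongrightarrow> h\<^sub>0 t" for t by (rule tendsto_uniform_limitI[OF ul]) simp
  have hnorm: "(\<lambda>k. nrm2 T (\<lambda>t. h k t - h\<^sub>0 t)) \<longlonglongrightarrow> 0"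
  proof (rule LIMSEQ_I)
    fix e :: real assume "e > 0"
    define e' where "e' = sqrt (e / (2 * T))"
    have e': "e' > 0" "T * e'\<^sup>2 = e / 2" using \<open>e > 0\<close> T0 by (simp_all add: e'_def)
    from uniform_limitD[OF ul e'(1)] obtain K where K: "\<forall>k\<ge>K. \<forall>t. dist (h k t) (h\<^sub>0 t) < e'"
      by (auto simp: eventually_sequentially)
    have "norm (nrm2 T (\<lambda>t. h k t - h\<^sub>0 t) - 0) < e" if "k \<ge> K" for k
    proof -
      have c: "cts (\<lambda>t. h k t - h\<^sub>0 t)" by (intro continuous_intros hc h0c)
      have "nrm2 T (\<lambda>t. h k t - h\<^sub>0 t) \<le> T * e'\<^sup>2"
        by (rule nrm2_le_bound[OF c]) (use T0 K that in \<open>auto simp: dist_real_def intro: less_imp_le\<close>)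
      then show ?thesis using e' \<open>e > 0\<close> nrm2_nonneg[OF c, of T] by simp
    qed
    then show "\<exists>no. \<forall>n\<ge>no. norm (nrm2 T (\<lambda>t. h n t - h\<^sub>0 t) - 0) < e" by blast
  qed
  \<comment> \<open>Lop (\<Phi> k) tends to 0 and Eop (\<Phi> k) to \<open>h\<^sub>0\<close>, so exp
    (- r0 t) \<Phi> k must tend to - \<open>h\<^sub>0\<close>; solved for \<Phi> k this is
    F.\<close>
  define F where "F t = - (exp (r0 * t) * h\<^sub>0 t)" for t
  have Fc: "cts F" unfolding F_def[abs_def] by (intro continuous_intros h0c)
  define E where "E = exp (\<bar>r0\<bar> * T)"
  have \<Phi>F: "(\<lambda>k. nrm2 T (\<lambda>t. \<Phi> k t - F t)) \<longlonglongrightarrow> 0"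
  proof (rule tendsto_zeroI_le)
    have "(\<lambda>k. E\<^sup>2 * (2 * nrm2 T (Lop (\<Phi> k)) + 2 * nrm2 T (\<lambda>t. h k t - h\<^sub>0 t))) \<longlonglongrightarrow> E\<^sup>2 * (2 * 0 + 2 * 0)"
      by (intro tendsto_intros small hnorm)
    then show "(\<lambda>k. E\<^sup>2 * (2 * nrm2 T (Lop (\<Phi> k)) + 2 * nrm2 T (\<lambda>t. h k t - h\<^sub>0 t))) \<longlonglongrightarrow> 0" by simp
    fix k
    have c: "cts (\<lambda>t. \<Phi> k t - F t)" by (intro continuous_intros \<Phi> Fc)
    show "0 \<le> nrm2 T (\<lambda>t. \<Phi> k t - F t)" by (rule nrm2_nonneg[OF c])
    have ch: "cts (\<lambda>t. h k t - h\<^sub>0 t)" by (intro continuous_intros hc h0c)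
    have "nrm2 T (\<lambda>t. \<Phi> k t - F t) \<le> nrm2 T (\<lambda>t. E * (Lop (\<Phi> k) t - (h k t - h\<^sub>0 t)))"
    proof (rule nrm2_mono[OF c])
      show "cts (\<lambda>t. E * (Lop (\<Phi> k) t - (h k t - h\<^sub>0 t)))" by (intro continuous_intros Lop_cts \<Phi> hc h0c)
      fix s assume s: "0 \<le> s" "s \<le> T"
      have "r0 * s \<le> \<bar>r0\<bar> * T" using s by (intro mult_mono) auto
      then have E: "exp (r0 * s) \<le> E" by (simp add: E_def)
      have "\<Phi> k s - F s = exp (r0 * s) * (Lop (\<Phi> k) s - (h k s - h\<^sub>0 s))"
        using s by (simp add: h_def F_def Eop_def algebra_simps exp_add[symmetric] mult.assoc[symmetric])
      then have "\<bar>\<Phi> k s - F s\<bar> = exp (r0 * s) * \<bar>Lop (\<Phi> k) s - (h k s - h\<^sub>0 s)\<bar>" by (simp add: abs_mult)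
      also have "\<dots> \<le> E * \<bar>Lop (\<Phi> k) s - (h k s - h\<^sub>0 s)\<bar>" using E by (intro mult_right_mono) auto
      finally show "\<bar>\<Phi> k s - F s\<bar> \<le> \<bar>E * (Lop (\<Phi> k) s - (h k s - h\<^sub>0 s))\<bar>" by (simp add: abs_mult E_def)
    qed
    also have "\<dots> \<le> E\<^sup>2 * (2 * nrm2 T (Lop (\<Phi> k)) + 2 * nrm2 T (\<lambda>t. h k t - h\<^sub>0 t))"
      unfolding nrm2_scale by (intro mult_left_mono nrm2_diff_le Lop_cts \<Phi> ch) auto
    finally show "nrm2 T (\<lambda>t. \<Phi> k t - F t) \<le> E\<^sup>2 * (2 * nrm2 T (Lop (\<Phi> k)) + 2 * nrm2 T (\<lambda>t. h k t - h\<^sub>0 t))" .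
  qed
  \<comment> \<open>The length of the overlap of [0,T] with its translate by 2 pi, positive since T
    > 2 pi. Periodicity of the \<Phi> k passes to F on this overlap; at its end point it says F 0 =
    F (2 pi), which is what a continuous periodic extension requires.\<close>
  define \<delta> where "\<delta> = T - 2 * pi"
  have \<delta>: "\<delta> > 0" "\<delta> \<le> T" using T pi_gt_zero unfolding \<delta>_def by linarith+
  have shiftF: "cts (\<lambda>t. F (t + 2 * pi))" by (intro cts_compose[OF Fc] continuous_intros)
  have dc: "cts (\<lambda>t. F (t + 2 * pi) - F t)" by (intro continuous_intros shiftF Fc)
  have "nrm2 \<delta> (\<lambda>t. F (t + 2 * pi) - F t) \<le> 0"
  proof (rule zero_of_le_null_sequence)
    show "(\<lambda>k. 4 * nrm2 T (\<lambda>t. \<Phi> k t - F t)) \<longlonglongrightarrow> 0" using tendsto_mult[OF tendsto_const[of 4] \<Phi>F] by simp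
    fix k
    have c: "cts (\<lambda>t. \<Phi> k t - F t)" by (intro continuous_intros \<Phi> Fc)
    have c': "cts (\<lambda>t. \<Phi> k (t + 2 * pi) - F (t + 2 * pi))" by (intro cts_compose[OF c] continuous_intros)
    have "nrm2 \<delta> (\<lambda>t. F (t + 2 * pi) - F t) = nrm2 \<delta> (\<lambda>t. (\<Phi> k t - F t) - (\<Phi> k (t + 2 * pi) - F (t + 2 * pi)))"
      using \<Phi>(2)[of k] by (simp add: periodic_def)
    also have "\<dots> \<le> 2 * nrm2 \<delta> (\<lambda>t. \<Phi> k t - F t) + 2 * nrm2 \<delta> (\<lambda>t. \<Phi> k (t + 2 * pi) - F (t + 2 * pi))"
      by (rule nrm2_diff_le[OF c c'])
    also have "nrm2 \<delta> (\<lambda>t. \<Phi> k t - F t) \<le> nrm2 T (\<lambda>t. \<Phi> k t - F t)" by (rule nrm2_mono_T[OF c]) (use \<delta> in auto)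
    also have "nrm2 \<delta> (\<lambda>t. \<Phi> k (t + 2 * pi) - F (t + 2 * pi)) \<le> nrm2 T (\<lambda>t. \<Phi> k t - F t)"
    proof -
      have "nrm2 \<delta> (\<lambda>t. \<Phi> k (t + 2 * pi) - F (t + 2 * pi)) = integral {0..\<delta>} ((\<lambda>t. (\<Phi> k t - F t)\<^sup>2) \<circ> (\<lambda>t. t + 2 * pi))"
        by (simp add: nrm2_def o_def)
      also have "\<dots> = integral {0 + 2 * pi..\<delta> + 2 * pi} (\<lambda>t. (\<Phi> k t - F t)\<^sup>2)"
        by (rule integral_shift) (rule cts_on[OF sq_cts[OF c]])
      also have "\<dots> \<le> nrm2 T (\<lambda>t. \<Phi> k t - F t)"
        unfolding nrm2_def by (rule integral_subset_le) (auto intro!: cts_integrable sq_cts c simp: \<delta>_def)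
      finally show ?thesis .
    qed
    finally show "nrm2 \<delta> (\<lambda>t. F (t + 2 * pi) - F t) \<le> 4 * nrm2 T (\<lambda>t. \<Phi> k t - F t)" by simp
  qed
  from nrm2_eq_0[OF dc this, of 0] \<delta> have "F 0 = F (2 * pi)" by simp
  from periodic_extension[OF Fc this] obtain \<Psi> where \<Psi>: "cts \<Psi>" "periodic \<Psi>" "\<And>t. 0 \<le> t \<Longrightarrow> t \<le> 2 * pi \<Longrightarrow> \<Psi> t = F t" by blast
  have \<Phi>\<Psi>: "(\<lambda>k. nrm2 (2 * pi) (\<lambda>t. \<Phi> k t - \<Psi> t)) \<longlonglongrightarrow> 0"
  proof (rule tendsto_zeroI_le[OF \<Phi>F])
    fix k
    have c: "cts (\<lambda>t. \<Phi> k t - F t)" "cts (\<lambda>t. \<Phi> k t - \<Psi> t)" by (intro continuous_intros \<Phi> Fc \<Psi>)+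
    show "0 \<le> nrm2 (2 * pi) (\<lambda>t. \<Phi> k t - \<Psi> t)" by (rule nrm2_nonneg[OF c(2)])
    have "nrm2 (2 * pi) (\<lambda>t. \<Phi> k t - \<Psi> t) = nrm2 (2 * pi) (\<lambda>t. \<Phi> k t - F t)"
      unfolding nrm2_def by (rule integral_cong) (use \<Psi>(3) in auto)
    also have "\<dots> \<le> nrm2 T (\<lambda>t. \<Phi> k t - F t)" by (rule nrm2_mono_T[OF c(1)]) (use T0 in auto)
    finally show "nrm2 (2 * pi) (\<lambda>t. \<Phi> k t - \<Psi> t) \<le> nrm2 T (\<lambda>t. \<Phi> k t - F t)" .
  qed
  obtain K where K: "T \<le> 2 * pi * real K"
    using real_arch_simple[of "T / (2 * pi)"] pi_gt_zero by (auto simp: field_simps)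
  \<comment> \<open>\<Psi> was matched with F on [0,2 pi] only. Both are limits of the same periodic
    functions, so they agree on the rest of [0,T] as well.\<close>
  have "nrm2 T (\<lambda>t. \<Psi> t - F t) \<le> 0"
  proof (rule zero_of_le_null_sequence)
    have "(\<lambda>k. 2 * nrm2 T (\<lambda>t. \<Phi> k t - F t) + 2 * (real K * nrm2 (2 * pi) (\<lambda>t. \<Phi> k t - \<Psi> t))) \<longlonglongrightarrow> 2 * 0 + 2 * (real K * 0)"
      by (intro tendsto_intros \<Phi>F \<Phi>\<Psi>)
    then show "(\<lambda>k. 2 * nrm2 T (\<lambda>t. \<Phi> k t - F t) + 2 * (real K * nrm2 (2 * pi) (\<lambda>t. \<Phi> k t - \<Psi> t))) \<longlonglongrightarrow> 0" by simp
    fix k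
    have c: "cts (\<lambda>t. \<Phi> k t - F t)" "cts (\<lambda>t. \<Phi> k t - \<Psi> t)" by (intro continuous_intros \<Phi> Fc \<Psi>)+
    have "nrm2 T (\<lambda>t. \<Psi> t - F t) \<le> 2 * nrm2 T (\<lambda>t. \<Phi> k t - F t) + 2 * nrm2 T (\<lambda>t. \<Phi> k t - \<Psi> t)"
      using nrm2_diff_le[OF c, of T] by simp
    also have "nrm2 T (\<lambda>t. \<Phi> k t - \<Psi> t) \<le> real K * nrm2 (2 * pi) (\<lambda>t. \<Phi> k t - \<Psi> t)"
      unfolding nrm2_def
      by (rule periodic_integral_le[OF sq_cts[OF c(2)] _ _ K]) (use \<Phi>(2)[of k] \<Psi>(2) in \<open>auto simp: periodic_def\<close>)
    finally show "nrm2 T (\<lambda>t. \<Psi> t - F t) \<le> 2 * nrm2 T (\<lambda>t. \<Phi> k t - F t) + 2 * (real K * nrm2 (2 * pi) (\<lambda>t. \<Phi> k t - \<Psi> t))" by simp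
  qed
  then have \<Psi>F: "\<Psi> t = F t" if "0 \<le> t" "t \<le> T" for t
    using nrm2_eq_0[of "\<lambda>t. \<Psi> t - F t" T t] that T0 \<Psi>(1) Fc by (simp add: continuous_on_diff)
  have "W \<Psi> t + (r \<star> W (par 1 \<Psi>)) t = 0" if t: "0 \<le> t" "t \<le> T" for t
  proof -
    \<comment> \<open>\<open>Eop\<close> is continuous from L^2 of a period to values at t, so Eop
      \<Psi> is the limit \<open>h\<^sub>0\<close>; the multiplication part of Lop \<Psi> is -
      \<open>h\<^sub>0\<close> by the choice of F, and the two cancel.\<close>
    have "(\<lambda>k. Eop (\<Phi> k) t - Eop \<Psi> t) \<longlonglongrightarrow> 0"
    proof (rule Lim_null_comparison[OF always_eventually])
      have "(\<lambda>k. C * sqrt (nrm2 (2 * pi) (\<lambda>t. \<Phi> k t - \<Psi> t))) \<longlonglongrightarrow> C * sqrt 0" by (intro tendsto_intros \<Phi>\<Psi>)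
      then show "(\<lambda>k. C * sqrt (nrm2 (2 * pi) (\<lambda>t. \<Phi> k t - \<Psi> t))) \<longlonglongrightarrow> 0" by simp
      show "\<forall>k. norm (Eop (\<Phi> k) t - Eop \<Psi> t) \<le> C * sqrt (nrm2 (2 * pi) (\<lambda>t. \<Phi> k t - \<Psi> t))"
        using Cle t dif[OF \<Phi>(1) \<Psi>(1) \<Phi>(2) \<Psi>(2)] by (auto simp: Eop_diff[OF \<Phi>(1) \<Psi>(1), symmetric])
    qed
    then have "(\<lambda>k. Eop (\<Phi> k) t) \<longlonglongrightarrow> Eop \<Psi> t" by (simp add: LIM_zero_iff)
    moreover have "(\<lambda>k. Eop (\<Phi> k) t) \<longlonglongrightarrow> h\<^sub>0 t" using hlim[of t] t by (simp add: h_def)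
    ultimately have "Eop \<Psi> t = h\<^sub>0 t" by (rule LIMSEQ_unique)
    moreover have "h\<^sub>0 t = - (exp (- (r0 * t)) * \<Psi> t)"
      by (simp add: \<Psi>F[OF t] F_def mult.assoc[symmetric] exp_add[symmetric])
    ultimately show ?thesis unfolding Eop_def Lop_def by simp
  qed
  then have "annih T 1 \<Psi>" using \<Psi> by (simp add: annih_def)
  then have "\<Psi> t = 0" for t by (rule annih_trivial[OF T])
  then have "(\<lambda>k. nrm2 (2 * pi) (\<Phi> k)) \<longlonglongrightarrow> 0" using \<Phi>\<Psi> by simp
  \<comment> \<open>The normalisation of the coefficients keeps the square norm at least pi, which
    excludes a vanishing limit.\<close>
  moreover have "pi \<le> nrm2 (2 * pi) (\<Phi> k)" for k
    using nrm2_trig_bounds(1)[where N="N k" and x="X k"] X0(2)[of "\<sigma> k"] by (simp add: \<Phi>_def N_def X_def)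
  ultimately have "pi \<le> 0" by (rule zero_of_le_null_sequence)
  then show False using pi_gt_zero by simp
qed

end

section \<open>Moment problems and completeness of square-integrable functions\<close>

text \<open>One Gram-Schmidt step per index: q is orthogonal to the first N vectors and has last
  coefficient 1, so the lower bound makes its square norm Q positive. A multiple of q then corrects
  the new moment without disturbing the earlier ones.\<close>

lemma gram_solve:
  fixes g :: "nat \<Rightarrow> nat \<Rightarrow> real"
  assumes sym: "\<And>i j. g i j = g j i" and c: "0 < c"
    and lb: "\<And>N x. c * (\<Sum>j<N. (x j)\<^sup>2) \<le> (\<Sum>i<N. \<Sum>j<N. x i * x j * g i j)"
  shows "\<exists>a. \<forall>i<N. (\<Sum>j<N. a j * g j i) = d i"
proof (induction N arbitrary: d)
  case (Suc N)
  from Suc[of "g N"] obtain b where b: "\<And>i. i < N \<Longrightarrow> (\<Sum>j<N. b j * g j i) = g N i" by blast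
  define q where "q j = (if j < N then - b j else 1)" for j
  have qo: "(\<Sum>j<Suc N. q j * g j i) = 0" if "i < N" for i
    using b[OF that] by (simp add: q_def sum_negf)
  define Q where "Q = (\<Sum>j<Suc N. q j * g j N)"
  have "(\<Sum>i<Suc N. \<Sum>j<Suc N. q i * q j * g i j) = (\<Sum>j<Suc N. q j * (\<Sum>i<Suc N. q i * g i j))"
    by (subst sum.swap) (simp only: sum_distrib_left mult_ac)
  also have "\<dots> = (\<Sum>j<N. q j * (\<Sum>i<Suc N. q i * g i j)) + q N * Q"
    by (simp only: sum.lessThan_Suc[of _ N] Q_def)
  also have "(\<Sum>j<N. q j * (\<Sum>i<Suc N. q i * g i j)) = 0"
    by (rule sum.neutral) (use qo in auto)
  finally have "(\<Sum>i<Suc N. \<Sum>j<Suc N. q i * q j * g i j) = Q" by (simp add: q_def)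
  moreover have "(1::real) \<le> (\<Sum>j<Suc N. (q j)\<^sup>2)" using sum_nonneg[of "{..<N}" "\<lambda>j. (q j)\<^sup>2"] by (simp add: q_def)
  ultimately have "c * 1 \<le> Q" using lb[of q "Suc N"] c by (meson mult_left_mono less_imp_le order_trans)
  then have Q: "Q > 0" using c by simp
  from Suc[of d] obtain a where a: "\<And>i. i < N \<Longrightarrow> (\<Sum>j<N. a j * g j i) = d i" by blast
  define \<tau> where "\<tau> = (d N - (\<Sum>j<N. a j * g j N)) / Q"
  define a' where "a' j = (if j < N then a j else 0) + \<tau> * q j" for j
  have "(\<Sum>j<Suc N. a' j * g j i) = d i" if "i < Suc N" for i
  proof -
    have "(\<Sum>j<Suc N. a' j * g j i) = (\<Sum>j<Suc N. (if j < N then a j else 0) * g j i) + \<tau> * (\<Sum>j<Suc N. q j * g j i)"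
      unfolding a'_def by (simp only: distrib_right sum.distrib sum_distrib_left mult.assoc)
    also have "(\<Sum>j<Suc N. (if j < N then a j else 0) * g j i) = (\<Sum>j<N. a j * g j i)" by simp
    finally have e: "(\<Sum>j<Suc N. a' j * g j i) = (\<Sum>j<N. a j * g j i) + \<tau> * (\<Sum>j<Suc N. q j * g j i)" .
    show ?thesis
    proof (cases "i < N")
      case True then show ?thesis unfolding e using a qo by simp
    next
      case False
      then have "i = N" using that by simp
      then have "(\<Sum>j<Suc N. a' j * g j i) = (\<Sum>j<N. a j * g j N) + \<tau> * Q" using e \<open>i = N\<close> by (simp only: Q_def)
      moreover have "\<tau> * Q = d N - (\<Sum>j<N. a j * g j N)" using Q by (simp add: \<tau>_def)
      ultimately show ?thesis unfolding \<open>i = N\<close> by linarith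
    qed
  qed
  then show ?case by blast
qed simp

text \<open>Minimal-norm solutions of the truncated moment problems form a Cauchy sequence: each solution is orthogonal
  to the increments that follow it.\<close>

lemma moment_approximation:
  fixes p :: "nat \<Rightarrow> real \<Rightarrow> real"
  assumes p: "\<And>j. cts (p j)" and c: "0 < c" and T: "0 \<le> T"
    and lb: "\<And>N x. c * (\<Sum>j<N. (x j)\<^sup>2) \<le> nrm2 T (\<lambda>s. \<Sum>j<N. x j * p j s)"
    and d: "\<And>N. (\<Sum>j<N. (d j)\<^sup>2) \<le> D"
  shows "\<exists>G. (\<forall>N. cts (G N)) \<and> (\<forall>N j. j < N \<longrightarrow> integral {0..T} (\<lambda>s. G N s * p j s) = d j) \<and>
    (\<forall>e>0. \<exists>K. \<forall>m\<ge>K. \<forall>n\<ge>K. nrm2 T (\<lambda>s. G m s - G n s) < e)"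
proof -
  define g where "g i j = integral {0..T} (\<lambda>s. p i s * p j s)" for i j
  have pi: "(\<lambda>s. x * (p i s * p j s)) integrable_on {0..T}" for x i j by (intro cts_integrable continuous_intros p)
  have dbl: "integral {0..T} (\<lambda>s. (\<Sum>i<N. x i * p i s) * (\<Sum>j<M. y j * p j s)) = (\<Sum>i<N. \<Sum>j<M. x i * y j * g i j)" for N M x y
  proof -
    have "(\<lambda>s. (\<Sum>i<N. x i * p i s) * (\<Sum>j<M. y j * p j s)) = (\<lambda>s. \<Sum>i<N. \<Sum>j<M. (x i * y j) * (p i s * p j s))"
      by (auto simp: sum_product mult_ac)
    then show ?thesis by (simp add: integral_sum integrable_sum pi g_def)
  qed
  have nrmg: "nrm2 T (\<lambda>s. \<Sum>j<N. x j * p j s) = (\<Sum>i<N. \<Sum>j<N. x i * x j * g i j)" for N x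
    unfolding nrm2_def power2_eq_square by (rule dbl)
  have sym: "g i j = g j i" for i j unfolding g_def by (simp add: mult.commute)
  have "\<exists>a. \<forall>i<N. (\<Sum>j<N. a j * g j i) = d i" for N
    by (rule gram_solve[OF sym c]) (use lb in \<open>simp add: nrmg\<close>)
  then obtain a where a: "\<And>N i. i < N \<Longrightarrow> (\<Sum>j<N. a N j * g j i) = d i" by metis
  define G where "G N s = (\<Sum>j<N. a N j * p j s)" for N s
  have Gc: "cts (G N)" for N unfolding G_def[abs_def] by (intro continuous_intros p)
  have Gp: "integral {0..T} (\<lambda>s. G N s * p i s) = (\<Sum>j<N. a N j * g j i)" for N i
  proof -
    have "(\<lambda>s. G N s * p i s) = (\<lambda>s. \<Sum>j<N. a N j * (p j s * p i s))" by (simp add: G_def sum_distrib_right mult.assoc)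
    then show ?thesis by (simp add: integral_sum pi g_def)
  qed
  \<comment> \<open>The moments of G M with index below N are prescribed, so this inner product does
    not depend on M.\<close>
  have GG: "integral {0..T} (\<lambda>s. G M s * G N s) = (\<Sum>i<N. a N i * d i)" if "N \<le> M" for M N
  proof -
    have "integral {0..T} (\<lambda>s. G M s * G N s) = (\<Sum>i<M. \<Sum>j<N. a M i * a N j * g i j)" unfolding G_def by (rule dbl)
    also have "\<dots> = (\<Sum>j<N. a N j * (\<Sum>i<M. a M i * g i j))" by (subst sum.swap) (simp add: sum_distrib_left mult_ac)
    also have "\<dots> = (\<Sum>j<N. a N j * d j)" by (intro sum.cong refl) (use a that in auto)
    finally show ?thesis .
  qed
  define s where "s N = (\<Sum>i<N. a N i * d i)" for N
  have sn: "nrm2 T (G N) = s N" for N using GG[of N N] by (simp add: nrm2_def power2_eq_square s_def)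
  have s0: "s N \<ge> 0" for N using nrm2_nonneg[OF Gc, of T N] by (simp add: sn)
  have dif: "nrm2 T (\<lambda>t. G M t - G N t) = s M - s N" if "N \<le> M" for M N
  proof -
    have "((\<lambda>t. (G M t)\<^sup>2 - 2 * (G M t * G N t) + (G N t)\<^sup>2) has_integral (nrm2 T (G M) - 2 * integral {0..T} (\<lambda>t. G M t * G N t) + nrm2 T (G N))) {0..T}"
      unfolding nrm2_def
      by (intro has_integral_add has_integral_diff has_integral_mult_right integrable_integral cts_integrable continuous_intros Gc)
    moreover have "(\<lambda>t. (G M t)\<^sup>2 - 2 * (G M t * G N t) + (G N t)\<^sup>2) = (\<lambda>t. (G M t - G N t)\<^sup>2)"
      by (auto simp: power2_eq_square algebra_simps)
    ultimately show ?thesis unfolding nrm2_def[of T "\<lambda>t. G M t - G N t"] by (simp add: integral_unique GG[OF that] sn s_def)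
  qed
  \<comment> \<open>With A the square sum of the coefficients, c A \<le> s and s^2 \<le> A D;
    eliminating A gives s \<le> D / c.\<close>
  have sb: "s N \<le> D / c" for N
  proof -
    let ?A = "\<Sum>i<N. (a N i)\<^sup>2"
    have "c * ?A \<le> s N" using lb[of "a N" N] sn[of N] by (simp add: G_def[abs_def])
    have "(s N)\<^sup>2 \<le> ?A * (\<Sum>i<N. (d i)\<^sup>2)" unfolding s_def by (rule Cauchy_Schwarz_ineq_sum)
    also have "\<dots> \<le> ?A * D" by (intro mult_left_mono d sum_nonneg) auto
    finally have "c * (s N)\<^sup>2 \<le> c * (?A * D)" using c by simp
    also have "\<dots> \<le> s N * D"
    proof -
      have "D \<ge> 0" using d[of 0] by simp
      then show ?thesis using mult_right_mono[OF \<open>c * ?A \<le> s N\<close>, of D] by (simp add: mult_ac)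
    qed
    finally have le: "s N * (c * s N) \<le> s N * D" by (simp add: power2_eq_square mult_ac)
    show ?thesis
    proof (cases "s N = 0")
      case True then show ?thesis using d[of 0] c by simp
    next
      case False
      then have "c * s N \<le> D" using le s0[of N] by (simp add: mult_le_cancel_left)
      then show ?thesis using c by (simp add: field_simps)
    qed
  qed
  have inc: "incseq s"
  proof (rule incseq_SucI)
    fix n
    have "0 \<le> nrm2 T (\<lambda>t. G (Suc n) t - G n t)" by (intro nrm2_nonneg continuous_intros Gc)
    then show "s n \<le> s (Suc n)" using dif[of n "Suc n"] by simp
  qed
  obtain L where L: "s \<longlonglongrightarrow> L" using incseq_convergent[OF inc] sb by metis
  then have "Cauchy s" by (rule LIMSEQ_imp_Cauchy)
  have "\<exists>K. \<forall>m\<ge>K. \<forall>n\<ge>K. nrm2 T (\<lambda>t. G m t - G n t) < e" if "e > 0" for e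
  proof -
    from \<open>Cauchy s\<close> that obtain K where K: "\<And>m n. m \<ge> K \<Longrightarrow> n \<ge> K \<Longrightarrow> dist (s m) (s n) < e" unfolding Cauchy_def by blast
    have "nrm2 T (\<lambda>t. G m t - G n t) < e" if "m \<ge> K" "n \<ge> K" for m n
    proof (cases "n \<le> m")
      case True then show ?thesis using dif[OF True] K[OF that] by (simp add: dist_real_def)
    next
      case False
      then have "n \<ge> m" by simp
      have "nrm2 T (\<lambda>t. G m t - G n t) = nrm2 T (\<lambda>t. G n t - G m t)" by (simp add: nrm2_def power2_commute)
      then show ?thesis using dif[OF \<open>n \<ge> m\<close>] K[OF that] by (simp add: dist_real_def)
    qed
    then show ?thesis by blast
  qed
  then show ?thesis using Gc Gp a by (intro exI[of _ G]) auto
qed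

text \<open>A rapidly convergent subsequence converges almost everywhere, and Fatou's lemma turns
  this into convergence of the full sequence in square mean.\<close>

lemma L2_limit:
  fixes u :: "nat \<Rightarrow> real \<Rightarrow> real"
  assumes u: "\<And>n. cts (u n)" and T: "0 \<le> T"
    and cau: "\<And>e. 0 < e \<Longrightarrow> \<exists>K. \<forall>m\<ge>K. \<forall>n\<ge>K. nrm2 T (\<lambda>s. u m s - u n s) < e"
  obtains g where "g \<in> borel_measurable borel" "\<And>x. x \<notin> {0..T} \<Longrightarrow> g x = 0" "integrable lborel (\<lambda>x. (g x)\<^sup>2)"
    "\<And>n. integrable lborel (\<lambda>x. indicator {0..T} x * (u n x - g x)\<^sup>2)"
    "(\<lambda>n. LBINT x. indicator {0..T} x * (u n x - g x)\<^sup>2) \<longlonglongrightarrow> 0"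
proof -
  define v where "v n x = indicator {0..T} x * u n x" for n x
  have [measurable]: "u n \<in> borel_measurable borel" for n by (rule cts_measurable[OF u])
  have [measurable]: "v n \<in> borel_measurable borel" for n unfolding v_def[abs_def] by measurable
  have nn: "(\<integral>\<^sup>+x. ennreal ((v m x - v n x)\<^sup>2) \<partial>lborel) = ennreal (nrm2 T (\<lambda>s. u m s - u n s))" for m n
  proof -
    have c: "cts (\<lambda>s. (u m s - u n s)\<^sup>2)" by (intro continuous_intros u)
    have "set_integrable lborel {0..T} (\<lambda>s. (u m s - u n s)\<^sup>2)"
      by (rule borel_integrable_atLeastAtMost'[OF cts_on[OF c]])
    from set_borel_integral_eq_integral(2)[OF this]
    have "nrm2 T (\<lambda>s. u m s - u n s) = (LBINT x. indicator {0..T} x * (u m x - u n x)\<^sup>2)"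
      by (simp add: nrm2_def set_lebesgue_integral_def)
    also have "\<dots> = (LBINT x. (v m x - v n x)\<^sup>2)"
      by (intro Bochner_Integration.integral_cong refl) (auto simp: v_def indicator_def)
    finally have e: "nrm2 T (\<lambda>s. u m s - u n s) = (LBINT x. (v m x - v n x)\<^sup>2)" .
    have "integrable lborel (\<lambda>x. indicator {0..T} x *\<^sub>R (u m x - u n x)\<^sup>2)"
      using borel_integrable_atLeastAtMost'[OF cts_on[OF c], of 0 T] by (simp add: set_integrable_def)
    also have "(\<lambda>x. indicator {0..T} x *\<^sub>R (u m x - u n x)\<^sup>2) = (\<lambda>x. (v m x - v n x)\<^sup>2)"
      by (auto simp: v_def indicator_def)
    finally have "integrable lborel (\<lambda>x. (v m x - v n x)\<^sup>2)" .
    from nn_integral_eq_integral[OF this] show ?thesis by (simp add: e)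
  qed
  \<comment> \<open>The rate (1/4)^k for square norms is matched to the pointwise estimate |w| \<le>
    2^(-k) + 2^k w^2 on [0,T]: after integration both terms are of order 2^(-k), hence
    summable.\<close>
  have "\<exists>K. \<forall>m\<ge>K. \<forall>n\<ge>K. nrm2 T (\<lambda>s. u m s - u n s) < (1/4) ^ k" for k by (rule cau) simp
  then obtain \<kappa> where \<kappa>: "\<And>k m n. m \<ge> \<kappa> k \<Longrightarrow> n \<ge> \<kappa> k \<Longrightarrow> nrm2 T (\<lambda>s. u m s - u n s) < (1/4) ^ k" by metis
  \<comment> \<open>Partial sums make the selected indices monotone and keep the n-th one above
    \<open>\<kappa> k\<close> for every k \<le> n.\<close>
  define \<phi> where "\<phi> k = (\<Sum>i\<le>k. \<kappa> i)" for k
  have \<phi>ge: "\<kappa> k \<le> \<phi> k" "\<phi> k \<le> \<phi> (Suc k)" for k by (auto simp: \<phi>_def intro!: member_le_sum)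
  have \<phi>k: "\<kappa> k \<le> \<phi> n" if "k \<le> n" for k n unfolding \<phi>_def by (rule member_le_sum) (use that in auto)
  define w where "w k x = v (\<phi> (Suc k)) x - v (\<phi> k) x" for k x
  have [measurable]: "w k \<in> borel_measurable borel" for k unfolding w_def[abs_def] by measurable
  have wle: "(\<integral>\<^sup>+x. ennreal \<bar>w k x\<bar> \<partial>lborel) \<le> ennreal ((T + 1) * (1/2) ^ k)" for k
  proof -
    have "(\<integral>\<^sup>+x. ennreal \<bar>w k x\<bar> \<partial>lborel) \<le> (\<integral>\<^sup>+x. ennreal ((1/2) ^ k * indicator {0..T} x) + ennreal (2 ^ k * (w k x)\<^sup>2) \<partial>lborel)"
    proof (rule nn_integral_mono)
      fix x :: real
      have "\<bar>w k x\<bar> \<le> (1/2) ^ k * indicator {0..T} x + 2 ^ k * (w k x)\<^sup>2"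
      proof (cases "x \<in> {0..T}")
        case True
        define b where "b = (2::real) ^ k"
        have b: "b > 0" "(1/2) ^ k = 1 / b" by (simp_all add: b_def power_one_over)
        have "0 \<le> b * (1 / b - \<bar>w k x\<bar>)\<^sup>2" using b by simp
        also have "\<dots> = 1 / b - 2 * \<bar>w k x\<bar> + b * (w k x)\<^sup>2"
          using b(1) by (simp add: power2_eq_square field_simps)
        finally have "2 * \<bar>w k x\<bar> \<le> (1/2) ^ k + 2 ^ k * (w k x)\<^sup>2" by (simp only: b(2) b_def[symmetric])
        then show ?thesis using True by simp
      next
        case False then show ?thesis by (simp add: w_def v_def)
      qed
      then have "ennreal \<bar>w k x\<bar> \<le> ennreal ((1/2) ^ k * indicator {0..T} x + 2 ^ k * (w k x)\<^sup>2)" by (rule ennreal_leI)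
      also have "\<dots> = ennreal ((1/2) ^ k * indicator {0..T} x) + ennreal (2 ^ k * (w k x)\<^sup>2)" by (rule ennreal_plus) auto
      finally show "ennreal \<bar>w k x\<bar> \<le> ennreal ((1/2) ^ k * indicator {0..T} x) + ennreal (2 ^ k * (w k x)\<^sup>2)" .
    qed
    also have "\<dots> = (\<integral>\<^sup>+x. ennreal ((1/2) ^ k) * indicator {0..T} x \<partial>lborel) + (\<integral>\<^sup>+x. ennreal (2 ^ k) * ennreal ((w k x)\<^sup>2) \<partial>lborel)"
      by (subst nn_integral_add) (auto simp: ennreal_mult ennreal_indicator)
    also have "\<dots> = ennreal ((1/2) ^ k) * ennreal T + ennreal (2 ^ k) * ennreal (nrm2 T (\<lambda>s. u (\<phi> (Suc k)) s - u (\<phi> k) s))"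
      using T by (simp add: nn_integral_cmult w_def nn)
    also have "\<dots> \<le> ennreal ((1/2) ^ k) * ennreal T + ennreal (2 ^ k) * ennreal ((1/4) ^ k)"
      using \<kappa>[of k "\<phi> (Suc k)" "\<phi> k"] \<phi>k[of k k] \<phi>k[of k "Suc k"] by (intro add_left_mono mult_left_mono ennreal_leI) auto
    also have "\<dots> = ennreal ((T + 1) * (1/2) ^ k)"
    proof -
      have "(2::real) ^ k * (1/4) ^ k = (1/2) ^ k" by (simp add: power_mult_distrib[symmetric])
      then show ?thesis using T by (simp add: ennreal_mult[symmetric] ennreal_plus[symmetric] algebra_simps del: ennreal_plus)
    qed
    finally show ?thesis .
  qed
  have "(\<integral>\<^sup>+x. (\<Sum>k. ennreal \<bar>w k x\<bar>) \<partial>lborel) = (\<Sum>k. \<integral>\<^sup>+x. ennreal \<bar>w k x\<bar> \<partial>lborel)"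
    by (rule nn_integral_suminf) measurable
  also have "\<dots> \<le> (\<Sum>k. ennreal ((T + 1) * (1/2) ^ k))" by (intro suminf_le wle) auto
  also have "\<dots> < top"
  proof -
    have "summable (\<lambda>k. (T + 1) * (1/2) ^ k :: real)" by (intro summable_mult summable_geometric) simp
    then have "(\<Sum>k. ennreal ((T + 1) * (1/2) ^ k)) = ennreal (\<Sum>k. (T + 1) * (1/2) ^ k)"
      using T by (intro suminf_ennreal2) auto
    then show ?thesis by simp
  qed
  finally have "AE x in lborel. (\<Sum>k. ennreal \<bar>w k x\<bar>) \<noteq> \<infinity>"
    by (intro nn_integral_PInf_AE) auto
  then have ae: "AE x in lborel. convergent (\<lambda>k. v (\<phi> k) x)"
  proof eventually_elim
    fix x assume "(\<Sum>k. ennreal \<bar>w k x\<bar>) \<noteq> \<infinity>"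
    then have "summable (\<lambda>k. \<bar>w k x\<bar>)" by (intro summable_suminf_not_top) auto
    then have "summable (\<lambda>k. w k x)" by (rule summable_rabs_cancel)
    then have "convergent (\<lambda>n. \<Sum>k<n. w k x)" by (simp add: summable_iff_convergent)
    moreover have "(\<Sum>k<n. w k x) = v (\<phi> n) x - v (\<phi> 0) x" for n
      unfolding w_def by (rule sum_lessThan_telescope)
    ultimately have "convergent (\<lambda>n. v (\<phi> n) x - v (\<phi> 0) x)" by simp
    then show "convergent (\<lambda>k. v (\<phi> k) x)" using convergent_add[OF _ convergent_const[of "v (\<phi> 0) x"]] by fastforce
  qed
  \<comment> \<open>Where the subsequence diverges \<open>lim\<close> is unspecified, but only on a
    null set; outside [0,T] the sequence is constantly 0.\<close>
  define g where "g x = lim (\<lambda>k. v (\<phi> k) x)" for x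
  have gm [measurable]: "g \<in> borel_measurable borel" unfolding g_def[abs_def] by measurable
  have aelim: "AE x in lborel. (\<lambda>k. v (\<phi> k) x) \<longlonglongrightarrow> g x"
    using ae by eventually_elim (simp add: g_def convergent_LIMSEQ_iff)
  have g0: "g x = 0" if "x \<notin> {0..T}" for x using that by (simp add: g_def v_def lim_const)
  have fatou: "(\<integral>\<^sup>+x. ennreal ((v n x - g x)\<^sup>2) \<partial>lborel) \<le> ennreal ((1/4) ^ k)" if "\<kappa> k \<le> n" for n k
  proof -
    have "(\<integral>\<^sup>+x. ennreal ((v n x - g x)\<^sup>2) \<partial>lborel) \<le> (\<integral>\<^sup>+x. liminf (\<lambda>i. ennreal ((v n x - v (\<phi> i) x)\<^sup>2)) \<partial>lborel)"
      using aelim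
    proof (intro nn_integral_mono_AE, eventually_elim)
      fix x assume "(\<lambda>k. v (\<phi> k) x) \<longlonglongrightarrow> g x"
      then have l: "(\<lambda>i. ennreal ((v n x - v (\<phi> i) x)\<^sup>2)) \<longlonglongrightarrow> ennreal ((v n x - g x)\<^sup>2)" by (intro tendsto_intros)
      show "ennreal ((v n x - g x)\<^sup>2) \<le> liminf (\<lambda>i. ennreal ((v n x - v (\<phi> i) x)\<^sup>2))"
        by (subst lim_imp_Liminf[OF _ l]) auto
    qed
    also have "\<dots> \<le> liminf (\<lambda>i. \<integral>\<^sup>+x. ennreal ((v n x - v (\<phi> i) x)\<^sup>2) \<partial>lborel)" by (rule nn_integral_liminf) measurable
    also have "\<dots> \<le> ennreal ((1/4) ^ k)"
    proof (rule Liminf_le)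
      show "\<forall>\<^sub>F i in sequentially. (\<integral>\<^sup>+x. ennreal ((v n x - v (\<phi> i) x)\<^sup>2) \<partial>lborel) \<le> ennreal ((1/4) ^ k)"
        using eventually_ge_at_top[of k]
      proof eventually_elim
        fix i assume "k \<le> i"
        then show "(\<integral>\<^sup>+x. ennreal ((v n x - v (\<phi> i) x)\<^sup>2) \<partial>lborel) \<le> ennreal ((1/4) ^ k)"
          unfolding nn using \<kappa>[of k n "\<phi> i"] \<phi>k[of k i] that by (intro ennreal_leI) auto
      qed
    qed simp
    finally show ?thesis .
  qed
  have int1: "integrable lborel (\<lambda>x. (v n x - g x)\<^sup>2)" if "\<kappa> k \<le> n" for n k
    by (rule integrableI_bounded) (use fatou[OF that] in \<open>auto simp: less_top[symmetric] top_unique elim: order_le_less_trans\<close>)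
  have v2: "integrable lborel (\<lambda>x. (v n x)\<^sup>2)" for n
  proof -
    have "integrable lborel (\<lambda>x. indicator {0..T} x *\<^sub>R (u n x)\<^sup>2)"
      using borel_integrable_atLeastAtMost'[OF cts_on[OF sq_cts[OF u]], of 0 T] by (simp add: set_integrable_def)
    also have "(\<lambda>x. indicator {0..T} x *\<^sub>R (u n x)\<^sup>2) = (\<lambda>x. (v n x)\<^sup>2)" by (auto simp: v_def indicator_def)
    finally show ?thesis .
  qed
  have g2: "integrable lborel (\<lambda>x. (g x)\<^sup>2)"
  proof (rule Bochner_Integration.integrable_bound)
    show "integrable lborel (\<lambda>x. 2 * (v (\<kappa> 0) x)\<^sup>2 + 2 * (v (\<kappa> 0) x - g x)\<^sup>2)"
      by (intro Bochner_Integration.integrable_add integrable_mult_right v2 int1[of 0]) auto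
    have "(g x)\<^sup>2 \<le> 2 * (v (\<kappa> 0) x)\<^sup>2 + 2 * (v (\<kappa> 0) x - g x)\<^sup>2" for x
      using zero_le_power2[of "2 * v (\<kappa> 0) x - g x"] by (simp add: power2_eq_square algebra_simps)
    then show "AE x in lborel. norm ((g x)\<^sup>2) \<le> norm (2 * (v (\<kappa> 0) x)\<^sup>2 + 2 * (v (\<kappa> 0) x - g x)\<^sup>2)"
      by (auto intro!: AE_I2)
  qed auto
  have int2: "integrable lborel (\<lambda>x. (v n x - g x)\<^sup>2)" for n
  proof (rule Bochner_Integration.integrable_bound)
    show "integrable lborel (\<lambda>x. 2 * (v n x)\<^sup>2 + 2 * (g x)\<^sup>2)"
      by (intro Bochner_Integration.integrable_add integrable_mult_right v2 g2)
    have "(v n x - g x)\<^sup>2 \<le> 2 * (v n x)\<^sup>2 + 2 * (g x)\<^sup>2" for x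
      using zero_le_power2[of "v n x + g x"] by (simp add: power2_eq_square algebra_simps)
    then show "AE x in lborel. norm ((v n x - g x)\<^sup>2) \<le> norm (2 * (v n x)\<^sup>2 + 2 * (g x)\<^sup>2)"
      by (auto intro!: AE_I2)
  qed auto
  have vi: "(\<lambda>x. (v n x - g x)\<^sup>2) = (\<lambda>x. indicator {0..T} x * (u n x - g x)\<^sup>2)" for n
    using g0 by (auto simp: v_def indicator_def)
  have lim: "(\<lambda>n. LBINT x. (v n x - g x)\<^sup>2) \<longlonglongrightarrow> 0"
  proof (rule LIMSEQ_I)
    fix e :: real assume "e > 0"
    then obtain k where k: "(1/4) ^ k < e" using real_arch_pow_inv[of e "1/4"] by auto
    have "norm ((LBINT x. (v n x - g x)\<^sup>2) - 0) < e" if "\<kappa> k \<le> n" for n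
    proof -
      have "ennreal (LBINT x. (v n x - g x)\<^sup>2) \<le> ennreal ((1/4) ^ k)"
        using fatou[OF that] nn_integral_eq_integral[OF int2[of n]] by simp
      then have "(LBINT x. (v n x - g x)\<^sup>2) \<le> (1/4) ^ k" by (subst (asm) ennreal_le_iff) auto
      then show ?thesis using k by (simp add: Bochner_Integration.integral_nonneg)
    qed
    then show "\<exists>no. \<forall>n\<ge>no. norm ((LBINT x. (v n x - g x)\<^sup>2) - 0) < e" by blast
  qed
  show ?thesis
    by (rule that[of g]) (use gm g0 g2 int2 lim in \<open>simp_all add: vi[symmetric]\<close>)
qed

section \<open>Sobolev functions on an interval\<close>

abbreviation Lb :: "real \<Rightarrow> real measure" where
  "Lb T \<equiv> lebesgue_on {0<..<T}"

abbreviation L2 :: "real \<Rightarrow> (real \<Rightarrow> real) set" where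
  "L2 T \<equiv> L2_fun 0 T"

lemma LINT_Lb: "(LINT x:{a<..<b}|lebesgue. f x) = integral\<^sup>L (lebesgue_on {a<..<b}) (f::real \<Rightarrow> real)"
  unfolding set_lebesgue_integral_def by (subst integral_restrict_space) auto

lemma set_integrable_Lb: "set_integrable lebesgue {a<..<b} f \<longleftrightarrow> integrable (lebesgue_on {a<..<b}) (f::real \<Rightarrow> real)"
  unfolding set_integrable_def by (subst integrable_restrict_space) auto

lemma L2_iff: "u \<in> L2 T \<longleftrightarrow> u \<in> borel_measurable (Lb T) \<and> integrable (Lb T) (\<lambda>x. (u x)\<^sup>2)"
  unfolding L2_fun_def set_borel_measurable_def set_integrable_Lb by (simp add: borel_measurable_restrict_space_iff)

lemma L2_measurable: "u \<in> L2 T \<Longrightarrow> u \<in> borel_measurable (Lb T)"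
  by (simp add: L2_iff)

lemma finite_measure_Lb: "finite_measure (Lb T)"
proof (rule finite_measureI)
  show "emeasure (Lb T) (space (Lb T)) \<noteq> \<infinity>"
    by (cases "0 \<le> T") (auto simp: emeasure_restrict_space)
qed

lemma Lb_const: "integrable (Lb T) (\<lambda>_. c::real)"
  using finite_measure.integrable_const[OF finite_measure_Lb] .

lemma integrable_Lb_iff: "integrable (Lb T) f \<longleftrightarrow> f absolutely_integrable_on {0..T::real}" for f :: "real \<Rightarrow> real"
  using set_integrable_Lb[of 0 T f] absolutely_integrable_on_Icc_iff_Ioo by blast

lemma integral_Lb: "integrable (Lb T) f \<Longrightarrow> integral\<^sup>L (Lb T) f = integral {0..T} (f::real \<Rightarrow> real)"
  using set_lebesgue_integral_eq_integral(2)[of "{0<..<T}" f] set_integrable_Lb[of 0 T f] LINT_Lb[of 0 T f]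
  by (simp add: integral_open_interval_real)

lemma Lb_cts: "cts f \<Longrightarrow> integrable (Lb T) f" "cts f \<Longrightarrow> integral\<^sup>L (Lb T) f = integral {0..T} f" "cts f \<Longrightarrow> f \<in> borel_measurable (Lb T)"
proof -
  show 1: "integrable (Lb T) f" if "cts f" using cts_abs_integrable[OF that] by (simp add: integrable_Lb_iff)
  show "integral\<^sup>L (Lb T) f = integral {0..T} f" if "cts f" by (rule integral_Lb[OF 1[OF that]])
  show "f \<in> borel_measurable (Lb T)" if "cts f" using 1[OF that] by (rule borel_measurable_integrable)
qed

lemma L2_cts: "cts f \<Longrightarrow> f \<in> L2 T"
  using Lb_cts(3)[of f T] Lb_cts(1)[OF sq_cts] by (simp add: L2_iff)

lemma L2_mult: "u \<in> L2 T \<Longrightarrow> v \<in> L2 T \<Longrightarrow> integrable (Lb T) (\<lambda>x. u x * v x)"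
proof -
  assume u: "u \<in> L2 T" and v: "v \<in> L2 T"
  have [measurable]: "u \<in> borel_measurable (Lb T)" "v \<in> borel_measurable (Lb T)" using u v L2_measurable by auto
  show ?thesis
  proof (rule Bochner_Integration.integrable_bound[of _ "\<lambda>x. (u x)\<^sup>2 + (v x)\<^sup>2"])
    have "\<bar>u x * v x\<bar> \<le> (u x)\<^sup>2 + (v x)\<^sup>2" for x
    proof -
      have "0 \<le> (\<bar>u x\<bar> - \<bar>v x\<bar>)\<^sup>2" by simp
      then have "2 * (\<bar>u x\<bar> * \<bar>v x\<bar>) \<le> (u x)\<^sup>2 + (v x)\<^sup>2" by (simp add: power2_eq_square algebra_simps)
      moreover have "0 \<le> \<bar>u x\<bar> * \<bar>v x\<bar>" by simp
      ultimately show ?thesis unfolding abs_mult by linarith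
    qed
    then show "AE x in Lb T. norm (u x * v x) \<le> norm ((u x)\<^sup>2 + (v x)\<^sup>2)" by (intro AE_I2) simp
  qed (use u v in \<open>auto simp: L2_iff\<close>)
qed

lemma L2_integrable: "u \<in> L2 T \<Longrightarrow> integrable (Lb T) u"
  using L2_mult[OF _ L2_cts[OF cts_const[of 1]]] by simp

lemma L2_scale: "u \<in> L2 T \<Longrightarrow> (\<lambda>x. c * u x) \<in> L2 T"
  by (auto simp: L2_iff power_mult_distrib)

lemma L2_add: "u \<in> L2 T \<Longrightarrow> v \<in> L2 T \<Longrightarrow> (\<lambda>x. u x + v x) \<in> L2 T"
proof -
  assume u: "u \<in> L2 T" and v: "v \<in> L2 T"
  have "(\<lambda>x. (u x + v x)\<^sup>2) = (\<lambda>x. (u x)\<^sup>2 + (2 * (u x * v x) + (v x)\<^sup>2))" by (auto simp: power2_eq_square algebra_simps)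
  then show ?thesis using u v L2_mult[OF u v] by (auto simp: L2_iff)
qed

lemma L2_diff: "u \<in> L2 T \<Longrightarrow> v \<in> L2 T \<Longrightarrow> (\<lambda>x. u x - v x) \<in> L2 T"
  using L2_add[of u T "\<lambda>x. (-1) * v x"] L2_scale[of v T "-1"] by simp

lemma L2_norm_sq: "(L2_norm 0 T u)\<^sup>2 = integral\<^sup>L (Lb T) (\<lambda>x. (u x)\<^sup>2)"
  unfolding L2_norm_def LINT_Lb by (simp add: Bochner_Integration.integral_nonneg)

lemma L2_norm_nonneg: "0 \<le> L2_norm 0 T u"
  unfolding L2_norm_def LINT_Lb by (simp add: Bochner_Integration.integral_nonneg)

lemma L2_CS:
  assumes u: "u \<in> L2 T" and v: "v \<in> L2 T"
  shows "\<bar>integral\<^sup>L (Lb T) (\<lambda>x. u x * v x)\<bar> \<le> L2_norm 0 T u * L2_norm 0 T v"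
proof -
  let ?P = "integral\<^sup>L (Lb T) (\<lambda>x. u x * v x)"
  have "?P\<^sup>2 \<le> (L2_norm 0 T u)\<^sup>2 * (L2_norm 0 T v)\<^sup>2"
  proof (rule quadratic_nonneg_discrim)
    fix x :: real
    have "(\<lambda>s. (u s - x * v s)\<^sup>2) = (\<lambda>s. (u s)\<^sup>2 - (2 * x) * (u s * v s) + x\<^sup>2 * (v s)\<^sup>2)"
      by (auto simp: power2_eq_square algebra_simps)
    then have "integral\<^sup>L (Lb T) (\<lambda>s. (u s - x * v s)\<^sup>2) = integral\<^sup>L (Lb T) (\<lambda>s. (u s)\<^sup>2 - (2 * x) * (u s * v s) + x\<^sup>2 * (v s)\<^sup>2)" by simp
    also have "\<dots> = (L2_norm 0 T u)\<^sup>2 - 2 * x * ?P + x\<^sup>2 * (L2_norm 0 T v)\<^sup>2"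
      unfolding L2_norm_sq using u v L2_mult[OF u v] by (simp add: L2_iff)
    finally have eq: "integral\<^sup>L (Lb T) (\<lambda>s. (u s - x * v s)\<^sup>2) = (L2_norm 0 T u)\<^sup>2 - 2 * x * ?P + x\<^sup>2 * (L2_norm 0 T v)\<^sup>2" .
    show "0 \<le> (L2_norm 0 T u)\<^sup>2 - 2 * x * ?P + x\<^sup>2 * (L2_norm 0 T v)\<^sup>2"
      unfolding eq[symmetric] by (rule Bochner_Integration.integral_nonneg) simp
  qed simp
  then have "\<bar>?P\<bar>\<^sup>2 \<le> (L2_norm 0 T u * L2_norm 0 T v)\<^sup>2" by (simp add: power_mult_distrib)
  then show ?thesis by (rule power2_le_imp_le) (simp add: L2_norm_nonneg)
qed

lemma AE_Lb_iff: "(AE x in Lb T. P x) \<longleftrightarrow> (AE x in lebesgue. x \<in> {0<..<T} \<longrightarrow> P x)"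
  by (subst AE_restrict_space_iff) auto

section \<open>Test functions and weak derivatives\<close>

text \<open>Test functions with the derivative as an explicit argument and the support enclosed in a
  closed interval. The lemmas \<open>has_test_deriv_test\<close> and, for T > 0,
  \<open>test_has_test_deriv\<close> relate this to \<open>test_fun\<close>.\<close>

definition has_test_deriv :: "real \<Rightarrow> (real \<Rightarrow> real) \<Rightarrow> (real \<Rightarrow> real) \<Rightarrow> bool" where
  "has_test_deriv T \<phi> \<phi>' \<longleftrightarrow> (\<forall>x. (\<phi> has_real_derivative \<phi>' x) (at x)) \<and> cts \<phi>' \<and>
    (\<exists>a b. 0 < a \<and> a \<le> b \<and> b < T \<and> (\<forall>x. x \<notin> {a..b} \<longrightarrow> \<phi> x = 0))"

lemma has_test_derivI:
  assumes "\<And>x. (\<phi> has_real_derivative \<phi>' x) (at x)" "cts \<phi>'" "0 < a" "a \<le> b" "b < T" "\<And>x. x \<notin> {a..b} \<Longrightarrow> \<phi> x = 0"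
  shows "has_test_deriv T \<phi> \<phi>'"
proof -
  have "\<exists>a b. 0 < a \<and> a \<le> b \<and> b < T \<and> (\<forall>x. x \<notin> {a..b} \<longrightarrow> \<phi> x = 0)" using assms(3-6) by blast
  then show ?thesis using assms(1,2) by (simp add: has_test_deriv_def)
qed

lemma has_test_deriv_deriv: "has_test_deriv T \<phi> \<phi>' \<Longrightarrow> deriv \<phi> = \<phi>'"
  by (auto simp: has_test_deriv_def intro!: ext DERIV_imp_deriv)

lemma has_test_deriv_cts: "has_test_deriv T \<phi> \<phi>' \<Longrightarrow> cts \<phi>"
  by (auto simp: has_test_deriv_def continuous_on_eq_continuous_at intro: DERIV_isCont)

lemma has_test_deriv_test: "has_test_deriv T \<phi> \<phi>' \<Longrightarrow> \<phi> \<in> test_fun 0 T"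
proof -
  assume h: "has_test_deriv T \<phi> \<phi>'"
  then obtain a b where ab: "0 < a" "a \<le> b" "b < T" "\<forall>x. x \<notin> {a..b} \<longrightarrow> \<phi> x = 0" by (auto simp: has_test_deriv_def)
  have "\<phi> C1_differentiable_on UNIV"
    unfolding C1_differentiable_on_def
    using h by (auto simp: has_test_deriv_def has_real_derivative_iff_has_vector_derivative)
  moreover have "compact {a..b}" "{a..b} \<subseteq> {0<..<T}" using ab by auto
  ultimately show ?thesis using ab(4) by (auto simp: test_fun_def)
qed

lemma test_has_test_deriv:
  assumes "\<phi> \<in> test_fun 0 T" "0 < T"
  shows "has_test_deriv T \<phi> (deriv \<phi>)"
proof -
  obtain D K where D: "\<And>x. (\<phi> has_vector_derivative D x) (at x)" "cts D"
    and K: "compact K" "K \<subseteq> {0<..<T}" "\<And>x. x \<notin> K \<Longrightarrow> \<phi> x = 0"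
    using assms(1) by (auto simp: test_fun_def C1_differentiable_on_def)
  have D': "(\<phi> has_real_derivative D x) (at x)" for x using D(1) by (simp add: has_real_derivative_iff_has_vector_derivative)
  then have dD: "deriv \<phi> = D" by (auto intro!: ext DERIV_imp_deriv)
  have "\<exists>a b. 0 < a \<and> a \<le> b \<and> b < T \<and> (\<forall>x. x \<notin> {a..b} \<longrightarrow> \<phi> x = 0)"
  proof (cases "K = {}")
    case True
    then show ?thesis using K(3) assms(2) by (intro exI[of _ "T/2"]) auto
  next
    case False
    have bdd: "bdd_below K" "bdd_above K"
      using compact_imp_bounded[OF K(1)] by (rule bounded_imp_bdd_below, rule bounded_imp_bdd_above)
    have "Inf K \<in> K" "Sup K \<in> K"
      using closed_contains_Inf[OF False bdd(1) compact_imp_closed[OF K(1)]] closed_contains_Sup[OF False bdd(2) compact_imp_closed[OF K(1)]]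
      by simp_all
    then have lu: "0 < Inf K" "Inf K \<le> Sup K" "Sup K < T" using K(2) cInf_lower[OF _ bdd(1)] by auto
    have "x \<in> {Inf K..Sup K}" if "x \<in> K" for x
      using cInf_lower[OF that bdd(1)] cSup_upper[OF that bdd(2)] by simp
    then have "\<forall>x. x \<notin> {Inf K..Sup K} \<longrightarrow> \<phi> x = 0" using K(3) by blast
    with lu show ?thesis by (intro exI[of _ "Inf K"] exI[of _ "Sup K"] conjI)
  qed
  then show ?thesis unfolding has_test_deriv_def dD using D' D(2) by blast
qed

lemma has_test_deriv_add:
  assumes "has_test_deriv T \<phi> \<phi>'" "has_test_deriv T \<psi> \<psi>'"
  shows "has_test_deriv T (\<lambda>x. \<phi> x + c * \<psi> x) (\<lambda>x. \<phi>' x + c * \<psi>' x)"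
proof -
  obtain a b where ab: "0 < a" "a \<le> b" "b < T" "\<And>x. x \<notin> {a..b} \<Longrightarrow> \<phi> x = 0" using assms(1) unfolding has_test_deriv_def by blast
  obtain a' b' where ab': "0 < a'" "a' \<le> b'" "b' < T" "\<And>x. x \<notin> {a'..b'} \<Longrightarrow> \<psi> x = 0" using assms(2) unfolding has_test_deriv_def by blast
  have z: "\<phi> x + c * \<psi> x = 0" if "x \<notin> {min a a'..max b b'}" for x
  proof -
    have "x \<notin> {a..b}" "x \<notin> {a'..b'}" using that by auto
    then show ?thesis using ab(4)[of x] ab'(4)[of x] by simp
  qed
  have "0 < min a a'" "min a a' \<le> max b b'" "max b b' < T" using ab ab' by auto
  moreover have "((\<lambda>x. \<phi> x + c * \<psi> x) has_real_derivative \<phi>' x + c * \<psi>' x) (at x)" for x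
    using assms unfolding has_test_deriv_def by (auto intro!: derivative_eq_intros)
  moreover have "cts (\<lambda>x. \<phi>' x + c * \<psi>' x)" using assms unfolding has_test_deriv_def by (auto intro!: continuous_intros)
  ultimately show ?thesis using z by (intro has_test_derivI[of _ _ "min a a'" "max b b'"])
qed

text \<open>By convention J k is 0 on the negative axis, which is consistent with the derivative k
  when k vanishes there. For x \<le> 0 the base point of the integral is shifted to x - 1, which
  places x in the interior.\<close>

lemma J_has_derivative:
  assumes "cts k" "\<And>x. x \<le> 0 \<Longrightarrow> k x = 0"
  shows "(J k has_real_derivative k x) (at x)"
proof (cases "0 < x")
  case True then show ?thesis by (rule J_derivative[OF assms(1)])
next
  case False
  let ?k = "\<lambda>s. k (s - 1 + x)"
  have kc: "cts ?k" by (intro cts_compose[OF assms(1)] continuous_intros)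
  have eq: "J k y = J ?k (y + 1 - x)" if "y > x - 1" for y
  proof -
    have "J ?k (y + 1 - x) = integral {0..1 - x + y} (k \<circ> (\<lambda>s. s + (x - 1)))" by (simp add: J_eq o_def algebra_simps)
    also have "\<dots> = integral {0 + (x - 1)..1 - x + y + (x - 1)} k" by (rule integral_shift) (rule cts_on[OF assms(1)])
    also have "\<dots> = integral {x - 1..y} k" by simp
    also have "\<dots> = J k y"
    proof (cases "0 \<le> y")
      case True
      have "integral {x - 1..y} k = integral {x - 1..0} k + integral {0..y} k"
        by (rule Henstock_Kurzweil_Integration.integral_combine[symmetric]) (use False True cts_integrable[OF assms(1)] in auto)
      also have "integral {x - 1..0} k = integral {x - 1..0} (\<lambda>_. 0)" by (rule integral_cong) (use assms(2) in auto)
      finally show ?thesis by (simp add: J_eq)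
    next
      case False
      have "integral {x - 1..y} k = integral {x - 1..y} (\<lambda>_. 0)" by (rule integral_cong) (use assms(2) False in auto)
      then show ?thesis using False by (simp add: J_eq)
    qed
    finally show ?thesis by simp
  qed
  have "((\<lambda>y. J ?k (y + (1 - x))) has_real_derivative ?k 1) (at x)"
    by (rule DERIV_shift[THEN iffD1]) (use J_derivative[OF kc, of 1] in simp)
  then have "((\<lambda>y. J ?k (y + 1 - x)) has_real_derivative k x) (at x)" by (simp add: algebra_simps)
  then show ?thesis
    by (rule has_field_derivative_transform_within_open[of _ _ _ "{x - 1<..}"]) (use eq in auto)
qed

text \<open>Mean zero is what makes the primitive vanish to the right of the support of k.\<close>

lemma J_test:
  assumes k: "cts k" and ab: "0 < a" "a \<le> b" "b < T" "\<And>x. x \<notin> {a..b} \<Longrightarrow> k x = 0" and z: "integral {0..T} k = 0"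
  shows "has_test_deriv T (J k) k"
proof -
  have "J k x = 0" if "x \<notin> {a..b}" for x
  proof (cases "x < a")
    case True
    have "J k x = integral {0..x} (\<lambda>_. 0)" unfolding J_eq by (rule integral_cong) (use ab True in auto)
    then show ?thesis by simp
  next
    case False
    then have x: "b < x" using that by auto
    have "J k x = integral {0..b} k + integral {b..x} k"
      unfolding J_eq by (rule Henstock_Kurzweil_Integration.integral_combine[symmetric]) (use ab x cts_integrable[OF k] in auto)
    also have "integral {b..x} k = integral {b..x} (\<lambda>_. 0)"
      by (rule integral_spike[of "{b}"]) (use ab in auto)
    also have "integral {b..x} (\<lambda>_. 0) = integral {b..T} (\<lambda>_. 0::real)" by simp
    also have "integral {b..T} (\<lambda>_. 0) = integral {b..T} k" by (rule integral_spike[of "{b}"]) (use ab in auto)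
    also have "integral {0..b} k + integral {b..T} k = integral {0..T} k"
      by (rule Henstock_Kurzweil_Integration.integral_combine) (use ab cts_integrable[OF k] in auto)
    finally show ?thesis using z by simp
  qed
  note z = this
  have k0: "k x = 0" if "x \<le> 0" for x using ab(1) that by (intro ab(4)) auto
  show ?thesis by (rule has_test_derivI[OF J_has_derivative[OF k k0] k ab(1-3) z])
qed

lemma DERIV_max_sq: "((\<lambda>y::real. (max 0 y)\<^sup>2) has_real_derivative 2 * max 0 y) (at y)"
proof -
  consider "y < 0" | "y > 0" | "y = 0" by linarith
  then show ?thesis
  proof cases
    case 1
    have "((\<lambda>y::real. 0) has_real_derivative 2 * max 0 y) (at y)" using 1 by simp
    then show ?thesis by (rule has_field_derivative_transform_within_open[of _ _ _ "{..<0}"]) (use 1 in auto)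
  next
    case 2
    have "((\<lambda>y::real. y\<^sup>2) has_real_derivative 2 * max 0 y) (at y)" using 2 by (auto intro!: derivative_eq_intros)
    then show ?thesis by (rule has_field_derivative_transform_within_open[of _ _ _ "{0<..}"]) (use 2 in auto)
  next
    case 3
    have "(\<lambda>h::real. (max 0 h)\<^sup>2 / h) \<midarrow>0\<rightarrow> 0"
    proof (rule Lim_null_comparison[of _ "\<lambda>h. \<bar>h\<bar>"])
      show "\<forall>\<^sub>F h in at (0::real). norm ((max 0 h)\<^sup>2 / h) \<le> \<bar>h\<bar>"
        by (rule always_eventually) (auto simp: max_def power2_eq_square)
      show "(\<lambda>h::real. \<bar>h\<bar>) \<midarrow>0\<rightarrow> 0" using tendsto_rabs[OF tendsto_ident_at[of "0::real" UNIV]] by simp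
    qed
    then show ?thesis using 3 by (simp add: DERIV_def)
  qed
qed

text \<open>The quotients \<open>P / (P + 1/k)\<close>, with \<open>P\<close> a squared truncated parabola, are test functions that increase to an indicator.\<close>

lemma indicator_approximation:
  assumes q: "0 < q" "q \<le> T"
  obtains h where "\<And>k. \<exists>h'. has_test_deriv T (h k) h'" "\<And>k x. 0 \<le> h k x \<and> h k x \<le> (1::real)"
    "\<And>x. (\<lambda>k. h k x) \<longlonglongrightarrow> indicator {0<..<q} x"
proof -
  \<comment> \<open>With k + 3 the interval from a k to q - a k is nonempty already for k =
    0.\<close>
  define a where "a k = q / real (k + 3)" for k
  define v where "v k x = (x - a k) * (q - a k - x)" for k x
  define P where "P k x = (max 0 (v k x))\<^sup>2" for k x
  define e where "e k = 1 / real (Suc k)" for k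
  define h where "h k x = P k x / (P k x + e k)" for k x
  have a: "0 < a k" "a k \<le> q - a k" "q - a k < T" for k
  proof -
    show "0 < a k" using q by (simp add: a_def)
    have "a k \<le> q / 2" unfolding a_def using q by (intro divide_left_mono) auto
    then show "a k \<le> q - a k" by simp
    show "q - a k < T" using \<open>0 < a k\<close> q by simp
  qed
  have e: "e k > 0" for k by (simp add: e_def)
  have P0: "P k x \<ge> 0" for k x by (simp add: P_def)
  have Pe: "P k x + e k > 0" for k x using P0[of k x] e[of k] by simp
  have Pz: "P k x = 0" if "x \<notin> {a k..q - a k}" for k x
  proof -
    have "v k x \<le> 0" unfolding v_def using that a[of k] by (auto simp: mult_le_0_iff)
    then show ?thesis by (simp add: P_def)
  qed
  have "\<exists>h'. has_test_deriv T (h k) h'" for k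
  proof -
    define P' where "P' x = 2 * max 0 (v k x) * (q - 2 * x)" for x
    have dv: "(v k has_real_derivative q - 2 * x) (at x)" for x
      unfolding v_def[abs_def] by (auto intro!: derivative_eq_intros simp: algebra_simps)
    have dP: "(P k has_real_derivative P' x) (at x)" for x
      unfolding P_def[abs_def] P'_def by (rule DERIV_chain2[OF DERIV_max_sq dv])
    have dh: "(h k has_real_derivative P' x * e k / (P k x + e k)\<^sup>2) (at x)" for x
      unfolding h_def[abs_def] using Pe[of k x]
      by (auto intro!: derivative_eq_intros dP simp: power2_eq_square algebra_simps)
    have cv: "cts (v k)" unfolding v_def[abs_def] by (intro continuous_intros)
    have cP: "cts (P k)" unfolding P_def[abs_def] by (intro continuous_intros cv)
    have cP': "cts P'" unfolding P'_def[abs_def] by (intro continuous_intros cv)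
    have "(P k x + e k)\<^sup>2 \<noteq> 0" for x using Pe[of k x] by simp
    then have "cts (\<lambda>x. P' x * e k / (P k x + e k)\<^sup>2)" by (intro continuous_intros cP cP') auto
    moreover have z: "h k x = 0" if "x \<notin> {a k..q - a k}" for x using Pz[OF that] by (simp add: h_def)
    ultimately have "has_test_deriv T (h k) (\<lambda>x. P' x * e k / (P k x + e k)\<^sup>2)"
      by (intro has_test_derivI[OF dh _ a(1)[of k] a(2)[of k] a(3)[of k]])
    then show ?thesis by (rule exI[of "has_test_deriv T (h k)"])
  qed
  moreover have "0 \<le> h k x \<and> h k x \<le> 1" for k x
    using P0[of k x] Pe[of k x] e[of k] by (simp add: h_def)
  moreover have "(\<lambda>k. h k x) \<longlonglongrightarrow> indicator {0<..<q} x" for x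
  proof -
    have "(\<lambda>k. 1 / real (k + 3)) \<longlonglongrightarrow> 0" using LIMSEQ_ignore_initial_segment[OF lim_1_over_n, of 3] by simp
    from tendsto_mult[OF tendsto_const[of q] this] have a0: "a \<longlonglongrightarrow> 0" by (simp add: a_def[abs_def])
    have e0: "e \<longlonglongrightarrow> 0" unfolding e_def[abs_def] using LIMSEQ_Suc[OF lim_1_over_n] by simp
    show ?thesis
    proof (cases "x \<in> {0<..<q}")
      case True
      have "(\<lambda>k. v k x) \<longlonglongrightarrow> (x - 0) * (q - 0 - x)" unfolding v_def by (intro tendsto_intros a0)
      then have "(\<lambda>k. P k x) \<longlonglongrightarrow> (max 0 ((x - 0) * (q - 0 - x)))\<^sup>2" unfolding P_def by (intro tendsto_intros)
      then have PL: "(\<lambda>k. P k x) \<longlonglongrightarrow> (x * (q - x))\<^sup>2" using True by (simp add: max_def)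
      have "(\<lambda>k. h k x) \<longlonglongrightarrow> (x * (q - x))\<^sup>2 / ((x * (q - x))\<^sup>2 + 0)"
        unfolding h_def by (intro tendsto_intros PL e0) (use True in auto)
      then show ?thesis using True by simp
    next
      case False
      have "h k x = 0" for k
      proof -
        have "x \<notin> {a k..q - a k}" using False a(1)[of k] by auto
        then show ?thesis using Pz by (simp add: h_def)
      qed
      then show ?thesis using False by simp
    qed
  qed
  ultimately show ?thesis using that by blast
qed

text \<open>The fundamental lemma of the calculus of variations. Dominated convergence gives zero
  integrals over the intervals (0,q); half-lines generate the Borel sets and are stable under
  intersection, so the integral vanishes over every Borel set and the density is 0.\<close>

lemma zero_of_test_integrals:
  assumes T: "0 < T" and u: "integrable (Lb T) u"
    and z: "\<And>\<phi> \<phi>'. has_test_deriv T \<phi> \<phi>' \<Longrightarrow> integral\<^sup>L (Lb T) (\<lambda>x. u x * \<phi> x) = 0"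
  shows "AE x in Lb T. u x = (0::real)"
proof -
  have sub: "integral\<^sup>L (Lb T) (\<lambda>x. u x * indicator {0<..<q} x) = 0" if q: "0 < q" "q \<le> T" for q
  proof -
    obtain h where h: "\<forall>k. \<exists>h'. has_test_deriv T (h k) h'" "\<forall>k x. 0 \<le> h k x \<and> h k x \<le> 1"
      "\<forall>x. (\<lambda>k. h k x) \<longlonglongrightarrow> indicator {0<..<q} x"
      using indicator_approximation[OF q] by metis
    have hc: "cts (h k)" for k using h(1) has_test_deriv_cts by blast
    have [measurable]: "u \<in> borel_measurable (Lb T)" "h k \<in> borel_measurable (Lb T)" for k
      using borel_measurable_integrable[OF u] Lb_cts(3)[OF hc] by auto
    have "(\<lambda>k. integral\<^sup>L (Lb T) (\<lambda>x. u x * h k x)) \<longlonglongrightarrow> integral\<^sup>L (Lb T) (\<lambda>x. u x * indicator {0<..<q} x)"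
    proof (rule integral_dominated_convergence[where w="\<lambda>x. \<bar>u x\<bar>"])
      show "AE x in Lb T. (\<lambda>k. u x * h k x) \<longlonglongrightarrow> u x * indicator {0<..<q} x"
        using h(3) by (intro AE_I2 tendsto_intros) auto
      have "\<bar>u x * h k x\<bar> \<le> \<bar>u x\<bar>" for x k
        unfolding abs_mult using h(2) by (intro mult_left_le) auto
      then show "AE x in Lb T. norm (u x * h k x) \<le> \<bar>u x\<bar>" for k by (intro AE_I2) simp
      show "(\<lambda>x. u x * indicator {0<..<q} x) \<in> borel_measurable (Lb T)"
        by (intro borel_measurable_times borel_measurable_indicator') (auto simp: sets_restrict_space)
    qed (use u in \<open>auto intro: integrable_abs\<close>)
    moreover have "integral\<^sup>L (Lb T) (\<lambda>x. u x * h k x) = 0" for k using z h(1) by blast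
    ultimately show ?thesis by (simp add: LIMSEQ_const_iff)
  qed
  have ul: "integrable lebesgue (\<lambda>x. indicator {0<..<T} x *\<^sub>R u x)"
    using u by (subst (asm) integrable_restrict_space) auto
  \<comment> \<open>The induction over Borel sets is carried out for a Borel representative of u
    extended by 0.\<close>
  obtain g where gm: "g \<in> borel_measurable lborel" and gu: "AE x in lborel. indicator {0<..<T} x *\<^sub>R u x = g x"
    using completion_ex_borel_measurable_real[OF borel_measurable_integrable[OF ul]] by auto
  have gu': "AE x in lebesgue. indicator {0<..<T} x *\<^sub>R u x = g x" by (rule AE_completion[OF gu])
  have "integrable lebesgue g"
    by (rule integrable_cong_AE_imp[OF ul]) (use gm gu' in \<open>auto intro: measurable_completion\<close>)
  then have gi: "integrable lborel g" using gm by (simp add: integrable_completion)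
  have half: "(LINT x:{..q}|lborel. g x) = 0" for q
  proof -
    define p where "p = min q T"
    have "(LINT x:{..q}|lborel. g x) = integral\<^sup>L lebesgue (\<lambda>x. indicator {..q} x *\<^sub>R g x)"
      unfolding set_lebesgue_integral_def using gm by (intro integral_completion[symmetric]) auto
    also have "\<dots> = integral\<^sup>L lebesgue (\<lambda>x. indicator {0<..<T} x *\<^sub>R (u x * indicator {0<..<p} x))"
    proof (rule integral_cong_AE)
      have "AE x in lborel. x \<noteq> p \<and> x \<noteq> T"
        using AE_lborel_singleton[of p] AE_lborel_singleton[of T] by eventually_elim auto
      then have "AE x in lebesgue. x \<noteq> p \<and> x \<noteq> T" by (rule AE_completion)
      with gu' show "AE x in lebesgue. indicator {..q} x *\<^sub>R g x = indicator {0<..<T} x *\<^sub>R (u x * indicator {0<..<p} x)"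
        by eventually_elim (auto simp: indicator_def p_def min_def split: if_splits)
      show "(\<lambda>x. indicator {..q} x *\<^sub>R g x) \<in> borel_measurable lebesgue"
        using gm by (intro measurable_completion) auto
      have "(\<lambda>x. (indicator {0<..<T} x *\<^sub>R u x) * indicator {0<..<p} x) \<in> borel_measurable lebesgue"
        by (intro borel_measurable_times borel_measurable_integrable[OF ul] borel_measurable_indicator) auto
      then show "(\<lambda>x. indicator {0<..<T} x *\<^sub>R (u x * indicator {0<..<p} x)) \<in> borel_measurable lebesgue" by (simp add: mult.assoc)
    qed
    also have "\<dots> = integral\<^sup>L (Lb T) (\<lambda>x. u x * indicator {0<..<p} x)" by (subst integral_restrict_space) auto
    also have "\<dots> = 0"
    proof (cases "0 < p")
      case True then show ?thesis by (rule sub) (simp add: p_def)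
    next
      case False then show ?thesis by simp
    qed
    finally show ?thesis .
  qed
  have tot: "(LINT x:UNIV|lborel. g x) = 0"
  proof -
    have "(LINT x:UNIV|lborel. g x) = (LINT x:{..T}|lborel. g x)"
      unfolding set_lebesgue_integral_def
    proof (rule integral_cong_AE)
      show "AE x in lborel. indicator UNIV x *\<^sub>R g x = indicator {..T} x *\<^sub>R g x"
        using gu by eventually_elim (auto simp: indicator_def split: if_splits)
    qed (use gm in auto)
    then show ?thesis using half by simp
  qed
  have gset: "set_integrable lborel A g" if "A \<in> sets borel" for A
    unfolding set_integrable_def using gi that by (intro integrable_mult_indicator) auto
  have all: "(LINT x:A|lborel. g x) = 0" if "A \<in> sets borel" for A
  proof -
    have "A \<in> sigma_sets UNIV (range (\<lambda>a::real. {..a}))"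
      using that unfolding borel_eq_atMost by simp
    then show ?thesis
    proof (rule sigma_sets_induct_disjoint[rotated 2, where P="\<lambda>A. (LINT x:A|lborel. g x) = 0"])
      show "Int_stable (range (\<lambda>a::real. {..a}))" by (auto simp: Int_stable_def)
      show "range (\<lambda>a::real. {..a}) \<subseteq> Pow UNIV" by auto
      fix A :: "real set"
      show "(LINT x:A|lborel. g x) = 0" if "A \<in> range (\<lambda>a::real. {..a})" using that half by auto
      assume "A \<in> sigma_sets UNIV (range (\<lambda>a::real. {..a}))" and z: "(LINT x:A|lborel. g x) = 0"
      then have A: "A \<in> sets borel" unfolding borel_eq_atMost by simp
      have "(LINT x:A \<union> (UNIV - A)|lborel. g x) = (LINT x:A|lborel. g x) + (LINT x:UNIV - A|lborel. g x)"
        by (rule set_integral_Un) (use A gset in auto)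
      then show "(LINT x:UNIV - A|lborel. g x) = 0" using z tot by (simp add: Un_Diff_cancel)
    next
      fix A :: "nat \<Rightarrow> real set"
      assume dA: "disjoint_family A" and "range A \<subseteq> sigma_sets UNIV (range (\<lambda>a::real. {..a}))" and z: "\<And>i. (LINT x:A i|lborel. g x) = 0"
      then have A: "\<And>i. A i \<in> sets borel" unfolding borel_eq_atMost by auto
      have "(LINT x:(\<Union>i. A i)|lborel. g x) = (\<Sum>i. LINT x:A i|lborel. g x)"
        by (rule lebesgue_integral_countable_add) (use A dA gset in \<open>auto simp: disjoint_family_on_def\<close>)
      then show "(LINT x:(\<Union>i. A i)|lborel. g x) = 0" using z by simp
    qed (simp add: set_lebesgue_integral_def)
  qed
  have "AE x in lborel. g x = 0" by (rule sigma_finite_measure.density_zero[OF lborel.sigma_finite_measure_axioms gi]) (use all in auto)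
  then have "AE x in lebesgue. g x = 0" by (rule AE_completion)
  with gu' have "AE x in lebesgue. x \<in> {0<..<T} \<longrightarrow> u x = 0" by eventually_elim (auto simp: indicator_def)
  then show ?thesis by (simp add: AE_Lb_iff)
qed

lemma weak_derivD:
  assumes "has_weak_deriv 0 T u g" "has_test_deriv T \<phi> \<phi>'"
  shows "integral\<^sup>L (Lb T) (\<lambda>x. u x * \<phi>' x) = - integral\<^sup>L (Lb T) (\<lambda>x. g x * \<phi> x)"
  using assms(1)[unfolded has_weak_deriv_def LINT_Lb, rule_format, OF has_test_deriv_test[OF assms(2)]]
  by (simp add: has_test_deriv_deriv[OF assms(2)])

lemma weak_derivI:
  assumes "0 < T" "\<And>\<phi> \<phi>'. has_test_deriv T \<phi> \<phi>' \<Longrightarrow> integral\<^sup>L (Lb T) (\<lambda>x. u x * \<phi>' x) = - integral\<^sup>L (Lb T) (\<lambda>x. g x * \<phi> x)"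
  shows "has_weak_deriv 0 T u g"
  unfolding has_weak_deriv_def LINT_Lb
proof
  fix \<phi> assume "\<phi> \<in> test_fun 0 T"
  from assms(2)[OF test_has_test_deriv[OF this assms(1)]]
  show "integral\<^sup>L (Lb T) (\<lambda>x. u x * deriv \<phi> x) = - integral\<^sup>L (Lb T) (\<lambda>x. g x * \<phi> x)" .
qed

lemma test_L2:
  assumes "has_test_deriv T \<phi> \<phi>'" shows "\<phi> \<in> L2 T" "\<phi>' \<in> L2 T"
  using assms L2_cts[OF has_test_deriv_cts[OF assms]] L2_cts[of \<phi>' T] by (auto simp: has_test_deriv_def)

lemma weak_deriv_unique:
  assumes T: "0 < T" and g: "g \<in> L2 T" "h \<in> L2 T" and d: "has_weak_deriv 0 T u g" "has_weak_deriv 0 T u h"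
  shows "AE x in Lb T. g x = h x"
proof -
  have "AE x in Lb T. g x - h x = 0"
  proof (rule zero_of_test_integrals[OF T])
    show "integrable (Lb T) (\<lambda>x. g x - h x)" by (intro L2_integrable L2_diff g)
    fix \<phi> \<phi>' assume t: "has_test_deriv T \<phi> \<phi>'"
    have "integral\<^sup>L (Lb T) (\<lambda>x. g x * \<phi> x) = integral\<^sup>L (Lb T) (\<lambda>x. h x * \<phi> x)"
      using weak_derivD[OF d(1) t] weak_derivD[OF d(2) t] by simp
    then show "integral\<^sup>L (Lb T) (\<lambda>x. (g x - h x) * \<phi> x) = 0"
      using L2_mult[OF g(1) test_L2(1)[OF t]] L2_mult[OF g(2) test_L2(1)[OF t]] by (simp add: left_diff_distrib)
  qed
  then show ?thesis by eventually_elim simp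
qed

lemma L2_norm_AE: "u \<in> L2 T \<Longrightarrow> v \<in> L2 T \<Longrightarrow> AE x in Lb T. u x = v x \<Longrightarrow> L2_norm 0 T u = L2_norm 0 T v"
  unfolding L2_norm_def LINT_Lb
  by (intro arg_cong[where f=sqrt] integral_cong_AE) (auto simp: L2_iff elim: AE_mp)

lemma H1_weak_deriv:
  assumes "u \<in> H1_fun 0 T"
  shows "weak_deriv 0 T u \<in> L2 T" "has_weak_deriv 0 T u (weak_deriv 0 T u)"
proof -
  have "\<exists>g. g \<in> L2 T \<and> has_weak_deriv 0 T u g" using assms by (auto simp: H1_fun_def)
  from someI_ex[OF this] show "weak_deriv 0 T u \<in> L2 T" "has_weak_deriv 0 T u (weak_deriv 0 T u)"
    unfolding weak_deriv_def by auto
qed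

text \<open>Frees the norm from the choice made in \<open>weak_deriv\<close>: any weak derivative in
  L^2 computes it.\<close>

lemma H1_norm_eq:
  assumes "0 < T" "u \<in> L2 T" "g \<in> L2 T" "has_weak_deriv 0 T u g"
  shows "H1_norm 0 T u = sqrt ((L2_norm 0 T u)\<^sup>2 + (L2_norm 0 T g)\<^sup>2)"
proof -
  have "u \<in> H1_fun 0 T" using assms by (auto simp: H1_fun_def)
  from H1_weak_deriv[OF this] have "L2_norm 0 T (weak_deriv 0 T u) = L2_norm 0 T g"
    using weak_deriv_unique[OF assms(1) _ assms(3) _ assms(4)] L2_norm_AE assms(3) by blast
  then show ?thesis by (simp add: H1_norm_def)
qed

lemma weak_deriv_diff:
  assumes T: "0 < T" and "u \<in> L2 T" "v \<in> L2 T" "g \<in> L2 T" "h \<in> L2 T" "has_weak_deriv 0 T u g" "has_weak_deriv 0 T v h"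
  shows "has_weak_deriv 0 T (\<lambda>x. u x - v x) (\<lambda>x. g x - h x)"
proof (rule weak_derivI[OF T])
  fix \<phi> \<phi>' assume t: "has_test_deriv T \<phi> \<phi>'"
  show "integral\<^sup>L (Lb T) (\<lambda>x. (u x - v x) * \<phi>' x) = - integral\<^sup>L (Lb T) (\<lambda>x. (g x - h x) * \<phi> x)"
    using weak_derivD[OF assms(6) t] weak_derivD[OF assms(7) t] assms(2-5) test_L2[OF t]
    by (simp add: left_diff_distrib L2_mult)
qed

lemma J_continuous_on:
  assumes "integrable (Lb T) g" shows "continuous_on {0..T} (J g)"
proof -
  have "g integrable_on {0..T}" using assms by (simp add: integrable_Lb_iff absolutely_integrable_on_def)
  then show ?thesis unfolding J_eq[abs_def] by (rule indefinite_integral_continuous_1)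
qed

lemma continuous_on_L2:
  assumes "continuous_on {0..T} u" shows "u \<in> L2 T"
proof -
  define v where "v x = u (min (max x 0) T)" for x
  show ?thesis
  proof (cases "0 < T")
    case True
    have "cts v" unfolding v_def[abs_def]
      by (rule continuous_on_compose2[OF assms]) (use True in \<open>auto intro!: continuous_intros\<close>)
    from L2_cts[OF this] have "v \<in> L2 T" .
    moreover have eq: "\<And>x. x \<in> space (Lb T) \<Longrightarrow> u x = v x" by (auto simp: v_def)
    have "u \<in> borel_measurable (Lb T) \<longleftrightarrow> v \<in> borel_measurable (Lb T)" by (rule measurable_cong) (rule eq)
    moreover have "integrable (Lb T) (\<lambda>x. (u x)\<^sup>2) \<longleftrightarrow> integrable (Lb T) (\<lambda>x. (v x)\<^sup>2)"
      by (rule Bochner_Integration.integrable_cong) (simp_all only: eq)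
    ultimately show ?thesis by (simp add: L2_iff)
  next
    case False
    then have e: "space (Lb T) = {}" by simp
    show ?thesis unfolding L2_iff using e Bochner_Integration.integrable_cong[of "Lb T" "Lb T" "\<lambda>x. (u x)\<^sup>2" "\<lambda>_. 0"]
      by (simp add: measurable_def)
  qed
qed

text \<open>With \<psi> s = \<phi>' (T - s) the left side is (\<psi> \<star> (1 \<star> g)) T.
  Associativity with an integrable last factor takes the place of Fubini, and (\<psi> \<star> 1) (T
  - s) = \<phi> T - \<phi> s.\<close>

lemma integration_by_parts_J:
  assumes g: "integrable (Lb T) g" and T: "0 < T"
    and \<phi>: "\<And>x. (\<phi> has_real_derivative \<phi>' x) (at x)" "cts \<phi>'"
  shows "integral\<^sup>L (Lb T) (\<lambda>x. J g x * \<phi>' x) = \<phi> T * J g T - integral\<^sup>L (Lb T) (\<lambda>x. g x * \<phi> x)"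
proof -
  have gi: "g absolutely_integrable_on {0..T}" using g by (simp add: integrable_Lb_iff)
  then have gi': "g integrable_on {0..T}" by (simp add: absolutely_integrable_on_def)
  have \<phi>c: "cts \<phi>" using \<phi>(1) by (auto simp: continuous_on_eq_continuous_at intro: DERIV_isCont)
  define \<psi> where "\<psi> s = \<phi>' (T - s)" for s
  have \<psi>: "cts \<psi>" unfolding \<psi>_def[abs_def] by (intro cts_compose[OF \<phi>(2)] continuous_intros)
  have "integral\<^sup>L (Lb T) (\<lambda>x. J g x * \<phi>' x) = integral {0..T} (\<lambda>x. J g x * \<phi>' x)"
    by (intro integral_Lb L2_mult continuous_on_L2 J_continuous_on g cts_on \<phi>)
  also have "\<dots> = (\<psi> \<star> J g) T" by (simp add: conv_def \<psi>_def mult.commute)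
  also have "\<dots> = ((\<psi> \<star> (\<lambda>_. 1)) \<star> g) T" by (rule conv_assoc_L1[OF \<psi> cts_const gi])
  also have "\<dots> = integral {0..T} (\<lambda>s. \<phi> T * g s - g s * \<phi> s)"
    unfolding conv_def[of "\<psi> \<star> _"]
  proof (rule integral_cong)
    fix s assume s: "s \<in> {0..T}"
    have "((\<lambda>x. \<phi>' (T - x)) has_integral (- \<phi> (T - (T - s)) - (- \<phi> (T - 0)))) {0..T - s}"
      by (rule fundamental_theorem_of_calculus)
         (use s in \<open>auto intro!: derivative_eq_intros DERIV_chain2[OF \<phi>(1)] simp flip: has_real_derivative_iff_has_vector_derivative\<close>)
    then have "J \<psi> (T - s) = \<phi> T - \<phi> s" unfolding J_eq \<psi>_def[abs_def] by (simp add: integral_unique)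
    then have "(\<psi> \<star> (\<lambda>_. 1)) (T - s) = \<phi> T - \<phi> s" by (simp only: conv_commute[OF \<psi> cts_const])
    then show "(\<psi> \<star> (\<lambda>_. 1)) (T - s) * g s = \<phi> T * g s - g s * \<phi> s" by (simp only: left_diff_distrib mult.commute[of "g s"])
  qed
  also have "\<dots> = \<phi> T * J g T - integral {0..T} (\<lambda>s. g s * \<phi> s)"
  proof -
    have b: "(\<lambda>s. \<phi> s * g s) absolutely_integrable_on {0..T}"
    proof (rule absolutely_integrable_bounded_measurable_product_real)
      show "\<phi> \<in> borel_measurable (lebesgue_on {0..T})"
        by (intro continuous_imp_measurable_on_sets_lebesgue cts_on \<phi>c) auto
      show "bounded (\<phi> ` {0..T})" by (intro compact_imp_bounded compact_continuous_image cts_on \<phi>c) auto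
    qed (use gi in auto)
    then have "(\<lambda>s. g s * \<phi> s) integrable_on {0..T}" by (simp add: mult.commute absolutely_integrable_on_def)
    then show ?thesis unfolding J_eq
      by (intro integral_unique has_integral_diff has_integral_mult_right integrable_integral gi')
  qed
  also have "integral {0..T} (\<lambda>s. g s * \<phi> s) = integral\<^sup>L (Lb T) (\<lambda>x. g x * \<phi> x)"
  proof (rule integral_Lb[symmetric])
    have "(\<lambda>s. \<phi> s * g s) absolutely_integrable_on {0..T}"
    proof (rule absolutely_integrable_bounded_measurable_product_real)
      show "\<phi> \<in> borel_measurable (lebesgue_on {0..T})"
        by (intro continuous_imp_measurable_on_sets_lebesgue cts_on \<phi>c) auto
      show "bounded (\<phi> ` {0..T})" by (intro compact_imp_bounded compact_continuous_image cts_on \<phi>c) auto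
    qed (use gi in auto)
    then show "integrable (Lb T) (\<lambda>x. g x * \<phi> x)" by (simp add: integrable_Lb_iff mult.commute)
  qed
  finally show ?thesis .
qed

lemma J_weak_deriv:
  assumes "0 < T" "integrable (Lb T) g" shows "has_weak_deriv 0 T (J g) g"
proof (rule weak_derivI[OF assms(1)])
  fix \<phi> \<phi>' assume t: "has_test_deriv T \<phi> \<phi>'"
  then obtain a b where "0 < a" "a \<le> b" "b < T" "\<And>x. x \<notin> {a..b} \<Longrightarrow> \<phi> x = 0" unfolding has_test_deriv_def by blast
  then have "\<phi> T = 0" by simp
  then show "integral\<^sup>L (Lb T) (\<lambda>x. J g x * \<phi>' x) = - integral\<^sup>L (Lb T) (\<lambda>x. g x * \<phi> x)"
    using integration_by_parts_J[OF assms(2,1), of \<phi> \<phi>'] t by (simp add: has_test_deriv_def)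
qed

lemma unit_test:
  assumes "0 < T"
  obtains \<theta> \<theta>' where "has_test_deriv T \<theta> \<theta>'" "integral {0..T} \<theta> = 1"
proof -
  obtain h where h: "\<forall>k. \<exists>h'. has_test_deriv T (h k) h'" "\<forall>k x. 0 \<le> h k x \<and> h k x \<le> 1"
    "\<forall>x. (\<lambda>k. h k x) \<longlonglongrightarrow> indicator {0<..<T} x"
    using indicator_approximation[OF assms order_refl] by metis
  have hc: "cts (h k)" for k using h(1) has_test_deriv_cts by blast
  have "(\<lambda>k. integral\<^sup>L (Lb T) (h k)) \<longlonglongrightarrow> integral\<^sup>L (Lb T) (\<lambda>x. 1)"
  proof (rule integral_dominated_convergence[where w="\<lambda>x. 1"])
    show "AE x in Lb T. (\<lambda>k. h k x) \<longlonglongrightarrow> 1"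
    proof (rule AE_I2)
      fix x assume "x \<in> space (Lb T)"
      then show "(\<lambda>k. h k x) \<longlonglongrightarrow> 1" using h(3)[rule_format, of x] by simp
    qed
    show "AE x in Lb T. norm (h k x) \<le> 1" for k using h(2) by (intro AE_I2) auto
    show "integrable (Lb T) (\<lambda>x. 1::real)" by (rule Lb_const)
  qed (use Lb_cts(3)[OF hc] in auto)
  also have "integral\<^sup>L (Lb T) (\<lambda>x. 1) = T" using integral_Lb[OF Lb_const, of T 1] assms by simp
  finally have "(\<lambda>k. integral {0..T} (h k)) \<longlonglongrightarrow> T" by (simp add: Lb_cts(2)[OF hc])
  from order_tendstoD(1)[OF this assms] obtain k where k: "integral {0..T} (h k) > 0"
    by (auto simp: eventually_sequentially)
  define I where "I = integral {0..T} (h k)"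
  obtain h' where h': "has_test_deriv T (h k) h'" using h(1) by blast
  \<comment> \<open>This is division by I, written as a sum to fit
    \<open>has_test_deriv_add\<close>.\<close>
  have "has_test_deriv T (\<lambda>x. h k x + (1 / I - 1) * h k x) (\<lambda>x. h' x + (1 / I - 1) * h' x)"
    by (rule has_test_deriv_add[OF h' h'])
  moreover have "integral {0..T} (\<lambda>x. h k x + (1 / I - 1) * h k x) = 1"
  proof -
    have "(\<lambda>x. h k x + (1 / I - 1) * h k x) = (\<lambda>x. (1 / I) * h k x)" by (simp add: algebra_simps)
    then show ?thesis using k by (simp add: I_def)
  qed
  ultimately show ?thesis using that by blast
qed

lemma test_derivative_of_mean_zero:
  assumes t: "has_test_deriv T \<psi> \<psi>'" and z: "integral {0..T} \<psi> = 0"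
  shows "has_test_deriv T (J \<psi>) \<psi>"
proof -
  obtain a b where ab: "0 < a" "a \<le> b" "b < T" "\<And>x. x \<notin> {a..b} \<Longrightarrow> \<psi> x = 0" using t unfolding has_test_deriv_def by blast
  show ?thesis by (rule J_test[OF has_test_deriv_cts[OF t] ab z])
qed

text \<open>U = u - J g has weak derivative 0. A test function minus its mean times \<theta> has
  mean zero, hence is the derivative of a test function and is annihilated by U. So U acts like the
  constant c, its integral against \<theta>.\<close>

lemma weak_deriv_primitive:
  assumes T: "0 < T" and u: "u \<in> L2 T" and g: "g \<in> L2 T" and d: "has_weak_deriv 0 T u g"
  shows "\<exists>c. AE x in Lb T. u x = c + J g x"
proof -
  have gi: "integrable (Lb T) g" by (rule L2_integrable[OF g])
  have Jg: "J g \<in> L2 T" by (rule continuous_on_L2[OF J_continuous_on[OF gi]])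
  define U where "U x = u x - J g x" for x
  have U: "U \<in> L2 T" unfolding U_def[abs_def] by (rule L2_diff[OF u Jg])
  have dU: "has_weak_deriv 0 T U (\<lambda>x. g x - g x)"
    unfolding U_def[abs_def] by (rule weak_deriv_diff[OF T u Jg g g d J_weak_deriv[OF T gi]])
  obtain \<theta> \<theta>' where \<theta>: "has_test_deriv T \<theta> \<theta>'" "integral {0..T} \<theta> = 1" using unit_test[OF T] by blast
  define c where "c = integral\<^sup>L (Lb T) (\<lambda>x. U x * \<theta> x)"
  have "AE x in Lb T. U x - c = 0"
  proof (rule zero_of_test_integrals[OF T])
    show "integrable (Lb T) (\<lambda>x. U x - c)" using L2_integrable[OF U] Lb_const by simp
    fix \<phi> \<phi>' assume t: "has_test_deriv T \<phi> \<phi>'"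
    define m where "m = integral {0..T} \<phi>"
    have p: "has_test_deriv T (\<lambda>x. \<phi> x + (- m) * \<theta> x) (\<lambda>x. \<phi>' x + (- m) * \<theta>' x)" by (rule has_test_deriv_add[OF t \<theta>(1)])
    have "integral {0..T} (\<lambda>x. \<phi> x + (- m) * \<theta> x) = 0"
    proof -
      have "((\<lambda>x. \<phi> x + (- m) * \<theta> x) has_integral (integral {0..T} \<phi> + (- m) * integral {0..T} \<theta>)) {0..T}"
        by (intro has_integral_add has_integral_mult_right integrable_integral cts_integrable has_test_deriv_cts[OF t] has_test_deriv_cts[OF \<theta>(1)])
      then show ?thesis using \<theta>(2) by (simp add: integral_unique m_def)
    qed
    from test_derivative_of_mean_zero[OF p this]
    have "integral\<^sup>L (Lb T) (\<lambda>x. U x * (\<phi> x + (- m) * \<theta> x)) = 0" using weak_derivD[OF dU] by fastforce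
    moreover have "integral\<^sup>L (Lb T) (\<lambda>x. U x * (\<phi> x + (- m) * \<theta> x)) = integral\<^sup>L (Lb T) (\<lambda>x. U x * \<phi> x) - m * c"
      using L2_mult[OF U test_L2(1)[OF t]] L2_mult[OF U test_L2(1)[OF \<theta>(1)]]
      by (simp add: right_diff_distrib mult.left_commute[of _ m] c_def)
    moreover have "m = integral\<^sup>L (Lb T) \<phi>" unfolding m_def by (rule Lb_cts(2)[OF has_test_deriv_cts[OF t], symmetric])
    moreover have "integral\<^sup>L (Lb T) (\<lambda>x. (U x - c) * \<phi> x) = integral\<^sup>L (Lb T) (\<lambda>x. U x * \<phi> x) - c * integral\<^sup>L (Lb T) \<phi>"
      using L2_mult[OF U test_L2(1)[OF t]] L2_integrable[OF test_L2(1)[OF t]] by (simp add: left_diff_distrib)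
    ultimately show "integral\<^sup>L (Lb T) (\<lambda>x. (U x - c) * \<phi> x) = 0" by (simp add: mult.commute)
  qed
  then have "AE x in Lb T. u x = c + J g x" by eventually_elim (simp add: U_def)
  then show ?thesis by blast
qed

lemma J_AE_cong:
  assumes "AE x in Lb T. f x = (g x::real)" "t \<le> T"
  shows "J f t = J g t"
proof -
  have "AE x in lebesgue. x \<in> {0<..<T} \<longrightarrow> f x = g x" using assms(1) by (simp add: AE_Lb_iff)
  then obtain N where N: "N \<in> null_sets lebesgue" "{x \<in> space lebesgue. \<not> (x \<in> {0<..<T} \<longrightarrow> f x = g x)} \<subseteq> N"
    unfolding eventually_ae_filter by auto
  have "negligible (N \<union> {0, T})" using N(1) by (simp add: negligible_iff_null_sets[symmetric] negligible_Un)
  then show ?thesis unfolding J_eq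
  proof (rule integral_spike)
    fix x assume "x \<in> {0..t} - (N \<union> {0, T})"
    then have x: "x \<in> {0<..<T}" "x \<notin> N" using assms(2) by auto
    show "g x = f x"
    proof (rule ccontr)
      assume "g x \<noteq> f x"
      then have "x \<in> {x \<in> space lebesgue. \<not> (x \<in> {0<..<T} \<longrightarrow> f x = g x)}" using x(1) by simp
      then show False using N(2) x(2) by blast
    qed
  qed
qed

text \<open>The form of M from which \<open>conv_sqrt\<close> starts. The second weak derivative
  makes the first one continuous on [0,T]; freezing it outside gives m1 on the whole line.\<close>

lemma H2_regularity:
  assumes T: "0 < T" and M: "M \<in> H2_fun 0 T"
  obtains m0 m1 where "cts m1" "AE x in Lb T. M x = m0 + J m1 x"
proof -
  obtain g where MH: "M \<in> H1_fun 0 T" and gH: "g \<in> H1_fun 0 T" and d: "has_weak_deriv 0 T M g" using M by (auto simp: H2_fun_def)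
  have MinL2: "M \<in> L2 T" and ginL2: "g \<in> L2 T" using MH gH by (auto simp: H1_fun_def)
  obtain h where h: "h \<in> L2 T" "has_weak_deriv 0 T g h" using gH by (auto simp: H1_fun_def)
  obtain c where c: "AE x in Lb T. g x = c + J h x" using weak_deriv_primitive[OF T ginL2 h] by blast
  define m1 where "m1 x = c + J h (min (max x 0) T)" for x
  have hc: "continuous_on {0..T} (J h)" by (rule J_continuous_on[OF L2_integrable[OF h(1)]])
  have m1: "cts m1" unfolding m1_def[abs_def]
    by (intro continuous_intros continuous_on_compose2[OF hc]) (use T in auto)
  have gm: "AE x in Lb T. g x = m1 x"
    using c AE_space by eventually_elim (auto simp: m1_def)
  obtain m0 where m0: "AE x in Lb T. M x = m0 + J g x" using weak_deriv_primitive[OF T MinL2 ginL2 d] by blast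
  have "AE x in Lb T. M x = m0 + J m1 x"
    using m0 AE_space by eventually_elim (use J_AE_cong[OF gm] in auto)
  then show ?thesis using that m1 by blast
qed

section \<open>Sine series\<close>

lemma L2_abs: "u \<in> L2 T \<Longrightarrow> (\<lambda>x. \<bar>u x\<bar>) \<in> L2 T"
  by (auto simp: L2_iff)

lemma L2_norm_one: "0 < T \<Longrightarrow> (L2_norm 0 T (\<lambda>_. 1))\<^sup>2 = T"
  unfolding L2_norm_sq using integral_Lb[OF Lb_const, of T 1] by simp

lemma L2_sq_add_le:
  assumes "u \<in> L2 T" "v \<in> L2 T"
  shows "integral\<^sup>L (Lb T) (\<lambda>x. (u x + v x)\<^sup>2) \<le> 2 * integral\<^sup>L (Lb T) (\<lambda>x. (u x)\<^sup>2) + 2 * integral\<^sup>L (Lb T) (\<lambda>x. (v x)\<^sup>2)"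
proof -
  have i: "integrable (Lb T) (\<lambda>x. (u x)\<^sup>2)" "integrable (Lb T) (\<lambda>x. (v x)\<^sup>2)" "integrable (Lb T) (\<lambda>x. (u x + v x)\<^sup>2)"
    using assms L2_add[OF assms] by (auto simp: L2_iff)
  have "integral\<^sup>L (Lb T) (\<lambda>x. (u x + v x)\<^sup>2) \<le> integral\<^sup>L (Lb T) (\<lambda>x. 2 * (u x)\<^sup>2 + 2 * (v x)\<^sup>2)"
  proof (rule integral_mono)
    fix x show "(u x + v x)\<^sup>2 \<le> 2 * (u x)\<^sup>2 + 2 * (v x)\<^sup>2"
      using zero_le_power2[of "u x - v x"] by (simp add: power2_eq_square algebra_simps)
  qed (use i in auto)
  then show ?thesis using i by simp
qed

lemma integral_abs_L2:
  assumes T: "0 < T" and f: "f \<in> L2 T"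
  shows "(integral {0..T} (\<lambda>x. \<bar>f x\<bar>))\<^sup>2 \<le> T * integral\<^sup>L (Lb T) (\<lambda>x. (f x)\<^sup>2)"
proof -
  have a: "(\<lambda>x. \<bar>f x\<bar>) \<in> L2 T" by (rule L2_abs[OF f])
  have "integral\<^sup>L (Lb T) (\<lambda>x. \<bar>f x\<bar> * 1) = integral {0..T} (\<lambda>x. \<bar>f x\<bar>)"
    using integral_Lb[OF L2_integrable[OF a]] by simp
  then have "\<bar>integral {0..T} (\<lambda>x. \<bar>f x\<bar>)\<bar> \<le> L2_norm 0 T (\<lambda>x. \<bar>f x\<bar>) * L2_norm 0 T (\<lambda>_. 1)"
    using L2_CS[OF a L2_cts[OF cts_const[of 1]]] by simp
  then have "\<bar>integral {0..T} (\<lambda>x. \<bar>f x\<bar>)\<bar>\<^sup>2 \<le> (L2_norm 0 T (\<lambda>x. \<bar>f x\<bar>) * L2_norm 0 T (\<lambda>_. 1))\<^sup>2"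
    by (intro power_mono) auto
  also have "\<dots> = T * integral\<^sup>L (Lb T) (\<lambda>x. (f x)\<^sup>2)"
    by (simp add: power_mult_distrib L2_norm_one[OF T]) (simp add: L2_norm_sq)
  finally show ?thesis by simp
qed

lemma conv_L2_bound:
  assumes T: "0 < T" and f: "f \<in> L2 T" and a: "cts a" "\<And>s. 0 \<le> s \<Longrightarrow> s \<le> T \<Longrightarrow> \<bar>a s\<bar> \<le> A" and t: "0 \<le> t" "t \<le> T"
  shows "\<bar>(a \<star> f) t\<bar> \<le> A * sqrt (T * integral\<^sup>L (Lb T) (\<lambda>x. (f x)\<^sup>2))"
proof -
  have fi: "f absolutely_integrable_on {0..T}" using L2_integrable[OF f] by (simp add: integrable_Lb_iff)
  have fi': "f absolutely_integrable_on {0..t}" by (rule set_integrable_subset[OF fi]) (use t in auto)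
  have A: "A \<ge> 0" using a(2)[of t] t by (meson abs_ge_zero order_trans)
  have "\<bar>(a \<star> f) t\<bar> \<le> A * integral {0..t} (\<lambda>s. \<bar>f s\<bar>)" by (rule conv_bound[OF _ a(1) fi']) (use a t in auto)
  also have "\<dots> \<le> A * integral {0..T} (\<lambda>s. \<bar>f s\<bar>)"
    by (intro mult_left_mono A integral_subset_le) (use fi fi' t in \<open>auto simp: absolutely_integrable_on_def\<close>)
  also have "\<dots> \<le> A * sqrt (T * integral\<^sup>L (Lb T) (\<lambda>x. (f x)\<^sup>2))"
    using integral_abs_L2[OF T f] by (intro mult_left_mono A real_le_rsqrt) auto
  finally show ?thesis .
qed

text \<open>A test function close to J k in H^1 is built from a continuous approximation of k: cut
  it off near the end points, subtract a multiple m of \<theta> to obtain mean zero, and integrate.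
  The correction m is small because k itself has mean zero.\<close>

lemma J_in_H10:
  assumes T: "0 < T" and k: "k \<in> L2 T" and z: "J k T = 0"
    and \<kappa>: "\<And>n. cts (\<kappa> n)" and lim: "(\<lambda>n. integral\<^sup>L (Lb T) (\<lambda>x. (\<kappa> n x - k x)\<^sup>2)) \<longlonglongrightarrow> 0"
  shows "J k \<in> H10_fun 0 T"
proof -
  have ki: "integrable (Lb T) k" by (rule L2_integrable[OF k])
  have Jk: "J k \<in> L2 T" by (rule continuous_on_L2[OF J_continuous_on[OF ki]])
  have dk: "has_weak_deriv 0 T (J k) k" by (rule J_weak_deriv[OF T ki])
  have H1: "J k \<in> H1_fun 0 T" using Jk k dk by (auto simp: H1_fun_def)
  obtain h where h: "\<forall>i. \<exists>h'. has_test_deriv T (h i) h'" "\<forall>i x. 0 \<le> h i x \<and> h i x \<le> 1"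
    "\<forall>x. (\<lambda>i. h i x) \<longlonglongrightarrow> indicator {0<..<T} x"
    using indicator_approximation[OF T order_refl] by metis
  have hc: "cts (h i)" for i using h(1) has_test_deriv_cts by blast
  obtain \<theta> \<theta>' where \<theta>: "has_test_deriv T \<theta> \<theta>'" "integral {0..T} \<theta> = 1" using unit_test[OF T] by blast
  have \<theta>c: "cts \<theta>" by (rule has_test_deriv_cts[OF \<theta>(1)])
  define N\<theta> where "N\<theta> = integral\<^sup>L (Lb T) (\<lambda>x. (\<theta> x)\<^sup>2)"
  have N\<theta>: "N\<theta> \<ge> 0" unfolding N\<theta>_def by (rule Bochner_Integration.integral_nonneg) simp
  have "\<exists>\<phi>\<in>test_fun 0 T. H1_norm 0 T (\<lambda>x. J k x - \<phi> x) < e" if e: "0 < e" for e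
  proof -
    \<comment> \<open>C collects the losses: q < 4 d after the cut-off, Q \<le> (2 + 2 T
      \<open>N\<theta>\<close>) q after the correction of the mean, and T^2 + 1 for passing from the
      derivative to the H^1 norm.\<close>
    define C where "C = (T\<^sup>2 + 1) * (2 + 2 * T * N\<theta>) * 4"
    have C: "C > 0" unfolding C_def using T N\<theta> by (intro mult_pos_pos add_nonneg_pos add_pos_nonneg mult_nonneg_nonneg) auto
    define d where "d = e\<^sup>2 / (2 * C)"
    have d: "d > 0" using e C by (simp add: d_def)
    from order_tendstoD(2)[OF lim d] obtain n where n: "integral\<^sup>L (Lb T) (\<lambda>x. (\<kappa> n x - k x)\<^sup>2) < d"
      by (auto simp: eventually_sequentially)
    have "(\<lambda>i. integral\<^sup>L (Lb T) (\<lambda>x. (\<kappa> n x - h i x * \<kappa> n x)\<^sup>2)) \<longlonglongrightarrow> integral\<^sup>L (Lb T) (\<lambda>x. 0)"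
    proof (rule integral_dominated_convergence[where w="\<lambda>x. (\<kappa> n x)\<^sup>2"])
      show "AE x in Lb T. (\<lambda>i. (\<kappa> n x - h i x * \<kappa> n x)\<^sup>2) \<longlonglongrightarrow> 0"
      proof (rule AE_I2)
        fix x assume "x \<in> space (Lb T)"
        then have "(\<lambda>i. h i x) \<longlonglongrightarrow> 1" using h(3)[rule_format, of x] by simp
        then have "(\<lambda>i. (\<kappa> n x - h i x * \<kappa> n x)\<^sup>2) \<longlonglongrightarrow> (\<kappa> n x - 1 * \<kappa> n x)\<^sup>2" by (intro tendsto_intros)
        then show "(\<lambda>i. (\<kappa> n x - h i x * \<kappa> n x)\<^sup>2) \<longlonglongrightarrow> 0" by simp
      qed
      show "AE x in Lb T. norm ((\<kappa> n x - h i x * \<kappa> n x)\<^sup>2) \<le> (\<kappa> n x)\<^sup>2" for i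
      proof (rule AE_I2)
        fix x
        have "(\<kappa> n x - h i x * \<kappa> n x)\<^sup>2 = (1 - h i x)\<^sup>2 * (\<kappa> n x)\<^sup>2" by (simp add: power2_eq_square algebra_simps)
        also have "\<dots> \<le> 1 * (\<kappa> n x)\<^sup>2" using h(2)[rule_format, of i x] by (intro mult_right_mono power_le_one) auto
        finally show "norm ((\<kappa> n x - h i x * \<kappa> n x)\<^sup>2) \<le> (\<kappa> n x)\<^sup>2" by simp
      qed
      show "(\<lambda>x. (\<kappa> n x - h i x * \<kappa> n x)\<^sup>2) \<in> borel_measurable (Lb T)" for i
        by (intro Lb_cts(3) continuous_intros \<kappa> hc)
    qed (use Lb_cts(1)[OF sq_cts[OF \<kappa>]] in auto)
    then have "(\<lambda>i. integral\<^sup>L (Lb T) (\<lambda>x. (\<kappa> n x - h i x * \<kappa> n x)\<^sup>2)) \<longlonglongrightarrow> 0" by simp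
    from order_tendstoD(2)[OF this d] obtain i where i: "integral\<^sup>L (Lb T) (\<lambda>x. (\<kappa> n x - h i x * \<kappa> n x)\<^sup>2) < d"
      by (auto simp: eventually_sequentially)
    define \<psi> where "\<psi> x = h i x * \<kappa> n x" for x
    have \<psi>c: "cts \<psi>" unfolding \<psi>_def[abs_def] by (intro continuous_intros hc \<kappa>)
    define q where "q = integral\<^sup>L (Lb T) (\<lambda>x. (\<psi> x - k x)\<^sup>2)"
    have "q = integral\<^sup>L (Lb T) (\<lambda>x. (- (\<kappa> n x - \<psi> x) + (\<kappa> n x - k x))\<^sup>2)" by (simp add: q_def)
    also have "\<dots> \<le> 2 * integral\<^sup>L (Lb T) (\<lambda>x. (- (\<kappa> n x - \<psi> x))\<^sup>2) + 2 * integral\<^sup>L (Lb T) (\<lambda>x. (\<kappa> n x - k x)\<^sup>2)"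
    proof (rule L2_sq_add_le)
      show "(\<lambda>x. - (\<kappa> n x - \<psi> x)) \<in> L2 T" by (rule L2_cts) (intro continuous_intros \<kappa> \<psi>c)
      show "(\<lambda>x. \<kappa> n x - k x) \<in> L2 T" by (rule L2_diff[OF L2_cts[OF \<kappa>] k])
    qed
    finally have q: "q < 4 * d" using n i by (simp add: \<psi>_def power2_commute)
    have q0: "q \<ge> 0" unfolding q_def by (rule Bochner_Integration.integral_nonneg) simp
    have \<psi>k: "(\<lambda>x. \<psi> x - k x) \<in> L2 T" by (intro L2_diff L2_cts \<psi>c k)
    define m where "m = integral {0..T} \<psi>"
    have "m = integral\<^sup>L (Lb T) (\<lambda>x. \<psi> x - k x)"
      using Lb_cts(1)[OF \<psi>c, of T] ki integral_Lb[OF ki] z by (simp add: m_def Lb_cts(2)[OF \<psi>c] J_eq)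
    then have "\<bar>m\<bar> \<le> L2_norm 0 T (\<lambda>x. \<psi> x - k x) * L2_norm 0 T (\<lambda>_. 1)"
      using L2_CS[OF \<psi>k L2_cts[OF cts_const[of 1]]] by simp
    then have "\<bar>m\<bar>\<^sup>2 \<le> (L2_norm 0 T (\<lambda>x. \<psi> x - k x) * L2_norm 0 T (\<lambda>_. 1))\<^sup>2" by (intro power_mono) auto
    then have m2: "m\<^sup>2 \<le> q * T" by (simp add: power_mult_distrib L2_norm_one[OF T]) (simp add: L2_norm_sq q_def)
    define \<kappa>' where "\<kappa>' x = \<psi> x - m * \<theta> x" for x
    have \<kappa>'c: "cts \<kappa>'" unfolding \<kappa>'_def[abs_def] by (intro continuous_intros \<psi>c \<theta>c)
    obtain h' where h': "has_test_deriv T (h i) h'" using h(1) by blast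
    obtain a b where ab: "0 < a" "a \<le> b" "b < T" "\<And>x. x \<notin> {a..b} \<Longrightarrow> h i x = 0" using h' unfolding has_test_deriv_def by blast
    obtain a' b' where ab': "0 < a'" "a' \<le> b'" "b' < T" "\<And>x. x \<notin> {a'..b'} \<Longrightarrow> \<theta> x = 0" using \<theta>(1) unfolding has_test_deriv_def by blast
    have "integral {0..T} \<kappa>' = 0"
    proof -
      have "((\<lambda>x. \<psi> x - m * \<theta> x) has_integral (integral {0..T} \<psi> - m * integral {0..T} \<theta>)) {0..T}"
        by (intro has_integral_diff has_integral_mult_right integrable_integral cts_integrable \<psi>c \<theta>c)
      then show ?thesis using \<theta>(2) by (simp add: \<kappa>'_def[abs_def] m_def integral_unique)
    qed
    then have t: "has_test_deriv T (J \<kappa>') \<kappa>'"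
    proof (rule J_test[OF \<kappa>'c, of "min a a'" "max b b'", rotated 4])
      fix x assume "x \<notin> {min a a'..max b b'}"
      then have "x \<notin> {a..b}" "x \<notin> {a'..b'}" by auto
      then show "\<kappa>' x = 0" using ab ab' by (simp add: \<kappa>'_def \<psi>_def)
    qed (use ab ab' in auto)
    define f where "f x = k x - \<kappa>' x" for x
    have fL: "f \<in> L2 T" unfolding f_def[abs_def] by (intro L2_diff k L2_cts \<kappa>'c)
    define Q where "Q = integral\<^sup>L (Lb T) (\<lambda>x. (f x)\<^sup>2)"
    have "Q = integral\<^sup>L (Lb T) (\<lambda>x. ((-1) * (\<psi> x - k x) + m * \<theta> x)\<^sup>2)" by (simp add: Q_def f_def \<kappa>'_def algebra_simps)
    also have "\<dots> \<le> 2 * integral\<^sup>L (Lb T) (\<lambda>x. ((-1) * (\<psi> x - k x))\<^sup>2) + 2 * integral\<^sup>L (Lb T) (\<lambda>x. (m * \<theta> x)\<^sup>2)"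
      by (rule L2_sq_add_le) (intro L2_scale \<psi>k L2_cts[OF \<theta>c])+
    also have "\<dots> = 2 * q + 2 * (m\<^sup>2 * N\<theta>)" by (simp add: power_mult_distrib q_def N\<theta>_def power2_commute)
    also have "\<dots> \<le> 2 * q + 2 * (q * T * N\<theta>)" using m2 N\<theta> by (intro add_left_mono mult_left_mono mult_right_mono) auto
    finally have Q: "Q \<le> (2 + 2 * T * N\<theta>) * q" by (simp add: algebra_simps)
    have Q0: "Q \<ge> 0" unfolding Q_def by (rule Bochner_Integration.integral_nonneg) simp
    have Jd: "J k x - J \<kappa>' x = J f x" if "x \<in> {0..T}" for x
    proof -
      have "k integrable_on {0..x}"
        by (rule integrable_subinterval_real[of k 0 T]) (use ki that in \<open>auto simp: integrable_Lb_iff absolutely_integrable_on_def\<close>)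
      then show ?thesis unfolding J_eq f_def[abs_def] using cts_integrable[OF \<kappa>'c, of 0 x] by (simp add: integral_diff)
    qed
    have Jsq: "(J k x - J \<kappa>' x)\<^sup>2 \<le> T * Q" if "x \<in> {0<..<T}" for x
    proof -
      have "\<bar>J f x\<bar> \<le> 1 * sqrt (T * Q)" unfolding Q_def by (rule conv_L2_bound[OF T fL]) (use that in auto)
      then have "\<bar>J f x\<bar>\<^sup>2 \<le> (sqrt (T * Q))\<^sup>2" by (intro power_mono) auto
      then show ?thesis using T Q0 that by (simp add: Jd)
    qed
    have J\<kappa>: "J \<kappa>' \<in> L2 T" by (intro L2_cts conv_cts \<kappa>'c) auto
    have uL: "(\<lambda>x. J k x - J \<kappa>' x) \<in> L2 T" by (intro L2_diff Jk J\<kappa>)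
    have "integral\<^sup>L (Lb T) (\<lambda>x. (J k x - J \<kappa>' x)\<^sup>2) \<le> integral\<^sup>L (Lb T) (\<lambda>x. T * Q)"
      by (rule integral_mono) (use uL Jsq Lb_const in \<open>auto simp: L2_iff\<close>)
    also have "\<dots> = T * (T * Q)" using integral_Lb[OF Lb_const, of T "T * Q"] T by simp
    finally have 1: "(L2_norm 0 T (\<lambda>x. J k x - J \<kappa>' x))\<^sup>2 \<le> T\<^sup>2 * Q" unfolding L2_norm_sq by (simp add: power2_eq_square mult.assoc)
    have wd: "has_weak_deriv 0 T (\<lambda>x. J k x - J \<kappa>' x) f"
      unfolding f_def[abs_def] by (rule weak_deriv_diff[OF T Jk J\<kappa> k L2_cts[OF \<kappa>'c] dk J_weak_deriv[OF T Lb_cts(1)[OF \<kappa>'c]]])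
    have "(L2_norm 0 T (\<lambda>x. J k x - J \<kappa>' x))\<^sup>2 + (L2_norm 0 T f)\<^sup>2 \<le> (T\<^sup>2 + 1) * Q"
      using 1 by (simp add: L2_norm_sq[of T f] Q_def[symmetric] algebra_simps)
    also have "\<dots> \<le> (T\<^sup>2 + 1) * ((2 + 2 * T * N\<theta>) * q)" using Q by (intro mult_left_mono) auto
    also have "\<dots> \<le> (T\<^sup>2 + 1) * ((2 + 2 * T * N\<theta>) * (4 * d))" using q T N\<theta> by (intro mult_left_mono) auto
    also have "\<dots> = C * d" by (simp add: C_def)
    also have "\<dots> < e\<^sup>2" using C e by (simp add: d_def)
    finally have "H1_norm 0 T (\<lambda>x. J k x - J \<kappa>' x) < sqrt (e\<^sup>2)"
      unfolding H1_norm_eq[OF T uL fL wd] by (rule real_sqrt_less_mono)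
    then show ?thesis using has_test_deriv_test[OF t] e by (intro bexI[of _ "J \<kappa>'"]) auto
  qed
  then show ?thesis using H1 by (simp add: H10_fun_def)
qed

section \<open>Orthonormal sines and cosines\<close>

lemma integral_cos_pi: "integral {0..pi} (\<lambda>s. cos (real_of_int k * s)) = (if k = 0 then pi else 0)"
proof (cases "k = 0")
  case False
  have "((\<lambda>s. cos (real_of_int k * s)) has_integral (sin (real_of_int k * pi) / k - sin (real_of_int k * 0) / k)) {0..pi}"
    by (rule fundamental_theorem_of_calculus)
       (use False in \<open>auto intro!: derivative_eq_intros simp flip: has_real_derivative_iff_has_vector_derivative\<close>)
  moreover have "sin (real_of_int k * pi) = 0" using sin_int_times_real sin_zero_iff_int2 by blast
  ultimately show ?thesis using False by (auto dest: integral_unique)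
qed simp

text \<open>The derivative of \<open>Phi n\<close> is n times \<open>Psi n\<close>; cosine
  coefficients are those of weak derivatives.\<close>

definition Psi :: "nat \<Rightarrow> real \<Rightarrow> real" where "Psi n x = sqrt (2 / pi) * cos (real n * x)"

lemma Phi_cts: "cts (Phi n)" and Psi_cts: "cts (Psi n)"
  unfolding Phi_def[abs_def] Psi_def[abs_def] by (intro continuous_intros)+

lemma Phi_orthonormal:
  assumes "1 \<le> m" "1 \<le> n"
  shows "integral {0..pi} (\<lambda>x. Phi m x * Phi n x) = (if m = n then 1 else 0)"
    "integral {0..pi} (\<lambda>x. Psi m x * Psi n x) = (if m = n then 1 else 0)"
proof -
  have pp: "sqrt (2 / pi) * sqrt (2 / pi) = 2 / pi" using pi_gt_zero by simp
  have "(\<lambda>x. Phi m x * Phi n x) = (\<lambda>x. (1 / pi) * (cos (real_of_int (int m - int n) * x) - cos (real_of_int (int m + int n) * x)))"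
  proof
    fix x
    have "Phi m x * Phi n x = (sqrt (2 / pi) * sqrt (2 / pi)) * (sin (real m * x) * sin (real n * x))" by (simp add: Phi_def mult_ac)
    also have "\<dots> = (1 / pi) * (cos (real_of_int (int m - int n) * x) - cos (real_of_int (int m + int n) * x))"
      unfolding pp by (simp add: sin_times_sin left_diff_distrib distrib_right field_simps)
    finally show "Phi m x * Phi n x = (1 / pi) * (cos (real_of_int (int m - int n) * x) - cos (real_of_int (int m + int n) * x))" .
  qed
  then have "integral {0..pi} (\<lambda>x. Phi m x * Phi n x) = (1 / pi) * (integral {0..pi} (\<lambda>x. cos (real_of_int (int m - int n) * x)) - integral {0..pi} (\<lambda>x. cos (real_of_int (int m + int n) * x)))"
    by (simp only: integral_mult_right integral_diff int_cos_cts)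
  then show "integral {0..pi} (\<lambda>x. Phi m x * Phi n x) = (if m = n then 1 else 0)"
    unfolding integral_cos_pi using assms by auto
  have "(\<lambda>x. Psi m x * Psi n x) = (\<lambda>x. (1 / pi) * (cos (real_of_int (int m - int n) * x) + cos (real_of_int (int m + int n) * x)))"
  proof
    fix x
    have "Psi m x * Psi n x = (sqrt (2 / pi) * sqrt (2 / pi)) * (cos (real m * x) * cos (real n * x))" by (simp add: Psi_def mult_ac)
    also have "\<dots> = (1 / pi) * (cos (real_of_int (int m - int n) * x) + cos (real_of_int (int m + int n) * x))"
      unfolding pp by (simp add: cos_times_cos left_diff_distrib distrib_right field_simps)
    finally show "Psi m x * Psi n x = (1 / pi) * (cos (real_of_int (int m - int n) * x) + cos (real_of_int (int m + int n) * x))" .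
  qed
  then have "integral {0..pi} (\<lambda>x. Psi m x * Psi n x) = (1 / pi) * (integral {0..pi} (\<lambda>x. cos (real_of_int (int m - int n) * x)) + integral {0..pi} (\<lambda>x. cos (real_of_int (int m + int n) * x)))"
    by (simp only: integral_mult_right integral_add int_cos_cts)
  then show "integral {0..pi} (\<lambda>x. Psi m x * Psi n x) = (if m = n then 1 else 0)"
    unfolding integral_cos_pi using assms by auto
qed

text \<open>u is tested against its own projection V. The pairing and the square norm of V are the
  same number q, so q \<le> ||u|| sqrt q.\<close>

lemma bessel:
  fixes e :: "nat \<Rightarrow> real \<Rightarrow> real"
  assumes e: "\<And>n. cts (e n)" and on: "\<And>m n. m \<in> S \<Longrightarrow> n \<in> S \<Longrightarrow> integral {0..T} (\<lambda>x. e m x * e n x) = (if m = n then 1 else 0)"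
    and u: "u \<in> L2 T" and S: "finite S"
  shows "(\<Sum>n\<in>S. (integral\<^sup>L (Lb T) (\<lambda>x. u x * e n x))\<^sup>2) \<le> (L2_norm 0 T u)\<^sup>2"
proof -
  define x where "x n = integral\<^sup>L (Lb T) (\<lambda>y. u y * e n y)" for n
  let ?q = "\<Sum>n\<in>S. (x n)\<^sup>2"
  let ?V = "\<lambda>y. \<Sum>n\<in>S. x n * e n y"
  have V: "cts ?V" by (intro continuous_intros e)
  have eL: "e n \<in> L2 T" for n by (rule L2_cts[OF e])
  have "integral\<^sup>L (Lb T) (\<lambda>y. u y * ?V y) = (\<Sum>n\<in>S. x n * x n)"
  proof -
    have "(\<lambda>y. u y * ?V y) = (\<lambda>y. \<Sum>n\<in>S. x n * (u y * e n y))" by (simp add: sum_distrib_left mult_ac)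
    then show ?thesis using L2_mult[OF u eL] by (simp add: x_def)
  qed
  then have 1: "integral\<^sup>L (Lb T) (\<lambda>y. u y * ?V y) = ?q" by (simp add: power2_eq_square)
  have "(L2_norm 0 T ?V)\<^sup>2 = integral {0..T} (\<lambda>y. (?V y)\<^sup>2)" unfolding L2_norm_sq by (rule Lb_cts(2)[OF sq_cts[OF V]])
  also have "\<dots> = (\<Sum>m\<in>S. \<Sum>n\<in>S. x m * x n * integral {0..T} (\<lambda>y. e m y * e n y))"
  proof -
    have i: "(\<lambda>y. c * (e m y * e n y)) integrable_on {0..T}" for c m n by (intro cts_integrable continuous_intros e)
    have "(\<lambda>y. (?V y)\<^sup>2) = (\<lambda>y. \<Sum>m\<in>S. \<Sum>n\<in>S. (x m * x n) * (e m y * e n y))" by (auto simp: power2_eq_square sum_product mult_ac)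
    then show ?thesis using S by (simp add: integral_sum integrable_sum i)
  qed
  also have "\<dots> = (\<Sum>m\<in>S. \<Sum>n\<in>S. if n = m then (x m)\<^sup>2 else 0)"
    by (intro sum.cong refl) (auto simp: on power2_eq_square)
  also have "\<dots> = ?q" using S by (intro sum.cong refl) (simp add: sum.delta)
  finally have 2: "(L2_norm 0 T ?V)\<^sup>2 = ?q" .
  have q0: "?q \<ge> 0" by (intro sum_nonneg) auto
  have "?q \<le> L2_norm 0 T u * L2_norm 0 T ?V" using L2_CS[OF u L2_cts[OF V]] 1 q0 by simp
  then have "?q\<^sup>2 \<le> (L2_norm 0 T u * L2_norm 0 T ?V)\<^sup>2" using q0 by (intro power_mono) auto
  then have "?q * ?q \<le> (L2_norm 0 T u)\<^sup>2 * ?q" by (simp add: power_mult_distrib 2 power2_eq_square[of ?q])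
  then show ?thesis using q0 unfolding x_def[symmetric] by (cases "?q = 0") (auto simp: mult_le_cancel_right)
qed

lemma sine_coeff_eq: "sine_coeff n u = integral\<^sup>L (Lb pi) (\<lambda>x. u x * Phi n x)"
  unfolding sine_coeff_def LINT_Lb by (simp add: mult.commute)

lemma divide_plus_one_mult_le: "0 < e \<Longrightarrow> 0 \<le> C \<Longrightarrow> e / (C + 1) * C \<le> (e::real)"
  by (simp add: field_simps)

text \<open>Integration by parts. The boundary terms vanish for test functions, and the definition
  of H^1_0 as a closure extends the identity. Together with \<open>bessel\<close> it makes n times
  the coefficients of \<xi> square summable.\<close>

lemma H10_sine_coeff:
  assumes "u \<in> H10_fun 0 pi"
  shows "\<exists>g\<in>L2 pi. (L2_norm 0 pi g \<le> H1_norm 0 pi u) \<and> (\<forall>n. real n * sine_coeff n u = integral\<^sup>L (Lb pi) (\<lambda>x. g x * Psi n x))"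
proof -
  have T: "0 < pi" by simp
  have uH: "u \<in> H1_fun 0 pi" and ap: "\<And>e. 0 < e \<Longrightarrow> \<exists>\<phi>\<in>test_fun 0 pi. H1_norm 0 pi (\<lambda>x. u x - \<phi> x) < e"
    using assms by (auto simp: H10_fun_def)
  have u: "u \<in> L2 pi" using uH by (simp add: H1_fun_def)
  define g where "g = weak_deriv 0 pi u"
  have g: "g \<in> L2 pi" "has_weak_deriv 0 pi u g" unfolding g_def using H1_weak_deriv[OF uH] by auto
  have "L2_norm 0 pi g = sqrt ((L2_norm 0 pi g)\<^sup>2)" by (simp add: L2_norm_nonneg)
  also have "\<dots> \<le> H1_norm 0 pi u" unfolding H1_norm_def g_def[symmetric] by (intro real_sqrt_le_mono) simp
  finally have le: "L2_norm 0 pi g \<le> H1_norm 0 pi u" .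
  have PL: "Phi n \<in> L2 pi" "Psi n \<in> L2 pi" for n by (rule L2_cts[OF Phi_cts], rule L2_cts[OF Psi_cts])
  have "real n * sine_coeff n u = integral\<^sup>L (Lb pi) (\<lambda>x. g x * Psi n x)" for n
  proof -
    \<comment> \<open>The defect of the identity: it vanishes on test functions and is bounded by
      \<open>?C\<close> times the H^1 norm.\<close>
    let ?D = "real n * sine_coeff n u - integral\<^sup>L (Lb pi) (\<lambda>x. g x * Psi n x)"
    let ?C = "real n * L2_norm 0 pi (Phi n) + L2_norm 0 pi (Psi n)"
    have C0: "?C \<ge> 0" by (simp add: L2_norm_nonneg)
    have "\<bar>?D\<bar> \<le> 0 + e" if e: "0 < e" for e
    proof -
      have "0 < e / (?C + 1)" using e C0 by simp
      from ap[OF this] obtain \<phi> where \<phi>: "\<phi> \<in> test_fun 0 pi" "H1_norm 0 pi (\<lambda>x. u x - \<phi> x) < e / (?C + 1)" by blast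
      have t: "has_test_deriv pi \<phi> (deriv \<phi>)" by (rule test_has_test_deriv[OF \<phi>(1) T])
      have \<phi>L: "\<phi> \<in> L2 pi" "deriv \<phi> \<in> L2 pi" by (rule test_L2[OF t])+
      have dc: "cts (deriv \<phi>)" and c: "cts \<phi>" using t has_test_deriv_cts[OF t] by (auto simp: has_test_deriv_def)
      have dd: "\<And>x. (\<phi> has_real_derivative deriv \<phi> x) (at x)" using t by (simp add: has_test_deriv_def)
      obtain a b where ab: "0 < a" "a \<le> b" "b < pi" "\<And>x. x \<notin> {a..b} \<Longrightarrow> \<phi> x = 0" using t unfolding has_test_deriv_def by blast
      have ends: "\<phi> 0 = 0" "\<phi> pi = 0" using ab by auto
      have "((\<lambda>x. deriv \<phi> x * Psi n x - real n * (\<phi> x * Phi n x)) has_integral (\<phi> pi * Psi n pi - \<phi> 0 * Psi n 0)) {0..pi}"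
        by (rule fundamental_theorem_of_calculus)
           (auto intro!: derivative_eq_intros has_field_derivative_at_within[OF dd] simp: Psi_def[abs_def] Phi_def algebra_simps simp flip: has_real_derivative_iff_has_vector_derivative)
      then have "integral {0..pi} (\<lambda>x. deriv \<phi> x * Psi n x - real n * (\<phi> x * Phi n x)) = 0" using ends by (simp add: integral_unique)
      then have "integral\<^sup>L (Lb pi) (\<lambda>x. deriv \<phi> x * Psi n x - real n * (\<phi> x * Phi n x)) = 0"
        by (subst Lb_cts(2)) (auto intro!: continuous_intros dc c Psi_cts Phi_cts)
      then have t0: "integral\<^sup>L (Lb pi) (\<lambda>x. deriv \<phi> x * Psi n x) = real n * integral\<^sup>L (Lb pi) (\<lambda>x. \<phi> x * Phi n x)"
        using L2_mult[OF \<phi>L(2) PL(2)] L2_mult[OF \<phi>L(1) PL(1)] by simp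
      have uL: "(\<lambda>x. u x - \<phi> x) \<in> L2 pi" "(\<lambda>x. g x - deriv \<phi> x) \<in> L2 pi" by (intro L2_diff u g \<phi>L)+
      have "has_weak_deriv 0 pi \<phi> (deriv \<phi>)"
      proof -
        have J: "\<phi> x = J (deriv \<phi>) x" if "0 \<le> x" for x using FTC_J[OF dd that] ends by simp
        have "has_weak_deriv 0 pi (J (deriv \<phi>)) (deriv \<phi>)" by (rule J_weak_deriv[OF T L2_integrable[OF \<phi>L(2)]])
        moreover have "integral\<^sup>L (Lb pi) (\<lambda>x. \<phi> x * f x) = integral\<^sup>L (Lb pi) (\<lambda>x. J (deriv \<phi>) x * f x)" for f
          by (rule Bochner_Integration.integral_cong) (auto simp: J)
        ultimately show ?thesis unfolding has_weak_deriv_def LINT_Lb by simp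
      qed
      from weak_deriv_diff[OF T u \<phi>L(1) g(1) \<phi>L(2) g(2) this]
      have wd: "has_weak_deriv 0 pi (\<lambda>x. u x - \<phi> x) (\<lambda>x. g x - deriv \<phi> x)" .
      let ?h = "H1_norm 0 pi (\<lambda>x. u x - \<phi> x)"
      have n1: "L2_norm 0 pi (\<lambda>x. u x - \<phi> x) \<le> ?h" "L2_norm 0 pi (\<lambda>x. g x - deriv \<phi> x) \<le> ?h"
        unfolding H1_norm_eq[OF T uL wd] by (auto intro!: real_le_rsqrt)
      have e1: "?D = real n * integral\<^sup>L (Lb pi) (\<lambda>x. (u x - \<phi> x) * Phi n x) - integral\<^sup>L (Lb pi) (\<lambda>x. (g x - deriv \<phi> x) * Psi n x)"
        using t0 L2_mult[OF u PL(1)] L2_mult[OF \<phi>L(1) PL(1)] L2_mult[OF g(1) PL(2)] L2_mult[OF \<phi>L(2) PL(2)]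
        by (simp add: sine_coeff_eq left_diff_distrib right_diff_distrib)
      have "\<bar>real n * integral\<^sup>L (Lb pi) (\<lambda>x. (u x - \<phi> x) * Phi n x) - integral\<^sup>L (Lb pi) (\<lambda>x. (g x - deriv \<phi> x) * Psi n x)\<bar> \<le> real n * (L2_norm 0 pi (\<lambda>x. u x - \<phi> x) * L2_norm 0 pi (Phi n)) + L2_norm 0 pi (\<lambda>x. g x - deriv \<phi> x) * L2_norm 0 pi (Psi n)"
        (is "\<bar>real n * ?x - ?y\<bar> \<le> _")
      proof -
        have "\<bar>real n * ?x - ?y\<bar> \<le> real n * \<bar>?x\<bar> + \<bar>?y\<bar>" using abs_triangle_ineq4[of "real n * ?x" ?y] by (simp add: abs_mult)
        also have "\<dots> \<le> real n * (L2_norm 0 pi (\<lambda>x. u x - \<phi> x) * L2_norm 0 pi (Phi n)) + L2_norm 0 pi (\<lambda>x. g x - deriv \<phi> x) * L2_norm 0 pi (Psi n)"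
          by (rule add_mono[OF mult_left_mono[OF L2_CS[OF uL(1) PL(1)]] L2_CS[OF uL(2) PL(2)]]) simp
        finally show ?thesis .
      qed
      also have "\<dots> \<le> real n * (?h * L2_norm 0 pi (Phi n)) + ?h * L2_norm 0 pi (Psi n)"
        by (rule add_mono[OF mult_left_mono[OF mult_right_mono[OF n1(1) L2_norm_nonneg]] mult_right_mono[OF n1(2) L2_norm_nonneg]]) simp
      also have "\<dots> = ?h * ?C" by (simp only: distrib_left mult.left_commute mult.assoc)
      also have "\<dots> \<le> e / (?C + 1) * ?C" by (rule mult_right_mono[OF less_imp_le[OF \<phi>(2)] C0])
      also have "\<dots> \<le> e" by (rule divide_plus_one_mult_le[OF e C0])
      finally show ?thesis unfolding e1 by (simp only: add_0)
    qed
    then have "\<bar>?D\<bar> \<le> 0" by (rule field_le_epsilon)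
    then show ?thesis by simp
  qed
  then show ?thesis using g le by blast
qed

lemma L2_limit_Lb:
  fixes u :: "nat \<Rightarrow> real \<Rightarrow> real"
  assumes u: "\<And>n. cts (u n)" and T: "0 \<le> T"
    and cau: "\<And>e. 0 < e \<Longrightarrow> \<exists>K. \<forall>m\<ge>K. \<forall>n\<ge>K. nrm2 T (\<lambda>s. u m s - u n s) < e"
  obtains g where "g \<in> L2 T" "(\<lambda>n. integral\<^sup>L (Lb T) (\<lambda>x. (u n x - g x)\<^sup>2)) \<longlonglongrightarrow> 0"
proof -
  note outer = that
  have main: thesis if g: "g \<in> borel_measurable borel" "\<And>x. x \<notin> {0..T} \<Longrightarrow> g x = 0" "integrable lborel (\<lambda>x. (g x)\<^sup>2)"
    "\<And>n. integrable lborel (\<lambda>x. indicator {0..T} x * (u n x - g x)\<^sup>2)"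
    and lim: "(\<lambda>n. LBINT x. indicator {0..T} x * (u n x - g x)\<^sup>2) \<longlonglongrightarrow> 0"
    for g
  proof -
    note [measurable] = g(1)
    have gL: "g \<in> L2 T"
    proof -
      have "g \<in> borel_measurable lebesgue" using g(1) by (intro measurable_completion) simp
      moreover have "integrable lebesgue (\<lambda>x. (g x)\<^sup>2)" using g(3) by (subst integrable_completion) auto
      then have "set_integrable lebesgue {0<..<T} (\<lambda>x. (g x)\<^sup>2)"
        unfolding set_integrable_def by (intro integrable_mult_indicator) auto
      ultimately show ?thesis unfolding L2_iff set_integrable_Lb[symmetric] by (simp add: measurable_restrict_space1)
    qed
    have "integral\<^sup>L (Lb T) (\<lambda>x. (u n x - g x)\<^sup>2) = (LBINT x. indicator {0..T} x * (u n x - g x)\<^sup>2)" for n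
    proof -
      have [measurable]: "u n \<in> borel_measurable borel" by (rule cts_measurable[OF u])
      have "integral\<^sup>L (Lb T) (\<lambda>x. (u n x - g x)\<^sup>2) = integral\<^sup>L lebesgue (\<lambda>x. indicator {0<..<T} x * (u n x - g x)\<^sup>2)"
        unfolding LINT_Lb[symmetric] set_lebesgue_integral_def by simp
      also have "\<dots> = integral\<^sup>L lborel (\<lambda>x. indicator {0<..<T} x * (u n x - g x)\<^sup>2)"
        by (rule integral_completion) measurable
      also have "\<dots> = (LBINT x. indicator {0..T} x * (u n x - g x)\<^sup>2)"
      proof (rule integral_cong_AE)
        have "AE x in lborel. x \<noteq> 0 \<and> x \<noteq> T" using AE_lborel_singleton[of 0] AE_lborel_singleton[of T] by eventually_elim simp
        then show "AE x in lborel. indicator {0<..<T} x * (u n x - g x)\<^sup>2 = indicator {0..T} x * (u n x - g x)\<^sup>2"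
          by eventually_elim (auto simp: indicator_def)
      qed measurable
      finally show ?thesis .
    qed
    then show thesis using outer[OF gL] lim by simp
  qed
  show thesis
    by (rule L2_limit[where u=u and T=T, OF u T]) (erule cau, rule main)
qed

lemma L2_tendsto_integral:
  assumes u: "\<And>n. u n \<in> L2 T" and g: "g \<in> L2 T" and v: "v \<in> L2 T"
    and lim: "(\<lambda>n. integral\<^sup>L (Lb T) (\<lambda>x. (u n x - g x)\<^sup>2)) \<longlonglongrightarrow> 0"
  shows "(\<lambda>n. integral\<^sup>L (Lb T) (\<lambda>x. u n x * v x)) \<longlonglongrightarrow> integral\<^sup>L (Lb T) (\<lambda>x. g x * v x)"
proof -
  have "(\<lambda>n. integral\<^sup>L (Lb T) (\<lambda>x. u n x * v x) - integral\<^sup>L (Lb T) (\<lambda>x. g x * v x)) \<longlonglongrightarrow> 0"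
  proof (rule Lim_null_comparison)
    have "(\<lambda>n. sqrt (integral\<^sup>L (Lb T) (\<lambda>x. (u n x - g x)\<^sup>2)) * L2_norm 0 T v) \<longlonglongrightarrow> sqrt 0 * L2_norm 0 T v"
      by (intro tendsto_intros lim)
    then show "(\<lambda>n. L2_norm 0 T (\<lambda>x. u n x - g x) * L2_norm 0 T v) \<longlonglongrightarrow> 0" by (simp add: L2_norm_def LINT_Lb)
    show "\<forall>\<^sub>F n in sequentially. norm (integral\<^sup>L (Lb T) (\<lambda>x. u n x * v x) - integral\<^sup>L (Lb T) (\<lambda>x. g x * v x))
        \<le> L2_norm 0 T (\<lambda>x. u n x - g x) * L2_norm 0 T v"
    proof (intro always_eventually allI)
      fix n
      have "integral\<^sup>L (Lb T) (\<lambda>x. u n x * v x) - integral\<^sup>L (Lb T) (\<lambda>x. g x * v x) = integral\<^sup>L (Lb T) (\<lambda>x. (u n x - g x) * v x)"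
        using L2_mult[OF u v] L2_mult[OF g v] by (simp add: left_diff_distrib)
      then show "norm (integral\<^sup>L (Lb T) (\<lambda>x. u n x * v x) - integral\<^sup>L (Lb T) (\<lambda>x. g x * v x))
        \<le> L2_norm 0 T (\<lambda>x. u n x - g x) * L2_norm 0 T v" using L2_CS[OF L2_diff[OF u g] v] by simp
    qed
  qed
  then show ?thesis using LIM_zero_iff by blast
qed

section \<open>Completeness of the sines and expansions\<close>

text \<open>The hypothesis yields vanishing integrals of u x sin x p (cos x) for all polynomials p,
  and these p (cos x) approximate every test function uniformly. So u x sin x = 0 almost everywhere,
  and sin x > 0 inside (0,pi).\<close>

lemma sine_completeness:
  assumes u: "u \<in> L2 pi" and z: "\<And>n. 1 \<le> n \<Longrightarrow> sine_coeff n u = 0"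
  shows "AE x in Lb pi. u x = 0"
proof -
  have c: "integrable (Lb pi) (\<lambda>x. u x * g x)" if "cts g" for g by (rule L2_mult[OF u L2_cts[OF that]])
  have sc: "integral\<^sup>L (Lb pi) (\<lambda>x. u x * sin (real n * x)) = 0" for n
  proof (cases "n = 0")
    case False
    have "u x * Phi n x = sqrt (2 / pi) * (u x * sin (real n * x))" for x by (simp add: Phi_def)
    then have "sine_coeff n u = sqrt (2 / pi) * integral\<^sup>L (Lb pi) (\<lambda>x. u x * sin (real n * x))"
      by (simp only: sine_coeff_eq integral_mult_right_zero)
    then show ?thesis using z[of n] False by simp
  qed simp
  \<comment> \<open>A factor cos x spreads sin (n x) to its neighbours n + 1 and n - 1, so vanishing
    for all n passes from m to m + 1.\<close>
  have pw: "integral\<^sup>L (Lb pi) (\<lambda>x. u x * (sin (real n * x) * cos x ^ m)) = 0" for n m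
  proof (induction m arbitrary: n)
    case 0 then show ?case using sc by simp
  next
    case (Suc m)
    show ?case
    proof (cases n)
      case (Suc k)
      have "u x * (sin (real n * x) * cos x ^ Suc m)
        = (1 / 2) * (u x * (sin (real (k + 2) * x) * cos x ^ m)) + (1 / 2) * (u x * (sin (real k * x) * cos x ^ m))" for x
      proof -
        have "sin (real n * x) * cos x = (sin (real (k + 2) * x) + sin (real k * x)) / 2"
          using sin_times_cos[of "real n * x" x] by (simp add: Suc algebra_simps)
        then have "u x * cos x ^ m * (sin (real n * x) * cos x) = u x * cos x ^ m * ((sin (real (k + 2) * x) + sin (real k * x)) / 2)" by simp
        then show ?thesis by (simp add: algebra_simps)
      qed
      then have "integral\<^sup>L (Lb pi) (\<lambda>x. u x * (sin (real n * x) * cos x ^ Suc m))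
        = integral\<^sup>L (Lb pi) (\<lambda>x. (1 / 2) * (u x * (sin (real (k + 2) * x) * cos x ^ m)) + (1 / 2) * (u x * (sin (real k * x) * cos x ^ m)))"
        by (intro Bochner_Integration.integral_cong) auto
      also have "\<dots> = (1 / 2) * integral\<^sup>L (Lb pi) (\<lambda>x. u x * (sin (real (k + 2) * x) * cos x ^ m))
          + (1 / 2) * integral\<^sup>L (Lb pi) (\<lambda>x. u x * (sin (real k * x) * cos x ^ m))"
        by (subst Bochner_Integration.integral_add) (auto intro!: integrable_mult_right c continuous_intros simp only: integral_mult_right_zero)
      finally show ?thesis unfolding Suc.IH by (simp only: mult_zero_right add_0)
    qed simp
  qed
  have "AE x in Lb pi. u x * sin x = 0"
  proof (rule zero_of_test_integrals)
    show "integrable (Lb pi) (\<lambda>x. u x * sin x)" by (intro c continuous_intros)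
    fix \<phi> \<phi>' assume t: "has_test_deriv pi \<phi> \<phi>'"
    have \<phi>c: "cts \<phi>" by (rule has_test_deriv_cts[OF t])
    let ?I = "integral\<^sup>L (Lb pi) (\<lambda>x. u x * sin x * \<phi> x)"
    define A where "A = integral\<^sup>L (Lb pi) (\<lambda>x. \<bar>u x\<bar>)"
    have A0: "A \<ge> 0" unfolding A_def by (rule Bochner_Integration.integral_nonneg) simp
    have "\<bar>?I\<bar> \<le> 0 + e" if e: "0 < e" for e
    proof -
      let ?d = "e / (A + 1)"
      have d: "0 < ?d" using e A0 by simp
      \<comment> \<open>The substitution y = cos x transfers the approximation to [-1,1], where
        polynomials are dense in the continuous functions.\<close>
      have "continuous_on {-1..1} (\<lambda>y. \<phi> (arccos y))" by (rule cts_compose[OF \<phi>c continuous_on_arccos'])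
      then obtain p where p: "real_polynomial_function p" "\<And>y. y \<in> {-1..1} \<Longrightarrow> \<bar>\<phi> (arccos y) - p y\<bar> < ?d"
        using Stone_Weierstrass_real_polynomial_function[of "{-1..1::real}" "\<lambda>y. \<phi> (arccos y)" ?d] d by auto
      obtain a n where pa: "p = (\<lambda>y. \<Sum>i\<le>n. a i * y ^ i)" using real_polynomial_function_imp_sum[OF p(1)] by blast
      have "integral\<^sup>L (Lb pi) (\<lambda>x. u x * (sin x * p (cos x))) = integral\<^sup>L (Lb pi) (\<lambda>x. \<Sum>i\<le>n. a i * (u x * (sin x * cos x ^ i)))"
        by (simp add: pa sum_distrib_left mult_ac)
      also have "\<dots> = (\<Sum>i\<le>n. a i * integral\<^sup>L (Lb pi) (\<lambda>x. u x * (sin x * cos x ^ i)))"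
        by (subst Bochner_Integration.integral_sum) (auto intro!: integrable_mult_right c continuous_intros simp only: integral_mult_right_zero)
      also have "\<dots> = 0" using pw[of 1] by simp
      finally have 0: "integral\<^sup>L (Lb pi) (\<lambda>x. u x * (sin x * p (cos x))) = 0" .
      have pc: "cts (\<lambda>x. p (cos x))" unfolding pa by (intro continuous_intros)
      have i1: "integrable (Lb pi) (\<lambda>x. u x * (sin x * \<phi> x))" "integrable (Lb pi) (\<lambda>x. u x * (sin x * p (cos x)))"
        by (intro c continuous_intros \<phi>c pc)+
      have "?I = integral\<^sup>L (Lb pi) (\<lambda>x. u x * (sin x * \<phi> x) - u x * (sin x * p (cos x)))"
        using i1 0 by (simp add: mult.assoc)
      also have "\<bar>\<dots>\<bar> \<le> integral\<^sup>L (Lb pi) (\<lambda>x. \<bar>u x\<bar> * ?d)"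
      proof -
        have "norm (integral\<^sup>L (Lb pi) (\<lambda>x. u x * (sin x * \<phi> x) - u x * (sin x * p (cos x)))) \<le> integral\<^sup>L (Lb pi) (\<lambda>x. \<bar>u x\<bar> * ?d)"
        proof (rule Bochner_Integration.integral_norm_bound_integral)
          show "integrable (Lb pi) (\<lambda>x. u x * (sin x * \<phi> x) - u x * (sin x * p (cos x)))" using i1 by simp
          show "integrable (Lb pi) (\<lambda>x. \<bar>u x\<bar> * ?d)" using L2_integrable[OF u] by simp
          fix x assume "x \<in> space (Lb pi)"
          then have x: "0 < x" "x < pi" by auto
          have "\<bar>\<phi> x - p (cos x)\<bar> \<le> ?d" using p(2)[of "cos x"] arccos_cos[of x] x by auto
          moreover have "\<bar>sin x\<bar> \<le> 1" by simp
          ultimately have "\<bar>sin x\<bar> * \<bar>\<phi> x - p (cos x)\<bar> \<le> 1 * ?d" by (intro mult_mono) auto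
          then have "\<bar>u x\<bar> * (\<bar>sin x\<bar> * \<bar>\<phi> x - p (cos x)\<bar>) \<le> \<bar>u x\<bar> * ?d" by (intro mult_left_mono) auto
          then show "norm (u x * (sin x * \<phi> x) - u x * (sin x * p (cos x))) \<le> \<bar>u x\<bar> * ?d"
            by (simp add: abs_mult flip: right_diff_distrib)
        qed
        then show ?thesis by simp
      qed
      also have "\<dots> = ?d * A" by (simp add: A_def)
      also have "\<dots> \<le> e" by (rule divide_plus_one_mult_le[OF e A0])
      finally show ?thesis by simp
    qed
    then have "\<bar>?I\<bar> \<le> 0" by (rule field_le_epsilon)
    then show "?I = 0" by simp
  qed simp
  then show ?thesis
    unfolding AE_Lb_iff
  proof eventually_elim
    fix x assume h: "x \<in> {0<..<pi} \<longrightarrow> u x * sin x = 0"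
    show "x \<in> {0<..<pi} \<longrightarrow> u x = 0"
    proof
      assume x: "x \<in> {0<..<pi}"
      then have "sin x > 0" by (simp add: sin_gt_zero)
      then show "u x = 0" using h x by simp
    qed
  qed
qed

lemma sine_coeff_0 [simp]: "sine_coeff 0 u = 0"
  by (simp add: sine_coeff_def Phi_def)

lemma sine_coeff_add: "u \<in> L2 pi \<Longrightarrow> v \<in> L2 pi \<Longrightarrow> sine_coeff n (\<lambda>x. u x + v x) = sine_coeff n u + sine_coeff n v"
  using L2_mult[of u pi "Phi n"] L2_mult[of v pi "Phi n"] L2_cts[OF Phi_cts] by (simp add: sine_coeff_eq distrib_right)

lemma sine_coeff_diff: "u \<in> L2 pi \<Longrightarrow> v \<in> L2 pi \<Longrightarrow> sine_coeff n (\<lambda>x. u x - v x) = sine_coeff n u - sine_coeff n v"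
  using L2_mult[of u pi "Phi n"] L2_mult[of v pi "Phi n"] L2_cts[OF Phi_cts] by (simp add: sine_coeff_eq left_diff_distrib)

lemma sine_coeff_scale: "sine_coeff n (\<lambda>x. c * u x) = c * sine_coeff n u"
  by (simp add: sine_coeff_eq mult.assoc)

lemma Phi_orthonormal_Lb: "1 \<le> m \<Longrightarrow> integral\<^sup>L (Lb pi) (\<lambda>x. Phi m x * Phi n x) = (if m = n then 1 else 0)"
proof (cases "n = 0")
  case True then show "1 \<le> m \<Longrightarrow> ?thesis" by (simp add: Phi_def)
next
  case False
  assume m: "1 \<le> m"
  have "integral\<^sup>L (Lb pi) (\<lambda>x. Phi m x * Phi n x) = integral {0..pi} (\<lambda>x. Phi m x * Phi n x)"
    by (intro Lb_cts(2) continuous_intros Phi_cts)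
  then show ?thesis using Phi_orthonormal(1)[of m n] m False by simp
qed

text \<open>The partial sums are Cauchy by orthonormality and L^2 is complete. \<open>Phi 0\<close>
  is the zero function, so coefficients are recovered from index 1 on.\<close>

lemma riesz_fischer:
  assumes K: "\<And>N. (\<Sum>n<N. (a n)\<^sup>2) \<le> K"
  obtains g where "g \<in> L2 pi" "(\<lambda>N. integral\<^sup>L (Lb pi) (\<lambda>x. ((\<Sum>n<N. a n * Phi n x) - g x)\<^sup>2)) \<longlonglongrightarrow> 0"
    "\<And>n. 1 \<le> n \<Longrightarrow> sine_coeff n g = a n"
proof -
  let ?u = "\<lambda>N x. \<Sum>n<N. a n * Phi n x"
  have uc: "cts (?u N)" for N by (intro continuous_intros Phi_cts)
  have sm: "summable (\<lambda>n. (a n)\<^sup>2)" by (rule bounded_imp_summable[of _ K]) (use K[of "Suc _"] in \<open>auto simp: lessThan_Suc_atMost\<close>)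
  have diff: "nrm2 pi (\<lambda>s. ?u m s - ?u n s) \<le> (\<Sum>i\<in>{n..<m}. (a i)\<^sup>2)" if "n \<le> m" for m n
  proof -
    have e: "?u m s - ?u n s = (\<Sum>i\<in>{n..<m}. a i * Phi i s)" for s
      using that sum_diff_nat_ivl[of 0 n m "\<lambda>i. a i * Phi i s"] by (simp add: atLeast0LessThan)
    have "nrm2 pi (\<lambda>s. ?u m s - ?u n s) = integral {0..pi} (\<lambda>s. \<Sum>i\<in>{n..<m}. \<Sum>j\<in>{n..<m}. (a i * a j) * (Phi i s * Phi j s))"
      unfolding nrm2_def e by (simp add: power2_eq_square sum_product mult_ac)
    also have "\<dots> = (\<Sum>i\<in>{n..<m}. \<Sum>j\<in>{n..<m}. (a i * a j) * integral {0..pi} (\<lambda>s. Phi i s * Phi j s))"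
    proof -
      have i: "(\<lambda>s. c * (Phi i s * Phi j s)) integrable_on {0..pi}" for c i j by (intro cts_integrable continuous_intros Phi_cts)
      show ?thesis by (simp add: integral_sum integrable_sum i)
    qed
    \<comment> \<open>The diagonal entry for i = 0 is 0 because \<open>Phi 0\<close> vanishes; hence
      the bound obtained below is an inequality.\<close>
    also have "\<dots> = (\<Sum>i\<in>{n..<m}. \<Sum>j\<in>{n..<m}. if j = i then (if i = 0 then 0 else (a i)\<^sup>2) else 0)"
    proof (intro sum.cong refl)
      fix i j
      show "(a i * a j) * integral {0..pi} (\<lambda>s. Phi i s * Phi j s) = (if j = i then (if i = 0 then 0 else (a i)\<^sup>2) else 0)"
      proof (cases "i = 0 \<or> j = 0")
        case True then show ?thesis by (auto simp: Phi_def)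
      next
        case False then show ?thesis using Phi_orthonormal(1)[of i j] by (auto simp: power2_eq_square)
      qed
    qed
    also have "\<dots> = (\<Sum>i\<in>{n..<m}. if i = 0 then 0 else (a i)\<^sup>2)" by (intro sum.cong refl) (simp add: sum.delta)
    also have "\<dots> \<le> (\<Sum>i\<in>{n..<m}. (a i)\<^sup>2)" by (intro sum_mono) auto
    finally show ?thesis .
  qed
  have cau: "\<exists>K. \<forall>m\<ge>K. \<forall>n\<ge>K. nrm2 pi (\<lambda>s. ?u m s - ?u n s) < e" if e: "0 < e" for e
  proof -
    obtain K where K: "\<And>m n. m \<ge> K \<Longrightarrow> norm (\<Sum>i\<in>{m..<n}. (a i)\<^sup>2) < e"
      using sm e unfolding summable_Cauchy by blast
    have "nrm2 pi (\<lambda>s. ?u m s - ?u n s) < e" if "m \<ge> K" "n \<ge> K" for m n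
    proof (cases "n \<le> m")
      case True
      then show ?thesis using diff[OF True] K[of n m] that by simp
    next
      case False
      then have "n \<ge> m" by simp
      have "nrm2 pi (\<lambda>s. ?u m s - ?u n s) = nrm2 pi (\<lambda>s. ?u n s - ?u m s)" unfolding nrm2_def by (simp add: power2_commute)
      then show ?thesis using diff[OF \<open>n \<ge> m\<close>] K[of m n] that by simp
    qed
    then show ?thesis by blast
  qed
  obtain g where g: "g \<in> L2 pi" "(\<lambda>N. integral\<^sup>L (Lb pi) (\<lambda>x. (?u N x - g x)\<^sup>2)) \<longlonglongrightarrow> 0"
    by (rule L2_limit_Lb[of ?u pi, OF uc _ cau]) auto
  have "sine_coeff m g = a m" if m: "1 \<le> m" for m
  proof -
    have "(\<lambda>N. integral\<^sup>L (Lb pi) (\<lambda>x. ?u N x * Phi m x)) \<longlonglongrightarrow> sine_coeff m g"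
      unfolding sine_coeff_eq by (rule L2_tendsto_integral[OF L2_cts[OF uc] g(1) L2_cts[OF Phi_cts] g(2)])
    moreover have "\<forall>\<^sub>F N in sequentially. integral\<^sup>L (Lb pi) (\<lambda>x. ?u N x * Phi m x) = a m"
    proof (rule eventually_sequentiallyI[of "Suc m"])
      fix N assume N: "Suc m \<le> N"
      have i: "integrable (Lb pi) (\<lambda>x. a n * (Phi m x * Phi n x))" for n by (intro Lb_cts(1) continuous_intros Phi_cts)
      have "integral\<^sup>L (Lb pi) (\<lambda>x. ?u N x * Phi m x) = integral\<^sup>L (Lb pi) (\<lambda>x. \<Sum>n<N. a n * (Phi m x * Phi n x))"
        unfolding sum_distrib_right by (simp add: mult_ac)
      also have "\<dots> = (\<Sum>n<N. a n * (if m = n then 1 else 0))"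
        using i Phi_orthonormal_Lb[OF m] by (simp add: Bochner_Integration.integral_sum)
      also have "\<dots> = a m" using N by (simp add: if_distrib cong: if_cong)
      finally show "integral\<^sup>L (Lb pi) (\<lambda>x. ?u N x * Phi m x) = a m" .
    qed
    ultimately show ?thesis by (rule LIMSEQ_unique[OF _ tendsto_eventually])
  qed
  then show thesis by (rule that[OF g])
qed

lemma sine_bessel: "u \<in> L2 pi \<Longrightarrow> (\<Sum>n<N. (sine_coeff n u)\<^sup>2) \<le> (L2_norm 0 pi u)\<^sup>2"
proof -
  assume u: "u \<in> L2 pi"
  have "(\<Sum>n<N. (sine_coeff n u)\<^sup>2) = (\<Sum>n\<in>{1..<N}. (sine_coeff n u)\<^sup>2)"
    by (rule sum.mono_neutral_right) (auto simp: not_less_eq_eq)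
  also have "\<dots> \<le> (L2_norm 0 pi u)\<^sup>2" unfolding sine_coeff_eq
    by (rule bessel[OF Phi_cts _ u]) (use Phi_orthonormal(1) in auto)
  finally show ?thesis .
qed

text \<open>Riesz-Fischer gives a limit with the coefficients of u, and completeness identifies it
  with u.\<close>

lemma sine_expansion:
  assumes u: "u \<in> L2 pi"
  shows "(\<lambda>N. integral\<^sup>L (Lb pi) (\<lambda>x. ((\<Sum>n<N. sine_coeff n u * Phi n x) - u x)\<^sup>2)) \<longlonglongrightarrow> 0"
proof -
  obtain g where g: "g \<in> L2 pi" "(\<lambda>N. integral\<^sup>L (Lb pi) (\<lambda>x. ((\<Sum>n<N. sine_coeff n u * Phi n x) - g x)\<^sup>2)) \<longlonglongrightarrow> 0"
    "\<And>n. 1 \<le> n \<Longrightarrow> sine_coeff n g = sine_coeff n u" using riesz_fischer[OF sine_bessel[OF u]] by blast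
  have "AE x in Lb pi. u x - g x = 0"
    by (rule sine_completeness) (use u g in \<open>auto intro!: L2_diff simp: sine_coeff_diff\<close>)
  then have "integral\<^sup>L (Lb pi) (\<lambda>x. ((\<Sum>n<N. sine_coeff n u * Phi n x) - u x)\<^sup>2) = integral\<^sup>L (Lb pi) (\<lambda>x. ((\<Sum>n<N. sine_coeff n u * Phi n x) - g x)\<^sup>2)" for N
  proof (intro integral_cong_AE)
    have c: "cts (\<lambda>x. \<Sum>n<N. sine_coeff n u * Phi n x)" by (intro continuous_intros Phi_cts)
    show "(\<lambda>x. ((\<Sum>n<N. sine_coeff n u * Phi n x) - u x)\<^sup>2) \<in> borel_measurable (Lb pi)"
      "(\<lambda>x. ((\<Sum>n<N. sine_coeff n u * Phi n x) - g x)\<^sup>2) \<in> borel_measurable (Lb pi)"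
      using Lb_cts(3)[OF c] u g(1) by (auto simp: L2_iff)
    show "AE x in Lb pi. ((\<Sum>n<N. sine_coeff n u * Phi n x) - u x)\<^sup>2 = ((\<Sum>n<N. sine_coeff n u * Phi n x) - g x)\<^sup>2"
      if "AE x in Lb pi. u x - g x = 0" using that by eventually_elim simp
  qed
  then show ?thesis using g(2) by simp
qed

lemma parseval:
  assumes u: "u \<in> L2 pi" and v: "v \<in> L2 pi"
  shows "(\<lambda>n. sine_coeff n u * sine_coeff n v) sums integral\<^sup>L (Lb pi) (\<lambda>x. u x * v x)"
proof -
  let ?u = "\<lambda>N x. \<Sum>n<N. sine_coeff n u * Phi n x"
  have uc: "cts (?u N)" for N by (intro continuous_intros Phi_cts)
  have "integral\<^sup>L (Lb pi) (\<lambda>x. ?u N x * v x) = (\<Sum>n<N. sine_coeff n u * sine_coeff n v)" for N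
  proof -
    have "integral\<^sup>L (Lb pi) (\<lambda>x. ?u N x * v x) = integral\<^sup>L (Lb pi) (\<lambda>x. \<Sum>n<N. sine_coeff n u * (v x * Phi n x))"
      unfolding sum_distrib_right by (simp add: mult_ac)
    then show ?thesis using L2_mult[OF v L2_cts[OF Phi_cts]] by (simp add: sine_coeff_eq[of _ v])
  qed
  then show ?thesis unfolding sums_def
    using L2_tendsto_integral[OF L2_cts[OF uc] u v sine_expansion[OF u]] by simp
qed

section \<open>Sine series in H^-1 and regularity in time\<close>

lemma H10_L2: "u \<in> H10_fun 0 T \<Longrightarrow> u \<in> L2 T"
  by (simp add: H10_fun_def H1_fun_def)

lemma H10_zero:
  assumes "0 < T" shows "(\<lambda>_. 0) \<in> H10_fun 0 T" "H1_norm 0 T (\<lambda>_. 0) = 0"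
proof -
  have z: "(\<lambda>_. 0) \<in> L2 T" by (rule L2_cts[OF cts_const])
  have J0: "J (\<lambda>_. 0) = (\<lambda>_. 0)" by (auto simp: J_eq)
  have "J (\<lambda>_. 0) \<in> H10_fun 0 T"
    by (rule J_in_H10[OF assms z _ cts_const[of 0]]) (auto simp: J_eq)
  then show "(\<lambda>_. 0) \<in> H10_fun 0 T" unfolding J0 .
  have "has_weak_deriv 0 T (\<lambda>_. 0) (\<lambda>_. 0)" by (rule weak_derivI[OF assms]) simp
  from H1_norm_eq[OF assms z z this] show "H1_norm 0 T (\<lambda>_. 0) = 0" by (simp add: L2_norm_def)
qed

lemma H1_norm_nonneg: "0 \<le> H1_norm a b u"
  by (simp add: H1_norm_def)

text \<open>The numbers n times the coefficients of u have square sum at most the squared H^1 norm.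
  Cauchy-Schwarz pairs them with c n / n, whose square sum therefore controls the H^-1 norm of the
  functional.\<close>

lemma sine_series_bound:
  assumes u: "u \<in> H10_fun 0 pi" and K: "\<And>N. (\<Sum>n<N. (c n / real n)\<^sup>2) \<le> K"
  shows "summable (\<lambda>n. \<bar>c n * sine_coeff n u\<bar>)"
    "\<bar>\<Sum>n. c n * sine_coeff n u\<bar> \<le> sqrt K * H1_norm 0 pi u"
proof -
  let ?h = "H1_norm 0 pi u"
  obtain g where g: "g \<in> L2 pi" "L2_norm 0 pi g \<le> ?h" "\<And>n. real n * sine_coeff n u = integral\<^sup>L (Lb pi) (\<lambda>x. g x * Psi n x)"
    using H10_sine_coeff[OF u] by blast
  have K0: "0 \<le> K" using K[of 0] by simp
  have b: "(\<Sum>n<N. \<bar>c n * sine_coeff n u\<bar>) \<le> sqrt K * ?h" for N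
  proof -
    have "(\<Sum>n<N. (\<bar>real n * sine_coeff n u\<bar>)\<^sup>2) = (\<Sum>n\<in>{1..<N}. (real n * sine_coeff n u)\<^sup>2)"
      unfolding power2_abs by (rule sum.mono_neutral_right) (auto simp: not_less_eq_eq)
    also have "\<dots> \<le> (L2_norm 0 pi g)\<^sup>2" unfolding g(3)
      by (rule bessel[OF Psi_cts _ g(1)]) (use Phi_orthonormal(2) in auto)
    also have "\<dots> \<le> ?h\<^sup>2" by (rule power_mono[OF g(2) L2_norm_nonneg])
    finally have h: "(\<Sum>n<N. (\<bar>real n * sine_coeff n u\<bar>)\<^sup>2) \<le> ?h\<^sup>2" .
    \<comment> \<open>For n = 0 both sides are 0: division by zero gives 0 and
      \<open>sine_coeff 0\<close> vanishes.\<close>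
    have "\<bar>c n * sine_coeff n u\<bar> = \<bar>c n / real n\<bar> * \<bar>real n * sine_coeff n u\<bar>" for n
      by (cases "n = 0") (auto simp: abs_mult)
    then have "(\<Sum>n<N. \<bar>c n * sine_coeff n u\<bar>)\<^sup>2 = (\<Sum>n<N. \<bar>c n / real n\<bar> * \<bar>real n * sine_coeff n u\<bar>)\<^sup>2" by simp
    also have "\<dots> \<le> (\<Sum>n<N. (\<bar>c n / real n\<bar>)\<^sup>2) * (\<Sum>n<N. (\<bar>real n * sine_coeff n u\<bar>)\<^sup>2)"
      by (rule Cauchy_Schwarz_ineq_sum)
    also have "\<dots> \<le> K * ?h\<^sup>2" using K[of N] h K0 unfolding power2_abs by (intro mult_mono sum_nonneg) auto
    also have "\<dots> = (sqrt K * ?h)\<^sup>2" using K0 by (simp add: power_mult_distrib)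
    finally show ?thesis by (rule power2_le_imp_le) (use K0 H1_norm_nonneg in auto)
  qed
  show s: "summable (\<lambda>n. \<bar>c n * sine_coeff n u\<bar>)"
    by (rule bounded_imp_summable[of _ "sqrt K * ?h"]) (use b[of "Suc _"] in \<open>auto simp: lessThan_Suc_atMost\<close>)
  have "\<bar>\<Sum>n. c n * sine_coeff n u\<bar> \<le> (\<Sum>n. \<bar>c n * sine_coeff n u\<bar>)" by (rule summable_rabs[OF s])
  also have "\<dots> \<le> sqrt K * ?h" by (rule suminf_le_const[OF s b])
  finally show "\<bar>\<Sum>n. c n * sine_coeff n u\<bar> \<le> sqrt K * ?h" .
qed

lemma Hm1_norm_series:
  assumes K: "\<And>N. (\<Sum>n<N. (c n / real n)\<^sup>2) \<le> K"
    and G: "\<And>\<phi>. \<phi> \<in> H10_fun 0 pi \<Longrightarrow> G \<phi> = (\<Sum>n. c n * sine_coeff n \<phi>)"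
  shows "0 \<le> Hm1_norm 0 pi G" "Hm1_norm 0 pi G \<le> sqrt K"
proof -
  let ?B = "{\<phi> \<in> H10_fun 0 pi. H1_norm 0 pi \<phi> \<le> 1}"
  have K0: "0 \<le> K" using K[of 0] by simp
  \<comment> \<open>The unit ball contains 0, so the real supremum is taken over a nonempty
    set.\<close>
  have z: "(\<lambda>_. 0) \<in> ?B" using H10_zero[of pi] by simp
  have b: "\<bar>G \<phi>\<bar> \<le> sqrt K" if "\<phi> \<in> ?B" for \<phi>
  proof -
    have "\<bar>G \<phi>\<bar> \<le> sqrt K * H1_norm 0 pi \<phi>" using sine_series_bound(2)[OF _ K, of \<phi>] G that by simp
    also have "\<dots> \<le> sqrt K * 1" using that K0 by (intro mult_left_mono) auto
    finally show ?thesis by simp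
  qed
  show "Hm1_norm 0 pi G \<le> sqrt K" unfolding Hm1_norm_def using z b by (intro cSUP_least) auto
  have "\<bar>G (\<lambda>_. 0)\<bar> \<le> Hm1_norm 0 pi G" unfolding Hm1_norm_def
    by (rule cSUP_upper[OF z]) (use b in \<open>auto simp: bdd_above_def\<close>)
  then show "0 \<le> Hm1_norm 0 pi G" by (rule order_trans[OF abs_ge_zero])
qed

lemma sine_series_in_Hm1:
  assumes K: "\<And>N. (\<Sum>n<N. (c n / real n)\<^sup>2) \<le> K"
  shows "(\<lambda>\<phi>. \<Sum>n. c n * sine_coeff n \<phi>) \<in> Hm1 0 pi"
proof -
  have s: "summable (\<lambda>n. c n * sine_coeff n \<phi>)" if "\<phi> \<in> H10_fun 0 pi" for \<phi>
    by (rule summable_rabs_cancel[OF sine_series_bound(1)[OF that K]])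
  show ?thesis unfolding Hm1_def
  proof (intro CollectI conjI ballI allI)
    fix \<phi> \<psi> assume h: "\<phi> \<in> H10_fun 0 pi" "\<psi> \<in> H10_fun 0 pi"
    show "(\<Sum>n. c n * sine_coeff n (\<lambda>x. \<phi> x + \<psi> x)) = (\<Sum>n. c n * sine_coeff n \<phi>) + (\<Sum>n. c n * sine_coeff n \<psi>)"
      using suminf_add[OF s[OF h(1)] s[OF h(2)]] h[THEN H10_L2] by (simp add: sine_coeff_add distrib_left)
  next
    fix a \<phi> assume h: "\<phi> \<in> H10_fun 0 pi"
    show "(\<Sum>n. c n * sine_coeff n (\<lambda>x. a * \<phi> x)) = a * (\<Sum>n. c n * sine_coeff n \<phi>)"
      using suminf_mult[OF s[OF h], of a] by (simp add: sine_coeff_scale mult.left_commute)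
  next
    show "\<exists>C. \<forall>\<phi>\<in>H10_fun 0 pi. \<bar>\<Sum>n. c n * sine_coeff n \<phi>\<bar> \<le> C * H1_norm 0 pi \<phi>"
      using sine_series_bound(2)[OF _ K] by blast
  qed
qed

lemma inverse_square_sum: "summable (\<lambda>n. (C / real n)\<^sup>2)"
proof -
  have "summable (\<lambda>n. C\<^sup>2 * inverse (real n ^ 2))"
    by (intro summable_mult inverse_power_summable) simp
  moreover have "(C / real n)\<^sup>2 = C\<^sup>2 * inverse (real n ^ 2)" for n by (simp add: power_divide divide_inverse power_mult_distrib power_inverse)
  ultimately show ?thesis by simp
qed

text \<open>Bounded coefficients already define an element of H^-1, since the sum of 1 / n^2
  converges.\<close>

lemma weighted_bound:
  assumes "\<And>n. \<bar>c n\<bar> \<le> C"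
  shows "(\<Sum>n<N. (c n / real n)\<^sup>2) \<le> (\<Sum>n. (C / real n)\<^sup>2)"
proof -
  have "(\<Sum>n<N. (c n / real n)\<^sup>2) \<le> (\<Sum>n<N. (C / real n)\<^sup>2)"
  proof (rule sum_mono)
    fix n show "(c n / real n)\<^sup>2 \<le> (C / real n)\<^sup>2" unfolding power_divide
      using power_mono[OF assms[of n] abs_ge_zero, of 2] by (intro divide_right_mono) auto
  qed
  also have "\<dots> \<le> (\<Sum>n. (C / real n)\<^sup>2)" by (rule sum_le_suminf[OF inverse_square_sum]) auto
  finally show ?thesis .
qed

text \<open>Dominated convergence for series: the tail is small uniformly in s because C / n is
  square summable, and the head has finitely many terms, each tending to 0.\<close>

lemma weighted_square_sum_small:
  assumes lim: "\<And>n. ((\<lambda>s. \<delta> n s) \<longlongrightarrow> 0) F" and b: "\<forall>\<^sub>F s in F. \<forall>n. \<bar>\<delta> n s\<bar> \<le> C" and e: "0 < (e::real)"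
  shows "\<forall>\<^sub>F s in F. \<forall>N. (\<Sum>n<N. (\<delta> n s / real n)\<^sup>2) \<le> e"
proof -
  have "0 < e / 2" using e by simp
  then obtain m where m: "\<And>N N'. N \<ge> m \<Longrightarrow> norm (\<Sum>n\<in>{N..<N'}. (C / real n)\<^sup>2) < e / 2"
    using iffD1[OF summable_Cauchy inverse_square_sum[of C], rule_format, of "e / 2"] by blast
  have "((\<lambda>s. \<Sum>n<m. (\<delta> n s / real n)\<^sup>2) \<longlongrightarrow> (\<Sum>n<m. 0)) F"
  proof (rule tendsto_sum)
    fix n
    have "((\<lambda>s. (\<delta> n s * inverse (real n))\<^sup>2) \<longlongrightarrow> (0 * inverse (real n))\<^sup>2) F" by (intro tendsto_intros lim)
    then show "((\<lambda>s. (\<delta> n s / real n)\<^sup>2) \<longlongrightarrow> 0) F" by (simp add: divide_inverse)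
  qed
  then have "\<forall>\<^sub>F s in F. (\<Sum>n<m. (\<delta> n s / real n)\<^sup>2) < e / 2" using order_tendstoD(2)[of _ 0 F "e / 2"] e by simp
  with b show ?thesis
  proof eventually_elim
    case (elim s)
    show ?case
    proof
      fix N
      have "(\<Sum>n<N. (\<delta> n s / real n)\<^sup>2) \<le> (\<Sum>n<max m N. (\<delta> n s / real n)\<^sup>2)" by (rule sum_mono2) auto
      also have "\<dots> = (\<Sum>n<m. (\<delta> n s / real n)\<^sup>2) + (\<Sum>n\<in>{m..<max m N}. (\<delta> n s / real n)\<^sup>2)"
        using sum.atLeastLessThan_concat[of 0 m "max m N" "\<lambda>n. (\<delta> n s / real n)\<^sup>2"] by (simp add: atLeast0LessThan)
      finally have 1: "(\<Sum>n<N. (\<delta> n s / real n)\<^sup>2) \<le> (\<Sum>n<m. (\<delta> n s / real n)\<^sup>2) + (\<Sum>n\<in>{m..<max m N}. (\<delta> n s / real n)\<^sup>2)" .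
      have "(\<Sum>n\<in>{m..<max m N}. (\<delta> n s / real n)\<^sup>2) \<le> (\<Sum>n\<in>{m..<max m N}. (C / real n)\<^sup>2)"
      proof (rule sum_mono)
        fix n show "(\<delta> n s / real n)\<^sup>2 \<le> (C / real n)\<^sup>2" unfolding power_divide
          using power_mono[OF elim(1)[rule_format, of n] abs_ge_zero, of 2] by (intro divide_right_mono) auto
      qed
      also have "\<dots> \<le> e / 2" using m[OF order_refl, of "max m N"] by simp
      finally show "(\<Sum>n<N. (\<delta> n s / real n)\<^sup>2) \<le> e" using elim(2) 1 by linarith
    qed
  qed
qed

lemma Hm1_norm_tendsto_0:
  assumes lim: "\<And>n. ((\<lambda>s. \<delta> n s) \<longlongrightarrow> 0) F" and b: "\<forall>\<^sub>F s in F. \<forall>n. \<bar>\<delta> n s\<bar> \<le> C"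
    and G: "\<forall>\<^sub>F s in F. \<forall>\<phi>\<in>H10_fun 0 pi. G s \<phi> = (\<Sum>n. \<delta> n s * sine_coeff n \<phi>)"
  shows "((\<lambda>s. Hm1_norm 0 pi (G s)) \<longlongrightarrow> 0) F"
proof (rule tendstoI)
  fix e :: real assume e: "0 < e"
  have "0 < (e / 2)\<^sup>2" using e by simp
  from weighted_square_sum_small[OF lim b this] G
  show "\<forall>\<^sub>F s in F. dist (Hm1_norm 0 pi (G s)) 0 < e"
  proof eventually_elim
    case (elim s)
    note n = Hm1_norm_series[where c="\<lambda>n. \<delta> n s" and K="(e / 2)\<^sup>2" and G="G s", OF elim(1)[rule_format] elim(2)[rule_format]]
    have "0 \<le> Hm1_norm 0 pi (G s)" by (rule n(1))
    moreover have "Hm1_norm 0 pi (G s) \<le> sqrt ((e / 2)\<^sup>2)" by (rule n(2))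
    ultimately show ?case using e by (simp add: real_sqrt_abs)
  qed
qed

text \<open>Regularity in time read off from the coefficients. A bound on their derivatives that is
  uniform in n is enough in H^-1. The locale is applied both to a constructed solution and to an
  arbitrary one.\<close>

locale sine_evolution =
  fixes T C :: real and w :: "real \<Rightarrow> real \<Rightarrow> real" and wn wp :: "nat \<Rightarrow> real \<Rightarrow> real"
  assumes T: "0 < T"
    and wL: "\<And>t. t \<in> {0..T} \<Longrightarrow> w t \<in> L2 pi"
    and wn: "\<And>n t. t \<in> {0..T} \<Longrightarrow> sine_coeff n (w t) = wn n t"
    and wd: "\<And>n t. t \<in> {0..T} \<Longrightarrow> (wn n has_real_derivative wp n t) (at t within {0..T})"
    and wp: "\<And>n. continuous_on {0..T} (wp n)" "\<And>n t. t \<in> {0..T} \<Longrightarrow> \<bar>wp n t\<bar> \<le> C"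
begin

definition v :: "real \<Rightarrow> (real \<Rightarrow> real) \<Rightarrow> real" where "v t \<phi> = (\<Sum>n. wp n t * sine_coeff n \<phi>)"

lemma v_summable: "t \<in> {0..T} \<Longrightarrow> \<phi> \<in> H10_fun 0 pi \<Longrightarrow> summable (\<lambda>n. wp n t * sine_coeff n \<phi>)"
  by (rule summable_rabs_cancel[OF sine_series_bound(1)[OF _ weighted_bound[OF wp(2)]]])

lemma near: "\<forall>\<^sub>F s in at t within {0..T}. s \<in> {0..T} \<and> s \<noteq> t"
  by (auto simp: eventually_at_filter)

lemma time_derivative:
  assumes t: "t \<in> {0..T}"
  shows "has_Hm1_time_deriv 0 pi T w t (v t)"
proof -
  define \<delta> where "\<delta> n s = (wn n s - wn n t) / (s - t) - wp n t" for n s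
  have "((\<lambda>s. Hm1_norm 0 pi (\<lambda>\<phi>. (L2_functional 0 pi (w s) \<phi> - L2_functional 0 pi (w t) \<phi>) / (s - t) - v t \<phi>)) \<longlongrightarrow> 0) (at t within {0..T})"
  proof (rule Hm1_norm_tendsto_0[where \<delta>=\<delta> and C="2 * C"])
    show "(\<delta> n \<longlongrightarrow> 0) (at t within {0..T})" for n
      using wd[OF t, of n] LIM_zero unfolding has_field_derivative_iff \<delta>_def by blast
    show "\<forall>\<^sub>F s in at t within {0..T}. \<forall>n. \<bar>\<delta> n s\<bar> \<le> 2 * C" using near
    proof eventually_elim
      case (elim s)
      show ?case
      proof
        fix n
        \<comment> \<open>The mean value inequality bounds the difference quotients of all
          coefficients by the same C.\<close>
        have "norm (wn n s - wn n t) \<le> C * norm (s - t)"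
          by (rule field_differentiable_bound[of "{0..T}" "wn n" "wp n"]) (use wd wp(2) elim t in auto)
        then have "\<bar>(wn n s - wn n t) / (s - t)\<bar> \<le> C" using elim by (simp add: field_simps)
        then show "\<bar>\<delta> n s\<bar> \<le> 2 * C" unfolding \<delta>_def using wp(2)[OF t, of n] by linarith
      qed
    qed
    show "\<forall>\<^sub>F s in at t within {0..T}. \<forall>\<phi>\<in>H10_fun 0 pi.
       (L2_functional 0 pi (w s) \<phi> - L2_functional 0 pi (w t) \<phi>) / (s - t) - v t \<phi> = (\<Sum>n. \<delta> n s * sine_coeff n \<phi>)" using near
    proof eventually_elim
      case (elim s)
      show ?case
      proof
        fix \<phi> assume \<phi>: "\<phi> \<in> H10_fun 0 pi"
        have f: "(\<lambda>n. wn n r * sine_coeff n \<phi>) sums L2_functional 0 pi (w r) \<phi>" if "r \<in> {0..T}" for r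
          using parseval[OF wL[OF that] H10_L2[OF \<phi>]] that by (simp add: wn L2_functional_def LINT_Lb)
        have "(\<lambda>n. (wn n s * sine_coeff n \<phi> - wn n t * sine_coeff n \<phi>) / (s - t) - wp n t * sine_coeff n \<phi>)
          sums ((L2_functional 0 pi (w s) \<phi> - L2_functional 0 pi (w t) \<phi>) / (s - t) - v t \<phi>)"
          unfolding v_def by (intro sums_diff sums_divide f summable_sums v_summable t \<phi>) (use elim in auto)
        moreover have "(wn n s * sine_coeff n \<phi> - wn n t * sine_coeff n \<phi>) / (s - t) - wp n t * sine_coeff n \<phi> = \<delta> n s * sine_coeff n \<phi>" for n
          by (simp add: \<delta>_def diff_divide_distrib left_diff_distrib)
        ultimately have "(\<lambda>n. \<delta> n s * sine_coeff n \<phi>) sums ((L2_functional 0 pi (w s) \<phi> - L2_functional 0 pi (w t) \<phi>) / (s - t) - v t \<phi>)"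
          by (simp only:)
        then show "(L2_functional 0 pi (w s) \<phi> - L2_functional 0 pi (w t) \<phi>) / (s - t) - v t \<phi> = (\<Sum>n. \<delta> n s * sine_coeff n \<phi>)"
          by (rule sums_unique)
      qed
    qed
  qed
  moreover have "v t \<in> Hm1 0 pi" unfolding v_def[abs_def] by (rule sine_series_in_Hm1[OF weighted_bound[OF wp(2)[OF t]]])
  ultimately show ?thesis unfolding has_Hm1_time_deriv_def by (rule conjI[rotated])
qed

lemma C1_regularity: "C1_Hm1 0 pi T w"
  unfolding C1_Hm1_def
proof (intro exI[of _ v] ballI conjI time_derivative)
  fix t assume t: "t \<in> {0..T}"
  show "((\<lambda>s. Hm1_norm 0 pi (\<lambda>\<phi>. v s \<phi> - v t \<phi>)) \<longlongrightarrow> 0) (at t within {0..T})"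
  proof (rule Hm1_norm_tendsto_0[where \<delta>="\<lambda>n s. wp n s - wp n t" and C="2 * C"])
    show "((\<lambda>s. wp n s - wp n t) \<longlongrightarrow> 0) (at t within {0..T})" for n
      using wp(1)[of n] t LIM_zero unfolding continuous_on_def by blast
    show "\<forall>\<^sub>F s in at t within {0..T}. \<forall>n. \<bar>wp n s - wp n t\<bar> \<le> 2 * C" using near
    proof eventually_elim
      case (elim s)
      show ?case
      proof
        fix n show "\<bar>wp n s - wp n t\<bar> \<le> 2 * C" using wp(2)[of s n] wp(2)[OF t, of n] elim by linarith
      qed
    qed
    show "\<forall>\<^sub>F s in at t within {0..T}. \<forall>\<phi>\<in>H10_fun 0 pi. v s \<phi> - v t \<phi> = (\<Sum>n. (wp n s - wp n t) * sine_coeff n \<phi>)" using near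
    proof eventually_elim
      case (elim s)
      then show ?case unfolding v_def using suminf_diff[OF v_summable v_summable[OF t]] by (auto simp: left_diff_distrib)
    qed
  qed
qed

text \<open>In L^2 the weight 1 / n comes from writing w_n = (n w_n) / n, with n w_n
  bounded.\<close>

lemma C0_regularity:
  assumes b: "\<And>n t. t \<in> {0..T} \<Longrightarrow> \<bar>real n * wn n t\<bar> \<le> D"
  shows "C0_L2 0 pi T w"
  unfolding C0_L2_def
proof (intro ballI conjI wL tendstoI)
  fix t e :: real assume t: "t \<in> {0..T}" and e: "0 < e"
  define \<delta> where "\<delta> n s = real n * (wn n s - wn n t)" for n s
  have lim: "(\<delta> n \<longlongrightarrow> 0) (at t within {0..T})" for n
  proof -
    have "(wn n \<longlongrightarrow> wn n t) (at t within {0..T})"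
      using has_field_derivative_imp_has_derivative[OF wd[OF t, of n], THEN has_derivative_continuous] by (simp add: continuous_within)
    then have "((\<lambda>s. real n * (wn n s - wn n t)) \<longlongrightarrow> real n * (wn n t - wn n t)) (at t within {0..T})" by (intro tendsto_intros)
    then show ?thesis by (simp add: \<delta>_def[abs_def])
  qed
  have bd: "\<forall>\<^sub>F s in at t within {0..T}. \<forall>n. \<bar>\<delta> n s\<bar> \<le> 2 * D" using near
  proof eventually_elim
    case (elim s)
    show ?case
    proof
      fix n
      show "\<bar>\<delta> n s\<bar> \<le> 2 * D" using b[of s n] b[OF t, of n] elim by (simp add: \<delta>_def right_diff_distrib)
    qed
  qed
  have "0 < (e / 2)\<^sup>2" using e by simp
  from weighted_square_sum_small[OF lim bd this] near
  show "\<forall>\<^sub>F s in at t within {0..T}. dist (L2_norm 0 pi (\<lambda>x. w s x - w t x)) 0 < e"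
  proof eventually_elim
    case (elim s)
    let ?u = "\<lambda>x. w s x - w t x"
    have u: "?u \<in> L2 pi" using elim t by (intro L2_diff wL) auto
    have cf: "sine_coeff n ?u = \<delta> n s / real n" for n
      using elim t by (cases "n = 0") (auto simp: \<delta>_def sine_coeff_diff wL wn)
    have "(\<lambda>n. (\<delta> n s / real n)\<^sup>2) sums (L2_norm 0 pi ?u)\<^sup>2"
      using parseval[OF u u] unfolding L2_norm_sq by (simp add: cf power2_eq_square)
    then have "(L2_norm 0 pi ?u)\<^sup>2 = (\<Sum>n. (\<delta> n s / real n)\<^sup>2)" "summable (\<lambda>n. (\<delta> n s / real n)\<^sup>2)" by (auto simp: sums_iff)
    then have "(L2_norm 0 pi ?u)\<^sup>2 \<le> (e / 2)\<^sup>2" using suminf_le_const[of "\<lambda>n. (\<delta> n s / real n)\<^sup>2" "(e / 2)\<^sup>2"] elim by simp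
    then have "L2_norm 0 pi ?u \<le> e / 2" by (rule power2_le_imp_le) (use e in simp)
    then show ?case using e L2_norm_nonneg[of pi ?u] by simp
  qed
qed

end

text \<open>The norm of H^-1 sees values on H^1_0 only, so a sine series may be exchanged for an
  integral that agrees with it there.\<close>

lemma has_Hm1_time_deriv_cong:
  assumes F: "has_Hm1_time_deriv 0 pi T w t F" and FG: "\<And>\<phi>. \<phi> \<in> H10_fun 0 pi \<Longrightarrow> F \<phi> = G \<phi>"
    and G: "G \<in> Hm1 0 pi"
  shows "has_Hm1_time_deriv 0 pi T w t G"
proof -
  have "Hm1_norm 0 pi (\<lambda>\<phi>. H \<phi> - F \<phi>) = Hm1_norm 0 pi (\<lambda>\<phi>. H \<phi> - G \<phi>)" for H
    unfolding Hm1_norm_def by (intro SUP_cong) (auto simp: FG)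
  then show ?thesis using F G by (simp add: has_Hm1_time_deriv_def)
qed

lemma L2_functional_sine_series:
  assumes \<eta>: "\<eta> \<in> L2 pi"
  shows "L2_functional 0 pi \<eta> \<in> Hm1 0 pi"
    "\<phi> \<in> H10_fun 0 pi \<Longrightarrow> L2_functional 0 pi \<eta> \<phi> = (\<Sum>n. sine_coeff n \<eta> * sine_coeff n \<phi>)"
proof -
  have e: "L2_functional 0 pi \<eta> = (\<lambda>\<phi>. integral\<^sup>L (Lb pi) (\<lambda>x. \<eta> x * \<phi> x))" by (auto simp: L2_functional_def LINT_Lb)
  show "\<phi> \<in> H10_fun 0 pi \<Longrightarrow> L2_functional 0 pi \<eta> \<phi> = (\<Sum>n. sine_coeff n \<eta> * sine_coeff n \<phi>)"
    unfolding e using parseval[OF \<eta> H10_L2] by (simp add: sums_iff)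
  show "L2_functional 0 pi \<eta> \<in> Hm1 0 pi" unfolding e Hm1_def
  proof (intro CollectI conjI ballI allI)
    fix \<phi> \<psi> assume h: "\<phi> \<in> H10_fun 0 pi" "\<psi> \<in> H10_fun 0 pi"
    show "integral\<^sup>L (Lb pi) (\<lambda>x. \<eta> x * (\<phi> x + \<psi> x)) = integral\<^sup>L (Lb pi) (\<lambda>x. \<eta> x * \<phi> x) + integral\<^sup>L (Lb pi) (\<lambda>x. \<eta> x * \<psi> x)"
      using L2_mult[OF \<eta> H10_L2[OF h(1)]] L2_mult[OF \<eta> H10_L2[OF h(2)]] by (simp add: distrib_left)
  next
    fix a \<phi> assume h: "\<phi> \<in> H10_fun 0 pi"
    show "integral\<^sup>L (Lb pi) (\<lambda>x. \<eta> x * (a * \<phi> x)) = a * integral\<^sup>L (Lb pi) (\<lambda>x. \<eta> x * \<phi> x)"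
      by (simp add: mult.left_commute)
  next
    show "\<exists>C. \<forall>\<phi>\<in>H10_fun 0 pi. \<bar>integral\<^sup>L (Lb pi) (\<lambda>x. \<eta> x * \<phi> x)\<bar> \<le> C * H1_norm 0 pi \<phi>"
    proof (intro exI[of _ "L2_norm 0 pi \<eta>"] ballI)
      fix \<phi> assume h: "\<phi> \<in> H10_fun 0 pi"
      have "\<bar>integral\<^sup>L (Lb pi) (\<lambda>x. \<eta> x * \<phi> x)\<bar> \<le> L2_norm 0 pi \<eta> * L2_norm 0 pi \<phi>" by (rule L2_CS[OF \<eta> H10_L2[OF h]])
      also have "\<dots> \<le> L2_norm 0 pi \<eta> * H1_norm 0 pi \<phi>"
        unfolding H1_norm_def by (intro mult_left_mono L2_norm_nonneg real_le_rsqrt) simp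
      finally show "\<bar>integral\<^sup>L (Lb pi) (\<lambda>x. \<eta> x * \<phi> x)\<bar> \<le> L2_norm 0 pi \<eta> * H1_norm 0 pi \<phi>" .
    qed
  qed
qed

section \<open>The controlled equation\<close>

context conv_root
begin

definition S :: "nat \<Rightarrow> real \<Rightarrow> real" where "S n = W (\<lambda>s. sin (real n * s))"

definition Cs :: "nat \<Rightarrow> real \<Rightarrow> real" where "Cs n = W (\<lambda>s. cos (real n * s))"

definition z :: "nat \<Rightarrow> real \<Rightarrow> real" where "z n = B (Cs n)"

text \<open>The kernel N of the integrated equation, formed with the continuous representative m of
  M.\<close>

definition Nk :: "real \<Rightarrow> real" where "Nk t = 1 + J m t"

text \<open>z n convolved with \<delta> + m; n times this is the derivative of \<open>S n\<close>,
  by \<open>S_eq\<close>.\<close>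

definition h :: "nat \<Rightarrow> real \<Rightarrow> real" where "h n t = z n t + (m \<star> z n) t"

lemma sin_cos_cts: "cts (\<lambda>s. sin (real n * s))" "cts (\<lambda>s. cos (real n * s))"
  by (intro continuous_intros)+

lemma S_cts: "cts (S n)" and Cs_cts: "cts (Cs n)"
  unfolding S_def Cs_def by (rule W_cts[OF sin_cos_cts(1)], rule W_cts[OF sin_cos_cts(2)])

lemma z_cts: "cts (z n)" unfolding z_def by (rule B_cts[OF Cs_cts])

lemma J_m_cts: "cts (J m)" by (rule conv_cts[OF cts_const m])

lemma Nk_cts: "cts Nk" unfolding Nk_def[abs_def] by (rule continuous_on_add[OF cts_const J_m_cts])

lemma h_cts: "cts (h n)" unfolding h_def[abs_def] by (rule continuous_on_add[OF z_cts conv_cts[OF m z_cts]])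

lemma Nk_conv: assumes \<phi>: "cts \<phi>" shows "Nk \<star> \<phi> = (\<lambda>t. J \<phi> t + J (m \<star> \<phi>) t)"
  unfolding Nk_def[abs_def] conv_add_left[OF \<phi> cts_const J_m_cts] conv_assoc[OF cts_const m \<phi>] by simp

text \<open>This and \<open>z_eq\<close> are \<open>W_intertwine\<close> for the derivatives of sin
  (n s) and cos (n s).\<close>

lemma B_S: assumes t: "0 \<le> t" shows "B (S n) t = real n * J (Cs n) t"
proof -
  have eq: "sin (real n * s) = 0 + J (\<lambda>s. real n * cos (real n * s)) s" if "0 \<le> s" for s
  proof -
    have d: "((\<lambda>s. sin (real n * s)) has_real_derivative real n * cos (real n * x)) (at x)" for x
      by (auto intro!: derivative_eq_intros)
    show ?thesis using FTC_J[OF d that] by simp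
  qed
  have "B (S n) t = 0 + J (W (\<lambda>s. real n * cos (real n * s))) t"
    unfolding S_def by (rule W_intertwine[OF sin_cos_cts(1) _ eq t]) (intro continuous_intros)
  then show ?thesis unfolding W_scale[OF sin_cos_cts(2)] conv_scale_right Cs_def by simp
qed

lemma z_eq: assumes t: "0 \<le> t" shows "z n t = 1 + (- real n) * J (S n) t"
proof -
  have eq: "cos (real n * s) = 1 + J (\<lambda>s. (- real n) * sin (real n * s)) s" if "0 \<le> s" for s
  proof -
    have d: "((\<lambda>s. cos (real n * s)) has_real_derivative (- real n) * sin (real n * x)) (at x)" for x
      by (auto intro!: derivative_eq_intros)
    show ?thesis using FTC_J[OF d that] by simp
  qed
  have "z n t = 1 + J (W (\<lambda>s. (- real n) * sin (real n * s))) t"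
    unfolding z_def Cs_def by (rule W_intertwine[OF sin_cos_cts(2) _ eq t]) (intro continuous_intros)
  then show ?thesis unfolding W_scale[OF sin_cos_cts(1)] conv_scale_right S_def .
qed

lemma J_h: "J (h n) = Nk \<star> z n"
  unfolding h_def[abs_def] conv_add_right[OF cts_const z_cts conv_cts[OF m z_cts]] Nk_conv[OF z_cts] ..

text \<open>Here the choice of r takes effect: convolution with \<delta> + m cancels two
  applications of B, so B (Nk \<star> z n) = J (Cs n). Hence B takes the same value on S n and on n
  (Nk \<star> z n), and B is injective.\<close>

lemma S_eq: assumes t: "0 \<le> t" shows "S n t = real n * J (h n) t"
proof -
  define D where "D s = S n s + (- real n) * (Nk \<star> z n) s" for s
  have Nz: "cts (Nk \<star> z n)" by (rule conv_cts[OF Nk_cts z_cts])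
  have sNz: "cts (\<lambda>s. (- real n) * (Nk \<star> z n) s)" by (rule continuous_on_mult[OF cts_const Nz])
  have D: "cts D" unfolding D_def[abs_def] by (rule continuous_on_add[OF S_cts sNz])
  have Bz: "cts (B (z n))" by (rule B_cts[OF z_cts])
  have "Nk \<star> B (z n) = J (\<lambda>s. B (z n) s + (m \<star> B (z n)) s)"
    unfolding Nk_conv[OF Bz] conv_add_right[OF cts_const Bz conv_cts[OF m Bz]] ..
  also have "(\<lambda>s. B (z n) s + (m \<star> B (z n)) s) = Cs n" unfolding z_def using B_B[OF Cs_cts] by auto
  finally have "B (Nk \<star> z n) = J (Cs n)" unfolding B_conv[OF Nk_cts z_cts] .
  moreover have "B D = (\<lambda>t. B (S n) t + (- real n) * B (Nk \<star> z n) t)"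
    unfolding D_def[abs_def] B_add[OF S_cts sNz] B_scale ..
  ultimately have "B D s = 0" if "0 \<le> s" for s using B_S[OF that] by simp
  then have "D t = 0" using B_inj[OF D, of t t] t by simp
  then show ?thesis by (simp add: D_def J_h)
qed

text \<open>This is \<open>z_eq\<close> convolved with \<delta> + m. Together with
  \<open>S_eq\<close> it says S n' = n Nk - n^2 Nk \<star> S n, the equation for the response of
  mode n to an impulse.\<close>

lemma h_eq: assumes t: "0 \<le> t" shows "h n t = Nk t + (- real n) * (Nk \<star> S n) t"
proof -
  have JS: "cts (J (S n))" by (rule conv_cts[OF cts_const S_cts])
  have sJS: "cts (\<lambda>s. (- real n) * J (S n) s)" by (rule continuous_on_mult[OF cts_const JS])
  have "(m \<star> z n) t = (m \<star> (\<lambda>s. 1 + (- real n) * J (S n) s)) t" by (rule conv_cong) (auto simp: z_eq)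
  also have "\<dots> = (m \<star> (\<lambda>_. 1)) t + (- real n) * (m \<star> J (S n)) t"
    unfolding conv_add_right[OF m cts_const sJS] conv_scale_right ..
  also have "m \<star> (\<lambda>_. 1) = J m" by (rule conv_commute[OF m cts_const])
  also have "m \<star> J (S n) = J (m \<star> S n)" by (rule conv_left_commute[OF m cts_const S_cts])
  finally have "(m \<star> z n) t = J m t + (- real n) * J (m \<star> S n) t" .
  then show ?thesis unfolding h_def z_eq[OF t] Nk_conv[OF S_cts] Nk_def by (simp add: distrib_left)
qed

lemma Lop_even: "Lop (bas (2 * n)) = z n"
proof
  fix t
  have b: "bas (2 * n) = (\<lambda>s. cos (real n * s))" by (auto simp: bas_def)
  have p: "par 1 (\<lambda>s. cos (real n * s)) = (\<lambda>s. cos (real n * s))" by (auto simp: par_def)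
  show "Lop (bas (2 * n)) t = z n t" unfolding Lop_def b p z_def B_def Cs_def ..
qed

lemma Lop_odd: "Lop (bas (Suc (2 * n))) = S (Suc n)"
proof
  fix t
  have b: "bas (Suc (2 * n)) = (\<lambda>s. sin (real (Suc n) * s))" by (auto simp: bas_def)
  have p: "par 1 (\<lambda>s. sin (real (Suc n) * s)) = (\<lambda>s. 0)" by (auto simp: par_def)
  have "W (\<lambda>s. 0) = (\<lambda>t. 0)" using W_scale[OF cts_const[of 0], of 0] by simp
  then show "Lop (bas (Suc (2 * n))) t = S (Suc n) t" unfolding Lop_def b p S_def by (simp add: conv_def)
qed

text \<open>One constant serves all n, because sines and cosines are bounded by 1 and the operators
  by the supremum norm.\<close>

lemma kernels_bounded:
  assumes T: "0 \<le> T"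
  obtains C where "0 \<le> C" "\<And>n t. 0 \<le> t \<Longrightarrow> t \<le> T \<Longrightarrow> \<bar>S n t\<bar> \<le> C" "\<And>n t. 0 \<le> t \<Longrightarrow> t \<le> T \<Longrightarrow> \<bar>z n t\<bar> \<le> C"
proof -
  obtain C1 where C1: "C1 \<ge> 0" "op_bound T W C1" using bop_W[OF T] unfolding bop_def by blast
  obtain C2 where C2: "C2 \<ge> 0" "op_bound T (\<lambda>\<phi>. B (W \<phi>)) C2"
    using bop_comp[OF bop_B[OF T] bop_W[OF T] W_cts] unfolding bop_def by blast
  have "\<bar>S n t\<bar> \<le> C1 * 1" if "0 \<le> t" "t \<le> T" for n t
    unfolding S_def by (rule op_boundD[OF C1(2) sin_cos_cts(1) _ that]) simp
  moreover have "\<bar>z n t\<bar> \<le> C2 * 1" if "0 \<le> t" "t \<le> T" for n t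
    unfolding z_def Cs_def by (rule op_boundD[OF C2(2) sin_cos_cts(2) _ that]) simp
  ultimately show thesis using that[of "max C1 C2"] C1(1) by (simp add: le_max_iff_disj)
qed

end

section \<open>The response of the modes to a control\<close>

locale controlled = conv_root +
  fixes T :: real and k :: "real \<Rightarrow> real"
  assumes T: "0 < T" and k: "k \<in> L2 T"
begin

text \<open>The control on [0,T], continued by constants so that it is continuous on the
  line.\<close>

definition F :: "real \<Rightarrow> real" where "F t = J k (min (max t 0) T)"

text \<open>Duhamel's formula with S n, up to normalisation, as impulse response.\<close>

definition wn :: "nat \<Rightarrow> real \<Rightarrow> real" where "wn n = (\<lambda>t. sqrt (2 / pi) * (S n \<star> F) t)"

definition wp :: "nat \<Rightarrow> real \<Rightarrow> real" where "wp n = (\<lambda>t. sqrt (2 / pi) * (real n * (h n \<star> F) t))"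

lemma F_cts: "cts F"
  unfolding F_def[abs_def]
  by (rule continuous_on_compose2[OF J_continuous_on[OF L2_integrable[OF k]]]) (use T in \<open>auto intro!: continuous_intros\<close>)

lemma F_eq: "0 \<le> t \<Longrightarrow> t \<le> T \<Longrightarrow> F t = J k t"
  by (simp add: F_def min_def max_def)

lemma k_integrable: "t \<le> T \<Longrightarrow> k absolutely_integrable_on {0..t}"
proof -
  assume t: "t \<le> T"
  have "k absolutely_integrable_on {0..T}" using L2_integrable[OF k] by (simp add: integrable_Lb_iff)
  then show ?thesis by (rule set_integrable_subset) (use t in auto)
qed

lemma conv_k_integrable: assumes "cts a" "t \<le> T" shows "(\<lambda>s. a (t - s) * k s) integrable_on {0..t}"
proof -
  have c: "cts (\<lambda>s. a (t - s))" by (rule cts_compose[OF assms(1)]) (intro continuous_intros)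
  have "(\<lambda>s. a (t - s) * k s) absolutely_integrable_on {0..T}"
    using L2_mult[OF L2_cts[OF c] k] by (simp add: integrable_Lb_iff)
  then have "(\<lambda>s. a (t - s) * k s) absolutely_integrable_on {0..t}" by (rule set_integrable_subset) (use assms in auto)
  then show ?thesis by (simp add: absolutely_integrable_on_def)
qed

lemma conv_F: assumes a: "cts a" and t: "0 \<le> t" "t \<le> T" shows "(a \<star> F) t = (J a \<star> k) t"
proof -
  have "(a \<star> F) t = (a \<star> J k) t" by (rule conv_cong) (use F_eq t in auto)
  also have "\<dots> = ((a \<star> (\<lambda>_. 1)) \<star> k) t" by (rule conv_assoc_L1[OF a cts_const k_integrable[OF t(2)]])
  also have "a \<star> (\<lambda>_. 1) = J a" by (rule conv_commute[OF a cts_const])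
  finally show ?thesis .
qed

lemma wp_cts: "cts (wp n)" and wn_cts: "cts (wn n)"
  unfolding wp_def wn_def
  by (rule continuous_on_mult[OF cts_const continuous_on_mult[OF cts_const conv_cts[OF h_cts F_cts]]],
      rule continuous_on_mult[OF cts_const conv_cts[OF S_cts F_cts]])

lemma wn_eq_J: assumes t: "0 \<le> t" shows "wn n t = J (wp n) t"
proof -
  have "(S n \<star> F) t = ((\<lambda>s. real n * J (h n) s) \<star> F) t" by (rule conv_cong) (use S_eq in auto)
  also have "\<dots> = real n * J (h n \<star> F) t" unfolding conv_scale_left conv_assoc[OF cts_const h_cts F_cts] ..
  finally show ?thesis by (simp add: wn_def wp_def conv_scale_right)
qed

lemma wn_deriv:
  assumes t: "t \<in> {0..T}" shows "(wn n has_real_derivative wp n t) (at t within {0..T})"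
proof -
  have "((\<lambda>x. integral {0..x} (wp n)) has_real_derivative wp n t) (at t within {0..T})"
    by (rule integral_has_real_derivative[OF cts_on[OF wp_cts] t])
  then show ?thesis unfolding has_field_derivative_def
    by (rule has_derivative_transform[OF t, rotated]) (simp add: wn_eq_J J_eq)
qed

lemma wp_ode:
  assumes t: "0 \<le> t"
  shows "wp n t = - (real n)\<^sup>2 * (Nk \<star> wn n) t + real n * sqrt (2 / pi) * (Nk \<star> F) t"
proof -
  have NS: "cts (Nk \<star> S n)" by (rule conv_cts[OF Nk_cts S_cts])
  have sNS: "cts (\<lambda>s. (- real n) * (Nk \<star> S n) s)" by (rule continuous_on_mult[OF cts_const NS])
  have "(h n \<star> F) t = ((\<lambda>s. Nk s + (- real n) * (Nk \<star> S n) s) \<star> F) t" by (rule conv_cong) (use h_eq in auto)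
  also have "\<dots> = (Nk \<star> F) t + (- real n) * (Nk \<star> (S n \<star> F)) t"
    unfolding conv_add_left[OF F_cts Nk_cts sNS] conv_scale_left conv_assoc[OF Nk_cts S_cts F_cts] ..
  finally have "(h n \<star> F) t = (Nk \<star> F) t + (- real n) * (Nk \<star> (S n \<star> F)) t" .
  then have "wp n t = sqrt (2 / pi) * (real n * ((Nk \<star> F) t + (- real n) * (Nk \<star> (S n \<star> F)) t))" by (simp only: wp_def)
  then show ?thesis unfolding wn_def conv_scale_right by (simp add: algebra_simps power2_eq_square)
qed

text \<open>The integration in F = J k is moved onto the kernel, where n J (h n) = S n.\<close>

lemma wp_k:
  assumes t: "0 \<le> t" "t \<le> T" shows "wp n t = sqrt (2 / pi) * (S n \<star> k) t"
proof -
  have "(S n \<star> k) t = ((\<lambda>s. real n * J (h n) s) \<star> k) t" by (rule conv_cong) (use S_eq in auto)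
  then show ?thesis unfolding wp_def conv_F[OF h_cts t] conv_scale_left by simp
qed

text \<open>As for \<open>wp_k\<close>, now with n J (S n) = 1 - z n. The right side is bounded
  uniformly in n, so w_n is of order 1 / n; this is what gives continuity in L^2.\<close>

lemma wn_k:
  assumes t: "0 \<le> t" "t \<le> T" shows "real n * wn n t = sqrt (2 / pi) * (J k t - (z n \<star> k) t)"
proof -
  have "J k t - (z n \<star> k) t = integral {0..t} (\<lambda>s. k s - z n (t - s) * k s)"
    using integral_diff[OF set_lebesgue_integral_eq_integral(1)[OF k_integrable[OF t(2)]] conv_k_integrable[OF z_cts t(2)]]
    by (simp add: conv_def)
  also have "\<dots> = integral {0..t} (\<lambda>s. (real n * J (S n) (t - s)) * k s)"
    by (rule integral_cong) (auto simp: z_eq left_diff_distrib algebra_simps)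
  also have "\<dots> = ((\<lambda>s. real n * J (S n) s) \<star> k) t" by (simp add: conv_def[of "\<lambda>s. real n * J (S n) s"])
  also have "\<dots> = real n * (J (S n) \<star> k) t" unfolding conv_scale_left ..
  finally show ?thesis unfolding wn_def conv_F[OF S_cts t] by simp
qed

lemma coefficients_bounded:
  obtains C where "\<And>n t. t \<in> {0..T} \<Longrightarrow> \<bar>wp n t\<bar> \<le> C" "\<And>n t. t \<in> {0..T} \<Longrightarrow> \<bar>real n * wn n t\<bar> \<le> C"
proof -
  let ?c = "sqrt (2 / pi)"
  obtain K where K: "0 \<le> K" "\<And>n t. 0 \<le> t \<Longrightarrow> t \<le> T \<Longrightarrow> \<bar>S n t\<bar> \<le> K" "\<And>n t. 0 \<le> t \<Longrightarrow> t \<le> T \<Longrightarrow> \<bar>z n t\<bar> \<le> K"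
    using kernels_bounded[OF less_imp_le[OF T]] by blast
  define Q where "Q = sqrt (T * integral\<^sup>L (Lb T) (\<lambda>x. (k x)\<^sup>2))"
  have c: "0 \<le> ?c" by simp
  have Q0: "0 \<le> Q" unfolding Q_def using T by (simp add: Bochner_Integration.integral_nonneg)
  have "\<bar>wp n t\<bar> \<le> ?c * (Q + K * Q)" if t: "t \<in> {0..T}" for n t
  proof -
    have "\<bar>(S n \<star> k) t\<bar> \<le> K * Q" unfolding Q_def by (rule conv_L2_bound[OF T k S_cts K(2)]) (use t in auto)
    then have "?c * \<bar>(S n \<star> k) t\<bar> \<le> ?c * (Q + K * Q)" using Q0 by (intro mult_left_mono c) auto
    then show ?thesis using wp_k[of t n] t by (simp add: abs_mult)
  qed
  moreover have "\<bar>real n * wn n t\<bar> \<le> ?c * (Q + K * Q)" if t: "t \<in> {0..T}" for n t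
  proof -
    have 1: "\<bar>(z n \<star> k) t\<bar> \<le> K * Q" unfolding Q_def by (rule conv_L2_bound[OF T k z_cts K(3)]) (use t in auto)
    have 2: "\<bar>J k t\<bar> \<le> 1 * Q" unfolding Q_def by (rule conv_L2_bound[OF T k cts_const]) (use t in auto)
    have "\<bar>J k t - (z n \<star> k) t\<bar> \<le> Q + K * Q" using 1 2 by linarith
    then have "?c * \<bar>J k t - (z n \<star> k) t\<bar> \<le> ?c * (Q + K * Q)" by (intro mult_left_mono c)
    then show ?thesis using wn_k[of t n] t by (simp add: abs_mult)
  qed
  ultimately show thesis by (rule that)
qed

text \<open>The final statement concerns every weak solution, so the formula must be forced by the
  equation. The difference of two solutions satisfies E = - n^2 (J Nk) \<star> E, a homogeneous
  Volterra equation.\<close>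

lemma coefficients_unique:
  assumes Y: "cts Y" "\<And>t. 0 \<le> t \<Longrightarrow> t \<le> T \<Longrightarrow> Y t = J (\<lambda>s. - (real n)\<^sup>2 * (Nk \<star> Y) s + real n * sqrt (2 / pi) * (Nk \<star> F) s) t"
    and t: "0 \<le> t" "t \<le> T"
  shows "Y t = wn n t"
proof -
  define E where "E s = Y s + (-1) * wn n s" for s
  have swn: "cts (\<lambda>s. (-1) * wn n s)" by (rule continuous_on_mult[OF cts_const wn_cts])
  have E: "cts E" unfolding E_def[abs_def] by (rule continuous_on_add[OF Y(1) swn])
  have JN: "cts (J Nk)" by (rule conv_cts[OF cts_const Nk_cts])
  obtain R where R: "R \<ge> 0" "\<And>s. \<bar>s\<bar> \<le> T \<Longrightarrow> \<bar>J Nk s\<bar> \<le> R" using cts_bounded_on[OF JN] by blast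
  have NkE: "Nk \<star> E = (\<lambda>s. (Nk \<star> Y) s + (-1) * (Nk \<star> wn n) s)"
    unfolding E_def[abs_def] conv_add_right[OF Nk_cts Y(1) swn] conv_scale_right ..
  have eq: "E t = - (real n)\<^sup>2 * (J Nk \<star> E) t" if t: "0 \<le> t" "t \<le> T" for t
  proof -
    let ?G = "\<lambda>s. - (real n)\<^sup>2 * (Nk \<star> Y) s + real n * sqrt (2 / pi) * (Nk \<star> F) s"
    have G: "cts ?G" by (intro continuous_on_add continuous_on_mult cts_const conv_cts[OF Nk_cts Y(1)] conv_cts[OF Nk_cts F_cts])
    have "E t = integral {0..t} ?G - integral {0..t} (wp n)"
      unfolding E_def using Y(2)[OF t] wn_eq_J[OF t(1)] by (simp add: J_eq)
    also have "\<dots> = integral {0..t} (\<lambda>s. ?G s - wp n s)"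
      by (rule integral_diff[OF cts_integrable[OF G] cts_integrable[OF wp_cts], symmetric])
    also have "\<dots> = integral {0..t} (\<lambda>s. - (real n)\<^sup>2 * (Nk \<star> E) s)"
      by (rule integral_cong) (simp add: wp_ode NkE algebra_simps)
    also have "\<dots> = - (real n)\<^sup>2 * J (Nk \<star> E) t" unfolding J_eq by (rule integral_mult_right)
    also have "J (Nk \<star> E) = J Nk \<star> E" by (rule conv_assoc[OF cts_const Nk_cts E])
    finally show ?thesis .
  qed
  have "E t = 0"
  proof (rule volterra_unique[OF E _ _ t, where C="(real n)\<^sup>2 * R"])
    fix s assume s: "0 \<le> s" "s \<le> T"
    have "\<bar>(J Nk \<star> E) s\<bar> \<le> R * integral {0..s} (\<lambda>x. \<bar>E x\<bar>)" by (rule conv_bound_cts[OF JN E]) (use R(2) s in auto)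
    then have "(real n)\<^sup>2 * \<bar>(J Nk \<star> E) s\<bar> \<le> (real n)\<^sup>2 * (R * integral {0..s} (\<lambda>x. \<bar>E x\<bar>))" by (rule mult_left_mono) simp
    then show "\<bar>E s\<bar> \<le> (real n)\<^sup>2 * R * integral {0..s} (\<lambda>x. \<bar>E x\<bar>)" unfolding eq[OF s] by (simp add: abs_mult mult.assoc)
  qed (use R in simp)
  then show ?thesis by (simp add: E_def)
qed

end

section \<open>The moment problem for the control\<close>

text \<open>Convolution with 1, evaluated at T, integrates the reflected function; commutativity
  does the work of a substitution.\<close>

lemma nrm2_reflect: assumes "cts g" shows "nrm2 T (\<lambda>s. g (T - s)) = nrm2 T g"
proof -
  have c: "cts (\<lambda>s. (g s)\<^sup>2)" by (rule sq_cts[OF assms])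
  have "nrm2 T (\<lambda>s. g (T - s)) = ((\<lambda>s. (g s)\<^sup>2) \<star> (\<lambda>_. 1)) T" by (simp add: nrm2_def conv_def)
  also have "\<dots> = J (\<lambda>s. (g s)\<^sup>2) T" unfolding conv_commute[OF c cts_const] ..
  finally show ?thesis by (simp add: J_eq nrm2_def)
qed

lemma sum_even_odd: "(\<Sum>j<2 * N. f j) = (\<Sum>n<N. f (2 * n) + f (Suc (2 * n)))" for f :: "nat \<Rightarrow> real"
  by (induction N) auto

context conv_root
begin

lemma control_exists:
  assumes T: "2 * pi < T" and \<xi>: "\<xi> \<in> H10_fun 0 pi" and \<eta>: "\<eta> \<in> L2 pi"
  obtains k \<kappa> where "k \<in> L2 T" "\<And>n. cts (\<kappa> n)" "(\<lambda>n. integral\<^sup>L (Lb T) (\<lambda>x. (\<kappa> n x - k x)\<^sup>2)) \<longlonglongrightarrow> 0" "J k T = 0"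
    "\<And>n. sqrt (2 / pi) * (z n \<star> k) T = - (real n * sine_coeff n \<xi>)"
    "\<And>n. 1 \<le> n \<Longrightarrow> sqrt (2 / pi) * (S n \<star> k) T = sine_coeff n \<eta>"
proof -
  let ?c = "sqrt (2 / pi)"
  have c0: "0 < ?c" by simp
  have T0: "0 < T" using T pi_gt_zero by linarith
  obtain c where c: "0 < c" "\<And>N x. c * (\<Sum>j<N. (x j)\<^sup>2) \<le> nrm2 T (Lop (trig N x))"
    using Lop_lower_bound[OF T] by blast
  define p where "p j = Lop (bas j)" for j
  have p: "cts (p j)" for j unfolding p_def by (rule Lop_cts[OF bas_cts])
  \<comment> \<open>By \<open>wn_k\<close>, reaching \<xi> with f(T) = 0 requires sqrt (2 / pi) (z n
    \<star> k)(T) = - n \<xi>_n, where \<xi>_n is the n-th coefficient. The condition f(T) = 0 is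
    the case n = 0, since z 0 = 1. Odd indices carry the conditions from \<open>wp_k\<close>,
    beginning with n = 1.\<close>
  define d where "d j = (if even j then - (real (j div 2) * sine_coeff (j div 2) \<xi>) else sine_coeff (Suc (j div 2)) \<eta>) / ?c" for j
  obtain g where g: "g \<in> L2 pi" "\<And>n. real n * sine_coeff n \<xi> = integral\<^sup>L (Lb pi) (\<lambda>x. g x * Psi n x)"
    using H10_sine_coeff[OF \<xi>] by blast
  define D where "D = ((L2_norm 0 pi g)\<^sup>2 + (L2_norm 0 pi \<eta>)\<^sup>2) / ?c\<^sup>2"
  have dD: "(\<Sum>j<N. (d j)\<^sup>2) \<le> D" for N
  proof -
    have 1: "(\<Sum>n<N. (real n * sine_coeff n \<xi>)\<^sup>2) \<le> (L2_norm 0 pi g)\<^sup>2"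
    proof -
      have "(\<Sum>n<N. (real n * sine_coeff n \<xi>)\<^sup>2) = (\<Sum>n\<in>{1..<N}. (real n * sine_coeff n \<xi>)\<^sup>2)"
        by (rule sum.mono_neutral_right) (auto simp: not_less_eq_eq)
      also have "\<dots> \<le> (L2_norm 0 pi g)\<^sup>2" unfolding g(2)
        by (rule bessel[OF Psi_cts _ g(1)]) (use Phi_orthonormal(2) in auto)
      finally show ?thesis .
    qed
    have 2: "(\<Sum>n<N. (sine_coeff (Suc n) \<eta>)\<^sup>2) \<le> (L2_norm 0 pi \<eta>)\<^sup>2"
      using sine_bessel[OF \<eta>, of "Suc N"] unfolding sum.lessThan_Suc_shift by simp
    have "(\<Sum>j<N. (d j)\<^sup>2) \<le> (\<Sum>j<2 * N. (d j)\<^sup>2)" by (rule sum_mono2) auto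
    also have "\<dots> = (\<Sum>n<N. (real n * sine_coeff n \<xi>)\<^sup>2 / ?c\<^sup>2 + (sine_coeff (Suc n) \<eta>)\<^sup>2 / ?c\<^sup>2)"
      unfolding sum_even_odd d_def by (simp add: power_divide)
    also have "\<dots> = ((\<Sum>n<N. (real n * sine_coeff n \<xi>)\<^sup>2) + (\<Sum>n<N. (sine_coeff (Suc n) \<eta>)\<^sup>2)) / ?c\<^sup>2"
      by (simp only: sum.distrib sum_divide_distrib add_divide_distrib)
    also have "\<dots> \<le> D" unfolding D_def by (intro divide_right_mono add_mono 1 2) simp
    finally show ?thesis .
  qed
  have lb: "c * (\<Sum>j<N. (x j)\<^sup>2) \<le> nrm2 T (\<lambda>s. \<Sum>j<N. x j * p j s)" for N x
    using c(2)[of x N] unfolding Lop_trig p_def .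
  obtain G where G: "\<forall>N. cts (G N)" "\<forall>N j. j < N \<longrightarrow> integral {0..T} (\<lambda>s. G N s * p j s) = d j"
    "\<forall>e>0. \<exists>K. \<forall>m\<ge>K. \<forall>n\<ge>K. nrm2 T (\<lambda>s. G m s - G n s) < e"
    using moment_approximation[OF p c(1) less_imp_le[OF T0] lb dD] by (elim exE conjE) (rule that)
  \<comment> \<open>The moment functions occur in convolutions at time T, whereas the G N have
    prescribed inner products; reversing time converts one into the other.\<close>
  define \<kappa> where "\<kappa> N s = G N (T - s)" for N s
  have \<kappa>: "cts (\<kappa> N)" for N unfolding \<kappa>_def[abs_def] by (rule cts_compose[OF G(1)[rule_format]]) (intro continuous_intros)
  have nn: "nrm2 T (\<lambda>s. \<kappa> m s - \<kappa> n s) = nrm2 T (\<lambda>s. G m s - G n s)" for m n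
    unfolding \<kappa>_def by (rule nrm2_reflect[where g="\<lambda>s. G m s - G n s"]) (rule continuous_on_diff[OF G(1)[rule_format] G(1)[rule_format]])
  have cau: "\<exists>K. \<forall>m\<ge>K. \<forall>n\<ge>K. nrm2 T (\<lambda>s. \<kappa> m s - \<kappa> n s) < e" if "0 < e" for e
    unfolding nn using G(3) that by simp
  have main: thesis if k: "k \<in> L2 T" and lim: "(\<lambda>n. integral\<^sup>L (Lb T) (\<lambda>x. (\<kappa> n x - k x)\<^sup>2)) \<longlonglongrightarrow> 0"
    and outer: "\<And>k \<kappa>. k \<in> L2 T \<Longrightarrow> (\<And>n. cts (\<kappa> n)) \<Longrightarrow> (\<lambda>n. integral\<^sup>L (Lb T) (\<lambda>x. (\<kappa> n x - k x)\<^sup>2)) \<longlonglongrightarrow> 0 \<Longrightarrow> J k T = 0 \<Longrightarrow>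
      (\<And>n. sqrt (2 / pi) * (z n \<star> k) T = - (real n * sine_coeff n \<xi>)) \<Longrightarrow>
      (\<And>n. 1 \<le> n \<Longrightarrow> sqrt (2 / pi) * (S n \<star> k) T = sine_coeff n \<eta>) \<Longrightarrow> thesis" for k
  proof -
    have mom: "(p j \<star> k) T = d j" for j
    proof -
      have rc: "cts (\<lambda>s. p j (T - s))" by (rule cts_compose[OF p]) (intro continuous_intros)
      have "(\<lambda>N. integral\<^sup>L (Lb T) (\<lambda>s. \<kappa> N s * p j (T - s))) \<longlonglongrightarrow> integral\<^sup>L (Lb T) (\<lambda>s. k s * p j (T - s))"
        by (rule L2_tendsto_integral[OF L2_cts[OF \<kappa>] k L2_cts[OF rc] lim])
      moreover have "\<forall>\<^sub>F N in sequentially. integral\<^sup>L (Lb T) (\<lambda>s. \<kappa> N s * p j (T - s)) = d j"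
      proof (rule eventually_sequentiallyI[of "Suc j"])
        fix N assume N: "Suc j \<le> N"
        have "integral\<^sup>L (Lb T) (\<lambda>s. \<kappa> N s * p j (T - s)) = integral {0..T} (\<lambda>s. \<kappa> N s * p j (T - s))"
          by (rule Lb_cts(2)[OF continuous_on_mult[OF \<kappa> rc]])
        also have "\<dots> = (p j \<star> \<kappa> N) T" by (simp add: conv_def mult.commute)
        also have "\<dots> = (\<kappa> N \<star> p j) T" unfolding conv_commute[OF p \<kappa>] ..
        also have "\<dots> = integral {0..T} (\<lambda>s. G N s * p j s)" by (simp add: conv_def \<kappa>_def)
        also have "\<dots> = d j" using G(2) N by simp
        finally show "integral\<^sup>L (Lb T) (\<lambda>s. \<kappa> N s * p j (T - s)) = d j" .
      qed
      ultimately have "integral\<^sup>L (Lb T) (\<lambda>s. k s * p j (T - s)) = d j" by (rule LIMSEQ_unique[OF _ tendsto_eventually])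
      then show ?thesis using integral_Lb[OF L2_mult[OF k L2_cts[OF rc]]] by (simp add: conv_def mult.commute)
    qed
    have mz: "?c * (z n \<star> k) T = - (real n * sine_coeff n \<xi>)" for n
      using mom[of "2 * n"] c0 unfolding p_def Lop_even by (simp add: d_def field_simps)
    have mS: "?c * (S n \<star> k) T = sine_coeff n \<eta>" if n: "1 \<le> n" for n
    proof -
      obtain i where "n = Suc i" using n by (cases n) auto
      then show ?thesis using mom[of "Suc (2 * i)"] c0 unfolding p_def Lop_odd by (simp add: d_def field_simps)
    qed
    \<comment> \<open>The moment with index 0 makes the control vanish at T.\<close>
    have "(z 0 \<star> k) T = J k T" by (rule conv_cong) (auto simp: z_eq)
    then have "J k T = 0" using mz[of 0] c0 by simp
    from outer[OF k \<kappa> lim this mz mS] show thesis .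
  qed
  show thesis
    by (rule L2_limit_Lb[where u=\<kappa> and T=T, OF \<kappa> less_imp_le[OF T0]]) (erule cau, rule main, assumption+, rule that)
qed

end

section \<open>Weak solutions and their terminal state\<close>

locale controlled_system = controlled +
  fixes M :: "real \<Rightarrow> real"
  assumes M_integrable: "integrable (Lb T) M" and M_AE: "AE x in Lb T. M x = m x"
begin

lemma Nker_eq: assumes t: "t \<le> T" shows "Nker M t = Nk t"
proof -
  have "M absolutely_integrable_on {0..T}" using M_integrable by (simp add: integrable_Lb_iff)
  then have "M absolutely_integrable_on {0..t}" by (rule set_integrable_subset) (use t in auto)
  then have "integrable (Lb t) M" by (simp add: integrable_Lb_iff)
  then have "integral\<^sup>L (Lb t) M = J M t" by (simp add: integral_Lb J_eq)
  then show ?thesis unfolding Nker_def LINT_Lb Nk_def using J_AE_cong[OF M_AE t] by simp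
qed

lemma memory_integral:
  assumes t: "t \<le> T" and \<phi>: "cts \<phi>" and g: "\<And>s. 0 < s \<Longrightarrow> s < t \<Longrightarrow> g s = \<phi> s"
  shows "(LINT s:{0<..<t}|lebesgue. Nker M (t - s) * g s) = (Nk \<star> \<phi>) t"
proof -
  have c: "cts (\<lambda>s. Nk (t - s) * \<phi> s)" by (rule conv_integrand[OF Nk_cts \<phi>])
  have "(LINT s:{0<..<t}|lebesgue. Nker M (t - s) * g s) = integral\<^sup>L (Lb t) (\<lambda>s. Nk (t - s) * \<phi> s)"
    unfolding LINT_Lb by (rule Bochner_Integration.integral_cong) (use t in \<open>auto simp: Nker_eq g\<close>)
  then show ?thesis unfolding Lb_cts(2)[OF c] conv_def .
qed

lemma wn_0: "0 \<le> t \<Longrightarrow> wn 0 t = 0"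
  using wn_eq_J[of t 0] by (simp add: wp_def J_eq)

text \<open>The coefficient, frozen outside [0,T], is a continuous function whose equation
  integrates to the one in \<open>coefficients_unique\<close>.\<close>

lemma solution_coefficients:
  assumes w: "weak_solution M (J k) T w" and t: "t \<in> {0..T}"
  shows "sine_coeff n (w t) = wn n t"
proof (cases "n = 0")
  case True then show ?thesis using wn_0 t by simp
next
  case False
  define y where "y \<tau> = sine_coeff n (w \<tau>)" for \<tau>
  define Y where "Y s = y (min (max s 0) T)" for s
  let ?G = "\<lambda>s. - (real n)\<^sup>2 * (Nk \<star> Y) s + real n * sqrt (2 / pi) * (Nk \<star> F) s"
  have y0: "y 0 = 0" using w False by (simp add: weak_solution_def y_def)
  have yd: "(y has_real_derivative
      (- (real n)\<^sup>2 * (LINT s:{0<..<t}|lebesgue. Nker M (t - s) * y s)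
        + real n * sqrt (2 / pi) * (LINT s:{0<..<t}|lebesgue. Nker M (t - s) * J k s))) (at t within {0..T})"
    if "t \<in> {0..T}" for t
    using w that False unfolding weak_solution_def y_def[abs_def] by simp
  have yc: "continuous_on {0..T} y" by (rule DERIV_continuous_on[OF yd])
  have Y: "cts Y" unfolding Y_def[abs_def]
    by (rule continuous_on_compose2[OF yc]) (use T in \<open>auto intro!: continuous_intros\<close>)
  have Yy: "Y s = y s" if "0 \<le> s" "s \<le> T" for s using that by (simp add: Y_def)
  have yd': "(y has_real_derivative ?G t) (at t within {0..T})" if t: "t \<in> {0..T}" for t
  proof -
    have 1: "(LINT s:{0<..<t}|lebesgue. Nker M (t - s) * y s) = (Nk \<star> Y) t"
      by (rule memory_integral[OF _ Y]) (use t Yy in auto)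
    have 2: "(LINT s:{0<..<t}|lebesgue. Nker M (t - s) * J k s) = (Nk \<star> F) t"
      by (rule memory_integral[OF _ F_cts]) (use t F_eq in auto)
    show ?thesis using yd[OF t] unfolding 1 2 .
  qed
  have YJ: "Y s = J ?G s" if s: "0 \<le> s" "s \<le> T" for s
  proof -
    have "(?G has_integral (y s - y 0)) {0..s}"
    proof (rule fundamental_theorem_of_calculus[OF s(1)])
      fix x assume x: "x \<in> {0..s}"
      have "(y has_real_derivative ?G x) (at x within {0..s})" by (rule DERIV_subset[OF yd']) (use x s in auto)
      then show "(y has_vector_derivative ?G x) (at x within {0..s})" by (simp add: has_real_derivative_iff_has_vector_derivative)
    qed
    then show ?thesis unfolding J_eq using Yy[OF s] y0 by (simp add: integral_unique)
  qed
  have "Y t = wn n t" using coefficients_unique[OF Y YJ] t by simp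
  then show ?thesis using Yy t by (simp add: y_def)
qed

lemma solution_evolution:
  assumes "\<And>t. t \<in> {0..T} \<Longrightarrow> w t \<in> L2 pi" "\<And>n t. t \<in> {0..T} \<Longrightarrow> sine_coeff n (w t) = wn n t"
    "\<And>n t. t \<in> {0..T} \<Longrightarrow> \<bar>wp n t\<bar> \<le> C"
  shows "sine_evolution T C w wn wp"
  by (unfold_locales) (use assms T wn_deriv cts_on[OF wp_cts] in auto)

text \<open>Each w t is chosen separately by Riesz-Fischer, with no link between different times;
  regularity in t is recovered from the coefficients through \<open>sine_evolution\<close>.\<close>

lemma solution_exists: "\<exists>w. weak_solution M (J k) T w"
proof -
  obtain C where C: "\<And>n t. t \<in> {0..T} \<Longrightarrow> \<bar>wp n t\<bar> \<le> C" "\<And>n t. t \<in> {0..T} \<Longrightarrow> \<bar>real n * wn n t\<bar> \<le> C"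
    using coefficients_bounded by blast
  have "\<exists>u. t \<in> {0..T} \<longrightarrow> u \<in> L2 pi \<and> (\<forall>n. sine_coeff n u = wn n t)" for t
  proof (cases "t \<in> {0..T}")
    case True
    have e: "(wn n t)\<^sup>2 = (real n * wn n t / real n)\<^sup>2" for n using wn_0[of t] True by (cases "n = 0") auto
    have "(\<Sum>n<N. (wn n t)\<^sup>2) \<le> (\<Sum>n. (C / real n)\<^sup>2)" for N
      unfolding e by (rule weighted_bound[OF C(2)[OF True]])
    then obtain u where u: "u \<in> L2 pi" "\<And>n. 1 \<le> n \<Longrightarrow> sine_coeff n u = wn n t"
      using riesz_fischer[of "\<lambda>n. wn n t"] by blast
    have "sine_coeff n u = wn n t" for n using u(2)[of n] wn_0[of t] True by (cases "n = 0") auto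
    then show ?thesis using u(1) by blast
  qed auto
  then have "\<forall>t. \<exists>u. t \<in> {0..T} \<longrightarrow> u \<in> L2 pi \<and> (\<forall>n. sine_coeff n u = wn n t)" by blast
  from choice[OF this] obtain w where w: "\<forall>t. t \<in> {0..T} \<longrightarrow> w t \<in> L2 pi \<and> (\<forall>n. sine_coeff n (w t) = wn n t)" by blast
  interpret E: sine_evolution T C w wn wp by (rule solution_evolution) (use w C in auto)
  have cf: "sine_coeff n (w t) = wn n t" if "t \<in> {0..T}" for n t using w that by blast
  have d: "((\<lambda>\<tau>. sine_coeff n (w \<tau>)) has_real_derivative
        (- (real n)\<^sup>2 * (LINT s:{0<..<t}|lebesgue. Nker M (t - s) * sine_coeff n (w s))
          + real n * sqrt (2 / pi) * (LINT s:{0<..<t}|lebesgue. Nker M (t - s) * J k s))) (at t within {0..T})"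
    if t: "t \<in> {0..T}" for n t
  proof -
    have 1: "(LINT s:{0<..<t}|lebesgue. Nker M (t - s) * sine_coeff n (w s)) = (Nk \<star> wn n) t"
      by (rule memory_integral[OF _ wn_cts]) (use t cf in auto)
    have 2: "(LINT s:{0<..<t}|lebesgue. Nker M (t - s) * J k s) = (Nk \<star> F) t"
      by (rule memory_integral[OF _ F_cts]) (use t F_eq in auto)
    have "((\<lambda>\<tau>. sine_coeff n (w \<tau>)) has_real_derivative wp n t) (at t within {0..T})"
      using wn_deriv[OF t, of n] unfolding has_field_derivative_def
      by (rule has_derivative_transform[OF t, rotated]) (rule cf)
    moreover have "wp n t = - (real n)\<^sup>2 * (Nk \<star> wn n) t + real n * sqrt (2 / pi) * (Nk \<star> F) t"
      by (rule wp_ode) (use t in simp)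
    ultimately show ?thesis unfolding 1 2 by simp
  qed
  have "sine_coeff n (w 0) = 0" for n using cf[of 0 n] wn_eq_J[of 0 n] T by (simp add: conv_neg)
  then have "weak_solution M (J k) T w"
    unfolding weak_solution_def
    by (intro conjI allI impI ballI) (rule E.C0_regularity[OF C(2)], assumption, rule E.C1_regularity, assumption, rule d, assumption)
  then show ?thesis by (rule exI[of _ w])
qed

text \<open>Both terminal conditions are equalities of sine coefficients: completeness turns the
  first into equality almost everywhere, and the sine series of the time derivative settles the
  second.\<close>

lemma solution_terminal:
  assumes w: "weak_solution M (J k) T w" and \<xi>: "\<xi> \<in> L2 pi" and \<eta>: "\<eta> \<in> L2 pi"
    and \<xi>n: "\<And>n. 1 \<le> n \<Longrightarrow> wn n T = sine_coeff n \<xi>" and \<eta>n: "\<And>n. 1 \<le> n \<Longrightarrow> wp n T = sine_coeff n \<eta>"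
  shows "AE x in lebesgue. x \<in> {0<..<pi} \<longrightarrow> w T x = \<xi> x" "has_Hm1_time_deriv 0 pi T w T (L2_functional 0 pi \<eta>)"
proof -
  have T1: "T \<in> {0..T}" using T by simp
  have c0: "C0_L2 0 pi T w" using w unfolding weak_solution_def by (rule conjunct1)
  have wL: "w t \<in> L2 pi" if "t \<in> {0..T}" for t
    by (rule conjunct1[OF bspec[OF c0[unfolded C0_L2_def] that]])
  obtain C where C: "\<And>n t. t \<in> {0..T} \<Longrightarrow> \<bar>wp n t\<bar> \<le> C" "\<And>n t. t \<in> {0..T} \<Longrightarrow> \<bar>real n * wn n t\<bar> \<le> C"
    using coefficients_bounded by blast
  interpret E: sine_evolution T C w wn wp
    by (rule solution_evolution, erule wL, erule solution_coefficients[OF w], erule C(1))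
  have "AE x in Lb pi. w T x - \<xi> x = 0"
    by (rule sine_completeness[OF L2_diff[OF wL[OF T1] \<xi>]])
       (simp add: sine_coeff_diff wL[OF T1] \<xi> solution_coefficients[OF w T1] \<xi>n)
  then show "AE x in lebesgue. x \<in> {0<..<pi} \<longrightarrow> w T x = \<xi> x" unfolding AE_Lb_iff by simp
  show "has_Hm1_time_deriv 0 pi T w T (L2_functional 0 pi \<eta>)"
  proof (rule has_Hm1_time_deriv_cong[OF E.time_derivative[OF T1] _ L2_functional_sine_series(1)[OF \<eta>]])
    fix \<phi> assume \<phi>: "\<phi> \<in> H10_fun 0 pi"
    have "wp n T * sine_coeff n \<phi> = sine_coeff n \<eta> * sine_coeff n \<phi>" for n
      by (cases "n = 0") (simp_all add: \<eta>n)
    then show "E.v T \<phi> = L2_functional 0 pi \<eta> \<phi>"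
      by (simp only: E.v_def L2_functional_sine_series(2)[OF \<eta> \<phi>])
  qed
qed

end

theorem theorem1:
  fixes M :: "real \<Rightarrow> real" and T :: real and \<xi> \<eta> :: "real \<Rightarrow> real"
  assumes "\<And>S. S > 0 \<Longrightarrow> M \<in> H2_fun 0 S"
    and "T > 2 * pi"
    and "\<xi> \<in> H10_fun 0 pi"
    and "\<eta> \<in> L2_fun 0 pi"
  shows "\<exists>f\<in>H10_fun 0 T.
           (\<exists>w. weak_solution M f T w) \<and>
           (\<forall>w. weak_solution M f T w \<longrightarrow>
              (AE x in lebesgue. x \<in> {0<..<pi} \<longrightarrow> w T x = \<xi> x) \<and>
              has_Hm1_time_deriv 0 pi T w T (L2_functional 0 pi \<eta>))"
proof -
  have T0: "0 < T" using assms(2) pi_gt_zero by linarith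
  have MH: "M \<in> H2_fun 0 T" by (rule assms(1)[OF T0])
  have Mi: "integrable (Lb T) M" using MH by (auto simp: H2_fun_def H1_fun_def intro: L2_integrable)
  obtain m0 m1 where m1: "cts m1" and ae: "AE x in Lb T. M x = m0 + J m1 x" by (rule H2_regularity[OF T0 MH])
  define m where "m = (\<lambda>t. m0 + J m1 t)"
  have m: "cts m" unfolding m_def by (rule continuous_on_add[OF cts_const conv_cts[OF cts_const m1]])
  obtain r0 r1 where r1: "cts r1" and root: "\<And>t. 0 \<le> t \<Longrightarrow> (let r = (\<lambda>t. r0 + J r1 t); q = (\<lambda>t. 2 * r t + (r \<star> r) t) in q t + m t + (m \<star> q) t) = 0"
    unfolding m_def by (rule conv_sqrt[where ?m0.0=m0, OF m1]) (rule that[unfolded m_def])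
  interpret R: conv_root m r1 r0 by unfold_locales (rule m, rule r1, rule root)
  obtain k \<kappa> where k: "k \<in> L2 T" "\<And>n. cts (\<kappa> n)" "(\<lambda>n. integral\<^sup>L (Lb T) (\<lambda>x. (\<kappa> n x - k x)\<^sup>2)) \<longlonglongrightarrow> 0" "J k T = 0"
    and kz: "\<And>n. sqrt (2 / pi) * (R.z n \<star> k) T = - (real n * sine_coeff n \<xi>)"
    and kS: "\<And>n. 1 \<le> n \<Longrightarrow> sqrt (2 / pi) * (R.S n \<star> k) T = sine_coeff n \<eta>"
    by (rule R.control_exists[OF assms(2-4)]) (rule that)
  interpret C: controlled_system m r1 r0 T k M
    by unfold_locales (use T0 k Mi ae in \<open>auto simp: m_def\<close>)
  have wn: "C.wn n T = sine_coeff n \<xi>" if "1 \<le> n" for n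
  proof -
    \<comment> \<open>J k T = 0 leaves only the convolution term of \<open>wn_k\<close>; the factor
      n can be cancelled because n \<ge> 1.\<close>
    have "real n * C.wn n T = real n * sine_coeff n \<xi>" using C.wn_k[of T n] kz[of n] k(4) T0 by simp
    then show ?thesis using that by simp
  qed
  have wp: "C.wp n T = sine_coeff n \<eta>" if "1 \<le> n" for n using C.wp_k[of T n] kS[OF that] T0 by simp
  have "J k \<in> H10_fun 0 T" by (rule J_in_H10[OF T0 k(1) k(4) k(2) k(3)])
  moreover have "\<exists>w. weak_solution M (J k) T w" by (rule C.solution_exists)
  moreover note C.solution_terminal[OF _ H10_L2[OF assms(3)] assms(4) wn wp]
  ultimately show ?thesis by blast
qed

end
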